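(* Let $\omega\subset\mathbb{R}^2$ be an open, bounded, smooth planar domain. Fix two integers $N,K\ge1$ and an exponent $\gamma\in(0,1)$. Then there exists $l_0\in(0,1)$ depending only on $\omega$, there exists $\sigma_0\ge1$ depending only on $\omega,\gamma,N,K$, and there exists a constant $C$ depending only on $\omega,\gamma,N,K$, such that the following holds. Let $s\in\{0,1\}$, $\beta\in(0,1]$, and let the positive constants $l,\lambda,\mathcal{M}$ and the fields $v,w\in\mathcal{C}^2(\bar\omega+\bar B_{2l}(0),\mathbb{R}^2)$, $A\in\mathcal{C}^{s,\beta}(\bar\omega+\bar B_{2l}(0),\mathbb{R}^{2\times2}_{\mathrm{sym}})$ satisfy $$l\le l_0,\qquad \lambda^{1-\gamma}l\ge\sigma_0,\qquad \mathcal{M}\ge\max\{\|v\|_2,\|w\|_2,1\}.$$ Then there exist $\tilde v,\tilde w\in\mathcal{C}^2(\bar\omega+\bar B_l(0),\mathbb{R}^2)$ such that, denoting the defects $$\mathcal{D}=A-\Big(\frac12(\nabla v)^T\nabla v+\mathrm{sym}\,\nabla w\Big),\qquad \tilde{\mathcal{D}}=A-\Big(\frac12(\nabla\tilde v)^T\nabla\tilde v+\mathrm{sym}\,\nabla\tilde w\Big),$$ the following bounds are valid: $$\|\tilde v-v\|_1\le C\lambda^{\gamma/2}\big(\|\mathcal{D}\|_0^{1/2}+l\mathcal{M}\big),$$ $$\|\tilde w-w\|_1\le C\lambda^{\gamma}\big(\|\mathcal{D}\|_0^{1/2}+l\mathcal{M}\big)\big(1+\|\mathcal{D}\|_0^{1/2}+l\mathcal{M}+\|\nabla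 v\|_0\big),$$ $$\|\nabla^2\tilde v\|_0\le C\,\frac{(\lambda l)^{K+N}\lambda^{\gamma/2}}{l}\big(\|\mathcal{D}\|_0^{1/2}+l\mathcal{M}\big),$$ $$\|\nabla^2\tilde w\|_0\le C\,\frac{(\lambda l)^{K+N}\lambda^{\gamma}}{l}\big(\|\mathcal{D}\|_0^{1/2}+l\mathcal{M}\big)\big(1+\|\mathcal{D}\|_0^{1/2}+l\mathcal{M}+\|\nabla v\|_0\big),$$ $$\|\tilde{\mathcal{D}}\|_0\le C\Big(l^{s+\beta}\|A\|_{s,\beta}+\frac{\|\mathcal{D}\|_0+(l\mathcal{M})^2}{(\lambda l)^{KN}}\Big).$$
   Context: $\bar\omega+\bar B_r(0)$ is the closed $r$-neighbourhood of $\omega$. $\mathbb{R}^{2\times2}_{\mathrm{sym}}$ is the space of symmetric $2\times2$ matrices; $(\nabla v)^T\nabla v$ has entries $\langle\partial_iv,\partial_jv\rangle$; $\mathrm{sym}\,\nabla w=\frac12(\nabla w+(\nabla w)^T)$. $\|\cdot\|_m$ denotes the $\mathcal{C}^m$ norm (so $\|\cdot\|_0$ is the supremum norm) and $\|\cdot\|_{m,\beta}$ the Hölder $\mathcal{C}^{m,\beta}$ norm. Norms of $v,w,A,\mathcal{D}$ are taken on $\bar\omega+\bar B_{2l}(0)$, norms of $\tilde v,\tilde w,\tilde{\mathcal{D}}$ (and of the differences $\tilde v-v$, $\tilde w-w$) on $\bar\omega+\bar B_l(0)$. The spaces $\mathcal{C}^{m}$, $\mathcal{C}^{m,\beta}$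 on a closed set consist of restrictions of functions of that regularity defined on $\mathbb{R}^2$. *)

theory Defs
  imports "HOL-Analysis.Analysis" "HOL-Library.Set_Algebras"
begin

subsection \<open>Smooth planar domains\<close>

definition smooth_real :: "(real \<Rightarrow> real) \<Rightarrow> bool" where
  "smooth_real g \<longleftrightarrow> (\<forall>n x. ((deriv ^^ n) g) field_differentiable (at x))"

text \<open>Near each boundary point, in suitable orthonormal coordinates (given by \<open>T\<close>), the set is
  the strict epigraph of a smooth function.\<close>

definition smooth_boundary :: "(real^2) set \<Rightarrow> bool" where
  "smooth_boundary \<omega> \<longleftrightarrow>
     (\<forall>p\<in>frontier \<omega>. \<exists>r>0. \<exists>(T :: real^2 \<Rightarrow> real^2) g. orthogonal_transformation T \<and> smooth_real g \<and>
        \<omega> \<inter> ball p r = {x \<in> ball p r. T x $ 2 > g (T x $ 1)})"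

definition smooth_planar_domain :: "(real^2) set \<Rightarrow> bool" where
  "smooth_planar_domain \<omega> \<longleftrightarrow> open \<omega> \<and> connected \<omega> \<and> \<omega> \<noteq> {} \<and> smooth_boundary \<omega>"

definition closed_nbhd :: "(real^2) set \<Rightarrow> real \<Rightarrow> (real^2) set" where
  "closed_nbhd \<omega> r = closure \<omega> + cball 0 r"


subsection \<open>Derivatives of functions on a closed set\<close>

text \<open>Derivatives are taken within the set \<open>S\<close>, so that they depend only on the values of the
  function on \<open>S\<close>. For \<open>S = closed_nbhd \<omega> r\<close> with \<open>r > 0\<close> they are unique also at
  boundary points, and agree with the derivatives of any differentiable extension to the plane;
  see \<open>partial_closed_nbhd\<close> below.\<close>

definition partial :: "(real^2) set \<Rightarrow> 2 \<Rightarrow> (real^2 \<Rightarrow> 'b::real_normed_vector) \<Rightarrow> real^2 \<Rightarrow> 'b" where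
  "partial S i f x = frechet_derivative f (at x within S) (axis i 1)"

primrec partials :: "(real^2) set \<Rightarrow> 2 list \<Rightarrow> (real^2 \<Rightarrow> 'b::real_normed_vector) \<Rightarrow> real^2 \<Rightarrow> 'b" where
  "partials S [] f = f"
| "partials S (i # is) f = partials S is (partial S i f)"

lemma has_derivative_within_cball_unique:
  fixes f :: "'a::real_normed_vector \<Rightarrow> 'b::real_normed_vector"
  assumes f1: "(f has_derivative f1) (at x within S)"
    and f2: "(f has_derivative f2) (at x within S)"
    and r: "r > 0" and x: "x \<in> cball c r" and sub: "cball c r \<subseteq> S"
  shows "f1 = f2"
proof
  have lin1: "linear f1" and lin2: "linear f2"
    using f1 f2 by (auto dest: has_derivative_linear)
  have eq: "f1 h = f2 h" if h: "x + h \<in> cball c r" for h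
  proof -
    have seg: "(\<lambda>t. x + t *\<^sub>R h) ` {0..1} \<subseteq> S"
    proof
      fix y assume "y \<in> (\<lambda>t. x + t *\<^sub>R h) ` {0..1}"
      then obtain t where t: "0 \<le> t" "t \<le> 1" "y = (1 - t) *\<^sub>R x + t *\<^sub>R (x + h)"
        by (auto simp: algebra_simps)
      then have "y \<in> cball c r"
        using convexD_alt[OF convex_cball x h, of t] by simp
      then show "y \<in> S" using sub by blast
    qed
    have line: "((\<lambda>t. x + t *\<^sub>R h) has_derivative (\<lambda>t. t *\<^sub>R h)) (at 0 within {0..1})"
      by (auto intro!: derivative_eq_intros)
    have D: "((\<lambda>t. f (x + t *\<^sub>R h)) has_vector_derivative f' h) (at 0 within {0..1})"
      if f': "(f has_derivative f') (at x within S)" for f'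
    proof -
      have "(f has_derivative f') (at (x + 0 *\<^sub>R h) within (\<lambda>t. x + t *\<^sub>R h) ` {0..1})"
        using has_derivative_subset[OF f' seg] by simp
      from has_derivative_in_compose[OF line this]
      have "((\<lambda>t. f (x + t *\<^sub>R h)) has_derivative (\<lambda>t. f' (t *\<^sub>R h))) (at 0 within {0..1})" .
      then show ?thesis
        using has_derivative_linear[OF f'] by (simp add: has_vector_derivative_def linear_cmul)
    qed
    show ?thesis
      using vector_derivative_unique_within_closed_interval[of 0 1 0] D[OF f1] D[OF f2]
      by (simp add: box_real)
  qed
  fix u :: 'a
  define e where "e = r / (norm u + 1)"
  have e: "e > 0" using r by (simp add: e_def add_nonneg_pos)
  have "e * norm u \<le> r"
    using r by (simp add: e_def divide_simps add_nonneg_pos)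
  then have "f1 (c + e *\<^sub>R u - x) = f2 (c + e *\<^sub>R u - x)"
    using e by (intro eq) (simp add: dist_norm)
  then have "f1 (c - x) + e *\<^sub>R f1 u = f2 (c - x) + e *\<^sub>R f2 u"
    using lin1 lin2 by (simp add: linear_diff linear_add linear_cmul algebra_simps)
  moreover have "f1 (c - x) = f2 (c - x)"
    using r by (intro eq) simp
  ultimately have "e *\<^sub>R f1 u = e *\<^sub>R f2 u"
    by simp
  then show "f1 u = f2 u" using e by simp
qed

lemma partial_closed_nbhd:
  assumes "r > 0" and x: "x \<in> closed_nbhd \<omega> r"
    and F: "F differentiable (at x)" and fF: "\<And>y. y \<in> closed_nbhd \<omega> r \<Longrightarrow> f y = F y"
  shows "partial (closed_nbhd \<omega> r) i f x = partial UNIV i F x"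
proof -
  let ?S = "closed_nbhd \<omega> r"
  obtain c y where c: "c \<in> closure \<omega>" "y \<in> cball 0 r" "x = c + y"
    using x by (auto simp: closed_nbhd_def elim!: set_plus_elim)
  have "cball c r \<subseteq> ?S"
  proof
    fix z assume "z \<in> cball c r"
    then have "c + (z - c) \<in> ?S"
      unfolding closed_nbhd_def using c
      by (intro set_plus_intro) (auto simp: dist_norm norm_minus_commute)
    then show "z \<in> ?S" by simp
  qed
  moreover have "(F has_derivative frechet_derivative F (at x)) (at x within ?S)"
    using F frechet_derivative_works has_derivative_at_withinI by blast
  then have D: "(f has_derivative frechet_derivative F (at x)) (at x within ?S)"
    using has_derivative_transform[OF x] fF by blast
  moreover have "(f has_derivative frechet_derivative f (at x within ?S)) (at x within ?S)"
    using D frechet_derivative_works differentiable_def by blast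
  moreover have "x \<in> cball c r" using c by (simp add: dist_norm)
  ultimately show ?thesis
    unfolding partial_def using has_derivative_within_cball_unique \<open>r > 0\<close> by metis
qed


subsection \<open>The function spaces and their norms\<close>

primrec C_class :: "nat \<Rightarrow> (real^2 \<Rightarrow> 'b::real_normed_vector) \<Rightarrow> bool" where
  "C_class 0 F \<longleftrightarrow> continuous_on UNIV F"
| "C_class (Suc m) F \<longleftrightarrow> F differentiable_on UNIV \<and> (\<forall>i. C_class m (partial UNIV i F))"

definition C_space :: "nat \<Rightarrow> (real^2) set \<Rightarrow> (real^2 \<Rightarrow> 'b::real_normed_vector) set" where
  "C_space m S = {f. \<exists>F. C_class m F \<and> (\<forall>x\<in>S. f x = F x)}"

definition locally_Holder :: "real \<Rightarrow> (real^2 \<Rightarrow> 'b::real_normed_vector) \<Rightarrow> bool" where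
  "locally_Holder \<beta> F \<longleftrightarrow>
     (\<forall>R. \<exists>H. \<forall>x\<in>cball 0 R. \<forall>y\<in>cball 0 R. norm (F x - F y) \<le> H * dist x y powr \<beta>)"

definition Holder_space :: "nat \<Rightarrow> real \<Rightarrow> (real^2) set \<Rightarrow> (real^2 \<Rightarrow> 'b::real_normed_vector) set" where
  "Holder_space m \<beta> S =
     {f. \<exists>F. C_class m F \<and> (\<forall>is. length is = m \<longrightarrow> locally_Holder \<beta> (partials UNIV is F)) \<and>
             (\<forall>x\<in>S. f x = F x)}"

text \<open>The supremum norm over \<open>S\<close> of the full \<open>j\<close>-th gradient, whose pointwise size is the
  Euclidean (Frobenius) norm of the array of all partial derivatives of order \<open>j\<close>. The suprema
  below are suprema of bounded sets of reals when \<open>S\<close> is compact and \<open>f\<close> lies in the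
  corresponding space.\<close>

definition grad_norm :: "nat \<Rightarrow> (real^2) set \<Rightarrow> (real^2 \<Rightarrow> 'b::real_normed_vector) \<Rightarrow> real" where
  "grad_norm j S f = (SUP x\<in>S. L2_set (\<lambda>is. norm (partials S is f x)) {is. length is = j})"

definition C_norm :: "nat \<Rightarrow> (real^2) set \<Rightarrow> (real^2 \<Rightarrow> 'b::real_normed_vector) \<Rightarrow> real" where
  "C_norm m S f = (\<Sum>j\<le>m. grad_norm j S f)"

definition Holder_seminorm :: "nat \<Rightarrow> real \<Rightarrow> (real^2) set \<Rightarrow> (real^2 \<Rightarrow> 'b::real_normed_vector) \<Rightarrow> real" where
  "Holder_seminorm m \<beta> S f =
     (SUP (x, y)\<in>{(x, y). x \<in> S \<and> y \<in> S \<and> x \<noteq> y}.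
        L2_set (\<lambda>is. norm (partials S is f x - partials S is f y)) {is. length is = m}
          / dist x y powr \<beta>)"

definition Holder_norm :: "nat \<Rightarrow> real \<Rightarrow> (real^2) set \<Rightarrow> (real^2 \<Rightarrow> 'b::real_normed_vector) \<Rightarrow> real" where
  "Holder_norm m \<beta> S f = C_norm m S f + Holder_seminorm m \<beta> S f"


subsection \<open>The defect\<close>

definition grad :: "(real^2) set \<Rightarrow> (real^2 \<Rightarrow> real^2) \<Rightarrow> real^2 \<Rightarrow> real^2^2" where
  "grad S v x = jacobian v (at x within S)"

definition sym_part :: "real^2^2 \<Rightarrow> real^2^2" where
  "sym_part B = (1/2) *\<^sub>R (B + transpose B)"

definition defect :: "(real^2) set \<Rightarrow> (real^2 \<Rightarrow> real^2^2) \<Rightarrow> (real^2 \<Rightarrow> real^2) \<Rightarrow> (real^2 \<Rightarrow> real^2)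
    \<Rightarrow> real^2 \<Rightarrow> real^2^2" where
  "defect S A v w x =
     A x - ((1/2) *\<^sub>R (transpose (grad S v x) ** grad S v x) + sym_part (grad S w x))"

end

theory Submission
  imports Defs
begin

text \<open>The defect of the mollified fields is brought to diagonal form by solving
  \<open>(\<partial>\<^sub>1 \<Psi>\<^sub>2 + \<partial>\<^sub>2 \<Psi>\<^sub>1) / 2 = f\<close>, which costs only the number of dyadic scales involved, that is a
  logarithm of \<open>\<lambda>\<close>; a large multiple of the identity makes the diagonal entries positive. Since the
  codimension equals the dimension, an oscillation in direction \<open>i\<close> can always be put into the component
  \<open>V\<^sub>i\<close>. One such corrugation, with frequency \<open>\<nu>\<close> replaced by \<open>\<nu> / \<rho>\<close>, cancels the entry \<open>ii\<close> of the defect.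
  Repeated integration by parts in the fast direction turns the remaining oscillatory terms into a symmetric
  gradient plus an entry \<open>jj\<close> that is smaller by the factor \<open>(\<rho> \<tau>)\<^sup>2\<close>, where \<open>\<tau>\<^sup>2\<close> is the logarithmic loss. The
  quadratic error in the slow gradient of the amplitude is removed beforehand by a Kallen iteration.
  Exchanging \<open>i\<close> and \<open>j\<close> at each step, the amplitude decays by \<open>\<rho> \<tau>\<close> while the frequency grows
  by \<open>1 / \<rho>\<close>. With \<open>\<rho> = (\<lambda> l)\<^bsup>-1/2\<^esup>\<close> the second derivatives therefore grow only through powers
  of \<open>\<tau>\<close>, and after \<open>K N + 2\<close> steps the defect has gained the factor \<open>(\<lambda> l)\<^bsup>-K N\<^esup>\<close>.\<close>

subsection \<open>Uniform estimates for families of fields\<close>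

text \<open>The choice of component is decisive. A ripple \<open>T\<close> of frequency \<mu> in
  direction \<open>i\<close>, added to \<open>V i\<close>, creates mixed terms which, after a
  correction of the second field, are \<open>T\<close> times second derivatives of
  \<open>V i\<close>. As \<open>T\<close> has size p / \<mu>, a second derivative of size p \<mu>
  would reproduce the defect undiminished. In the entry \<open>ii\<close> this is harmless, since
  the product oscillates in direction \<open>i\<close> and is integrated away. In the entry
  \<open>jj\<close> nothing of the kind is available: there one needs that every derivative of
  \<open>V i\<close> in direction \<open>j\<close> carries a factor \<rho>, and this holds because
  the previous oscillation, in direction \<open>j\<close>, went into \<open>V j\<close>. The budget:
  \<open>J\<close> steps multiply the frequency by \<rho>^(-J) but the amplitude only by (\<rho>
  \<tau>)^(J - 1). Together with two more factors from the set-up, the second derivatives lose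
  \<rho>^(-3), that is (\<lambda> l)^(3/2), and this is at most (\<lambda> l)^(K + N). All powers of
  \<tau> are affordable because the hypothesis on \<lambda> and l says exactly that \<lambda> l is
  at least \<lambda>^\<gamma>.\<close>

text \<open>All estimates are uniform in an index \<open>\<iota>\<close>, which will run through all admissible data at once;
  the constants hidden in \<open>BO\<close> and \<open>SC\<close> thus end up in the constant of the theorem. The sets \<open>D\<close>
  collect, for each index, the points at which an estimate holds, and \<open>SC D \<nu> m P f\<close> bounds
  \<open>\<partial>\<^sup>\<alpha> f\<close> by \<open>P \<nu>\<^sup>\<alpha>\<close> for \<open>\<bar>\<alpha>\<bar> \<le> m\<close>, with one frequency for each direction.\<close>

type_synonym 'i fld = "'i \<Rightarrow> real^2 \<Rightarrow> real"

definition pd :: "2 \<Rightarrow> 'i fld \<Rightarrow> 'i fld" where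
  "pd k f = (\<lambda>\<iota> x. frechet_derivative (f \<iota>) (at x) (axis k 1))"

text \<open>Open slices make unrestricted derivatives at points of \<open>D\<close> depend only on
  values in \<open>D\<close>. A slice may be empty, so \<open>D\<close> restricts the index as well
  as the point.\<close>

definition odom :: "('i \<times> (real^2)) set \<Rightarrow> bool" where
  "odom D \<longleftrightarrow> (\<forall>\<iota>. open {x. (\<iota>, x) \<in> D})"

definition BO :: "('i \<times> (real^2)) set \<Rightarrow> ('i \<Rightarrow> real) \<Rightarrow> 'i fld \<Rightarrow> bool" where
  "BO D P f \<longleftrightarrow> (\<exists>C>0. \<forall>\<iota> x. (\<iota>, x) \<in> D \<longrightarrow> \<bar>f \<iota> x\<bar> \<le> C * P \<iota>)"

primrec SC :: "('i \<times> (real^2)) set \<Rightarrow> (2 \<Rightarrow> 'i \<Rightarrow> real) \<Rightarrow> nat \<Rightarrow> ('i \<Rightarrow> real) \<Rightarrow> 'i fld \<Rightarrow> bool" where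
  "SC D \<nu> 0 P f \<longleftrightarrow> odom D \<and> BO D P f \<and> (\<forall>\<iota> x. (\<iota>, x) \<in> D \<longrightarrow> isCont (f \<iota>) x)"
| "SC D \<nu> (Suc m) P f \<longleftrightarrow> odom D \<and> BO D P f \<and> (\<forall>\<iota> x. (\<iota>, x) \<in> D \<longrightarrow> f \<iota> differentiable (at x)) \<and>
     (\<forall>k. SC D \<nu> m (\<lambda>\<iota>. P \<iota> * \<nu> k \<iota>) (pd k f))"

section \<open>Partial derivatives of indexed families\<close>

lemma has_derivative_pd:
  assumes "f \<iota> differentiable (at x)"
  shows "(f \<iota> has_derivative (\<lambda>h. \<Sum>k\<in>UNIV. h $ k * pd k f \<iota> x)) (at x)"
proof -
  have D: "(f \<iota> has_derivative frechet_derivative (f \<iota>) (at x)) (at x)"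
    using assms frechet_derivative_works by blast
  have "frechet_derivative (f \<iota>) (at x) = (\<lambda>h. \<Sum>k\<in>UNIV. h $ k * pd k f \<iota> x)"
  proof
    fix h
    have "frechet_derivative (f \<iota>) (at x) h
        = frechet_derivative (f \<iota>) (at x) (\<Sum>k\<in>UNIV. h $ k *\<^sub>R axis k 1)"
      using basis_expansion[of h] by (simp add: scalar_mult_eq_scaleR)
    also have "\<dots> = (\<Sum>k\<in>UNIV. h $ k * pd k f \<iota> x)"
      using has_derivative_linear[OF D] by (simp add: linear_sum linear_cmul pd_def)
    finally show "frechet_derivative (f \<iota>) (at x) h = (\<Sum>k\<in>UNIV. h $ k * pd k f \<iota> x)" .
  qed
  with D show ?thesis by (simp only:)
qed

lemma pd_eqI:
  assumes "(f \<iota> has_derivative g) (at x)"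
  shows "pd k f \<iota> x = g (axis k 1)"
  using frechet_derivative_at[OF assms] by (simp add: pd_def)

lemma sum_axis: "(\<Sum>k\<in>UNIV. (axis q (1::real) :: real^2) $ k * d k) = d q"
  by (simp add: axis_def if_distrib[of "\<lambda>x. x * _"] cong: if_cong)

lemma pd_eq:
  assumes "(f \<iota> has_derivative (\<lambda>h. \<Sum>k\<in>UNIV. h $ k * d k)) (at x)"
  shows "pd k f \<iota> x = d k"
  using pd_eqI[where f=f and \<iota>=\<iota> and k=k, OF assms] by (simp add: sum_axis)

lemma pd_const [simp]: "pd k (\<lambda>\<iota> x. c \<iota>) = (\<lambda>\<iota> x. 0)"
  by (simp add: pd_def)

lemma pd_add:
  assumes "f \<iota> differentiable (at x)" "g \<iota> differentiable (at x)"
  shows "pd k (\<lambda>\<iota> x. f \<iota> x + g \<iota> x) \<iota> x = pd k f \<iota> x + pd k g \<iota> x"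
  using pd_eqI[where f="\<lambda>\<iota> x. f \<iota> x + g \<iota> x", OF has_derivative_add[OF has_derivative_pd[of f, OF assms(1)] has_derivative_pd[of g, OF assms(2)]]]
  by (simp add: sum_axis)

lemma pd_diff:
  assumes "f \<iota> differentiable (at x)" "g \<iota> differentiable (at x)"
  shows "pd k (\<lambda>\<iota> x. f \<iota> x - g \<iota> x) \<iota> x = pd k f \<iota> x - pd k g \<iota> x"
  using pd_eqI[where f="\<lambda>\<iota> x. f \<iota> x - g \<iota> x", OF has_derivative_diff[OF has_derivative_pd[of f, OF assms(1)] has_derivative_pd[of g, OF assms(2)]]]
  by (simp add: sum_axis)

lemma pd_mult:
  assumes "f \<iota> differentiable (at x)" "g \<iota> differentiable (at x)"
  shows "pd k (\<lambda>\<iota> x. f \<iota> x * g \<iota> x) \<iota> x = f \<iota> x * pd k g \<iota> x + pd k f \<iota> x * g \<iota> x"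
  using pd_eqI[where f="\<lambda>\<iota> x. f \<iota> x * g \<iota> x", OF has_derivative_mult[OF has_derivative_pd[of f, OF assms(1)] has_derivative_pd[of g, OF assms(2)]]]
  by (simp add: sum_axis)

lemma pd_cmult:
  assumes "f \<iota> differentiable (at x)"
  shows "pd k (\<lambda>\<iota> x. c \<iota> * f \<iota> x) \<iota> x = c \<iota> * pd k f \<iota> x"
  using pd_eqI[where f="\<lambda>\<iota> x. c \<iota> * f \<iota> x", OF has_derivative_mult_right[OF has_derivative_pd[of f, OF assms(1)]]]
  by (simp add: sum_axis)

lemma odomD: "odom D \<Longrightarrow> (\<iota>, x) \<in> D \<Longrightarrow> open {x. (\<iota>, x) \<in> D} \<and> x \<in> {x. (\<iota>, x) \<in> D}"
  by (auto simp: odom_def)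

lemma pd_cong:
  assumes "odom D" "(\<iota>, x) \<in> D" and eq: "\<And>x. (\<iota>, x) \<in> D \<Longrightarrow> f \<iota> x = g \<iota> x"
  shows "f \<iota> differentiable (at x) \<Longrightarrow> g \<iota> differentiable (at x)"
    and "f \<iota> differentiable (at x) \<Longrightarrow> pd k g \<iota> x = pd k f \<iota> x"
proof -
  assume "f \<iota> differentiable (at x)"
  then have "(f \<iota> has_derivative (\<lambda>h. \<Sum>k\<in>UNIV. h $ k * pd k f \<iota> x)) (at x)"
    by (rule has_derivative_pd)
  then have *: "(g \<iota> has_derivative (\<lambda>h. \<Sum>k\<in>UNIV. h $ k * pd k f \<iota> x)) (at x)"
    by (rule has_derivative_transform_within_open[of _ _ _ _ "{x. (\<iota>, x) \<in> D}"])
       (use odomD[OF assms(1,2)] eq in auto)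
  show "g \<iota> differentiable (at x)" using * differentiable_def by blast
  show "pd k g \<iota> x = pd k f \<iota> x" by (rule pd_eq[where f=g and d="\<lambda>k. pd k f \<iota> x", OF *])
qed

lemma SC_BO: "SC D \<nu> m P f \<Longrightarrow> BO D P f" by (cases m) auto
lemma SC_odom: "SC D \<nu> m P f \<Longrightarrow> odom D" by (cases m) auto
lemma SC_diff: "SC D \<nu> (Suc m) P f \<Longrightarrow> (\<iota>, x) \<in> D \<Longrightarrow> f \<iota> differentiable (at x)" by auto
lemma SC_pd: "SC D \<nu> (Suc m) P f \<Longrightarrow> SC D \<nu> m (\<lambda>\<iota>. P \<iota> * \<nu> k \<iota>) (pd k f)" by auto

lemma SC_SucI_pd:
  "odom D \<Longrightarrow> BO D P f \<Longrightarrow> (\<And>\<iota> x. (\<iota>, x) \<in> D \<Longrightarrow> f \<iota> differentiable (at x)) \<Longrightarrow>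
    (\<And>k. SC D \<nu> m (\<lambda>\<iota>. P \<iota> * \<nu> k \<iota>) (pd k f)) \<Longrightarrow> SC D \<nu> (Suc m) P f"
  by auto

lemma SC_isCont: "SC D \<nu> m P f \<Longrightarrow> (\<iota>, x) \<in> D \<Longrightarrow> isCont (f \<iota>) x"
  by (cases m) (auto intro: differentiable_imp_continuous_within)

lemma BO_nonneg: "BO D P f \<Longrightarrow> (\<iota>, x) \<in> D \<Longrightarrow> 0 \<le> P \<iota>"
proof -
  assume "BO D P f" "(\<iota>, x) \<in> D"
  then obtain C where "C > 0" "\<bar>f \<iota> x\<bar> \<le> C * P \<iota>" unfolding BO_def by blast
  then have "0 \<le> C * P \<iota>" by linarith
  with \<open>C > 0\<close> show ?thesis by (simp add: zero_le_mult_iff)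
qed

lemma SC_nonneg: "SC D \<nu> m P f \<Longrightarrow> (\<iota>, x) \<in> D \<Longrightarrow> 0 \<le> P \<iota>"
  using SC_BO BO_nonneg by metis

lemma SC_SucD: "SC D \<nu> (Suc m) P f \<Longrightarrow> SC D \<nu> m P f"
proof (induction m arbitrary: P f)
  case 0
  then show ?case by (auto intro: differentiable_imp_continuous_within)
next
  case (Suc m)
  show ?case
    by (rule SC_SucI_pd[OF SC_odom[OF Suc.prems] SC_BO[OF Suc.prems] SC_diff[OF Suc.prems] Suc.IH[OF SC_pd[OF Suc.prems]]])
qed

lemma SC_order: "SC D \<nu> m P f \<Longrightarrow> n \<le> m \<Longrightarrow> SC D \<nu> n P f"
  by (induction m) (auto simp: le_Suc_eq dest: SC_SucD simp del: SC.simps)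

lemma BO_I: "C > 0 \<Longrightarrow> (\<And>\<iota> x. (\<iota>, x) \<in> D \<Longrightarrow> \<bar>f \<iota> x\<bar> \<le> C * P \<iota>) \<Longrightarrow> BO D P f"
  unfolding BO_def by blast

lemma BO_E:
  assumes "BO D P f"
  obtains C where "C > 0" "\<And>\<iota> x. (\<iota>, x) \<in> D \<Longrightarrow> \<bar>f \<iota> x\<bar> \<le> C * P \<iota>"
  using assms unfolding BO_def by blast

lemma BO_cong: "BO D P f \<Longrightarrow> (\<And>\<iota> x. (\<iota>, x) \<in> D \<Longrightarrow> g \<iota> x = f \<iota> x) \<Longrightarrow> BO D P g"
  unfolding BO_def by simp

lemma SC_cong:
  "SC D \<nu> m P f \<Longrightarrow> (\<And>\<iota> x. (\<iota>, x) \<in> D \<Longrightarrow> g \<iota> x = f \<iota> x) \<Longrightarrow> SC D \<nu> m P g"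
proof (induction m arbitrary: P f g)
  case 0
  have "isCont (g \<iota>) x" if "(\<iota>, x) \<in> D" for \<iota> x
  proof -
    have "eventually (\<lambda>y. g \<iota> y = f \<iota> y) (nhds x)"
      unfolding eventually_nhds
      by (rule exI[of _ "{x. (\<iota>, x) \<in> D}"]) (use odomD[OF SC_odom[OF 0(1)] that] 0(2) in auto)
    moreover have "isCont (f \<iota>) x" using 0(1) that by auto
    ultimately show ?thesis using isCont_cong by blast
  qed
  with 0(1) BO_cong[OF SC_BO[OF 0(1)] 0(2)] show ?case by simp
next
  case (Suc m)
  have o: "odom D" using Suc(2) by simp
  note c = pd_cong[OF o _ Suc(3)[symmetric] SC_diff[OF Suc(2)]]
  show ?case
  proof (rule SC_SucI_pd[OF o])
    show "BO D P g" using BO_cong[OF SC_BO[OF Suc(2)] Suc(3)] .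
    show "SC D \<nu> m (\<lambda>\<iota>. P \<iota> * \<nu> k \<iota>) (pd k g)" for k
      by (rule Suc.IH[OF SC_pd[OF Suc(2)]]) (rule c(2))
  qed (rule c(1))
qed

lemma SC_SucI:
  assumes "odom D" "BO D P f"
    and d: "\<And>\<iota> x. (\<iota>, x) \<in> D \<Longrightarrow> (f \<iota> has_derivative (\<lambda>h. \<Sum>k\<in>UNIV. h $ k * d k \<iota> x)) (at x)"
    and S: "\<And>k. SC D \<nu> m (\<lambda>\<iota>. P \<iota> * \<nu> k \<iota>) (d k)"
  shows "SC D \<nu> (Suc m) P f"
proof (rule SC_SucI_pd[OF assms(1,2)])
  show "f \<iota> differentiable (at x)" if "(\<iota>, x) \<in> D" for \<iota> x
    using d[OF that] differentiable_def by blast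
  show "SC D \<nu> m (\<lambda>\<iota>. P \<iota> * \<nu> k \<iota>) (pd k f)" for k
    by (rule SC_cong[OF S]) (rule pd_eq[where d="\<lambda>k. d k _ _", OF d])
qed

section \<open>Algebra of the weighted estimates\<close>

lemma BO_mono:
  assumes "BO D P f" "c > 0" "\<And>\<iota> x. (\<iota>, x) \<in> D \<Longrightarrow> P \<iota> \<le> c * Q \<iota>"
  shows "BO D Q f"
proof -
  obtain C where C: "C > 0" "\<And>\<iota> x. (\<iota>, x) \<in> D \<Longrightarrow> \<bar>f \<iota> x\<bar> \<le> C * P \<iota>"
    using BO_E[OF assms(1)] by blast
  show ?thesis
  proof (rule BO_I[of "C * c"])
    fix \<iota> x assume a: "(\<iota>, x) \<in> D"
    show "\<bar>f \<iota> x\<bar> \<le> C * c * Q \<iota>"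
      using order_trans[OF C(2)[OF a] mult_left_mono[OF assms(3)[OF a], of C]] C(1) by (simp add: mult.assoc)
  qed (use C assms in simp)
qed

lemma BO_add: assumes "BO D P f" "BO D P g" shows "BO D P (\<lambda>\<iota> x. f \<iota> x + g \<iota> x)"
proof -
  obtain C where C: "C > 0" "\<And>\<iota> x. (\<iota>, x) \<in> D \<Longrightarrow> \<bar>f \<iota> x\<bar> \<le> C * P \<iota>"
    using BO_E[OF assms(1)] by blast
  obtain C' where C': "C' > 0" "\<And>\<iota> x. (\<iota>, x) \<in> D \<Longrightarrow> \<bar>g \<iota> x\<bar> \<le> C' * P \<iota>"
    using BO_E[OF assms(2)] by blast
  show ?thesis
    by (rule BO_I[of "C + C'"]) (use C(1) C'(1) C(2) C'(2) in \<open>fastforce simp: algebra_simps\<close>)+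
qed

lemma BO_mult: assumes "BO D P f" "BO D Q g" shows "BO D (\<lambda>\<iota>. P \<iota> * Q \<iota>) (\<lambda>\<iota> x. f \<iota> x * g \<iota> x)"
proof -
  obtain C where C: "C > 0" "\<And>\<iota> x. (\<iota>, x) \<in> D \<Longrightarrow> \<bar>f \<iota> x\<bar> \<le> C * P \<iota>"
    using BO_E[OF assms(1)] by blast
  obtain C' where C': "C' > 0" "\<And>\<iota> x. (\<iota>, x) \<in> D \<Longrightarrow> \<bar>g \<iota> x\<bar> \<le> C' * Q \<iota>"
    using BO_E[OF assms(2)] by blast
  show ?thesis
  proof (rule BO_I[of "C * C'"])
    fix \<iota> x assume a: "(\<iota>, x) \<in> D"
    have "\<bar>f \<iota> x\<bar> * \<bar>g \<iota> x\<bar> \<le> (C * P \<iota>) * (C' * Q \<iota>)"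
      by (rule mult_mono[OF C(2)[OF a] C'(2)[OF a]]) (use C(2)[OF a] in auto)
    then show "\<bar>f \<iota> x * g \<iota> x\<bar> \<le> C * C' * (P \<iota> * Q \<iota>)" by (simp add: abs_mult mult_ac)
  qed (use C C' in simp)
qed

lemma BO_fun: "(\<And>\<iota> x. (\<iota>, x) \<in> D \<Longrightarrow> \<bar>f \<iota> x\<bar> \<le> P \<iota>) \<Longrightarrow> BO D P f"
  by (rule BO_I[of 1]) auto

lemma BO_cmult: "BO D P f \<Longrightarrow> BO D (\<lambda>\<iota>. \<bar>c \<iota>\<bar> * P \<iota>) (\<lambda>\<iota> x. c \<iota> * f \<iota> x)"
  by (rule BO_mult[OF BO_fun]) auto

lemma BO_minus: "BO D P f \<Longrightarrow> BO D P (\<lambda>\<iota> x. - f \<iota> x)"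
  unfolding BO_def by simp

lemma BO_diff: "BO D P f \<Longrightarrow> BO D P g \<Longrightarrow> BO D P (\<lambda>\<iota> x. f \<iota> x - g \<iota> x)"
  using BO_add[OF _ BO_minus, of D P f g] by simp

lemma BO_scale: "BO D P f \<Longrightarrow> BO D P (\<lambda>\<iota> x. c * f \<iota> x)"
  \<comment> \<open>The summand 1 keeps the constant positive when \<open>c\<close> is 0.\<close>
  by (rule BO_mono[OF BO_cmult[where c="\<lambda>_. c"], of _ _ _ "\<bar>c\<bar> + 1"])
     (auto intro!: mult_right_mono dest: BO_nonneg)

text \<open>The constant picks up a factor \<open>c'\<close> with every derivative. This is
  harmless, because the order \<open>m\<close> is fixed while the index varies.\<close>

lemma SC_mono:
  assumes "SC D \<nu> m P f" "c > 0" "c' > 0"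
    and "\<And>\<iota> x. (\<iota>, x) \<in> D \<Longrightarrow> P \<iota> \<le> c * Q \<iota>"
    and \<nu>: "\<And>k \<iota> x. (\<iota>, x) \<in> D \<Longrightarrow> 0 \<le> \<nu> k \<iota> \<and> \<nu> k \<iota> \<le> c' * \<nu>' k \<iota>"
  shows "SC D \<nu>' m Q f"
  using assms(1,2,4)
proof (induction m arbitrary: P Q f c)
  case 0
  then show ?case using BO_mono[of D P f c Q] by auto
next
  case (Suc m)
  show ?case
  proof (rule SC_SucI_pd[OF SC_odom[OF Suc(2)] BO_mono[OF SC_BO[OF Suc(2)] Suc(3,4)] SC_diff[OF Suc(2)]])
    fix k
    show "SC D \<nu>' m (\<lambda>\<iota>. Q \<iota> * \<nu>' k \<iota>) (pd k f)"
    proof (rule Suc.IH[OF SC_pd[OF Suc(2)], of "c * c'"])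
      fix \<iota> x assume a: "(\<iota>, x) \<in> D"
      have "0 \<le> c * Q \<iota>" using Suc(4)[OF a] SC_nonneg[OF Suc(2) a] by linarith
      moreover have "0 \<le> P \<iota>" by (rule SC_nonneg[OF Suc(2) a])
      ultimately have "P \<iota> * \<nu> k \<iota> \<le> (c * Q \<iota>) * (c' * \<nu>' k \<iota>)"
        using Suc(4)[OF a] \<nu>[OF a, of k] by (intro mult_mono) auto
      then show "P \<iota> * \<nu> k \<iota> \<le> c * c' * (Q \<iota> * \<nu>' k \<iota>)" by (simp add: mult_ac)
    qed (use Suc(3) assms(3) in simp)
  qed
qed

text \<open>Equal weights stay equal under multiplication by the frequencies, so in contrast to
  \<open>SC_mono\<close> no sign of the frequencies is required. This is the rule for simplifying
  products of weights.\<close>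

lemma SC_weight:
  assumes "SC D \<nu> m P f" "\<And>\<iota> x. (\<iota>, x) \<in> D \<Longrightarrow> P \<iota> = Q \<iota>"
  shows "SC D \<nu> m Q f"
  using assms
proof (induction m arbitrary: P Q f)
  case 0
  then show ?case using BO_mono[of D P f 1 Q] by auto
next
  case (Suc m)
  show ?case
    by (rule SC_SucI_pd[OF SC_odom[OF Suc(2)] BO_mono[OF SC_BO[OF Suc(2)], of 1] SC_diff[OF Suc(2)]
        Suc.IH[OF SC_pd[OF Suc(2)]]]) (use Suc(3) in auto)
qed

lemma SC_add:
  "SC D \<nu> m P f \<Longrightarrow> SC D \<nu> m P g \<Longrightarrow> SC D \<nu> m P (\<lambda>\<iota> x. f \<iota> x + g \<iota> x)"
proof (induction m arbitrary: P f g)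
  case 0
  then show ?case by (auto intro: BO_add)
next
  case (Suc m)
  note d = SC_diff[OF Suc(2)] SC_diff[OF Suc(3)]
  show ?case
    by (rule SC_SucI_pd[OF SC_odom[OF Suc(2)] BO_add[OF SC_BO[OF Suc(2)] SC_BO[OF Suc(3)]] differentiable_add[OF d]
        SC_cong[OF Suc.IH[OF SC_pd[OF Suc(2)] SC_pd[OF Suc(3)]] pd_add[OF d]]])
qed

lemma SC_mult:
  "SC D \<nu> m P f \<Longrightarrow> SC D \<nu> m Q g \<Longrightarrow> SC D \<nu> m (\<lambda>\<iota>. P \<iota> * Q \<iota>) (\<lambda>\<iota> x. f \<iota> x * g \<iota> x)"
proof (induction m arbitrary: P Q f g)
  case 0
  then show ?case by (auto intro: BO_mult)
next
  case (Suc m)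
  note d = SC_diff[OF Suc(2)] SC_diff[OF Suc(3)]
  note b = SC_SucD[OF Suc(2)] SC_SucD[OF Suc(3)]
  have "SC D \<nu> m (\<lambda>\<iota>. P \<iota> * Q \<iota> * \<nu> k \<iota>) (\<lambda>\<iota> x. f \<iota> x * pd k g \<iota> x + pd k f \<iota> x * g \<iota> x)" for k
    by (intro SC_add SC_weight[OF Suc.IH[OF b(1) SC_pd[OF Suc(3)]]] SC_weight[OF Suc.IH[OF SC_pd[OF Suc(2)] b(2)]])
       auto
  then show ?case
    by (intro SC_SucI_pd[OF SC_odom[OF Suc(2)] BO_mult[OF SC_BO[OF Suc(2)] SC_BO[OF Suc(3)]] differentiable_mult[OF d]]
        SC_cong[OF _ pd_mult[OF d]])
qed

lemma SC_const:
  assumes "odom D" "\<And>\<iota> x k. (\<iota>, x) \<in> D \<Longrightarrow> 0 \<le> \<nu> k \<iota>" "\<And>\<iota> x. (\<iota>, x) \<in> D \<Longrightarrow> \<bar>c \<iota>\<bar> \<le> P \<iota>"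
  shows "SC D \<nu> m P (\<lambda>\<iota> x. c \<iota>)"
  using assms(3)
proof (induction m arbitrary: P c)
  case 0
  then show ?case using assms by (auto intro: BO_fun)
next
  case (Suc m)
  show ?case
  proof (rule SC_SucI_pd[OF assms(1) BO_fun[OF Suc(2)]])
    fix k
    have "0 \<le> P \<iota>" if "(\<iota>, x) \<in> D" for \<iota> x using Suc(2)[OF that] by linarith
    then show "SC D \<nu> m (\<lambda>\<iota>. P \<iota> * \<nu> k \<iota>) (pd k (\<lambda>\<iota> x. c \<iota>))"
      unfolding pd_const using assms(2) by (intro Suc.IH) simp
  qed auto
qed

lemma SC_cmult:
  "SC D \<nu> m P f \<Longrightarrow> SC D \<nu> m (\<lambda>\<iota>. \<bar>c \<iota>\<bar> * P \<iota>) (\<lambda>\<iota> x. c \<iota> * f \<iota> x)"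
proof (induction m arbitrary: P f)
  case 0
  then show ?case by (auto intro: BO_cmult)
next
  case (Suc m)
  note d = SC_diff[OF Suc(2)]
  show ?case
    by (rule SC_SucI_pd[OF SC_odom[OF Suc(2)] BO_cmult[OF SC_BO[OF Suc(2)]] differentiable_mult[OF differentiable_const d]
         SC_cong[OF SC_weight[OF Suc.IH[OF SC_pd[OF Suc(2)]]] pd_cmult[where f=f and c=c, OF d]]]) auto
qed

lemma SC_minus: "SC D \<nu> m P f \<Longrightarrow> SC D \<nu> m P (\<lambda>\<iota> x. - f \<iota> x)"
  using SC_cmult[of D \<nu> m P f "\<lambda>_. -1"] by simp

lemma SC_sub: "SC D \<nu> m P f \<Longrightarrow> SC D \<nu> m P g \<Longrightarrow> SC D \<nu> m P (\<lambda>\<iota> x. f \<iota> x - g \<iota> x)"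
  using SC_add[OF _ SC_minus, of D \<nu> m P f g] by simp

lemma SC_wmono:
  assumes "SC D \<nu> m P f" "c > 0" "\<And>\<iota> x. (\<iota>, x) \<in> D \<Longrightarrow> P \<iota> \<le> c * Q \<iota>"
    and "\<And>k \<iota> x. (\<iota>, x) \<in> D \<Longrightarrow> 0 \<le> \<nu> k \<iota>"
  shows "SC D \<nu> m Q f"
  by (rule SC_mono[OF assms(1,2), of 1]) (use assms in auto)

lemma SC_scale:
  assumes "SC D \<nu> m P f" "\<And>k \<iota> x. (\<iota>, x) \<in> D \<Longrightarrow> 0 \<le> \<nu> k \<iota>"
  shows "SC D \<nu> m P (\<lambda>\<iota> x. c * f \<iota> x)"
  by (rule SC_wmono[OF SC_cmult[OF assms(1), of "\<lambda>_. c"], of "\<bar>c\<bar> + 1"])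
     (use SC_nonneg[OF assms(1)] assms(2) in \<open>auto intro!: mult_right_mono\<close>)

text \<open>The constant of the original family serves the pulled-back one. Used with
  \<open>fst\<close>, so that a field may carry an extra index such as a dyadic scale, and with the
  identity, to shrink the domain.\<close>

lemma SC_reindex:
  assumes "SC D \<nu> m P f" "odom E" "\<And>k x. (k, x) \<in> E \<Longrightarrow> (g k, x) \<in> D"
  shows "SC E (\<lambda>q k. \<nu> q (g k)) m (\<lambda>k. P (g k)) (\<lambda>k. f (g k))"
  using assms(1)
proof (induction m arbitrary: P f)
  case 0
  then show ?case using assms(2,3) by (auto simp: BO_def)
next
  case (Suc m)
  have "pd q (\<lambda>k. f (g k)) = (\<lambda>k. pd q f (g k))" for q by (simp add: pd_def)
  moreover have "BO E (\<lambda>k. P (g k)) (\<lambda>k. f (g k))"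
    using SC_BO[OF Suc(2)] assms(3) unfolding BO_def by blast
  ultimately show ?case
    using Suc.IH[OF SC_pd[OF Suc(2)]] SC_diff[OF Suc(2)] assms(2,3) by auto
qed

lemma SC_sub_dom: "SC D \<nu> m P f \<Longrightarrow> odom E \<Longrightarrow> E \<subseteq> D \<Longrightarrow> SC E \<nu> m P f"
  using SC_reindex[of D \<nu> m P f E "\<lambda>x. x"] by auto

text \<open>This is how a field multiplied by a cut-off becomes a field on the whole plane: on the
  open set \<open>Z\<close> all its derivatives vanish, so the constants found on \<open>D\<close>
  remain valid on \<open>E\<close>.\<close>

lemma SC_extend:
  assumes "SC D \<nu> m P f" "odom E" "odom Z" "E \<subseteq> D \<union> Z" "\<And>\<iota> x. (\<iota>, x) \<in> Z \<Longrightarrow> f \<iota> x = 0"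
    and P: "\<And>\<iota> x. (\<iota>, x) \<in> E \<Longrightarrow> 0 \<le> P \<iota>" "\<And>k \<iota> x. (\<iota>, x) \<in> E \<Longrightarrow> 0 \<le> \<nu> k \<iota>"
  shows "SC E \<nu> m P f"
  using assms(1,5) P(1)
proof (induction m arbitrary: P f)
  case 0
  have "SC Z (\<lambda>_ _. 0) 0 (\<lambda>_. 0) (\<lambda>_ _. 0)" by (rule SC_const[OF assms(3)]) auto
  then have "SC Z (\<lambda>_ _. 0) 0 (\<lambda>_. 0) f" by (rule SC_cong) (rule 0(2))
  then have z: "isCont (f \<iota>) x" if "(\<iota>, x) \<in> Z" for \<iota> x using that by simp
  have "BO E P f"
    using 0 assms(4) unfolding BO_def SC.simps
    by (metis (no_types, lifting) Un_iff abs_zero less_eq_real_def mult_nonneg_nonneg subsetD)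
  moreover have "isCont (f \<iota>) x" if "(\<iota>, x) \<in> E" for \<iota> x
    using that assms(4) SC_isCont[OF 0(1)] z by blast
  ultimately show ?case using assms(2) by simp
next
  case (Suc m)
  have z: "f \<iota> differentiable (at x)" "pd k f \<iota> x = 0" if "(\<iota>, x) \<in> Z" for \<iota> x k
    using pd_cong(1)[where f="\<lambda>_ _. 0" and g=f, OF assms(3) that] pd_cong(2)[where f="\<lambda>_ _. 0" and g=f and k=k, OF assms(3) that] Suc(3) by simp_all
  obtain C where C: "C > 0" "\<And>\<iota> x. (\<iota>, x) \<in> D \<Longrightarrow> \<bar>f \<iota> x\<bar> \<le> C * P \<iota>"
    using BO_E[OF SC_BO[OF Suc(2)]] by blast
  show ?case
  proof (rule SC_SucI_pd[OF assms(2)])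
    show "BO E P f"
      by (rule BO_I[OF C(1)]) (use C assms(4) Suc(3,4) in fastforce)
    show "f \<iota> differentiable (at x)" if "(\<iota>, x) \<in> E" for \<iota> x
      using that assms(4) z SC_diff[OF Suc(2)] by blast
    show "SC E \<nu> m (\<lambda>\<iota>. P \<iota> * \<nu> k \<iota>) (pd k f)" for k
      by (rule Suc.IH[OF SC_pd[OF Suc(2)] z(2)]) (use Suc(4) P(2) in auto)
  qed
qed


section \<open>Cosines, square roots and long sums\<close>

lemma has_derivative_vec_nth [derivative_intros]:
  "((\<lambda>x::real^2. x $ i) has_derivative (\<lambda>h. h $ i)) F"
  by (rule bounded_linear_imp_has_derivative[OF bounded_linear_vec_nth])

text \<open>The phase is general because differentiation shifts it by \<open>pi/2\<close>, which
  closes the induction without a companion statement for the sine. Only direction \<open>i\<close>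
  has to pay for the frequency.\<close>

lemma SC_cos:
  assumes "odom D" and \<nu>: "\<And>k \<iota> x. (\<iota>, x) \<in> D \<Longrightarrow> 0 \<le> \<nu> k \<iota>"
    and c: "K > 0" "\<And>\<iota> x. (\<iota>, x) \<in> D \<Longrightarrow> \<bar>c \<iota>\<bar> \<le> K * \<nu> i \<iota>"
  shows "SC D \<nu> m (\<lambda>_. 1) (\<lambda>\<iota> x. cos (c \<iota> * x $ i + \<theta>))"
proof (induction m arbitrary: \<theta>)
  case 0
  have "BO D (\<lambda>_. 1) (\<lambda>\<iota> x. cos (c \<iota> * x $ i + \<theta>))" by (rule BO_fun) auto
  then show ?case using assms(1) by (auto intro!: continuous_intros)
next
  case (Suc m)
  show ?case
  proof (rule SC_SucI[OF assms(1)])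
    show "BO D (\<lambda>_. 1) (\<lambda>\<iota> x. cos (c \<iota> * x $ i + \<theta>))" by (rule BO_fun) auto
    show "((\<lambda>x. cos (c \<iota> * x $ i + \<theta>)) has_derivative
        (\<lambda>h. \<Sum>k\<in>UNIV. h $ k * (if k = i then c \<iota> * cos (c \<iota> * x $ i + (\<theta> + pi/2)) else 0))) (at x)" for \<iota> x
      by (auto intro!: derivative_eq_intros ext simp: cos_add sin_add if_distrib[where f="\<lambda>z. _ * z"] algebra_simps cong: if_cong)
    show "SC D \<nu> m (\<lambda>\<iota>. 1 * \<nu> k \<iota>) (\<lambda>\<iota> x. if k = i then c \<iota> * cos (c \<iota> * x $ i + (\<theta> + pi/2)) else 0)" for k
    proof (cases "k = i")
      case True
      show ?thesis
        by (simp add: True, rule SC_wmono[OF SC_cmult[OF Suc], of K]) (use c \<nu> in auto)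
    next
      case False
      then show ?thesis by (simp, intro SC_const[OF assms(1)]) (use \<nu> in auto)
    qed
  qed
qed

text \<open>The derivative of b = 1 / sqrt h is -(1/2) h' b^3, a product of a derivative of
  \<open>h\<close> with copies of b of lower order, so the induction needs nothing beyond
  \<open>SC_mult\<close>. The lower bound on \<open>h\<close> enters only through the sup bound on b
  and through positivity.\<close>

lemma SC_inverse_sqrt:
  assumes "SC D \<nu> m (\<lambda>\<iota>. (p \<iota>)^2) h" "c > 0"
    and p: "\<And>\<iota> x. (\<iota>, x) \<in> D \<Longrightarrow> 0 < p \<iota>" "\<And>\<iota> x. (\<iota>, x) \<in> D \<Longrightarrow> c * (p \<iota>)^2 \<le> h \<iota> x"
    and \<nu>: "\<And>k \<iota> x. (\<iota>, x) \<in> D \<Longrightarrow> 0 \<le> \<nu> k \<iota>"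
  shows "SC D \<nu> m (\<lambda>\<iota>. 1 / p \<iota>) (\<lambda>\<iota> x. 1 / sqrt (h \<iota> x))"
  using assms(1)
proof (induction m)
  have pos: "0 < h \<iota> x" if "(\<iota>, x) \<in> D" for \<iota> x
    using p[OF that] \<open>c > 0\<close> by (smt (verit) mult_pos_pos zero_less_power)
  have B: "BO D (\<lambda>\<iota>. 1 / p \<iota>) (\<lambda>\<iota> x. 1 / sqrt (h \<iota> x))"
  proof (rule BO_I[of "1 / sqrt c"])
    fix \<iota> x assume a: "(\<iota>, x) \<in> D"
    have "sqrt (c * (p \<iota>)^2) \<le> sqrt (h \<iota> x)" using p(2)[OF a] by simp
    then have "sqrt c * p \<iota> \<le> sqrt (h \<iota> x)" using p(1)[OF a] by (simp add: real_sqrt_mult)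
    then show "\<bar>1 / sqrt (h \<iota> x)\<bar> \<le> 1 / sqrt c * (1 / p \<iota>)"
      using pos[OF a] p(1)[OF a] \<open>c > 0\<close> by (simp add: divide_simps)
  qed (use \<open>c > 0\<close> in simp)
  {
    case 0
    then show ?case using B pos by (auto intro!: continuous_intros) (metis less_irrefl)
  next
    case (Suc m)
    let ?b = "\<lambda>\<iota> x. 1 / sqrt (h \<iota> x)"
    note IH = Suc.IH[OF SC_SucD[OF Suc(2)]]
    show ?case
    proof (rule SC_SucI[OF SC_odom[OF Suc(2)] B])
      fix \<iota> x assume a: "(\<iota>, x) \<in> D"
      have "sqrt (h \<iota> x) \<noteq> 0" "h \<iota> x \<noteq> 0" "h \<iota> x > 0" using pos[OF a] by auto
      then show "((\<lambda>x. 1 / sqrt (h \<iota> x)) has_derivative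
          (\<lambda>t. \<Sum>k\<in>UNIV. t $ k * (-(1/2) * (pd k h \<iota> x * (?b \<iota> x * (?b \<iota> x * ?b \<iota> x)))))) (at x)"
        by (auto intro!: derivative_eq_intros has_derivative_pd[of h, OF SC_diff[OF Suc(2) a]]
            simp: sum_distrib_left sum_distrib_right sum_negf[symmetric] divide_simps simp del: sum_negf)
    next
      fix k
      have "SC D \<nu> m (\<lambda>\<iota>. (p \<iota>)^2 * \<nu> k \<iota> * (1 / p \<iota> * (1 / p \<iota> * (1 / p \<iota>))))
          (\<lambda>\<iota> x. pd k h \<iota> x * (?b \<iota> x * (?b \<iota> x * ?b \<iota> x)))"
        by (intro SC_mult SC_pd[OF Suc(2)] IH)
      from SC_scale[OF SC_weight[OF this] \<nu>]
      show "SC D \<nu> m (\<lambda>\<iota>. 1 / p \<iota> * \<nu> k \<iota>)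
          (\<lambda>\<iota> x. -(1/2) * (pd k h \<iota> x * (?b \<iota> x * (?b \<iota> x * ?b \<iota> x))))"
        by (rule meta_mp) (use p(1) in \<open>auto simp: power2_eq_square field_simps\<close>)
    qed
  }
qed

text \<open>Since sqrt h = h * (1 / sqrt h), no second induction is needed.\<close>

lemma SC_sqrt:
  assumes "SC D \<nu> m (\<lambda>\<iota>. (p \<iota>)^2) h" "c > 0"
    and p: "\<And>\<iota> x. (\<iota>, x) \<in> D \<Longrightarrow> 0 < p \<iota>" "\<And>\<iota> x. (\<iota>, x) \<in> D \<Longrightarrow> c * (p \<iota>)^2 \<le> h \<iota> x"
    and \<nu>: "\<And>k \<iota> x. (\<iota>, x) \<in> D \<Longrightarrow> 0 \<le> \<nu> k \<iota>"
  shows "SC D \<nu> m p (\<lambda>\<iota> x. sqrt (h \<iota> x))"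
proof (rule SC_cong[OF SC_weight[OF SC_mult[OF assms(1) SC_inverse_sqrt[OF assms]]]])
  fix \<iota> x assume a: "(\<iota>, x) \<in> D"
  have "0 < h \<iota> x" using p[OF a] \<open>c > 0\<close> by (smt (verit) mult_pos_pos zero_less_power)
  then show "sqrt (h \<iota> x) = h \<iota> x * (1 / sqrt (h \<iota> x))" by (simp add: real_div_sqrt)
qed (use p in \<open>auto simp: power2_eq_square\<close>)

text \<open>With the summation index made part of the index of the family, the constant is uniform
  in it. Only then does a sum whose length depends on the data cost no more than the factor
  \<open>n\<close>.\<close>

lemma SC_Sum:
  assumes "SC {((\<iota>, s), x). (\<iota>, x) \<in> D \<and> s < n \<iota>} (\<lambda>k. \<nu> k \<circ> fst) m (P \<circ> fst) f"
    and "odom D"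
  shows "SC D \<nu> m (\<lambda>\<iota>. real (n \<iota>) * P \<iota>) (\<lambda>\<iota> x. \<Sum>s<n \<iota>. f (\<iota>, s) x)"
  using assms(1)
proof (induction m arbitrary: P f)
  have B: "BO D (\<lambda>\<iota>. real (n \<iota>) * P \<iota>) (\<lambda>\<iota> x. \<Sum>s<n \<iota>. f (\<iota>, s) x)"
    if f: "BO {((\<iota>, s), x). (\<iota>, x) \<in> D \<and> s < n \<iota>} (P \<circ> fst) f" for P and f :: "'a \<times> nat \<Rightarrow> real^2 \<Rightarrow> real"
  proof -
    obtain C where C: "C > 0" "\<And>\<iota> s x. (\<iota>, x) \<in> D \<Longrightarrow> s < n \<iota> \<Longrightarrow> \<bar>f (\<iota>, s) x\<bar> \<le> C * P \<iota>"
      using f unfolding BO_def by auto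
    show ?thesis
    proof (rule BO_I[OF C(1)])
      fix \<iota> x assume a: "(\<iota>, x) \<in> D"
      have "\<bar>\<Sum>s<n \<iota>. f (\<iota>, s) x\<bar> \<le> (\<Sum>s<n \<iota>. C * P \<iota>)"
        by (rule order_trans[OF sum_abs sum_mono]) (use C(2)[OF a] in auto)
      then show "\<bar>\<Sum>s<n \<iota>. f (\<iota>, s) x\<bar> \<le> C * (real (n \<iota>) * P \<iota>)" by (simp add: mult_ac)
    qed
  qed
  {
    case 0
    then show ?case using B[OF SC_BO[OF 0]] assms(2) by (auto intro!: continuous_intros)
  next
    case (Suc m)
    show ?case
    proof (rule SC_SucI[OF assms(2) B[OF SC_BO[OF Suc(2)]]])
      fix \<iota> x assume a: "(\<iota>, x) \<in> D"
      have "((\<lambda>x. \<Sum>s<n \<iota>. f (\<iota>, s) x) has_derivative (\<lambda>h. \<Sum>s<n \<iota>. \<Sum>k\<in>UNIV. h $ k * pd k f (\<iota>, s) x)) (at x)"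
        by (intro has_derivative_sum has_derivative_pd SC_diff[OF Suc(2)]) (use a in auto)
      moreover have "(\<lambda>h. \<Sum>s<n \<iota>. \<Sum>k\<in>UNIV. h $ k * pd k f (\<iota>, s) x)
          = (\<lambda>h. \<Sum>k\<in>UNIV. h $ k * (\<Sum>s<n \<iota>. pd k f (\<iota>, s) x))"
        by (subst sum.swap) (simp add: sum_distrib_left)
      ultimately show "((\<lambda>x. \<Sum>s<n \<iota>. f (\<iota>, s) x) has_derivative
          (\<lambda>h. \<Sum>k\<in>UNIV. h $ k * (\<Sum>s<n \<iota>. pd k f (\<iota>, s) x))) (at x)" by simp
    next
      fix k
      have "SC D \<nu> m (\<lambda>\<iota>. real (n \<iota>) * (P \<iota> * \<nu> k \<iota>)) (\<lambda>\<iota> x. \<Sum>s<n \<iota>. pd k f (\<iota>, s) x)"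
        by (rule Suc.IH) (use SC_pd[OF Suc(2), of k] in \<open>simp add: comp_def\<close>)
      then show "SC D \<nu> m (\<lambda>\<iota>. real (n \<iota>) * P \<iota> * \<nu> k \<iota>) (\<lambda>\<iota> x. \<Sum>s<n \<iota>. pd k f (\<iota>, s) x)"
        by (simp add: mult.assoc)
    qed
  }
qed

subsection \<open>Averages and mollification\<close>

text \<open>The partial derivatives are an explicit argument because averaging a function means
  averaging them too.\<close>

definition C1 :: "(real^2 \<Rightarrow> real) \<Rightarrow> (2 \<Rightarrow> real^2 \<Rightarrow> real) \<Rightarrow> bool" where
  "C1 f d \<longleftrightarrow> (\<forall>x. (f has_derivative (\<lambda>h. \<Sum>k\<in>UNIV. h $ k * d k x)) (at x)) \<and>
     (\<forall>k. continuous_on UNIV (d k))"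

lemma C1_continuous: "C1 f d \<Longrightarrow> continuous_on UNIV f"
  unfolding C1_def by (intro continuous_at_imp_continuous_on ballI has_derivative_continuous) blast

text \<open>One-dimensional averages yield derivatives along the two axes only; continuity of these
  derivatives upgrades them to total differentiability.\<close>

lemma C1_of_partials:
  assumes D: "\<And>x k. ((\<lambda>s. F (x + s *\<^sub>R axis k 1)) has_real_derivative d k x) (at 0)"
    and c: "\<And>k. continuous_on UNIV (d k)"
  shows "C1 F d"
proof -
  define pt :: "real \<Rightarrow> real \<Rightarrow> real^2" where "pt a b = a *\<^sub>R axis 1 1 + b *\<^sub>R axis 2 1" for a b
  have pt: "pt (x $ 1) (x $ 2) = x" for x
    by (simp add: pt_def vec_eq_iff forall_2 axis_def)
  have ptc: "continuous_on UNIV (\<lambda>z. pt (fst z) (snd z))"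
    unfolding pt_def by (intro continuous_intros)
  have d1: "((\<lambda>a. F (pt a b)) has_real_derivative d 1 (pt a b)) (at a)" for a b
  proof -
    have "((\<lambda>s. F (pt a b + (s - a) *\<^sub>R axis 1 1)) has_real_derivative d 1 (pt a b) * 1) (at a)"
      by (rule DERIV_chain2[where f="\<lambda>s. F (pt a b + s *\<^sub>R axis 1 1)"])
         (use D[of "pt a b" 1] in \<open>auto intro!: derivative_eq_intros\<close>)
    moreover have "pt a b + (s - a) *\<^sub>R axis 1 1 = pt s b" for s by (simp add: pt_def algebra_simps)
    ultimately show ?thesis by simp
  qed
  have d2: "((\<lambda>b. F (pt a b)) has_real_derivative d 2 (pt a b)) (at b)" for a b
  proof -
    have "((\<lambda>s. F (pt a b + (s - b) *\<^sub>R axis 2 1)) has_real_derivative d 2 (pt a b) * 1) (at b)"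
      by (rule DERIV_chain2[where f="\<lambda>s. F (pt a b + s *\<^sub>R axis 2 1)"])
         (use D[of "pt a b" 2] in \<open>auto intro!: derivative_eq_intros\<close>)
    moreover have "pt a b + (s - b) *\<^sub>R axis 2 1 = pt a s" for s by (simp add: pt_def algebra_simps)
    ultimately show ?thesis by simp
  qed
  have "(F has_derivative (\<lambda>h. \<Sum>k\<in>UNIV. h $ k * d k x)) (at x)" for x
  proof -
    have cc: "continuous (at (x $ 1, x $ 2) within UNIV \<times> UNIV) (\<lambda>(a, b). blinfun_mult_right (d 2 (pt a b)))"
    proof -
      have "continuous_on UNIV (\<lambda>z. d 2 (pt (fst z) (snd z)))"
        by (rule continuous_on_compose2[OF c ptc]) auto
      then have "continuous_on UNIV (\<lambda>z. blinfun_mult_right (d 2 (pt (fst z) (snd z))))"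
        by (intro continuous_intros)
      then show ?thesis by (simp add: continuous_on_eq_continuous_at split_beta')
    qed
    have "((\<lambda>(a, b). F (pt a b)) has_derivative
        (\<lambda>(ta, tb). (d 1 (pt (x $ 1) (x $ 2)) * ta) + blinfun_mult_right (d 2 (pt (x $ 1) (x $ 2))) tb))
        (at (x $ 1, x $ 2) within UNIV \<times> UNIV)"
      by (rule has_derivative_partialsI[where fy="\<lambda>a b. blinfun_mult_right (d 2 (pt a b))"])
         (use d1 d2 cc in \<open>auto simp: has_field_derivative_def mult_commute_abs\<close>)
    then have "((\<lambda>(a, b). F (pt a b)) has_derivative (\<lambda>(ta, tb). d 1 x * ta + d 2 x * tb)) (at (x $ 1, x $ 2))"
      by (simp add: pt)
    moreover have "((\<lambda>x::real^2. (x $ 1, x $ 2)) has_derivative (\<lambda>h. (h $ 1, h $ 2))) (at x)"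
      by (intro derivative_intros)
    ultimately have "((\<lambda>x. case (x $ 1, x $ 2) of (a, b) \<Rightarrow> F (pt a b)) has_derivative
        (\<lambda>h. case (h $ 1, h $ 2) of (ta, tb) \<Rightarrow> d 1 x * ta + d 2 x * tb)) (at x)"
      by (rule has_derivative_compose[rotated])
    then show ?thesis by (simp add: pt sum_2 mult.commute)
  qed
  with c show ?thesis unfolding C1_def by blast
qed

lemma C1_line:
  assumes "C1 f d"
  shows "((\<lambda>s. f (x + s *\<^sub>R axis k c)) has_real_derivative c * d k (x + t *\<^sub>R axis k c)) (at t)"
proof -
  have "(f has_derivative (\<lambda>h. \<Sum>q\<in>UNIV. h $ q * d q (x + t *\<^sub>R axis k c))) (at (x + t *\<^sub>R axis k c))"
    using assms by (simp add: C1_def)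
  moreover have "((\<lambda>s. x + s *\<^sub>R axis k c) has_derivative (\<lambda>s. s *\<^sub>R axis k c)) (at t)"
    by (auto intro!: derivative_eq_intros)
  ultimately have "((\<lambda>s. f (x + s *\<^sub>R axis k c)) has_derivative
      (\<lambda>s. \<Sum>q\<in>UNIV. (s *\<^sub>R axis k c) $ q * d q (x + t *\<^sub>R axis k c))) (at t)"
    by (rule has_derivative_compose[rotated])
  moreover have "(\<Sum>q\<in>UNIV. (s *\<^sub>R axis k c) $ q * d q y) = c * d k y * s" for s y
    by (simp add: axis_def if_distrib[of "\<lambda>z. _ * z"] if_distrib[of "\<lambda>z. z * _"] cong: if_cong)
  ultimately show ?thesis
    by (simp add: has_field_derivative_def)
qed

text \<open>All planar averages below are compositions of averages over axis-parallel segments, so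
  that one-dimensional integrals suffice. The vector \<open>u\<close> may be long: both small and
  very large scales will occur.\<close>

definition av :: "real^2 \<Rightarrow> (real^2 \<Rightarrow> real) \<Rightarrow> real^2 \<Rightarrow> real" where
  "av u f x = integral {0..1} (\<lambda>s. f (x + s *\<^sub>R u))"

lemma av_cont: "continuous_on UNIV (f :: real^2 \<Rightarrow> real) \<Longrightarrow> continuous_on A (\<lambda>s. f (x + s *\<^sub>R u))"
  by (rule continuous_on_compose2[of UNIV f]) (auto intro!: continuous_intros)

lemma av_integrable: "continuous_on UNIV (f :: real^2 \<Rightarrow> real) \<Longrightarrow> (\<lambda>s. f (x + s *\<^sub>R u)) integrable_on {0..1}"
  by (intro integrable_continuous_interval av_cont)

lemma av_bound:
  assumes "continuous_on UNIV f" "\<And>s. 0 \<le> s \<Longrightarrow> s \<le> 1 \<Longrightarrow> \<bar>f (x + s *\<^sub>R u)\<bar> \<le> P"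
  shows "\<bar>av u f x\<bar> \<le> P"
  using integral_bound[of 0 1 "\<lambda>s. f (x + s *\<^sub>R u)" P] av_cont[OF assms(1), of "{0..1}" x u] assms(2)
  unfolding av_def by auto

lemma av_const [simp]: "av u (\<lambda>_. c) = (\<lambda>_. c)"
  by (rule ext) (simp add: av_def)

lemma av_add: "continuous_on UNIV f \<Longrightarrow> continuous_on UNIV g \<Longrightarrow> av u (\<lambda>x. f x + g x) x = av u f x + av u g x"
  unfolding av_def by (intro integral_add av_integrable)

lemma av_diff: "continuous_on UNIV f \<Longrightarrow> continuous_on UNIV g \<Longrightarrow> av u (\<lambda>x. f x - g x) x = av u f x - av u g x"
  unfolding av_def by (intro integral_diff av_integrable)

lemma av_cmult: "av u (\<lambda>x. c * f x) x = c * av u f x"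
  unfolding av_def by simp

lemma av_continuous: "continuous_on UNIV f \<Longrightarrow> continuous_on UNIV (av u f)"
proof -
  assume "continuous_on UNIV f"
  then have "continuous_on (UNIV \<times> cbox 0 1) (\<lambda>(x, s). f (x + s *\<^sub>R u))"
    unfolding split_beta' by (rule continuous_on_compose2) (auto intro!: continuous_intros)
  from integral_continuous_on_param[OF this]
  show ?thesis by (simp add: av_def[abs_def])
qed

lemma av_swap:
  assumes "continuous_on UNIV f"
  shows "av u (av v f) = av v (av u f)"
proof
  fix x
  have "continuous_on (cbox (0, 0) (1, 1)) (\<lambda>(s, t). f (x + s *\<^sub>R u + t *\<^sub>R v))"
    unfolding split_beta' by (rule continuous_on_compose2[OF assms]) (auto intro!: continuous_intros)
  from integral_swap_continuous[OF this]
  show "av u (av v f) x = av v (av u f) x"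
    by (simp add: av_def add_ac)
qed

lemma C1_av:
  assumes "C1 f d"
  shows "C1 (av u f) (\<lambda>k. av u (d k))"
proof (rule C1_of_partials)
  note c = assms[unfolded C1_def, THEN conjunct2, rule_format]
  show "continuous_on UNIV (av u (d k))" for k by (rule av_continuous[OF c])
  fix x k
  have "((\<lambda>s. integral (cbox 0 1) (\<lambda>t. f ((x + s *\<^sub>R axis k 1) + t *\<^sub>R u))) has_field_derivative
      integral (cbox 0 1) (\<lambda>t. d k ((x + 0 *\<^sub>R axis k 1) + t *\<^sub>R u))) (at 0 within UNIV)"
  proof (rule leibniz_rule_field_derivative)
    show "((\<lambda>s. f (x + s *\<^sub>R axis k 1 + t *\<^sub>R u)) has_real_derivative d k (x + s *\<^sub>R axis k 1 + t *\<^sub>R u))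
        (at s within UNIV)" for s t
      using C1_line[OF assms, of "x + t *\<^sub>R u" k 1 s] by (simp add: algebra_simps)
    show "(\<lambda>t. f (x + s *\<^sub>R axis k 1 + t *\<^sub>R u)) integrable_on cbox 0 1" for s
      using av_integrable[OF C1_continuous[OF assms]] by simp
    show "continuous_on (UNIV \<times> cbox 0 1) (\<lambda>(s, t). d k (x + s *\<^sub>R axis k 1 + t *\<^sub>R u))"
      unfolding split_beta' by (rule continuous_on_compose2[OF c]) (auto intro!: continuous_intros)
  qed auto
  then show "((\<lambda>s. av u f (x + s *\<^sub>R axis k 1)) has_real_derivative av u (d k) x) (at 0)"
    by (simp add: av_def)
qed

text \<open>The fundamental theorem of calculus on a segment. Read from right to left, a difference
  of two values is a derivative of an average times its length; differences of scales become
  divergences in this way.\<close>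

lemma av_axis_deriv:
  assumes "C1 f d"
  shows "c * av (axis k c) (d k) x = f (x + axis k c) - f x"
proof -
  have D: "((\<lambda>s. f (x + s *\<^sub>R axis k c)) has_vector_derivative c * d k (x + s *\<^sub>R axis k c)) (at s within {0..1})" for s
    using C1_line[OF assms, of x k c s] has_vector_derivative_at_within
    unfolding has_real_derivative_iff_has_vector_derivative by blast
  have "((\<lambda>s. c * d k (x + s *\<^sub>R axis k c)) has_integral f (x + 1 *\<^sub>R axis k c) - f (x + 0 *\<^sub>R axis k c)) {0..1}"
    by (rule fundamental_theorem_of_calculus[OF _ D]) simp
  then have "integral {0..1} (\<lambda>s. c * d k (x + s *\<^sub>R axis k c)) = f (x + 1 *\<^sub>R axis k c) - f (x + 0 *\<^sub>R axis k c)"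
    by (rule integral_unique)
  then show ?thesis unfolding av_def by (simp only: integral_mult_right scaleR_one scaleR_zero_left add_0_right)
qed

lemma antiderivative_exists:
  fixes g :: "real \<Rightarrow> real"
  assumes "continuous_on UNIV g"
  obtains G where "\<And>s. (G has_real_derivative g s) (at s)"
proof -
  have "\<exists>F. \<forall>x. -\<infinity> < ereal x \<longrightarrow> ereal x < \<infinity> \<longrightarrow> (F has_vector_derivative g x) (at x)"
    by (rule einterval_antiderivative) (use assms in \<open>auto simp: continuous_on_eq_continuous_at\<close>)
  then show ?thesis using that by (auto simp: has_real_derivative_iff_has_vector_derivative)
qed

text \<open>A single primitive \<open>G\<close> serves every base point and every length on the
  line. Hence averages of different lengths can be compared, and the average can be differentiated
  along its own direction although \<open>g\<close> is only continuous.\<close>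

lemma av_axis_primitive:
  assumes "continuous_on UNIV g"
  shows "\<exists>G. (\<forall>s. (G has_real_derivative g (x + s *\<^sub>R axis k 1)) (at s)) \<and>
    (\<forall>s c. c \<noteq> 0 \<longrightarrow> av (axis k c) g (x + s *\<^sub>R axis k 1) = (G (s + c) - G s) / c)"
proof -
  obtain G where G: "\<And>s. (G has_real_derivative g (x + s *\<^sub>R axis k 1)) (at s)"
    using antiderivative_exists[OF av_cont[OF assms(1), of UNIV x "axis k 1"]] by blast
  have "av (axis k c) g (x + s *\<^sub>R axis k 1) = (G (s + c) - G s) / c" if c: "c \<noteq> 0" for s c
  proof -
    have ax: "r *\<^sub>R axis k c = (r * c) *\<^sub>R axis k (1::real)" for r by (simp add: vec_eq_iff axis_def)
    have D: "((\<lambda>r. G (s + r * c) / c) has_vector_derivative g (x + s *\<^sub>R axis k 1 + r *\<^sub>R axis k c)) (at r within {0..1})" for r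
    proof -
      have "((\<lambda>r. s + r * c) has_real_derivative c) (at r)" by (auto intro!: derivative_eq_intros)
      from DERIV_cdivide[OF DERIV_chain2[OF G this], of c]
      have "((\<lambda>r. G (s + r * c) / c) has_real_derivative g (x + (s + r * c) *\<^sub>R axis k 1)) (at r)"
        using c by simp
      then have "((\<lambda>r. G (s + r * c) / c) has_real_derivative g (x + s *\<^sub>R axis k 1 + r *\<^sub>R axis k c)) (at r)"
        by (simp only: ax scaleR_add_left add.assoc)
      then show ?thesis
        unfolding has_real_derivative_iff_has_vector_derivative by (rule has_vector_derivative_at_within)
    qed
    have "((\<lambda>r. g (x + s *\<^sub>R axis k 1 + r *\<^sub>R axis k c)) has_integral G (s + 1 * c) / c - G (s + 0 * c) / c) {0..1}"
      by (rule fundamental_theorem_of_calculus[OF _ D]) simp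
    then have "av (axis k c) g (x + s *\<^sub>R axis k 1) = G (s + 1 * c) / c - G (s + 0 * c) / c"
      unfolding av_def by (rule integral_unique)
    then show ?thesis by (simp only: mult_1 mult_zero_left add_0_right diff_divide_distrib)
  qed
  with G show ?thesis by blast
qed

lemma axis_scaleR_one: "c *\<^sub>R axis k 1 = (axis k c :: real^2)"
  by (simp add: vec_eq_iff axis_def)

lemma axis_real_zero: "axis k 0 = (0 :: real^2)"
  by (simp add: vec_eq_iff axis_def)

lemma av_smooth_direction:
  assumes "continuous_on UNIV g" "c \<noteq> 0"
  shows "((\<lambda>s. av (axis k c) g (x + s *\<^sub>R axis k 1)) has_real_derivative (g (x + axis k c) - g x) / c) (at 0)"
proof -
  obtain G where G: "\<And>s. (G has_real_derivative g (x + s *\<^sub>R axis k 1)) (at s)"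
    and a: "\<And>s c. c \<noteq> 0 \<Longrightarrow> av (axis k c) g (x + s *\<^sub>R axis k 1) = (G (s + c) - G s) / c"
    using av_axis_primitive[where x=x and k=k, OF assms(1)] by blast
  have "((\<lambda>s. G (s + c)) has_real_derivative g (x + (0 + c) *\<^sub>R axis k 1) * 1) (at 0)"
    by (rule DERIV_chain2[OF G]) (auto intro!: derivative_eq_intros)
  then have "((\<lambda>s. (G (s + c) - G s) / c) has_real_derivative
      (g (x + (0 + c) *\<^sub>R axis k 1) * 1 - g (x + 0 *\<^sub>R axis k 1)) / c) (at 0)"
    by (intro DERIV_cdivide DERIV_diff G)
  then show ?thesis
    unfolding a[OF assms(2)] by (simp only: axis_scaleR_one axis_real_zero mult_1_right add_0 add_0_right)
qed

lemma av_axis_double: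
  assumes "continuous_on UNIV g" "c \<noteq> 0"
  shows "av (axis k (2 * c)) g x = (av (axis k c) g x + av (axis k c) g (x + axis k c)) / 2"
proof -
  obtain G where "\<And>s. (G has_real_derivative g (x + s *\<^sub>R axis k 1)) (at s)"
    and a: "\<And>s c. c \<noteq> 0 \<Longrightarrow> av (axis k c) g (x + s *\<^sub>R axis k 1) = (G (s + c) - G s) / c"
    using av_axis_primitive[where x=x and k=k, OF assms(1)] by blast
  have "c * (2 * av (axis k (2 * c)) g x) = c * (av (axis k c) g x + av (axis k c) g (x + axis k c))"
    using a[of "2 * c" 0] a[of c 0] a[of c c] assms(2) by (simp add: axis_scaleR_one axis_real_zero field_simps)
  then show ?thesis using assms(2) by simp
qed

text \<open>A continuous function becomes continuously differentiable once it is averaged along both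
  axes: for each \<open>k\<close> the average in direction \<open>k\<close> is moved to the outside
  by \<open>av_swap\<close>, and its derivative is a difference quotient of the other
  average.\<close>

lemma C1_smooth:
  assumes "continuous_on UNIV f" "c \<noteq> 0" "i \<noteq> j"
  shows "C1 (av (axis i c) (av (axis j c) f))
    (\<lambda>k x. (av (axis (if k = i then j else i) c) f (x + axis k c) - av (axis (if k = i then j else i) c) f x) / c)"
proof (rule C1_of_partials)
  have cs: "continuous_on UNIV (\<lambda>x. av u f (x + v))" for u v
    by (rule continuous_on_compose2[OF av_continuous[OF assms(1)]]) (auto intro!: continuous_intros)
  show "continuous_on UNIV (\<lambda>x. (av (axis (if k = i then j else i) c) f (x + axis k c) - av (axis (if k = i then j else i) c) f x) / c)" for k
    by (rule continuous_on_divide[OF continuous_on_diff[OF cs av_continuous[OF assms(1)]] continuous_on_const]) (simp add: assms(2))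
  fix x k
  have k: "k = i \<or> k = j" using exhaust_2[of i] exhaust_2[of j] exhaust_2[of k] assms(3) by auto
  show "((\<lambda>s. av (axis i c) (av (axis j c) f) (x + s *\<^sub>R axis k 1)) has_real_derivative
      (av (axis (if k = i then j else i) c) f (x + axis k c) - av (axis (if k = i then j else i) c) f x) / c) (at 0)"
  proof (cases "k = i")
    case True
    show ?thesis unfolding True if_P[OF refl]
      by (rule av_smooth_direction[OF av_continuous[OF assms(1)] assms(2)])
  next
    case False
    then have kj: "k = j" using k by blast
    show ?thesis unfolding av_swap[OF assms(1), of "axis i c" "axis j c"] if_not_P[OF False] unfolding kj
      by (rule av_smooth_direction[OF av_continuous[OF assms(1)] assms(2)])
  qed
qed

text \<open>The average over the square centred at \<open>x\<close>, so that affine functions are preserved. Each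
  iteration gains one derivative, and finitely many suffice.\<close>

definition sq :: "real \<Rightarrow> (real^2 \<Rightarrow> real) \<Rightarrow> real^2 \<Rightarrow> real" where
  "sq t f = av (axis 1 t) (av (axis 2 t) (av (axis 1 (-t)) (av (axis 2 (-t)) f)))"

primrec moll :: "nat \<Rightarrow> real \<Rightarrow> (real^2 \<Rightarrow> real) \<Rightarrow> real^2 \<Rightarrow> real" where
  "moll 0 t f = f"
| "moll (Suc m) t f = moll m t (sq t f)"

text \<open>The partial derivatives of \<open>sq t f\<close>: the average along
  \<open>axis k t\<close> has been traded for a difference quotient, and the other three
  remain.\<close>

definition sqd :: "2 \<Rightarrow> real \<Rightarrow> (real^2 \<Rightarrow> real) \<Rightarrow> real^2 \<Rightarrow> real" where
  "sqd k t f = (\<lambda>x. (av (axis (if k = 1 then 2 else 1) t) (av (axis 1 (-t)) (av (axis 2 (-t)) f)) (x + axis k t)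
     - av (axis (if k = 1 then 2 else 1) t) (av (axis 1 (-t)) (av (axis 2 (-t)) f)) x) / t)"

lemma sq_continuous: "continuous_on UNIV f \<Longrightarrow> continuous_on UNIV (sq t f)"
  unfolding sq_def by (intro av_continuous)

lemma sq_C1: "C1 f d \<Longrightarrow> C1 (sq t f) (\<lambda>k. sq t (d k))"
  unfolding sq_def by (intro C1_av)

lemma moll_C1: "C1 f d \<Longrightarrow> C1 (moll m t f) (\<lambda>k. moll m t (d k))"
  by (induction m arbitrary: f d) (auto intro: sq_C1)

lemma sq_smooth: "continuous_on UNIV f \<Longrightarrow> t \<noteq> 0 \<Longrightarrow> C1 (sq t f) (\<lambda>k. sqd k t f)"
  unfolding sq_def sqd_def by (rule C1_smooth) (auto intro: av_continuous)

lemma av_bound_dist: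
  assumes "continuous_on UNIV f" "norm u \<le> t" "\<And>y. dist x y \<le> r + t \<Longrightarrow> \<bar>f y\<bar> \<le> P" "dist x y \<le> r"
  shows "\<bar>av u f y\<bar> \<le> P"
proof (rule av_bound[OF assms(1) assms(3)])
  fix s :: real assume s: "0 \<le> s" "s \<le> 1"
  have "norm (s *\<^sub>R u) \<le> t" using s assms(2) mult_mono[of s 1 "norm u" t] by simp
  then show "dist x (y + s *\<^sub>R u) \<le> r + t"
    using dist_triangle[of x "y + s *\<^sub>R u" y] assms(4) by (simp add: dist_norm)
qed

lemma norm_axis_real: "norm (axis k (t::real) :: real^2) = \<bar>t\<bar>"
  by (simp add: norm_vec_def L2_set_def axis_def if_distrib[of norm] if_distrib[of "\<lambda>z. z\<^sup>2"] cong: if_cong)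

text \<open>Each of the four segments enlarges the region of dependence by \<open>t\<close>; this is
  the origin of the margin \<open>4 * t\<close> and, after \<open>m\<close> rounds, of
  \<open>4 * m * t\<close>.\<close>

lemma sq_bound:
  assumes "continuous_on UNIV f" "0 \<le> t" "\<And>y. dist x y \<le> r + 4 * t \<Longrightarrow> \<bar>f y\<bar> \<le> P" "dist x y \<le> r"
  shows "\<bar>sq t f y\<bar> \<le> P"
  unfolding sq_def
  apply (rule av_bound_dist[where t=t and x=x and r=r, OF _ _ _ assms(4)])
    apply (intro av_continuous assms(1))
   apply (simp add: norm_axis_real assms(2))
  apply (rule av_bound_dist[where t=t and x=x and r="r + t"])
     apply (intro av_continuous assms(1))
    apply (simp add: norm_axis_real assms(2))
   apply (rule av_bound_dist[where t=t and x=x and r="r + t + t"])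
      apply (intro av_continuous assms(1))
     apply (simp add: norm_axis_real assms(2))
    apply (rule av_bound_dist[where t=t and x=x and r="r + t + t + t"])
       apply (rule assms(1))
      apply (simp add: norm_axis_real assms(2))
     apply (rule assms(3), simp)
    apply assumption+
  done

lemma moll_bound:
  assumes "continuous_on UNIV f" "0 \<le> t" "\<And>y. dist x y \<le> r + 4 * real m * t \<Longrightarrow> \<bar>f y\<bar> \<le> P" "dist x y \<le> r"
  shows "\<bar>moll m t f y\<bar> \<le> P"
  using assms(1,3,4)
proof (induction m arbitrary: f)
  case 0
  then show ?case by simp
next
  case (Suc m)
  show ?case unfolding moll.simps
  proof (rule Suc.IH[OF sq_continuous[OF Suc(2)] _ Suc(4)])
    fix y assume "dist x y \<le> r + 4 * real m * t"
    then show "\<bar>sq t f y\<bar> \<le> P"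
      by (rule sq_bound[OF Suc(2) assms(2), rotated]) (rule Suc(3), simp add: algebra_simps)
  qed
qed

text \<open>The shift by \<open>axis k t\<close> replaces the missing average, so the reach is again
  \<open>4 * t\<close>.\<close>

lemma sqd_bound:
  assumes "continuous_on UNIV f" "0 < t" "\<And>y. dist x y \<le> r + 4 * t \<Longrightarrow> \<bar>f y\<bar> \<le> P" "dist x y \<le> r"
  shows "\<bar>sqd k t f y\<bar> \<le> 2 * P / t"
proof -
  let ?g = "av (axis (if k = 1 then 2 else 1) t) (av (axis 1 (-t)) (av (axis 2 (-t)) f))"
  have *: "\<bar>?g z\<bar> \<le> P" if "dist x z \<le> r + t" for z
    apply (rule av_bound_dist[where t=t and x=x and r="r + t"])
       apply (intro av_continuous assms(1))
      using assms(2) apply (simp add: norm_axis_real)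
     apply (rule av_bound_dist[where t=t and x=x and r="r + t + t"])
        apply (intro av_continuous assms(1))
       using assms(2) apply (simp add: norm_axis_real)
      apply (rule av_bound_dist[where t=t and x=x and r="r + t + t + t"])
         apply (rule assms(1))
        using assms(2) apply (simp add: norm_axis_real)
       apply (rule assms(3), simp)
      apply assumption+
    apply (rule that)
    done
  have "\<bar>?g (y + axis k t)\<bar> \<le> P"
    using dist_triangle[of x "y + axis k t" y] assms(2,4)
    by (intro *) (simp add: dist_norm norm_axis_real)
  moreover have "\<bar>?g y\<bar> \<le> P" using assms(2,4) by (intro *) simp
  ultimately have "\<bar>?g (y + axis k t) - ?g y\<bar> \<le> 2 * P" by linarith
  then show ?thesis using assms(2) unfolding sqd_def by (simp add: divide_right_mono)
qed

lemma sqd_continuous: "continuous_on UNIV f \<Longrightarrow> t \<noteq> 0 \<Longrightarrow> continuous_on UNIV (sqd k t f)"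
  using sq_smooth[of f t] by (simp add: C1_def)

text \<open>The field \<open>f\<close> need only be continuous: every derivative is absorbed by one
  round of averaging and costs 1 / t, so \<open>m\<close> rounds give an estimate of order
  \<open>m\<close>.\<close>

lemma SC_moll:
  assumes "odom D" "\<And>\<iota> x. (\<iota>, x) \<in> D \<Longrightarrow> 0 < t \<iota>"
    and "\<And>\<iota> x. (\<iota>, x) \<in> D \<Longrightarrow> continuous_on UNIV (f \<iota>)"
    and "\<And>\<iota> x y. (\<iota>, x) \<in> D \<Longrightarrow> dist x y \<le> 4 * real m * t \<iota> \<Longrightarrow> \<bar>f \<iota> y\<bar> \<le> P \<iota>"
  shows "SC D (\<lambda>_ \<iota>. 1 / t \<iota>) m P (\<lambda>\<iota>. moll m (t \<iota>) (f \<iota>))"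
  using assms(3,4)
proof (induction m arbitrary: P f)
  case 0
  have "BO D P f" by (rule BO_fun[OF 0(2)]) auto
  then show ?case using assms(1) 0(1) by (auto simp: continuous_on_eq_continuous_at)
next
  case (Suc m)
  show ?case
  proof (rule SC_SucI[OF assms(1)])
    show "BO D P (\<lambda>\<iota>. moll (Suc m) (t \<iota>) (f \<iota>))"
    proof (rule BO_fun)
      fix \<iota> x assume a: "(\<iota>, x) \<in> D"
      show "\<bar>moll (Suc m) (t \<iota>) (f \<iota>) x\<bar> \<le> P \<iota>"
        by (rule moll_bound[where x=x and r=0, OF Suc(2)[OF a]]) (use assms(2)[OF a] Suc(3)[OF a] in auto)
    qed
    fix \<iota> x assume a: "(\<iota>, x) \<in> D"
    \<comment> \<open>The derivative turns the innermost round into \<open>sqd\<close>; the other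
      \<open>m\<close> rounds are left for the induction hypothesis.\<close>
    have "C1 (moll (Suc m) (t \<iota>) (f \<iota>)) (\<lambda>k. moll m (t \<iota>) (sqd k (t \<iota>) (f \<iota>)))"
      using moll_C1[OF sq_smooth[OF Suc(2)[OF a]]] assms(2)[OF a] by simp
    then show "(moll (Suc m) (t \<iota>) (f \<iota>) has_derivative
        (\<lambda>h. \<Sum>k\<in>UNIV. h $ k * moll m (t \<iota>) (sqd k (t \<iota>) (f \<iota>)) x)) (at x)"
      by (simp add: C1_def)
  next
    fix k
    have "SC D (\<lambda>_ \<iota>. 1 / t \<iota>) m (\<lambda>\<iota>. 2 * P \<iota> / t \<iota>) (\<lambda>\<iota>. moll m (t \<iota>) (sqd k (t \<iota>) (f \<iota>)))"
    proof (rule Suc.IH)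
      fix \<iota> x assume a: "(\<iota>, x) \<in> D"
      then show "continuous_on UNIV (sqd k (t \<iota>) (f \<iota>))"
        using sqd_continuous[OF Suc(2)[OF a]] assms(2)[OF a] by simp
      fix y assume "dist x y \<le> 4 * real m * t \<iota>"
      then show "\<bar>sqd k (t \<iota>) (f \<iota>) y\<bar> \<le> 2 * P \<iota> / t \<iota>"
        by (rule sqd_bound[OF Suc(2)[OF a] assms(2)[OF a], rotated])
           (rule Suc(3)[OF a], simp add: algebra_simps)
    qed
    then show "SC D (\<lambda>_ \<iota>. 1 / t \<iota>) m (\<lambda>\<iota>. P \<iota> * (1 / t \<iota>)) (\<lambda>\<iota>. moll m (t \<iota>) (sqd k (t \<iota>) (f \<iota>)))"
      by (rule SC_wmono[where c=2]) (use assms(2) in \<open>auto intro: less_imp_le\<close>)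
  qed
qed


section \<open>Linearity of mollification and its exactness on affine functions\<close>

lemma av_add_fun: "continuous_on UNIV f \<Longrightarrow> continuous_on UNIV g \<Longrightarrow> av u (\<lambda>x. f x + g x) = (\<lambda>x. av u f x + av u g x)"
  by (rule ext) (rule av_add)

lemma av_cmult_fun: "av u (\<lambda>x. c * f x) = (\<lambda>x. c * av u f x)"
  by (rule ext) (rule av_cmult)

lemma sq_add: "continuous_on UNIV f \<Longrightarrow> continuous_on UNIV g \<Longrightarrow> sq t (\<lambda>x. f x + g x) = (\<lambda>x. sq t f x + sq t g x)"
  unfolding sq_def by (simp add: av_add_fun av_continuous)

lemma moll_add: "continuous_on UNIV f \<Longrightarrow> continuous_on UNIV g \<Longrightarrow> moll m t (\<lambda>x. f x + g x) = (\<lambda>x. moll m t f x + moll m t g x)"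
  by (induction m arbitrary: f g) (simp_all add: sq_add sq_continuous)

lemma moll_cmult: "moll m t (\<lambda>x. c * f x) = (\<lambda>x. c * moll m t f x)"
  by (induction m arbitrary: f) (simp_all add: sq_def av_cmult_fun)

lemma moll_diff:
  "continuous_on UNIV f \<Longrightarrow> continuous_on UNIV g \<Longrightarrow> moll m t (\<lambda>x. f x - g x) = (\<lambda>x. moll m t f x - moll m t g x)"
  using moll_add[of f "\<lambda>x. -1 * g x" m t] moll_cmult[of m t "-1" g] by (simp add: continuous_on_minus)

text \<open>A segment average shifts the constant by half of \<open>b \<bullet> u\<close>; the
  opposite segments in \<open>sq\<close> cancel these shifts.\<close>

lemma av_affine: "av u (\<lambda>y. c + b \<bullet> y) = (\<lambda>y. (c + (b \<bullet> u) / 2) + b \<bullet> y)"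
proof
  fix y
  have "((\<lambda>s. (c + b \<bullet> y) + s * (b \<bullet> u)) has_integral
      ((c + b \<bullet> y) * 1 + 1^2 / 2 * (b \<bullet> u)) - ((c + b \<bullet> y) * 0 + 0^2 / 2 * (b \<bullet> u))) {0..1}"
  proof (rule fundamental_theorem_of_calculus)
    fix s :: real
    have "((\<lambda>s. (c + b \<bullet> y) * s + s\<^sup>2 / 2 * (b \<bullet> u)) has_real_derivative (c + b \<bullet> y) + s * (b \<bullet> u)) (at s within {0..1})"
      by (auto intro!: derivative_eq_intros)
    then show "((\<lambda>s. (c + b \<bullet> y) * s + s\<^sup>2 / 2 * (b \<bullet> u)) has_vector_derivative (c + b \<bullet> y) + s * (b \<bullet> u)) (at s within {0..1})"
      by (simp only: has_real_derivative_iff_has_vector_derivative)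
  qed simp
  from integral_unique[OF this]
  show "av u (\<lambda>y. c + b \<bullet> y) y = (c + (b \<bullet> u) / 2) + b \<bullet> y"
    by (simp add: av_def inner_add_right add.assoc)
qed

lemma moll_affine: "moll m t (\<lambda>y. c + b \<bullet> y) = (\<lambda>y. c + b \<bullet> y)"
proof (induction m)
  case (Suc m)
  have "axis k (-t) = - axis k t" for k :: 2 by (simp add: vec_eq_iff axis_def)
  then have "sq t (\<lambda>y. c + b \<bullet> y) = (\<lambda>y. c + b \<bullet> y)"
    unfolding sq_def av_affine by simp
  then show ?case by (simp add: Suc)
qed simp

text \<open>Because affine functions are reproduced, the mollification error is governed by the
  distance to an affine function. For data in \<open>C^{1,\<beta>}\<close> this gives the error l^(1
  + \<beta>).\<close>

lemma moll_near_affine: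
  assumes "continuous_on UNIV f" "0 \<le> t" "\<And>y. dist x y \<le> 4 * real m * t \<Longrightarrow> \<bar>f y - (c + b \<bullet> y)\<bar> \<le> P"
  shows "\<bar>moll m t f x - (c + b \<bullet> x)\<bar> \<le> P"
proof -
  have "\<bar>moll m t (\<lambda>y. f y - (c + b \<bullet> y)) x\<bar> \<le> P"
    by (rule moll_bound[where x=x and r=0]) (use assms in \<open>auto intro!: continuous_intros\<close>)
  moreover have "moll m t (\<lambda>y. f y - (c + b \<bullet> y)) = (\<lambda>y. moll m t f y - moll m t (\<lambda>y. c + b \<bullet> y) y)"
    by (rule moll_diff) (auto intro!: continuous_intros assms)
  ultimately show ?thesis by (simp add: moll_affine)
qed

section \<open>Averages and shifts of families on the whole plane\<close>

lemma odom_UNIV [simp]: "odom (I \<times> UNIV)"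
  by (simp add: odom_def)

lemma SC_continuous: "SC (I \<times> UNIV) \<nu> m P f \<Longrightarrow> \<iota> \<in> I \<Longrightarrow> continuous_on UNIV (f \<iota>)"
  using SC_isCont[of "I \<times> UNIV" \<nu> m P f \<iota>] by (simp add: continuous_on_eq_continuous_at)

lemma SC_C1: "SC (I \<times> UNIV) \<nu> (Suc m) P f \<Longrightarrow> \<iota> \<in> I \<Longrightarrow> C1 (f \<iota>) (\<lambda>k. pd k f \<iota>)"
  unfolding C1_def by (intro conjI allI has_derivative_pd SC_continuous[OF SC_pd] SC_diff[where D="I \<times> UNIV"]) auto

lemma C1_pd: "C1 (f \<iota>) d \<Longrightarrow> pd k f \<iota> x = d k x"
  unfolding C1_def by (rule pd_eq[where d="\<lambda>k. d k x"]) blast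

text \<open>Averaging commutes with derivatives and does not increase suprema, so the weight is
  unchanged for every \<open>u\<close>. The domain is the whole plane because \<open>u\<close> may
  be arbitrarily long.\<close>

lemma SC_av:
  "SC (I \<times> UNIV) \<nu> m P f \<Longrightarrow> SC (I \<times> UNIV) \<nu> m P (\<lambda>\<iota>. av (u \<iota>) (f \<iota>))"
proof (induction m arbitrary: P f)
  have B: "BO (I \<times> UNIV) P (\<lambda>\<iota>. av (u \<iota>) (f \<iota>))" if S: "SC (I \<times> UNIV) \<nu> m P f" for m P f
  proof -
    obtain C where C: "C > 0" "\<And>\<iota> x. (\<iota>, x) \<in> I \<times> UNIV \<Longrightarrow> \<bar>f \<iota> x\<bar> \<le> C * P \<iota>"
      using BO_E[OF SC_BO[OF S]] by blast
    show ?thesis by (rule BO_I[OF C(1)]) (auto intro!: av_bound SC_continuous[OF S] C(2))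
  qed
  {
    case 0
    show ?case using B[OF 0] av_continuous[OF SC_continuous[OF 0]] by (auto simp: continuous_on_eq_continuous_at)
  next
    case (Suc m)
    show ?case
      by (rule SC_SucI[OF odom_UNIV B[OF Suc(2)] _ Suc.IH[OF SC_pd[OF Suc(2)]]])
         (use C1_av[OF SC_C1[OF Suc(2)]] in \<open>auto simp: C1_def\<close>)
  }
qed

lemma SC_shift:
  "SC (I \<times> UNIV) \<nu> m P f \<Longrightarrow> SC (I \<times> UNIV) \<nu> m P (\<lambda>\<iota> x. f \<iota> (x + u \<iota>))"
proof (induction m arbitrary: P f)
  case 0
  have "isCont (\<lambda>x. f \<iota> (x + u \<iota>)) x" if "\<iota> \<in> I" for \<iota> x
    by (rule isCont_o2[where f="\<lambda>x. x + u \<iota>" and g="f \<iota>"])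
       (simp, rule SC_isCont[OF 0], simp add: that)
  moreover have "BO (I \<times> UNIV) P (\<lambda>\<iota> x. f \<iota> (x + u \<iota>))" using SC_BO[OF 0] by (auto simp: BO_def)
  ultimately show ?case by simp
next
  case (Suc m)
  show ?case
  proof (rule SC_SucI[OF odom_UNIV _ _ Suc.IH[OF SC_pd[OF Suc(2)]]])
    show "BO (I \<times> UNIV) P (\<lambda>\<iota> x. f \<iota> (x + u \<iota>))" using SC_BO[OF Suc(2)] by (auto simp: BO_def)
    fix \<iota> x assume "(\<iota>, x) \<in> I \<times> (UNIV :: (real^2) set)"
    then have "(f \<iota> has_derivative (\<lambda>h. \<Sum>k\<in>UNIV. h $ k * pd k f \<iota> (x + u \<iota>))) (at (x + u \<iota>))"
      by (intro has_derivative_pd SC_diff[OF Suc(2)]) auto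
    moreover have "((\<lambda>x. x + u \<iota>) has_derivative (\<lambda>h. h)) (at x)"
      by (auto intro!: derivative_eq_intros)
    ultimately show "((\<lambda>x. f \<iota> (x + u \<iota>)) has_derivative (\<lambda>h. \<Sum>k\<in>UNIV. h $ k * pd k f \<iota> (x + u \<iota>))) (at x)"
      by (rule has_derivative_compose[rotated])
  qed
qed

text \<open>A line in direction \<open>i\<close> meets the slab where the coordinate
  \<open>i\<close> is at most \<open>R\<close> in absolute value in a piece of length
  \<open>2 * R\<close>, so \<open>t\<close> times the average stays bounded however large
  \<open>t\<close> is. This controls the large scales of the decomposition below.\<close>

lemma av_support_bound:
  assumes "continuous_on UNIV f" "\<And>y. \<bar>f y\<bar> \<le> P" "\<And>y. R < \<bar>y $ i\<bar> \<Longrightarrow> f y = 0" "0 < t" "0 \<le> R"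
  shows "\<bar>t * av (axis i t) f x\<bar> \<le> 2 * R * P"
proof -
  \<comment> \<open>\<open>a\<close> and \<open>b\<close> are the parameters at which the line
    enters and leaves the slab.\<close>
  define a where "a = - (R + x $ i) / t"
  define b where "b = (R - x $ i) / t"
  have P: "0 \<le> P" using assms(2)[of 0] by linarith
  have ab: "a \<le> b" "b - a = 2 * R / t" using assms(4,5) by (auto simp: a_def b_def field_simps)
  have z: "f (x + s *\<^sub>R axis i t) = 0" if "s \<notin> {a..b}" for s
  proof (rule assms(3))
    have "(x + s *\<^sub>R axis i t) $ i = x $ i + s * t" by (simp add: axis_def)
    moreover have "s < a \<or> b < s" using that by auto
    then have "s * t < - (R + x $ i) \<or> R - x $ i < s * t"
      unfolding a_def b_def using pos_less_divide_eq[OF assms(4)] pos_divide_less_eq[OF assms(4)] by blast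
    ultimately show "R < \<bar>(x + s *\<^sub>R axis i t) $ i\<bar>" by linarith
  qed
  have "av (axis i t) f x = integral {0..1} (\<lambda>s. if s \<in> {a..b} then f (x + s *\<^sub>R axis i t) else 0)"
    unfolding av_def using z by (intro Henstock_Kurzweil_Integration.integral_cong) auto
  also have "\<dots> = integral ({a..b} \<inter> {0..1}) (\<lambda>s. f (x + s *\<^sub>R axis i t))"
    by (rule Henstock_Kurzweil_Integration.integral_restrict_Int)
  also have "{a..b} \<inter> {0..1} = {max a 0..min b 1}" by auto
  finally have e: "av (axis i t) f x = integral {max a 0..min b 1} (\<lambda>s. f (x + s *\<^sub>R axis i t))" .
  have "\<bar>av (axis i t) f x\<bar> \<le> P * (2 * R / t)"
  proof (cases "max a 0 \<le> min b 1")
    case True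
    have "\<bar>av (axis i t) f x\<bar> \<le> P * (min b 1 - max a 0)"
      using integral_bound[OF True av_cont[OF assms(1)], of x "axis i t" P] assms(2) unfolding e by simp
    also have "\<dots> \<le> P * (2 * R / t)" by (rule mult_left_mono[OF _ P]) (use ab in auto)
    finally show ?thesis .
  next
    case False
    then show ?thesis unfolding e using P assms(4,5) by simp
  qed
  then show ?thesis using assms(4) by (simp add: abs_mult field_simps)
qed

subsection \<open>Symmetric gradients with a prescribed off-diagonal entry\<close>

lemma pd_Sum:
  assumes "\<And>s. s < n \<iota> \<Longrightarrow> f (\<iota>, s) differentiable (at x)"
  shows "pd k (\<lambda>\<iota> x. \<Sum>s<n \<iota>. f (\<iota>, s) x) \<iota> x = (\<Sum>s<n \<iota>. pd k f (\<iota>, s) x)"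
    and "(\<lambda>x. \<Sum>s<n \<iota>. f (\<iota>, s) x) differentiable (at x)"
proof -
  have *: "((\<lambda>x. \<Sum>s<n \<iota>. f (\<iota>, s) x) has_derivative (\<lambda>h. \<Sum>s<n \<iota>. \<Sum>k\<in>UNIV. h $ k * pd k f (\<iota>, s) x)) (at x)"
    by (intro has_derivative_sum has_derivative_pd assms) auto
  show "pd k (\<lambda>\<iota> x. \<Sum>s<n \<iota>. f (\<iota>, s) x) \<iota> x = (\<Sum>s<n \<iota>. pd k f (\<iota>, s) x)"
    using pd_eqI[where f="\<lambda>\<iota> x. \<Sum>s<n \<iota>. f (\<iota>, s) x" and k=k, OF *] by (simp only: sum_axis)
  show "(\<lambda>x. \<Sum>s<n \<iota>. f (\<iota>, s) x) differentiable (at x)"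
    using * differentiable_def by blast
qed

text \<open>The derivative in the direction of the average is a difference of two values of
  \<open>H\<close>: the factor \<open>t\<close> disappears and no derivative is spent. So this
  derivative has the size of \<open>H\<close> at every scale.\<close>

lemma SC_av_axis:
  assumes "SC (I \<times> UNIV) \<nu> (Suc m) P H" "\<And>\<iota>. \<iota> \<in> I \<Longrightarrow> t \<iota> \<noteq> (0::real)"
    and \<nu>: "\<forall>\<iota>\<in>I. \<forall>k. 0 \<le> \<nu> k \<iota>"
  shows "SC (I \<times> UNIV) \<nu> (Suc m) P (pd k (\<lambda>\<iota> x. c * t \<iota> * av (axis k (t \<iota>)) (H \<iota>) x))"
    and "\<iota> \<in> I \<Longrightarrow> (\<lambda>x. c * t \<iota> * av (axis k (t \<iota>)) (H \<iota>) x) differentiable (at x)"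
    and "\<iota> \<in> I \<Longrightarrow> pd k (\<lambda>\<iota> x. c * t \<iota> * av (axis k (t \<iota>)) (H \<iota>) x) \<iota> x = c * (H \<iota> (x + axis k (t \<iota>)) - H \<iota> x)"
proof -
  let ?A = "\<lambda>\<iota>. av (axis k (t \<iota>)) (H \<iota>)"
  have A: "C1 (?A \<iota>) (\<lambda>q. av (axis k (t \<iota>)) (pd q H \<iota>))" if "\<iota> \<in> I" for \<iota>
    by (rule C1_av[OF SC_C1[OF assms(1) that]])
  have d: "?A \<iota> differentiable (at x)" if "\<iota> \<in> I" for \<iota> x
    using A[OF that] unfolding C1_def differentiable_def by blast
  show "(\<lambda>x. c * t \<iota> * av (axis k (t \<iota>)) (H \<iota>) x) differentiable (at x)" if "\<iota> \<in> I"
    by (rule differentiable_mult[OF differentiable_const d[OF that]])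
  have e: "pd k (\<lambda>\<iota> x. c * t \<iota> * ?A \<iota> x) \<iota> x = c * (H \<iota> (x + axis k (t \<iota>)) - H \<iota> x)" if "\<iota> \<in> I" for \<iota> x
  proof -
    have "pd k (\<lambda>\<iota> x. c * t \<iota> * ?A \<iota> x) \<iota> x = c * t \<iota> * pd k ?A \<iota> x"
      by (rule pd_cmult[where f="?A" and c="\<lambda>\<iota>. c * t \<iota>", OF d[OF that]])
    also have "pd k ?A \<iota> x = av (axis k (t \<iota>)) (pd k H \<iota>) x"
      by (rule C1_pd[where f="?A", OF A[OF that]])
    finally show ?thesis
      using av_axis_deriv[OF SC_C1[OF assms(1) that], of "t \<iota>" k x] by (simp add: mult.assoc)
  qed
  then show "pd k (\<lambda>\<iota> x. c * t \<iota> * ?A \<iota> x) \<iota> x = c * (H \<iota> (x + axis k (t \<iota>)) - H \<iota> x)" if "\<iota> \<in> I"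
    using that by blast
  have "SC (I \<times> UNIV) \<nu> (Suc m) P (\<lambda>\<iota> x. c * (H \<iota> (x + axis k (t \<iota>)) - H \<iota> x))"
    by (intro SC_scale SC_sub SC_shift assms(1)) (use \<nu> in auto)
  then show "SC (I \<times> UNIV) \<nu> (Suc m) P (pd k (\<lambda>\<iota> x. c * t \<iota> * ?A \<iota> x))"
    by (rule SC_cong) (use e in auto)
qed

lemma av_close:
  assumes "C1 f d" "\<And>y. \<bar>d k y\<bar> \<le> B" "0 \<le> t"
  shows "\<bar>av (axis k t) f x - f x\<bar> \<le> t * B"
proof -
  have c: "continuous_on UNIV f" by (rule C1_continuous[OF assms(1)])
  have "\<bar>av (axis k t) (\<lambda>y. f y - f x) x\<bar> \<le> t * B"
  proof (rule av_bound)
    show "continuous_on UNIV (\<lambda>y. f y - f x)" by (intro continuous_intros c)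
    fix s :: real assume s: "0 \<le> s" "s \<le> 1"
    have "s *\<^sub>R axis k t = axis k (s * t)" by (simp add: vec_eq_iff axis_def)
    then have "f (x + s *\<^sub>R axis k t) - f x = s * t * av (axis k (s * t)) (d k) x"
      using av_axis_deriv[OF assms(1), of "s * t" k x] by simp
    moreover have "\<bar>av (axis k (s * t)) (d k) x\<bar> \<le> B"
      by (rule av_bound) (use assms(1,2) in \<open>auto simp: C1_def\<close>)
    moreover have "0 \<le> B" using assms(2)[of 0] by linarith
    ultimately show "\<bar>f (x + s *\<^sub>R axis k t) - f x\<bar> \<le> t * B"
      using s assms(3) mult_mono[of "s * t" t "\<bar>av (axis k (s * t)) (d k) x\<bar>" B]
      by (simp add: abs_mult mult_left_le_one_le)
  qed
  moreover have "av (axis k t) (\<lambda>y. f y - f x) x = av (axis k t) f x - f x"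
    using av_diff[OF c continuous_on_const, of "axis k t" "f x" x] by simp
  ultimately show ?thesis by simp
qed

lemma av_swap3: "continuous_on UNIV f \<Longrightarrow> av u (av v (av w f)) = av w (av u (av v f))"
  using av_swap[of f v w] av_swap[of "av v f" u w] av_continuous[of f v] by simp

text \<open>A Calderon--Zygmund type estimate for the equation \<open>f = (\<partial>\<^sub>i \<Psi>\<^sub>j + \<partial>\<^sub>j \<Psi>\<^sub>i) / 2\<close>, with one unit
  of loss per dyadic scale: averages over squares of successive sizes differ by a divergence.\<close>

lemma divergence_decomposition:
  fixes f :: "'i fld" and n :: "'i \<Rightarrow> nat" and \<nu> :: "'i \<Rightarrow> real"
  assumes f: "SC (I \<times> UNIV) (\<lambda>_. \<nu>) (Suc m) P f" and "i \<noteq> j"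
    and supp: "\<And>\<iota> y k. \<iota> \<in> I \<Longrightarrow> R < \<bar>y $ k\<bar> \<Longrightarrow> f \<iota> y = 0" and R: "0 < R"
    and \<nu>: "\<And>\<iota>. \<iota> \<in> I \<Longrightarrow> 0 \<le> \<nu> \<iota>"
  obtains \<Psi> where "\<And>q. BO (I \<times> UNIV) (\<lambda>\<iota>. real (2 * n \<iota>) * P \<iota>) (\<Psi> q)"
    "\<And>q p. SC (I \<times> UNIV) (\<lambda>_. \<nu>) m (\<lambda>\<iota>. real (2 * n \<iota>) * P \<iota>) (pd p (\<Psi> q))"
    "\<And>q \<iota> x. \<iota> \<in> I \<Longrightarrow> \<Psi> q \<iota> differentiable (at x)"
    "BO (I \<times> UNIV) (\<lambda>\<iota>. P \<iota> * (1 + \<nu> \<iota>) / 2 ^ n \<iota>) (\<lambda>\<iota> x. f \<iota> x - (pd i (\<Psi> j) \<iota> x + pd j (\<Psi> i) \<iota> x) / 2)"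
proof -
  define J where "J = {(\<iota>, s). \<iota> \<in> I \<and> s < 2 * n \<iota>}"
  \<comment> \<open>The side runs from 2^n down to 2^(-n) as \<open>s\<close> runs from 0 to
    \<open>2 * n\<close>; \<open>t\<close> is the smaller of two consecutive sides.\<close>
  define T :: "'i \<Rightarrow> nat \<Rightarrow> real" where "T \<iota> s = 2 ^ n \<iota> / 2 ^ s" for \<iota> s
  define t where "t = (\<lambda>(\<iota>, s). T \<iota> (Suc s))"
  define F where "F = (\<lambda>(\<iota>::'i, s::nat). f \<iota>)"
  \<comment> \<open>\<open>\<psi>\<close> belongs to halving the side in direction \<open>i\<close>,
    \<open>\<phi>\<close> to halving it in direction \<open>j\<close> beforehand. The derivative of
    each in its own direction is the average after the halving minus the one before.\<close>
  define \<psi> where "\<psi> = (\<lambda>k x. (-1/2) * t k * av (axis i (t k)) (av (axis i (t k)) (av (axis j (t k)) (F k))) x)"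
  define \<phi> where "\<phi> = (\<lambda>k x. (-1/2) * t k * av (axis j (t k)) (av (axis i (2 * t k)) (av (axis j (t k)) (F k))) x)"
  have T: "0 < T \<iota> s" for \<iota> s by (simp add: T_def)
  have t: "0 < t k" for k by (simp add: t_def T split: prod.split)
  have F: "SC (J \<times> UNIV) (\<lambda>_. \<nu> \<circ> fst) (Suc m) (P \<circ> fst) F"
    using SC_reindex[OF f odom_UNIV[of J], of fst] unfolding F_def J_def by (auto simp: comp_def case_prod_unfold)
  have fc: "continuous_on UNIV (f \<iota>)" if "\<iota> \<in> I" for \<iota> by (rule SC_continuous[OF f that])
  have Fc: "continuous_on UNIV (F k)" if "k \<in> J" for k by (rule SC_continuous[OF F that])
  have \<nu>': "\<forall>k\<in>J. \<forall>q::2. 0 \<le> (\<nu> \<circ> fst) k" using \<nu> by (auto simp: J_def)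
  have tn: "t k \<noteq> 0" "2 * t k \<noteq> 0" for k using t[of k] by simp_all
  note SF = SC_av[OF SC_av[OF F]]
  note A = SC_av_axis[where I=J and \<nu>="\<lambda>_. \<nu> \<circ> fst" and m=m and P="P \<circ> fst", OF _ _ \<nu>']
  note A\<psi> = A[where c="-1/2" and k=i and t=t and H="\<lambda>k. av (axis i (t k)) (av (axis j (t k)) (F k))", OF SF tn(1)]
  have S\<psi>: "SC (J \<times> UNIV) (\<lambda>_. \<nu> \<circ> fst) (Suc m) (P \<circ> fst) (pd i \<psi>)"
     unfolding \<psi>_def by (rule A\<psi>(1))
  have S\<psi>2: "\<psi> k differentiable (at x)"
     "pd i \<psi> k x = -1/2 * (av (axis i (t k)) (av (axis j (t k)) (F k)) (x + axis i (t k)) - av (axis i (t k)) (av (axis j (t k)) (F k)) x)"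
     if "k \<in> J" for k x
    unfolding \<psi>_def by (rule A\<psi>(2)[OF that], rule A\<psi>(3)[OF that])
  note A\<phi> = A[where c="-1/2" and k=j and t=t and H="\<lambda>k. av (axis i (2 * t k)) (av (axis j (t k)) (F k))", OF SF tn(1)]
  have S\<phi>: "SC (J \<times> UNIV) (\<lambda>_. \<nu> \<circ> fst) (Suc m) (P \<circ> fst) (pd j \<phi>)"
     unfolding \<phi>_def by (rule A\<phi>(1))
  have S\<phi>2: "\<phi> k differentiable (at x)"
     "pd j \<phi> k x = -1/2 * (av (axis i (2 * t k)) (av (axis j (t k)) (F k)) (x + axis j (t k)) - av (axis i (2 * t k)) (av (axis j (t k)) (F k)) x)"
     if "k \<in> J" for k x
    unfolding \<phi>_def by (rule A\<phi>(2)[OF that], rule A\<phi>(3)[OF that])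
  have pdc: "pd p g k x = pd p g' k x" if "g k = g' k" for p k x and g g' :: "'i \<times> nat \<Rightarrow> real^2 \<Rightarrow> real"
    using that by (simp add: pd_def)
  \<comment> \<open>The transversal derivative is bounded too: averages commute, so one over
    \<open>axis j\<close> can be moved outside, where the factor \<open>t\<close> again turns the
    derivative into a difference.\<close>
  have S\<psi>': "SC (J \<times> UNIV) (\<lambda>_. \<nu> \<circ> fst) (Suc m) (P \<circ> fst) (pd j \<psi>)"
  proof (rule SC_cong[OF A(1)[where c="-1/2" and k=j and t=t and H="\<lambda>k. av (axis i (t k)) (av (axis i (t k)) (F k))", OF SF tn(1)]])
    fix k x assume "(k, x) \<in> J \<times> (UNIV :: (real^2) set)"
    then have "k \<in> J" by simp
    show "pd j \<psi> k x = pd j (\<lambda>k x. (-1/2) * t k * av (axis j (t k)) (av (axis i (t k)) (av (axis i (t k)) (F k))) x) k x"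
      unfolding \<psi>_def by (rule pdc) (simp only: av_swap3[OF Fc[OF \<open>k \<in> J\<close>], of "axis i (t k)" "axis i (t k)" "axis j (t k)"])
  qed
  \<comment> \<open>Here the average moved outside has length \<open>2 * t\<close>, so the
    coefficient -1/2 with \<open>t\<close> is rewritten as -1/4 with \<open>2 * t\<close>.\<close>
  have S\<phi>': "SC (J \<times> UNIV) (\<lambda>_. \<nu> \<circ> fst) (Suc m) (P \<circ> fst) (pd i \<phi>)"
  proof (rule SC_cong[OF A(1)[where c="-1/4" and k=i and t="\<lambda>k. 2 * t k" and H="\<lambda>k. av (axis j (t k)) (av (axis j (t k)) (F k))", OF SF tn(2)]])
    fix k x assume "(k, x) \<in> J \<times> (UNIV :: (real^2) set)"
    then have "k \<in> J" by simp
    show "pd i \<phi> k x = pd i (\<lambda>k x. (-1/4) * (2 * t k) * av (axis i (2 * t k)) (av (axis j (t k)) (av (axis j (t k)) (F k))) x) k x"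
      unfolding \<phi>_def by (rule pdc) (simp add: av_swap[OF av_continuous[OF Fc[OF \<open>k \<in> J\<close>]], of "axis j (t k)" "axis i (2 * t k)"])
  qed
  \<comment> \<open>The factor 2 compensates the 1/2 in the symmetric gradient.\<close>
  define \<Psi> where "\<Psi> = (\<lambda>q \<iota> x. 2 * (\<Sum>s<2 * n \<iota>. (if q = j then \<psi> else \<phi>) (\<iota>, s) x))"
  have JD: "{((\<iota>, s), x). (\<iota>, x) \<in> I \<times> (UNIV::(real^2) set) \<and> s < 2 * n \<iota>} = J \<times> UNIV"
    by (auto simp: J_def)
  have d\<Psi>: "(\<lambda>x. \<Sum>s<2 * n \<iota>. (if q = j then \<psi> else \<phi>) (\<iota>, s) x) differentiable (at x)"
    "pd p (\<lambda>\<iota> x. \<Sum>s<2 * n \<iota>. (if q = j then \<psi> else \<phi>) (\<iota>, s) x) \<iota> x = (\<Sum>s<2 * n \<iota>. pd p (if q = j then \<psi> else \<phi>) (\<iota>, s) x)"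
    if "\<iota> \<in> I" for \<iota> q x p
  proof -
    have d: "(if q = j then \<psi> else \<phi>) (\<iota>, s) differentiable (at x)" if "s < 2 * n \<iota>" for s
      using S\<psi>2(1) S\<phi>2(1) that \<open>\<iota> \<in> I\<close> by (auto simp: J_def)
    show "(\<lambda>x. \<Sum>s<2 * n \<iota>. (if q = j then \<psi> else \<phi>) (\<iota>, s) x) differentiable (at x)"
      by (rule pd_Sum(2)[where n="\<lambda>\<iota>. 2 * n \<iota>" and f="if q = j then \<psi> else \<phi>", OF d])
    show "pd p (\<lambda>\<iota> x. \<Sum>s<2 * n \<iota>. (if q = j then \<psi> else \<phi>) (\<iota>, s) x) \<iota> x = (\<Sum>s<2 * n \<iota>. pd p (if q = j then \<psi> else \<phi>) (\<iota>, s) x)"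
      by (rule pd_Sum(1)[where n="\<lambda>\<iota>. 2 * n \<iota>" and f="if q = j then \<psi> else \<phi>", OF d])
  qed
  have p\<Psi>: "pd p (\<Psi> q) \<iota> x = 2 * (\<Sum>s<2 * n \<iota>. pd p (if q = j then \<psi> else \<phi>) (\<iota>, s) x)" if "\<iota> \<in> I" for \<iota> q x p
    unfolding \<Psi>_def using pd_cmult[where f="\<lambda>\<iota> x. \<Sum>s<2 * n \<iota>. (if q = j then \<psi> else \<phi>) (\<iota>, s) x" and c="\<lambda>_. 2" and k=p, OF d\<Psi>(1)[where q=q and x=x, OF that]] d\<Psi>(2)[OF that] by simp
  obtain C where C: "C > 0" "\<And>\<iota> x. \<iota> \<in> I \<Longrightarrow> \<bar>f \<iota> x\<bar> \<le> C * P \<iota>"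
    using BO_E[OF SC_BO[OF f]] by auto
  \<comment> \<open>A bound independent of the scale: one average is estimated together with its
    factor \<open>t\<close> through the bounded support, the others do not increase suprema.\<close>
  have B: "\<bar>(if q = j then \<psi> else \<phi>) (\<iota>, s) x\<bar> \<le> C * R * P \<iota>" if "\<iota> \<in> I" "s < 2 * n \<iota>" for \<iota> s x q
  proof -
    let ?t = "t (\<iota>, s)"
    have k: "(\<iota>, s) \<in> J" using that by (simp add: J_def)
    note c = fc[OF that(1)]
    have b1: "\<bar>?t * av (axis i ?t) (av (axis j ?t) (f \<iota>)) y\<bar> \<le> 2 * R * (C * P \<iota>)" for y
    proof (rule av_support_bound[OF av_continuous[OF c] _ _ t])
      show "\<bar>av (axis j ?t) (f \<iota>) y\<bar> \<le> C * P \<iota>" for y by (rule av_bound[OF c C(2)[OF that(1)]])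
      show "av (axis j ?t) (f \<iota>) y = 0" if "R < \<bar>y $ i\<bar>" for y
      proof -
        have "f \<iota> (y + s *\<^sub>R axis j ?t) = 0" for s
          by (rule supp[OF \<open>\<iota> \<in> I\<close>, of _ i]) (use that \<open>i \<noteq> j\<close> in \<open>simp add: axis_def\<close>)
        then show ?thesis by (simp add: av_def)
      qed
    qed (use R in simp)
    have b2: "\<bar>?t * av (axis j ?t) (f \<iota>) y\<bar> \<le> 2 * R * (C * P \<iota>)" for y
      by (rule av_support_bound[OF c C(2)[OF that(1)] supp[OF that(1)] t]) (use R in simp_all)
    have "\<bar>av (axis i ?t) (\<lambda>y. ?t * av (axis i ?t) (av (axis j ?t) (f \<iota>)) y) x\<bar> \<le> 2 * R * (C * P \<iota>)"
      by (rule av_bound[OF _ b1]) (intro continuous_intros av_continuous c)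
    moreover have "\<bar>av (axis j ?t) (av (axis i (2 * ?t)) (\<lambda>y. ?t * av (axis j ?t) (f \<iota>) y)) x\<bar> \<le> 2 * R * (C * P \<iota>)"
      by (intro av_bound av_continuous continuous_on_mult continuous_on_const c b2)
    ultimately show ?thesis
      unfolding \<psi>_def \<phi>_def F_def av_cmult_fun by (simp add: abs_mult algebra_simps)
  qed
  have BO\<Psi>: "BO (I \<times> UNIV) (\<lambda>\<iota>. real (2 * n \<iota>) * P \<iota>) (\<Psi> q)" for q
  proof (rule BO_I[of "2 * (C * R)"])
    fix \<iota> x assume "(\<iota>, x) \<in> I \<times> (UNIV::(real^2) set)"
    then have a: "\<iota> \<in> I" by simp
    have "\<bar>\<Sum>s<2 * n \<iota>. (if q = j then \<psi> else \<phi>) (\<iota>, s) x\<bar> \<le> (\<Sum>s<2 * n \<iota>. C * R * P \<iota>)"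
      by (rule order_trans[OF sum_abs sum_mono]) (use B[OF a] in auto)
    then show "\<bar>\<Psi> q \<iota> x\<bar> \<le> 2 * (C * R) * (real (2 * n \<iota>) * P \<iota>)"
      unfolding \<Psi>_def abs_mult by (simp add: algebra_simps)
  qed (use C R in simp)
  have SC\<Psi>: "SC (I \<times> UNIV) (\<lambda>_. \<nu>) m (\<lambda>\<iota>. real (2 * n \<iota>) * P \<iota>) (pd p (\<Psi> q))" for p q
  proof -
    have pij: "p = i \<or> p = j" using exhaust_2[of i] exhaust_2[of j] exhaust_2[of p] \<open>i \<noteq> j\<close> by metis
    have "SC (J \<times> UNIV) (\<lambda>_. \<nu> \<circ> fst) (Suc m) (P \<circ> fst) (pd p (if q = j then \<psi> else \<phi>))"
      using pij S\<psi> S\<phi> S\<psi>' S\<phi>' by (auto split: if_split)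
    then have "SC (J \<times> UNIV) (\<lambda>_. \<nu> \<circ> fst) m (P \<circ> fst) (pd p (if q = j then \<psi> else \<phi>))"
      by (rule SC_SucD)
    then have "SC (I \<times> UNIV) (\<lambda>_. \<nu>) m (\<lambda>\<iota>. real (2 * n \<iota>) * P \<iota>)
        (\<lambda>\<iota> x. \<Sum>s<2 * n \<iota>. pd p (if q = j then \<psi> else \<phi>) (\<iota>, s) x)"
      by (intro SC_Sum odom_UNIV) (simp only: JD)
    from SC_scale[OF this, of 2] have "SC (I \<times> UNIV) (\<lambda>_. \<nu>) m (\<lambda>\<iota>. real (2 * n \<iota>) * P \<iota>)
        (\<lambda>\<iota> x. 2 * (\<Sum>s<2 * n \<iota>. pd p (if q = j then \<psi> else \<phi>) (\<iota>, s) x))" using \<nu> by blast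
    then show ?thesis by (rule SC_cong) (use p\<Psi> in auto)
  qed
  define E where "E \<iota> s = av (axis i (T \<iota> s)) (av (axis j (T \<iota> s)) (f \<iota>))" for \<iota> s
  have tele: "pd i \<psi> (\<iota>, s) x + pd j \<phi> (\<iota>, s) x = E \<iota> (Suc s) x - E \<iota> s x" if "\<iota> \<in> I" "s < 2 * n \<iota>" for \<iota> s x
  proof -
    let ?t = "T \<iota> (Suc s)"
    have k: "(\<iota>, s) \<in> J" using that by (simp add: J_def)
    have 2: "T \<iota> s = 2 * ?t" by (simp add: T_def)
    note c = fc[OF that(1)]
    have tn: "?t \<noteq> 0" using T[of \<iota> "Suc s"] by simp
    have "E \<iota> s = av (axis j (2 * ?t)) (av (axis i (2 * ?t)) (f \<iota>))"
      unfolding E_def 2 by (rule av_swap[OF c])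
    then have "E \<iota> s x = (av (axis j ?t) (av (axis i (2 * ?t)) (f \<iota>)) x + av (axis j ?t) (av (axis i (2 * ?t)) (f \<iota>)) (x + axis j ?t)) / 2"
      using av_axis_double[OF av_continuous[OF c] tn] by simp
    also have "av (axis j ?t) (av (axis i (2 * ?t)) (f \<iota>)) = av (axis i (2 * ?t)) (av (axis j ?t) (f \<iota>))"
      by (rule av_swap[OF c])
    finally have e: "E \<iota> s x = (av (axis i (2 * ?t)) (av (axis j ?t) (f \<iota>)) x + av (axis i (2 * ?t)) (av (axis j ?t) (f \<iota>)) (x + axis j ?t)) / 2" .
    have "av (axis i (2 * ?t)) (av (axis j ?t) (f \<iota>)) x = (E \<iota> (Suc s) x + E \<iota> (Suc s) (x + axis i ?t)) / 2"
      unfolding E_def by (rule av_axis_double[OF av_continuous[OF c] tn])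
    then show ?thesis
      using e unfolding S\<psi>2(2)[OF k] S\<phi>2(2)[OF k] by (simp add: t_def F_def E_def algebra_simps)
  qed
  have "BO (I \<times> UNIV) (\<lambda>\<iota>. P \<iota> * (1 + \<nu> \<iota>) / 2 ^ n \<iota>) (\<lambda>\<iota> x. f \<iota> x - (pd i (\<Psi> j) \<iota> x + pd j (\<Psi> i) \<iota> x) / 2)"
  proof -
    obtain C' where C': "C' > 0" "\<And>k \<iota> x. \<iota> \<in> I \<Longrightarrow> \<bar>pd k f \<iota> x\<bar> \<le> C' * (P \<iota> * \<nu> \<iota>)"
    proof -
      obtain Ca where a: "Ca > 0" "\<And>\<iota> x. \<iota> \<in> I \<Longrightarrow> \<bar>pd 1 f \<iota> x\<bar> \<le> Ca * (P \<iota> * \<nu> \<iota>)"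
        using BO_E[OF SC_BO[OF SC_pd[OF f, of 1]]] by auto
      obtain Cb where b: "Cb > 0" "\<And>\<iota> x. \<iota> \<in> I \<Longrightarrow> \<bar>pd 2 f \<iota> x\<bar> \<le> Cb * (P \<iota> * \<nu> \<iota>)"
        using BO_E[OF SC_BO[OF SC_pd[OF f, of 2]]] by auto
      show thesis
      proof (rule that[of "Ca + Cb"])
        fix k \<iota> and x :: "real^2" assume i: "\<iota> \<in> I"
        have "0 \<le> P \<iota> * \<nu> \<iota>" using SC_nonneg[OF f, of \<iota> 0] \<nu>[OF i] i by simp
        then have "0 \<le> Ca * (P \<iota> * \<nu> \<iota>)" "0 \<le> Cb * (P \<iota> * \<nu> \<iota>)" using a(1) b(1) by auto
        then show "\<bar>pd k f \<iota> x\<bar> \<le> (Ca + Cb) * (P \<iota> * \<nu> \<iota>)"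
          using a(2)[OF i, of x] b(2)[OF i, of x] exhaust_2[of k] by (auto simp: distrib_right)
      qed (use a b in simp)
    qed
    show ?thesis
    proof (rule BO_I[of "2 * C' + 2 * R * C"])
      show "0 < 2 * C' + 2 * R * C" using C' C R by (simp add: add_pos_pos)
      fix \<iota> x assume "(\<iota>, x) \<in> I \<times> (UNIV::(real^2) set)"
      then have a: "\<iota> \<in> I" by simp
      note c = fc[OF a] and c1 = SC_C1[OF f a]
      have P0: "0 \<le> P \<iota>" using SC_nonneg[OF f, of \<iota> 0] a by simp
      have "(pd i (\<Psi> j) \<iota> x + pd j (\<Psi> i) \<iota> x) / 2 = (\<Sum>s<2 * n \<iota>. pd i \<psi> (\<iota>, s) x + pd j \<phi> (\<iota>, s) x)"
        unfolding p\<Psi>[OF a] using \<open>i \<noteq> j\<close> by (simp add: sum.distrib)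
      also have "\<dots> = (\<Sum>s<2 * n \<iota>. E \<iota> (Suc s) x - E \<iota> s x)"
        by (rule sum.cong[OF refl]) (use tele[OF a] in auto)
      also have "\<dots> = E \<iota> (2 * n \<iota>) x - E \<iota> 0 x" by (rule sum_lessThan_telescope)
      finally have "(pd i (\<Psi> j) \<iota> x + pd j (\<Psi> i) \<iota> x) / 2 = E \<iota> (2 * n \<iota>) x - E \<iota> 0 x" .
      then have e: "f \<iota> x - (pd i (\<Psi> j) \<iota> x + pd j (\<Psi> i) \<iota> x) / 2 = (f \<iota> x - E \<iota> (2 * n \<iota>) x) + E \<iota> 0 x" by linarith
      \<comment> \<open>The two ends of the telescope remain. At side 2^(-n) the average differs
        from \<open>f\<close> by at most gradient times side; at side 2^n it is small because the
        support has bounded width.\<close>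
      have T2: "T \<iota> (2 * n \<iota>) = 1 / 2 ^ n \<iota>" by (simp add: T_def mult_2 power_add)
      have T0: "T \<iota> 0 = 2 ^ n \<iota>" by (simp add: T_def)
      let ?r = "1 / 2 ^ n \<iota> :: real"
      have "\<bar>av (axis j ?r) (f \<iota>) x - f \<iota> x\<bar> \<le> ?r * (C' * (P \<iota> * \<nu> \<iota>))"
        by (rule av_close[OF c1 C'(2)[OF a]]) simp
      moreover have "\<bar>av (axis i ?r) (av (axis j ?r) (f \<iota>)) x - av (axis j ?r) (f \<iota>) x\<bar> \<le> ?r * (C' * (P \<iota> * \<nu> \<iota>))"
      proof (rule av_close[OF C1_av[OF c1]])
        show "\<bar>av (axis j ?r) (pd i f \<iota>) y\<bar> \<le> C' * (P \<iota> * \<nu> \<iota>)" for y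
          by (rule av_bound) (use c1 C'(2)[OF a] in \<open>auto simp: C1_def\<close>)
      qed simp
      ultimately have n1: "\<bar>f \<iota> x - E \<iota> (2 * n \<iota>) x\<bar> \<le> 2 * (?r * (C' * (P \<iota> * \<nu> \<iota>)))"
        unfolding E_def T2 by linarith
      have "\<bar>2 ^ n \<iota> * av (axis i (2 ^ n \<iota>)) (av (axis j (2 ^ n \<iota>)) (f \<iota>)) x\<bar> \<le> 2 * R * (C * P \<iota>)"
      proof (rule av_support_bound[OF av_continuous[OF c]])
        show "\<bar>av (axis j (2 ^ n \<iota>)) (f \<iota>) y\<bar> \<le> C * P \<iota>" for y by (rule av_bound[OF c C(2)[OF a]])
        show "av (axis j (2 ^ n \<iota>)) (f \<iota>) y = 0" if "R < \<bar>y $ i\<bar>" for y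
        proof -
          have "f \<iota> (y + s *\<^sub>R axis j (2 ^ n \<iota>)) = 0" for s
            by (rule supp[OF a, of _ i]) (use that \<open>i \<noteq> j\<close> in \<open>simp add: axis_def\<close>)
          then show ?thesis by (simp add: av_def)
        qed
      qed (use R in simp_all)
      then have n2: "\<bar>E \<iota> 0 x\<bar> \<le> ?r * (2 * R * (C * P \<iota>))"
        unfolding E_def T0 by (simp add: abs_mult field_simps)
      have "\<bar>f \<iota> x - (pd i (\<Psi> j) \<iota> x + pd j (\<Psi> i) \<iota> x) / 2\<bar> \<le> 2 * (?r * (C' * (P \<iota> * \<nu> \<iota>))) + ?r * (2 * R * (C * P \<iota>))"
        unfolding e using n1 n2 by linarith
      also have "\<dots> = ?r * P \<iota> * (2 * C' * \<nu> \<iota> + 2 * R * C)" by (simp add: algebra_simps)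
      also have "\<dots> \<le> ?r * P \<iota> * ((2 * C' + 2 * R * C) * (1 + \<nu> \<iota>))"
      proof (rule mult_left_mono)
        have "0 \<le> R * C * \<nu> \<iota>" "0 \<le> C'" using R C C' \<nu>[OF a] by simp_all
        then show "2 * C' * \<nu> \<iota> + 2 * R * C \<le> (2 * C' + 2 * R * C) * (1 + \<nu> \<iota>)"
          by (simp add: algebra_simps)
      qed (use P0 in simp)
      finally show "\<bar>f \<iota> x - (pd i (\<Psi> j) \<iota> x + pd j (\<Psi> i) \<iota> x) / 2\<bar> \<le> (2 * C' + 2 * R * C) * (P \<iota> * (1 + \<nu> \<iota>) / 2 ^ n \<iota>)"
        by (simp add: mult_ac)
    qed
  qed
  moreover have "\<Psi> q \<iota> differentiable (at x)" if "\<iota> \<in> I" for q \<iota> x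
    unfolding \<Psi>_def by (rule differentiable_mult[OF differentiable_const d\<Psi>(1)[OF that]])
  ultimately show thesis using that[of \<Psi>] BO\<Psi> SC\<Psi> by blast
qed

subsection \<open>Corrugations\<close>

declare SC.simps [simp del]

lemmas pds = pd_add pd_diff pd_mult
lemmas difs = differentiable_add differentiable_diff differentiable_mult differentiable_const

lemma UNIV_2_pair: "i \<noteq> j \<Longrightarrow> q = i \<or> q = (j::2)"
  using exhaust_2[of i] exhaust_2[of j] exhaust_2[of q] by metis

text \<open>\<open>\<mu>\<close> is the frequency of the corrugation to be added,
  \<open>\<rho> * \<mu>\<close> that of everything already present, and \<open>i\<close> is the
  direction of the new oscillation.\<close>

locale corrugation =
  fixes D :: "('i \<times> (real^2)) set" and \<mu> \<rho> :: "'i \<Rightarrow> real" and i j :: 2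
  assumes odom: "odom D" and ij: "i \<noteq> j"
    and \<mu>: "\<And>\<iota> x. (\<iota>, x) \<in> D \<Longrightarrow> 0 < \<mu> \<iota>"
    and \<rho>: "\<And>\<iota> x. (\<iota>, x) \<in> D \<Longrightarrow> 0 \<le> \<rho> \<iota>" "\<And>\<iota> x. (\<iota>, x) \<in> D \<Longrightarrow> \<rho> \<iota> \<le> 1"
begin

definition slow :: "2 \<Rightarrow> 'i \<Rightarrow> real" where "slow = (\<lambda>_ \<iota>. \<rho> \<iota> * \<mu> \<iota>)"
text \<open>The derivative costs of a slow amplitude times an oscillation in direction
  \<open>i\<close>: direction \<open>j\<close> stays slow. This anisotropy yields the factor
  \<rho>^2 in the entry \<open>jj\<close>.\<close>

definition mix :: "2 \<Rightarrow> 'i \<Rightarrow> real" where "mix = (\<lambda>k \<iota>. if k = i then \<mu> \<iota> else \<rho> \<iota> * \<mu> \<iota>)"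

lemma \<rho>\<mu>_nonneg: "(\<iota>, x) \<in> D \<Longrightarrow> 0 \<le> \<rho> \<iota> * \<mu> \<iota>"
  by (rule mult_nonneg_nonneg[OF \<rho>(1) less_imp_le[OF \<mu>]])

lemma slow_nonneg: "(\<iota>, x) \<in> D \<Longrightarrow> 0 \<le> slow k \<iota>"
  by (simp add: slow_def \<rho>\<mu>_nonneg)

lemma mix_nonneg: "(\<iota>, x) \<in> D \<Longrightarrow> 0 \<le> mix k \<iota>"
  by (simp add: mix_def \<rho>\<mu>_nonneg less_imp_le[OF \<mu>])

lemma \<rho>\<mu>_le: "(\<iota>, x) \<in> D \<Longrightarrow> \<rho> \<iota> * \<mu> \<iota> \<le> \<mu> \<iota>"
  using \<mu>[of \<iota> x] \<rho>[of \<iota> x] by (simp add: mult_left_le_one_le)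

lemma slow_mix: "SC D slow m P f \<Longrightarrow> SC D mix m P f"
  by (rule SC_mono[where c=1 and c'=1]) (auto simp: slow_nonneg, auto simp: slow_def mix_def \<rho>\<mu>_le)

lemma mix_iso: "SC D mix m P f \<Longrightarrow> SC D (\<lambda>_. \<mu>) m P f"
  by (rule SC_mono[where c=1 and c'=1]) (auto simp: mix_nonneg, auto simp: mix_def \<rho>\<mu>_le)

text \<open>A phase lets one function cover sine and cosine at all multiples \<open>k\<close> of the
  frequency. Its primitive in the fast variable is the same function with phase lowered by
  \<open>pi/2\<close>, divided by \<open>k * \<mu>\<close>.\<close>

definition osc :: "real \<Rightarrow> real \<Rightarrow> 'i fld" where
  "osc k \<theta> = (\<lambda>\<iota> x. cos (k * \<mu> \<iota> * x $ i + \<theta>))"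

lemma SC_osc: "SC D mix m (\<lambda>_. 1) (osc k \<theta>)"
  unfolding osc_def
  by (rule SC_cos[OF odom, where K="\<bar>k\<bar> + 1"])
     (auto simp: mix_nonneg, auto simp: mix_def abs_mult distrib_right less_imp_le[OF \<mu>] abs_of_pos[OF \<mu>])

lemma osc_deriv: "(osc k \<theta> \<iota> has_derivative (\<lambda>h. h $ i * (k * \<mu> \<iota> * osc k (\<theta> + pi/2) \<iota> x))) (at x)"
  unfolding osc_def by (auto intro!: derivative_eq_intros ext simp: cos_add sin_add algebra_simps)

lemma osc_diff [simp]: "osc k \<theta> \<iota> differentiable (at x)"
  using osc_deriv differentiable_def by blast

lemma pd_osc: "pd i (osc k (\<theta> - pi/2)) \<iota> x = k * \<mu> \<iota> * osc k \<theta> \<iota> x" "pd j (osc k \<theta>) \<iota> x = 0"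
  using pd_eqI[of "osc k (\<theta> - pi/2)" \<iota> _ x i, OF osc_deriv] pd_eqI[of "osc k \<theta>" \<iota> _ x j, OF osc_deriv] ij
  by (simp_all add: axis_def)

text \<open>With S the primitive of the oscillation, \<open>g * osc\<close> is the
  \<open>i\<close>-derivative of g S minus S times the slow derivative of \<open>g\<close>; each
  such integration by parts gains \<rho>. The \<open>j\<close>-derivative of \<open>G\<close> is of
  the same kind, because \<open>osc\<close> does not depend on that variable, and \<open>H\<close>
  is its primitive. Putting \<open>G\<close> into component \<open>i\<close> and \<open>- H\<close>
  into component \<open>j\<close> keeps the entry \<open>ij\<close> of the symmetric gradient at 0
  up to the error.\<close>

lemma oscillatory_primitive:
  assumes "k > 0"
  shows "SC D slow (Suc m + r) P g \<Longrightarrow> \<exists>G H. SC D mix (Suc m) (\<lambda>\<iota>. P \<iota> / \<mu> \<iota>) G \<and>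
    SC D mix (Suc m) (\<lambda>\<iota>. P \<iota> * \<rho> \<iota> / \<mu> \<iota>) H \<and>
    BO D (\<lambda>\<iota>. P \<iota> * \<rho> \<iota> ^ r) (\<lambda>\<iota> x. pd i G \<iota> x - g \<iota> x * osc k \<theta> \<iota> x) \<and>
    BO D (\<lambda>\<iota>. P \<iota> * \<rho> \<iota> ^ r) (\<lambda>\<iota> x. pd i H \<iota> x - pd j G \<iota> x)"
proof (induction r arbitrary: P g \<theta>)
  case 0
  \<comment> \<open>With no integration by parts left, both primitives are 0 and the whole product
    counts as error.\<close>
  have z: "SC D mix (Suc m) Q (\<lambda>_ _. 0)" if "\<And>\<iota> x. (\<iota>, x) \<in> D \<Longrightarrow> 0 \<le> Q \<iota>" for Q
    using SC_const[OF odom, of mix "\<lambda>_. 0" Q] that mix_nonneg by auto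
  have P: "0 \<le> P \<iota>" if "(\<iota>, x) \<in> D" for \<iota> x by (rule SC_nonneg[OF 0 that])
  have "BO D (\<lambda>\<iota>. P \<iota> * 1) (\<lambda>\<iota> x. - (g \<iota> x * osc k \<theta> \<iota> x))"
    by (intro BO_minus BO_mult SC_BO[OF 0] SC_BO[OF SC_osc])
  then show ?case
    by (intro exI[of _ "\<lambda>_ _. 0"] conjI z)
       (auto simp: P \<mu> \<rho> less_imp_le intro!: BO_fun mult_nonneg_nonneg divide_nonneg_nonneg P less_imp_le[OF \<mu>] \<rho>)
next
  case (Suc r)
  define c where "c = (\<lambda>\<iota>. 1 / (k * \<mu> \<iota>))"
  have kc: "c \<iota> * (k * \<mu> \<iota>) = 1" if "(\<iota>, x) \<in> D" for \<iota> x using \<mu>[OF that] assms by (simp add: c_def)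
  let ?\<theta> = "\<theta> - pi/2"
  have S: "SC D slow (Suc (Suc m + r)) P g" using Suc(2) by simp
  obtain G1 H1 where 1: "SC D mix (Suc m) (\<lambda>\<iota>. P \<iota> * slow i \<iota> / \<mu> \<iota>) G1"
    "SC D mix (Suc m) (\<lambda>\<iota>. P \<iota> * slow i \<iota> * \<rho> \<iota> / \<mu> \<iota>) H1"
    "BO D (\<lambda>\<iota>. P \<iota> * slow i \<iota> * \<rho> \<iota> ^ r) (\<lambda>\<iota> x. pd i G1 \<iota> x - pd i g \<iota> x * osc k ?\<theta> \<iota> x)"
    "BO D (\<lambda>\<iota>. P \<iota> * slow i \<iota> * \<rho> \<iota> ^ r) (\<lambda>\<iota> x. pd i H1 \<iota> x - pd j G1 \<iota> x)"
    using Suc.IH[OF SC_pd[OF S]] by blast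
  obtain G2 where 2: "SC D mix (Suc m) (\<lambda>\<iota>. P \<iota> * slow j \<iota> / \<mu> \<iota>) G2"
    "BO D (\<lambda>\<iota>. P \<iota> * slow j \<iota> * \<rho> \<iota> ^ r) (\<lambda>\<iota> x. pd i G2 \<iota> x - pd j g \<iota> x * osc k ?\<theta> \<iota> x)"
    using Suc.IH[OF SC_pd[OF S]] by blast
  \<comment> \<open>Up to the factor \<open>c\<close>, the \<open>j\<close>-derivative of
    \<open>G\<close> is the \<open>j\<close>-derivative of \<open>g\<close> times the shifted
    oscillation, minus the \<open>j\<close>-derivative of \<open>G1\<close>. \<open>G2\<close> and
    \<open>H1\<close> are primitives of these two terms, and \<open>H\<close> combines them.\<close>
  define G where "G = (\<lambda>\<iota> x. c \<iota> * (g \<iota> x * osc k ?\<theta> \<iota> x) - c \<iota> * G1 \<iota> x)"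
  define H where "H = (\<lambda>\<iota> x. c \<iota> * G2 \<iota> x - c \<iota> * H1 \<iota> x)"
  have P: "0 \<le> P \<iota>" if "(\<iota>, x) \<in> D" for \<iota> x by (rule SC_nonneg[OF S that])
  have w: "SC D mix n Q (\<lambda>\<iota> x. c \<iota> * f \<iota> x)"
    if "SC D mix n R f" "\<And>\<iota> x. (\<iota>, x) \<in> D \<Longrightarrow> R \<iota> \<le> Q \<iota> * \<mu> \<iota>" for R Q f n
  proof (rule SC_wmono[OF SC_cmult[OF that(1), where c="c"], of "1/k"])
    fix \<iota> x assume a: "(\<iota>, x) \<in> D"
    show "\<bar>c \<iota>\<bar> * R \<iota> \<le> 1 / k * Q \<iota>"
      using that(2)[OF a] \<mu>[OF a] assms by (simp add: c_def field_simps)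
  qed (use assms mix_nonneg in auto)
  have w': "BO D Q (\<lambda>\<iota> x. c \<iota> * f \<iota> x)"
    if "BO D R f" "\<And>\<iota> x. (\<iota>, x) \<in> D \<Longrightarrow> R \<iota> \<le> Q \<iota> * \<mu> \<iota>" for R Q f
  proof (rule BO_mono[OF BO_cmult[OF that(1), where c="c"], of "1/k"])
    fix \<iota> x assume a: "(\<iota>, x) \<in> D"
    show "\<bar>c \<iota>\<bar> * R \<iota> \<le> 1 / k * Q \<iota>"
      using that(2)[OF a] \<mu>[OF a] assms by (simp add: c_def field_simps)
  qed (use assms in auto)
  have le: "P \<iota> * slow q \<iota> \<le> P \<iota> * \<mu> \<iota>" if "(\<iota>, x) \<in> D" for q \<iota> x
    using P[OF that] \<rho>\<mu>_le[OF that] by (simp add: slow_def mult_left_mono)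
  have gm: "SC D mix (Suc m) P g" by (rule slow_mix[OF SC_order[OF S]]) simp
  have "SC D mix (Suc m) (\<lambda>\<iota>. P \<iota> / \<mu> \<iota>) G"
    unfolding G_def
  proof (intro SC_sub w[OF SC_mult[OF gm SC_osc]] w[OF 1(1)])
    fix \<iota> x assume a: "(\<iota>, x) \<in> D"
    show "P \<iota> * 1 \<le> P \<iota> / \<mu> \<iota> * \<mu> \<iota>" using \<mu>[OF a] by simp
    show "P \<iota> * slow i \<iota> / \<mu> \<iota> \<le> P \<iota> / \<mu> \<iota> * \<mu> \<iota>" using le[OF a, of i] \<mu>[OF a] by (simp add: field_simps)
  qed
  moreover have "SC D mix (Suc m) (\<lambda>\<iota>. P \<iota> * \<rho> \<iota> / \<mu> \<iota>) H"
    unfolding H_def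
  proof (intro SC_sub w[OF 2(1)] w[OF 1(2)])
    fix \<iota> x assume a: "(\<iota>, x) \<in> D"
    show "P \<iota> * slow j \<iota> / \<mu> \<iota> \<le> P \<iota> * \<rho> \<iota> / \<mu> \<iota> * \<mu> \<iota>" using \<mu>[OF a] by (simp add: slow_def)
    show "P \<iota> * slow i \<iota> * \<rho> \<iota> / \<mu> \<iota> \<le> P \<iota> * \<rho> \<iota> / \<mu> \<iota> * \<mu> \<iota>"
      using mult_right_mono[OF le[OF a, of i] \<rho>(1)[OF a]] \<mu>[OF a] by (simp add: field_simps)
  qed
  moreover have d: "g \<iota> differentiable (at x)" "G1 \<iota> differentiable (at x)" "G2 \<iota> differentiable (at x)" "H1 \<iota> differentiable (at x)"
    if "(\<iota>, x) \<in> D" for \<iota> x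
    using SC_diff[OF _ that] S 1 2 by blast+
  moreover have "BO D (\<lambda>\<iota>. P \<iota> * \<rho> \<iota> ^ Suc r) (\<lambda>\<iota> x. pd i G \<iota> x - g \<iota> x * osc k \<theta> \<iota> x)"
  proof (rule BO_cong[OF BO_minus[OF w'[OF 1(3)]]])
    fix \<iota> x assume a: "(\<iota>, x) \<in> D"
    have "pd i G \<iota> x = c \<iota> * (g \<iota> x * (k * \<mu> \<iota> * osc k \<theta> \<iota> x) + pd i g \<iota> x * osc k ?\<theta> \<iota> x) - c \<iota> * pd i G1 \<iota> x"
      unfolding G_def using d[OF a] by (simp add: pds difs pd_osc)
    also have "\<dots> = (c \<iota> * (k * \<mu> \<iota>)) * (g \<iota> x * osc k \<theta> \<iota> x) - c \<iota> * (pd i G1 \<iota> x - pd i g \<iota> x * osc k ?\<theta> \<iota> x)"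
      by (simp only: algebra_simps)
    finally show "pd i G \<iota> x - g \<iota> x * osc k \<theta> \<iota> x = - (c \<iota> * (pd i G1 \<iota> x - pd i g \<iota> x * osc k ?\<theta> \<iota> x))"
      unfolding kc[OF a] by simp
  qed (simp add: slow_def)
  moreover have "BO D (\<lambda>\<iota>. P \<iota> * \<rho> \<iota> ^ Suc r) (\<lambda>\<iota> x. pd i H \<iota> x - pd j G \<iota> x)"
  proof (rule BO_cong[OF BO_diff[OF w'[OF 2(2)] w'[OF 1(4)]]])
    fix \<iota> x assume a: "(\<iota>, x) \<in> D"
    show "pd i H \<iota> x - pd j G \<iota> x = c \<iota> * (pd i G2 \<iota> x - pd j g \<iota> x * osc k ?\<theta> \<iota> x) - c \<iota> * (pd i H1 \<iota> x - pd j G1 \<iota> x)"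
      unfolding G_def H_def using d[OF a] by (simp add: pds difs pd_osc algebra_simps)
  qed (simp_all add: slow_def)
  ultimately show ?case by blast
qed

definition im :: "'i \<Rightarrow> real" where "im = (\<lambda>\<iota>. 1 / \<mu> \<iota>)"

lemma im_\<mu>: "(\<iota>, x) \<in> D \<Longrightarrow> im \<iota> * \<mu> \<iota> = 1" and im_pos: "(\<iota>, x) \<in> D \<Longrightarrow> 0 < im \<iota>"
  using \<mu>[of \<iota> x] by (simp_all add: im_def)

lemma slow_w: "SC D slow m P f \<Longrightarrow> (\<And>\<iota> x. (\<iota>, x) \<in> D \<Longrightarrow> P \<iota> \<le> Q \<iota>) \<Longrightarrow> SC D slow m Q f"
  by (rule SC_wmono[where c=1]) (auto simp: slow_nonneg)

lemma mix_w: "SC D mix m P f \<Longrightarrow> (\<And>\<iota> x. (\<iota>, x) \<in> D \<Longrightarrow> P \<iota> \<le> Q \<iota>) \<Longrightarrow> SC D mix m Q f"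
  by (rule SC_wmono[where c=1]) (auto simp: mix_nonneg)

lemma SC_im: "SC D \<nu> m P f \<Longrightarrow> SC D \<nu> m (\<lambda>\<iota>. im \<iota> * P \<iota>) (\<lambda>\<iota> x. im \<iota> * f \<iota> x)"
  by (rule SC_weight[OF SC_cmult[where c=im]]) (auto simp: abs_of_pos[OF im_pos])

abbreviation "sn k \<equiv> osc k (0 - pi/2)"
abbreviation "cs k \<equiv> osc k 0"

text \<open>The factor 2 normalises the mean of half the square of the fast derivative to a^2. The
  function itself is of size a / \<mu>.\<close>

definition ripple :: "'i fld \<Rightarrow> 'i fld" where
  "ripple a = (\<lambda>\<iota> x. 2 * (im \<iota> * (a \<iota> x * sn 1 \<iota> x)))"

lemma SC_ripple: "SC D slow m p a \<Longrightarrow> SC D mix m (\<lambda>\<iota>. im \<iota> * p \<iota>) (ripple a)"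
  unfolding ripple_def
  by (rule SC_scale[OF SC_weight[OF SC_im[OF SC_mult[OF slow_mix SC_osc]]]]) (auto simp: mix_nonneg)

lemma trig_osc:
  "sn 1 \<iota> x * sn 1 \<iota> x = (1 - cs 2 \<iota> x) / 2"
  "cs 1 \<iota> x * cs 1 \<iota> x = (1 + cs 2 \<iota> x) / 2"
  "sn 1 \<iota> x * cs 1 \<iota> x = sn 2 \<iota> x / 2"
proof -
  define y where "y = \<mu> \<iota> * x $ i"
  have e: "sn 1 \<iota> x = sin y" "cs 1 \<iota> x = cos y" "sn 2 \<iota> x = sin (2 * y)" "cs 2 \<iota> x = cos (2 * y)"
    by (simp_all add: osc_def y_def cos_diff mult.assoc)
  show "sn 1 \<iota> x * sn 1 \<iota> x = (1 - cs 2 \<iota> x) / 2" "sn 1 \<iota> x * cs 1 \<iota> x = sn 2 \<iota> x / 2"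
    "cs 1 \<iota> x * cs 1 \<iota> x = (1 + cs 2 \<iota> x) / 2"
    unfolding e using cos_double_sin[of y] cos_double_cos[of y] sin_double[of y] by (simp_all add: power2_eq_square)
qed

lemma pd_ripple:
  assumes "(\<iota>, x) \<in> D" "a \<iota> differentiable (at x)"
  shows "pd i (ripple a) \<iota> x = 2 * (im \<iota> * (pd i a \<iota> x * sn 1 \<iota> x)) + 2 * (a \<iota> x * cs 1 \<iota> x)"
    and "pd j (ripple a) \<iota> x = 2 * (im \<iota> * (pd j a \<iota> x * sn 1 \<iota> x))"
proof -
  have "pd i (ripple a) \<iota> x = 2 * (im \<iota> * (a \<iota> x * (1 * \<mu> \<iota> * cs 1 \<iota> x) + pd i a \<iota> x * sn 1 \<iota> x))"
    unfolding ripple_def using assms(2) by (simp add: pds difs pd_osc del: diff_0)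
  also have "\<dots> = 2 * (im \<iota> * (pd i a \<iota> x * sn 1 \<iota> x)) + (im \<iota> * \<mu> \<iota>) * (2 * (a \<iota> x * cs 1 \<iota> x))"
    by (simp only: algebra_simps)
  finally show "pd i (ripple a) \<iota> x = 2 * (im \<iota> * (pd i a \<iota> x * sn 1 \<iota> x)) + 2 * (a \<iota> x * cs 1 \<iota> x)"
    unfolding im_\<mu>[OF assms(1)] by simp
  show "pd j (ripple a) \<iota> x = 2 * (im \<iota> * (pd j a \<iota> x * sn 1 \<iota> x))"
    unfolding ripple_def using assms(2) by (simp add: pds difs pd_osc del: diff_0)
qed

text \<open>\<open>Bii\<close>, \<open>Bij\<close>, \<open>Bjj\<close> stand for second derivatives
  of the component receiving the ripple; the products with them are what remains of the mixed terms
  of the quadratic part. In \<open>ii\<close> and \<open>ij\<close> every oscillating term fits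
  \<open>oscillatory_primitive\<close>, while the non-oscillating means are left to the amplitude
  equation. The line for \<open>ij\<close> states twice the entry.\<close>

lemma corrugate:
  assumes a: "SC D slow (Suc (Suc m + r)) p a"
    and Bii: "SC D slow (Suc m + r) (\<lambda>\<iota>. p \<iota> * \<mu> \<iota>) Bii"
    and Bij: "SC D slow (Suc m + r) (\<lambda>\<iota>. p \<iota> * \<mu> \<iota> * \<rho> \<iota>) Bij"
    and Bjj: "SC D slow (Suc m + r) (\<lambda>\<iota>. p \<iota> * \<mu> \<iota> * (\<rho> \<iota>)\<^sup>2) Bjj"
  shows "\<exists>U. (\<forall>q. SC D mix (Suc m) (\<lambda>\<iota>. im \<iota> * (p \<iota>)\<^sup>2) (U q)) \<and>
    BO D (\<lambda>\<iota>. (p \<iota>)\<^sup>2 * \<rho> \<iota> ^ r) (\<lambda>\<iota> x. (1/2) * (pd i (ripple a) \<iota> x)\<^sup>2 - ripple a \<iota> x * Bii \<iota> x + pd i (U i) \<iota> x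
       - ((a \<iota> x)\<^sup>2 + (im \<iota>)\<^sup>2 * (pd i a \<iota> x)\<^sup>2)) \<and>
    BO D (\<lambda>\<iota>. (p \<iota>)\<^sup>2 * \<rho> \<iota> ^ r) (\<lambda>\<iota> x. pd i (ripple a) \<iota> x * pd j (ripple a) \<iota> x - ripple a \<iota> x * Bij \<iota> x
       + pd i (U j) \<iota> x + pd j (U i) \<iota> x - 2 * (im \<iota>)\<^sup>2 * (pd i a \<iota> x * pd j a \<iota> x)) \<and>
    SC D (\<lambda>_. \<mu>) m (\<lambda>\<iota>. (p \<iota>)\<^sup>2 * (\<rho> \<iota>)\<^sup>2)
      (\<lambda>\<iota> x. (1/2) * (pd j (ripple a) \<iota> x)\<^sup>2 - ripple a \<iota> x * Bjj \<iota> x + pd j (U j) \<iota> x)"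
proof -
  have sn: "\<And>k \<iota> x. (\<iota>, x) \<in> D \<Longrightarrow> 0 \<le> slow k \<iota>" by (rule slow_nonneg)
  have mn: "\<And>k \<iota> x. (\<iota>, x) \<in> D \<Longrightarrow> 0 \<le> mix k \<iota>" by (rule mix_nonneg)
  have a0: "SC D slow (Suc m + r) p a" by (rule SC_SucD[OF a])
  have aq: "SC D slow (Suc m + r) (\<lambda>\<iota>. p \<iota> * (\<rho> \<iota> * \<mu> \<iota>)) (pd q a)" for q
    using SC_pd[OF a, of q] by (simp add: slow_def)
  note ai = aq[of i] and aj = aq[of j]
  have ad: "a \<iota> differentiable (at x)" if "(\<iota>, x) \<in> D" for \<iota> x by (rule SC_diff[OF a that])
  have \<rho>2: "(\<rho> \<iota>)\<^sup>2 \<le> \<rho> \<iota>" if "(\<iota>, x) \<in> D" for \<iota> x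
    using \<rho>(1)[OF that] \<rho>(2)[OF that] by (simp add: power2_eq_square mult_left_le)
  have pp: "0 \<le> (p \<iota>)\<^sup>2 * \<rho> \<iota>" if "(\<iota>, x) \<in> D" for \<iota> x using \<rho>(1)[OF that] by simp
  have \<rho>le: "(p \<iota>)\<^sup>2 * (\<rho> \<iota>)\<^sup>2 \<le> (p \<iota>)\<^sup>2" "(p \<iota>)\<^sup>2 * \<rho> \<iota> \<le> (p \<iota>)\<^sup>2" "(p \<iota>)\<^sup>2 * (\<rho> \<iota>)\<^sup>2 \<le> (p \<iota>)\<^sup>2 * \<rho> \<iota>"
    if "(\<iota>, x) \<in> D" for \<iota> x
    using \<rho>2[OF that] \<rho>[OF that] by (auto intro!: mult_left_le mult_left_mono order_trans[OF \<rho>2[OF that]])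
  have im1: "im \<iota> * (p \<iota> * (p \<iota> * (\<rho> \<iota> * \<mu> \<iota>))) = (p \<iota>)\<^sup>2 * \<rho> \<iota>" if "(\<iota>, x) \<in> D" for \<iota> x
  proof -
    have "im \<iota> * (p \<iota> * (p \<iota> * (\<rho> \<iota> * \<mu> \<iota>))) = (im \<iota> * \<mu> \<iota>) * ((p \<iota>)\<^sup>2 * \<rho> \<iota>)"
      by (simp add: power2_eq_square algebra_simps)
    then show ?thesis by (simp add: im_\<mu>[OF that])
  qed
  have im2: "im \<iota> * (im \<iota> * (p \<iota> * (\<rho> \<iota> * \<mu> \<iota>) * (p \<iota> * (\<rho> \<iota> * \<mu> \<iota>)))) = (p \<iota>)\<^sup>2 * (\<rho> \<iota>)\<^sup>2" if "(\<iota>, x) \<in> D" for \<iota> x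
  proof -
    have "im \<iota> * (im \<iota> * (p \<iota> * (\<rho> \<iota> * \<mu> \<iota>) * (p \<iota> * (\<rho> \<iota> * \<mu> \<iota>)))) = (im \<iota> * \<mu> \<iota>) * (im \<iota> * \<mu> \<iota>) * ((p \<iota>)\<^sup>2 * (\<rho> \<iota>)\<^sup>2)"
      by (simp add: power2_eq_square algebra_simps)
    then show ?thesis by (simp add: im_\<mu>[OF that])
  qed
  have im3: "im \<iota> * (p \<iota> * (p \<iota> * \<mu> \<iota> * z)) = (p \<iota>)\<^sup>2 * z" if "(\<iota>, x) \<in> D" for \<iota> x z
  proof -
    have "im \<iota> * (p \<iota> * (p \<iota> * \<mu> \<iota> * z)) = (im \<iota> * \<mu> \<iota>) * ((p \<iota>)\<^sup>2 * z)"
      by (simp add: power2_eq_square algebra_simps)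
    then show ?thesis by (simp add: im_\<mu>[OF that])
  qed
  \<comment> \<open>Coefficients from the double-angle formulas, with reversed sign so that their
    primitives cancel the oscillations: \<open>g1\<close>, \<open>g2\<close>, \<open>g3\<close>
    belong to the entry \<open>ii\<close>, the others to \<open>ij\<close>.\<close>
  define g1 where "g1 = (\<lambda>\<iota> x. im \<iota> * (im \<iota> * (pd i a \<iota> x * pd i a \<iota> x)) - a \<iota> x * a \<iota> x)"
  define g2 where "g2 = (\<lambda>\<iota> x. (-2) * (im \<iota> * (a \<iota> x * pd i a \<iota> x)))"
  define g3 where "g3 = (\<lambda>\<iota> x. 2 * (im \<iota> * (a \<iota> x * Bii \<iota> x)))"
  define g4 where "g4 = (\<lambda>\<iota> x. 2 * (im \<iota> * (im \<iota> * (pd i a \<iota> x * pd j a \<iota> x))))"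
  define g5 where "g5 = (\<lambda>\<iota> x. (-2) * (im \<iota> * (a \<iota> x * pd j a \<iota> x)))"
  define g6 where "g6 = (\<lambda>\<iota> x. 2 * (im \<iota> * (a \<iota> x * Bij \<iota> x)))"
  let ?P = "\<lambda>\<iota>. (p \<iota>)\<^sup>2" let ?Q = "\<lambda>\<iota>. (p \<iota>)\<^sup>2 * \<rho> \<iota>"
  have G1: "SC D slow (Suc m + r) ?P g1" unfolding g1_def
    by (intro SC_sub slow_w[OF SC_im[OF SC_im[OF SC_mult[OF ai ai]]]] slow_w[OF SC_mult[OF a0 a0]])
       (simp add: im2 \<rho>le, simp add: power2_eq_square)
  have G2: "SC D slow (Suc m + r) ?P g2" unfolding g2_def
    by (intro SC_scale sn slow_w[OF SC_im[OF SC_mult[OF a0 ai]]]) (simp add: im1 \<rho>le)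
  have G3: "SC D slow (Suc m + r) ?P g3" unfolding g3_def
    by (intro SC_scale sn slow_w[OF SC_im[OF SC_mult[OF a0 Bii]]]) (use im3[where z=1] in simp)
  have G4: "SC D slow (Suc m + r) ?Q g4" unfolding g4_def
    by (intro SC_scale sn slow_w[OF SC_im[OF SC_im[OF SC_mult[OF ai aj]]]]) (simp add: im2 \<rho>le)
  have G5: "SC D slow (Suc m + r) ?Q g5" unfolding g5_def
    by (intro SC_scale sn slow_w[OF SC_im[OF SC_mult[OF a0 aj]]]) (simp add: im1)
  have G6: "SC D slow (Suc m + r) ?Q g6" unfolding g6_def
    by (intro SC_scale sn slow_w[OF SC_im[OF SC_mult[OF a0 Bij]]]) (simp add: im3)
  have mono: "SC D mix (Suc m) Q G" if "SC D mix (Suc m) (\<lambda>\<iota>. P \<iota> / \<mu> \<iota>) G" "\<And>\<iota> x. (\<iota>, x) \<in> D \<Longrightarrow> P \<iota> \<le> R \<iota>"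
    "Q = (\<lambda>\<iota>. im \<iota> * R \<iota>)" for P Q R G
    unfolding that(3)
    by (rule mix_w[OF that(1)]) (use that(2) \<mu> in \<open>auto simp: im_def divide_right_mono less_imp_le\<close>)
  have ex: "\<exists>G H. SC D mix (Suc m) (\<lambda>\<iota>. im \<iota> * P \<iota>) G \<and> SC D mix (Suc m) (\<lambda>\<iota>. im \<iota> * (P \<iota> * \<rho> \<iota>)) H \<and>
      BO D (\<lambda>\<iota>. (p \<iota>)\<^sup>2 * \<rho> \<iota> ^ r) (\<lambda>\<iota> x. pd i G \<iota> x - g \<iota> x * osc k \<theta> \<iota> x) \<and>
      BO D (\<lambda>\<iota>. (p \<iota>)\<^sup>2 * \<rho> \<iota> ^ r) (\<lambda>\<iota> x. pd i H \<iota> x - pd j G \<iota> x)"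
    if "SC D slow (Suc m + r) P g" "k > 0" "\<forall>\<iota> x. (\<iota>, x) \<in> D \<longrightarrow> P \<iota> \<le> (p \<iota>)\<^sup>2" for P g k \<theta>
  proof -
    have w: "BO D (\<lambda>\<iota>. (p \<iota>)\<^sup>2 * \<rho> \<iota> ^ r) f" if "BO D (\<lambda>\<iota>. P \<iota> * \<rho> \<iota> ^ r) f" for f
      by (rule BO_mono[OF that, of 1]) (use \<open>\<forall>\<iota> x. (\<iota>, x) \<in> D \<longrightarrow> P \<iota> \<le> (p \<iota>)\<^sup>2\<close> \<rho>(1) in \<open>auto intro!: mult_right_mono\<close>)
    show ?thesis
      using oscillatory_primitive[OF that(2,1), of \<theta>] w by (auto simp: im_def)
  qed
  have leP: "\<forall>\<iota> x. (\<iota>, x) \<in> D \<longrightarrow> ?P \<iota> \<le> (p \<iota>)\<^sup>2" and leQ: "\<forall>\<iota> x. (\<iota>, x) \<in> D \<longrightarrow> ?Q \<iota> \<le> (p \<iota>)\<^sup>2"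
    using \<rho>le by auto
  obtain A1 H1 where 1: "SC D mix (Suc m) (\<lambda>\<iota>. im \<iota> * ?P \<iota>) A1" "SC D mix (Suc m) (\<lambda>\<iota>. im \<iota> * (?P \<iota> * \<rho> \<iota>)) H1"
    "BO D (\<lambda>\<iota>. (p \<iota>)\<^sup>2 * \<rho> \<iota> ^ r) (\<lambda>\<iota> x. pd i A1 \<iota> x - g1 \<iota> x * cs 2 \<iota> x)"
    "BO D (\<lambda>\<iota>. (p \<iota>)\<^sup>2 * \<rho> \<iota> ^ r) (\<lambda>\<iota> x. pd i H1 \<iota> x - pd j A1 \<iota> x)"
    using ex[OF G1 _ leP, where k=2 and \<theta>=0] by (auto simp del: diff_0)
  obtain A2 H2 where 2: "SC D mix (Suc m) (\<lambda>\<iota>. im \<iota> * ?P \<iota>) A2" "SC D mix (Suc m) (\<lambda>\<iota>. im \<iota> * (?P \<iota> * \<rho> \<iota>)) H2"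
    "BO D (\<lambda>\<iota>. (p \<iota>)\<^sup>2 * \<rho> \<iota> ^ r) (\<lambda>\<iota> x. pd i A2 \<iota> x - g2 \<iota> x * sn 2 \<iota> x)"
    "BO D (\<lambda>\<iota>. (p \<iota>)\<^sup>2 * \<rho> \<iota> ^ r) (\<lambda>\<iota> x. pd i H2 \<iota> x - pd j A2 \<iota> x)"
    using ex[OF G2 _ leP, where k=2 and \<theta>="0 - pi/2"] by (auto simp del: diff_0)
  obtain A3 H3 where 3: "SC D mix (Suc m) (\<lambda>\<iota>. im \<iota> * ?P \<iota>) A3" "SC D mix (Suc m) (\<lambda>\<iota>. im \<iota> * (?P \<iota> * \<rho> \<iota>)) H3"
    "BO D (\<lambda>\<iota>. (p \<iota>)\<^sup>2 * \<rho> \<iota> ^ r) (\<lambda>\<iota> x. pd i A3 \<iota> x - g3 \<iota> x * sn 1 \<iota> x)"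
    "BO D (\<lambda>\<iota>. (p \<iota>)\<^sup>2 * \<rho> \<iota> ^ r) (\<lambda>\<iota> x. pd i H3 \<iota> x - pd j A3 \<iota> x)"
    using ex[OF G3 _ leP, where k=1 and \<theta>="0 - pi/2"] by (auto simp del: diff_0)
  obtain A4 where 4: "SC D mix (Suc m) (\<lambda>\<iota>. im \<iota> * ?Q \<iota>) A4"
    "BO D (\<lambda>\<iota>. (p \<iota>)\<^sup>2 * \<rho> \<iota> ^ r) (\<lambda>\<iota> x. pd i A4 \<iota> x - g4 \<iota> x * cs 2 \<iota> x)"
    using ex[OF G4 _ leQ, where k=2 and \<theta>=0] by (auto simp del: diff_0)
  obtain A5 where 5: "SC D mix (Suc m) (\<lambda>\<iota>. im \<iota> * ?Q \<iota>) A5"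
    "BO D (\<lambda>\<iota>. (p \<iota>)\<^sup>2 * \<rho> \<iota> ^ r) (\<lambda>\<iota> x. pd i A5 \<iota> x - g5 \<iota> x * sn 2 \<iota> x)"
    using ex[OF G5 _ leQ, where k=2 and \<theta>="0 - pi/2"] by (auto simp del: diff_0)
  obtain A6 where 6: "SC D mix (Suc m) (\<lambda>\<iota>. im \<iota> * ?Q \<iota>) A6"
    "BO D (\<lambda>\<iota>. (p \<iota>)\<^sup>2 * \<rho> \<iota> ^ r) (\<lambda>\<iota> x. pd i A6 \<iota> x - g6 \<iota> x * sn 1 \<iota> x)"
    using ex[OF G6 _ leQ, where k=1 and \<theta>="0 - pi/2"] by (auto simp del: diff_0)
  define Ui where "Ui = (\<lambda>\<iota> x. A1 \<iota> x + A2 \<iota> x + A3 \<iota> x)"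
  \<comment> \<open>\<open>A4\<close>, \<open>A5\<close>, \<open>A6\<close> remove the oscillations
    of the entry \<open>ij\<close>; \<open>H1\<close>, \<open>H2\<close>, \<open>H3\<close> undo
    what \<open>Ui\<close> contributes to that entry through its
    \<open>j\<close>-derivative.\<close>
  define Uj where "Uj = (\<lambda>\<iota> x. A4 \<iota> x + A5 \<iota> x + A6 \<iota> x - (H1 \<iota> x + H2 \<iota> x + H3 \<iota> x))"
  define U where "U = (\<lambda>q. if q = i then Ui else Uj)"
  have U: "U i = Ui" "U j = Uj" using ij by (auto simp: U_def)
  have sUi: "SC D mix (Suc m) (\<lambda>\<iota>. im \<iota> * ?P \<iota>) Ui"
    unfolding Ui_def by (intro SC_add 1 2 3)
  have sUj: "SC D mix (Suc m) (\<lambda>\<iota>. im \<iota> * ?Q \<iota>) Uj"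
    unfolding Uj_def by (intro SC_add SC_sub 1 2 3 4 5 6)
  have sU: "\<forall>q. SC D mix (Suc m) (\<lambda>\<iota>. im \<iota> * ?P \<iota>) (U q)"
    using sUi mix_w[OF sUj, of "\<lambda>\<iota>. im \<iota> * ?P \<iota>"] \<rho>le(2) im_pos
    by (auto simp: U_def intro!: mult_left_mono less_imp_le)
  note d = SC_diff[OF 1(1)] SC_diff[OF 1(2)] SC_diff[OF 2(1)] SC_diff[OF 2(2)] SC_diff[OF 3(1)] SC_diff[OF 3(2)]
    SC_diff[OF 4(1)] SC_diff[OF 5(1)] SC_diff[OF 6(1)]
  have b1: "BO D (\<lambda>\<iota>. (p \<iota>)\<^sup>2 * \<rho> \<iota> ^ r) (\<lambda>\<iota> x. (1/2) * (pd i (ripple a) \<iota> x)\<^sup>2 - ripple a \<iota> x * Bii \<iota> x + pd i (U i) \<iota> x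
       - ((a \<iota> x)\<^sup>2 + (im \<iota>)\<^sup>2 * (pd i a \<iota> x)\<^sup>2))"
  proof (rule BO_cong[OF BO_add[OF BO_add[OF 1(3) 2(3)] 3(3)]])
    fix \<iota> x assume D: "(\<iota>, x) \<in> D"
    define s1 c1 s2 c2 A A' B where "s1 = sn 1 \<iota> x" and "c1 = cs 1 \<iota> x" and "s2 = sn 2 \<iota> x" and "c2 = cs 2 \<iota> x"
      and "A = a \<iota> x" and "A' = im \<iota> * pd i a \<iota> x" and "B = im \<iota> * (A * Bii \<iota> x)"
    note t = trig_osc[of \<iota> x, folded s1_def c1_def s2_def c2_def]
    have t': "c2 = 1 - 2 * (s1 * s1)" "c1 * c1 = 1 - s1 * s1" "s2 = 2 * (s1 * c1)" using t by simp_all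
    have e1: "pd i (ripple a) \<iota> x = 2 * A' * s1 + 2 * A * c1"
      unfolding pd_ripple[where a=a, OF D ad[OF D]] s1_def c1_def A_def A'_def by simp
    have e2: "ripple a \<iota> x * Bii \<iota> x = 2 * B * s1" unfolding ripple_def s1_def B_def A_def by simp
    have e3: "g1 \<iota> x = A' * A' - A * A" "g2 \<iota> x = - 2 * (A * A')" "g3 \<iota> x = 2 * B"
      unfolding g1_def g2_def g3_def A_def A'_def B_def by simp_all
    have e4: "(a \<iota> x)\<^sup>2 + (im \<iota>)\<^sup>2 * (pd i a \<iota> x)\<^sup>2 = A * A + A' * A'"
      unfolding A_def A'_def by (simp add: power2_eq_square)
    have "1/2 * (2 * A' * s1 + 2 * A * c1)\<^sup>2 = 2 * (A' * A') * (s1 * s1) + 4 * (A * A') * (s1 * c1) + 2 * (A * A) * (c1 * c1)"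
      by (simp add: power2_eq_square algebra_simps)
    then have e5: "1/2 * (2 * A' * s1 + 2 * A * c1)\<^sup>2 - (A * A + A' * A') = - (A' * A' - A * A) * c2 + 2 * (A * A') * s2"
      unfolding t' by (simp add: algebra_simps)
    have e6: "pd i (U i) \<iota> x = pd i A1 \<iota> x + pd i A2 \<iota> x + pd i A3 \<iota> x"
      unfolding U Ui_def using d[OF D] by (simp add: pds difs)
    show "(1/2) * (pd i (ripple a) \<iota> x)\<^sup>2 - ripple a \<iota> x * Bii \<iota> x + pd i (U i) \<iota> x - ((a \<iota> x)\<^sup>2 + (im \<iota>)\<^sup>2 * (pd i a \<iota> x)\<^sup>2)
      = (pd i A1 \<iota> x - g1 \<iota> x * cs 2 \<iota> x) + (pd i A2 \<iota> x - g2 \<iota> x * sn 2 \<iota> x) + (pd i A3 \<iota> x - g3 \<iota> x * sn 1 \<iota> x)"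
      unfolding e1 e2 e3 e4 e6 s1_def[symmetric] s2_def[symmetric] c2_def[symmetric] using e5 by (simp add: algebra_simps)
  qed
  have b2: "BO D (\<lambda>\<iota>. (p \<iota>)\<^sup>2 * \<rho> \<iota> ^ r) (\<lambda>\<iota> x. pd i (ripple a) \<iota> x * pd j (ripple a) \<iota> x - ripple a \<iota> x * Bij \<iota> x
       + pd i (U j) \<iota> x + pd j (U i) \<iota> x - 2 * (im \<iota>)\<^sup>2 * (pd i a \<iota> x * pd j a \<iota> x))"
  proof (rule BO_cong[OF BO_diff[OF BO_add[OF BO_add[OF 4(2) 5(2)] 6(2)] BO_add[OF BO_add[OF 1(4) 2(4)] 3(4)]]])
    fix \<iota> x assume D: "(\<iota>, x) \<in> D"
    define s1 c1 s2 c2 A A' A'' B where "s1 = sn 1 \<iota> x" and "c1 = cs 1 \<iota> x" and "s2 = sn 2 \<iota> x" and "c2 = cs 2 \<iota> x"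
      and "A = a \<iota> x" and "A' = im \<iota> * pd i a \<iota> x" and "A'' = im \<iota> * pd j a \<iota> x" and "B = im \<iota> * (A * Bij \<iota> x)"
    note t = trig_osc[of \<iota> x, folded s1_def c1_def s2_def c2_def]
    have t': "c2 = 1 - 2 * (s1 * s1)" "s2 = 2 * (s1 * c1)" using t by simp_all
    have e1: "pd i (ripple a) \<iota> x = 2 * A' * s1 + 2 * A * c1" "pd j (ripple a) \<iota> x = 2 * A'' * s1"
      unfolding pd_ripple[where a=a, OF D ad[OF D]] s1_def c1_def A_def A'_def A''_def by simp_all
    have e2: "ripple a \<iota> x * Bij \<iota> x = 2 * B * s1" unfolding ripple_def s1_def B_def A_def by simp
    have e3: "g4 \<iota> x = 2 * (A' * A'')" "g5 \<iota> x = - 2 * (A * A'')" "g6 \<iota> x = 2 * B"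
      unfolding g4_def g5_def g6_def A_def A'_def A''_def B_def by simp_all
    have e4: "2 * (im \<iota>)\<^sup>2 * (pd i a \<iota> x * pd j a \<iota> x) = 2 * (A' * A'')"
      unfolding A''_def A'_def by (simp add: power2_eq_square)
    have e5: "(2 * A' * s1 + 2 * A * c1) * (2 * A'' * s1) - 2 * (A' * A'') = - (2 * (A' * A'')) * c2 + 2 * (A * A'') * s2"
      unfolding t' by (simp add: algebra_simps)
    have e6: "pd i (U j) \<iota> x = pd i A4 \<iota> x + pd i A5 \<iota> x + pd i A6 \<iota> x - (pd i H1 \<iota> x + pd i H2 \<iota> x + pd i H3 \<iota> x)"
      "pd j (U i) \<iota> x = pd j A1 \<iota> x + pd j A2 \<iota> x + pd j A3 \<iota> x"
      unfolding U Ui_def Uj_def using d[OF D] by (simp_all add: pds difs)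
    show "pd i (ripple a) \<iota> x * pd j (ripple a) \<iota> x - ripple a \<iota> x * Bij \<iota> x
       + pd i (U j) \<iota> x + pd j (U i) \<iota> x - 2 * (im \<iota>)\<^sup>2 * (pd i a \<iota> x * pd j a \<iota> x)
      = (pd i A4 \<iota> x - g4 \<iota> x * cs 2 \<iota> x) + (pd i A5 \<iota> x - g5 \<iota> x * sn 2 \<iota> x) + (pd i A6 \<iota> x - g6 \<iota> x * sn 1 \<iota> x)
        - ((pd i H1 \<iota> x - pd j A1 \<iota> x) + (pd i H2 \<iota> x - pd j A2 \<iota> x) + (pd i H3 \<iota> x - pd j A3 \<iota> x))"
      unfolding e1 e2 e3 e4 e6 s1_def[symmetric] s2_def[symmetric] c2_def[symmetric] using e5 by (simp add: algebra_simps)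
  qed
  have sT: "SC D mix (Suc m) (\<lambda>\<iota>. im \<iota> * p \<iota>) (ripple a)"
    by (rule SC_order[OF SC_ripple[OF a]]) simp
  have sTj: "SC D mix m (\<lambda>\<iota>. im \<iota> * p \<iota> * (\<rho> \<iota> * \<mu> \<iota>)) (pd j (ripple a))"
    using SC_pd[OF sT, of j] ij by (simp add: mix_def)
  have sUjj: "SC D mix m (\<lambda>\<iota>. im \<iota> * ?Q \<iota> * (\<rho> \<iota> * \<mu> \<iota>)) (pd j Uj)"
    using SC_pd[OF sUj, of j] ij by (simp add: mix_def)
  \<comment> \<open>All three contributions to \<open>jj\<close> have size p^2 \<rho>^2, since each
    contains two derivatives in direction \<open>j\<close>: \<open>Uj\<close> is built from terms
    with one of them and is differentiated once more.\<close>
  have x1: "(im \<iota> * p \<iota> * (\<rho> \<iota> * \<mu> \<iota>)) * (im \<iota> * p \<iota> * (\<rho> \<iota> * \<mu> \<iota>)) = (p \<iota>)\<^sup>2 * (\<rho> \<iota>)\<^sup>2"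
     "im \<iota> * p \<iota> * (p \<iota> * \<mu> \<iota> * (\<rho> \<iota>)\<^sup>2) = (p \<iota>)\<^sup>2 * (\<rho> \<iota>)\<^sup>2"
     "im \<iota> * ?Q \<iota> * (\<rho> \<iota> * \<mu> \<iota>) = (p \<iota>)\<^sup>2 * (\<rho> \<iota>)\<^sup>2"
    if "(\<iota>, x) \<in> D" for \<iota> x
  proof -
    have "(im \<iota> * p \<iota> * (\<rho> \<iota> * \<mu> \<iota>)) * (im \<iota> * p \<iota> * (\<rho> \<iota> * \<mu> \<iota>)) = (im \<iota> * \<mu> \<iota>) * (im \<iota> * \<mu> \<iota>) * ((p \<iota>)\<^sup>2 * (\<rho> \<iota>)\<^sup>2)"
       "im \<iota> * p \<iota> * (p \<iota> * \<mu> \<iota> * (\<rho> \<iota>)\<^sup>2) = (im \<iota> * \<mu> \<iota>) * ((p \<iota>)\<^sup>2 * (\<rho> \<iota>)\<^sup>2)"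
       "im \<iota> * ?Q \<iota> * (\<rho> \<iota> * \<mu> \<iota>) = (im \<iota> * \<mu> \<iota>) * ((p \<iota>)\<^sup>2 * (\<rho> \<iota>)\<^sup>2)"
      by (simp_all add: power2_eq_square algebra_simps)
    then show "(im \<iota> * p \<iota> * (\<rho> \<iota> * \<mu> \<iota>)) * (im \<iota> * p \<iota> * (\<rho> \<iota> * \<mu> \<iota>)) = (p \<iota>)\<^sup>2 * (\<rho> \<iota>)\<^sup>2"
     "im \<iota> * p \<iota> * (p \<iota> * \<mu> \<iota> * (\<rho> \<iota>)\<^sup>2) = (p \<iota>)\<^sup>2 * (\<rho> \<iota>)\<^sup>2"
     "im \<iota> * ?Q \<iota> * (\<rho> \<iota> * \<mu> \<iota>) = (p \<iota>)\<^sup>2 * (\<rho> \<iota>)\<^sup>2" by (simp_all add: im_\<mu>[OF that])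
  qed
  have "SC D mix m (\<lambda>\<iota>. (p \<iota>)\<^sup>2 * (\<rho> \<iota>)\<^sup>2)
      (\<lambda>\<iota> x. (1/2) * (pd j (ripple a) \<iota> x * pd j (ripple a) \<iota> x) - ripple a \<iota> x * Bjj \<iota> x + pd j Uj \<iota> x)"
  proof (intro SC_add SC_sub SC_scale mn)
    show "SC D mix m (\<lambda>\<iota>. (p \<iota>)\<^sup>2 * (\<rho> \<iota>)\<^sup>2) (\<lambda>\<iota> x. pd j (ripple a) \<iota> x * pd j (ripple a) \<iota> x)"
      by (rule SC_weight[OF SC_mult[OF sTj sTj]]) (rule x1)
    have "SC D slow m (\<lambda>\<iota>. p \<iota> * \<mu> \<iota> * (\<rho> \<iota>)\<^sup>2) Bjj" by (rule SC_order[OF Bjj]) simp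
    then show "SC D mix m (\<lambda>\<iota>. (p \<iota>)\<^sup>2 * (\<rho> \<iota>)\<^sup>2) (\<lambda>\<iota> x. ripple a \<iota> x * Bjj \<iota> x)"
      by (intro SC_weight[OF SC_mult[OF SC_SucD[OF sT] slow_mix]]) (auto intro: x1)
    show "SC D mix m (\<lambda>\<iota>. (p \<iota>)\<^sup>2 * (\<rho> \<iota>)\<^sup>2) (pd j Uj)"
      by (rule SC_weight[OF sUjj]) (rule x1)
  qed
  from mix_iso[OF this] have "SC D (\<lambda>_. \<mu>) m (\<lambda>\<iota>. (p \<iota>)\<^sup>2 * (\<rho> \<iota>)\<^sup>2)
      (\<lambda>\<iota> x. (1/2) * (pd j (ripple a) \<iota> x)\<^sup>2 - ripple a \<iota> x * Bjj \<iota> x + pd j (U j) \<iota> x)"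
    unfolding U by (simp add: power2_eq_square)
  with sU b1 b2 show ?thesis by blast
qed

end

subsection \<open>The amplitude equation\<close>

text \<open>Here \<open>\<theta>\<close> is the logarithmic loss, and the equation needs to hold only on the smaller
  set \<open>D1\<close> and up to the error \<open>\<epsilon>\<close>.\<close>

definition decomposable :: "('i \<times> (real^2)) set \<Rightarrow> ('i \<times> (real^2)) set \<Rightarrow> ('i \<Rightarrow> real) \<Rightarrow> ('i \<Rightarrow> real) \<Rightarrow> nat \<Rightarrow>
    (2 \<Rightarrow> 'i \<Rightarrow> real) \<Rightarrow> bool" where
  "decomposable D D1 \<theta> \<epsilon> M \<nu> \<longleftrightarrow> (\<forall>m P f i j. i \<noteq> j \<longrightarrow> Suc m \<le> M \<longrightarrow> SC D \<nu> (Suc m) P f \<longrightarrow>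
     (\<exists>\<Psi>. (\<forall>q. SC D \<nu> (Suc m) (\<lambda>\<iota>. \<theta> \<iota> * P \<iota>) (\<Psi> q)) \<and>
          (\<forall>p q. SC D \<nu> m (\<lambda>\<iota>. \<theta> \<iota> * P \<iota>) (pd p (\<Psi> q))) \<and>
          BO D1 (\<lambda>\<iota>. P \<iota> * \<epsilon> \<iota>) (\<lambda>\<iota> x. f \<iota> x - (pd i (\<Psi> j) \<iota> x + pd j (\<Psi> i) \<iota> x) / 2)))"

lemma BO_subset: "BO D P f \<Longrightarrow> E \<subseteq> D \<Longrightarrow> BO E P f"
  unfolding BO_def by blast

locale stage = corrugation D \<mu> \<rho> i j
  for D :: "('i \<times> (real^2)) set" and \<mu> \<rho> :: "'i \<Rightarrow> real" and i j :: 2 +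
  fixes D1 :: "('i \<times> (real^2)) set" and \<theta> \<epsilon> :: "'i \<Rightarrow> real" and M :: nat
  assumes D1: "D1 \<subseteq> D"
    and \<theta>: "\<And>\<iota> x. (\<iota>, x) \<in> D \<Longrightarrow> 1 \<le> \<theta> \<iota>"
    and \<rho>\<theta>: "\<And>\<iota> x. (\<iota>, x) \<in> D \<Longrightarrow> (\<rho> \<iota>)\<^sup>2 * \<theta> \<iota> \<le> 1"
    and \<epsilon>: "\<And>\<iota> x. (\<iota>, x) \<in> D \<Longrightarrow> 0 \<le> \<epsilon> \<iota>"
    and dec: "decomposable D D1 \<theta> \<epsilon> M slow"
begin

text \<open>The gain of one round of the amplitude iteration: \<rho>^2 from two slow derivatives,
  each divided by \<open>\<mu>\<close>, and \<open>\<theta>\<close> lost in solving the off-diagonal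
  equation.\<close>

definition \<delta> :: "'i \<Rightarrow> real" where "\<delta> = (\<lambda>\<iota>. (\<rho> \<iota>)\<^sup>2 * \<theta> \<iota>)"

lemma \<delta>: "(\<iota>, x) \<in> D \<Longrightarrow> 0 \<le> \<delta> \<iota>" "(\<iota>, x) \<in> D \<Longrightarrow> \<delta> \<iota> \<le> 1" "(\<iota>, x) \<in> D \<Longrightarrow> (\<rho> \<iota>)\<^sup>2 \<le> \<delta> \<iota>"
  using \<theta>[of \<iota> x] \<rho>\<theta>[of \<iota> x] mult_left_mono[of 1 "\<theta> \<iota>" "(\<rho> \<iota>)\<^sup>2"] by (auto simp: \<delta>_def)

lemma power_\<delta>_le: "(\<iota>, x) \<in> D \<Longrightarrow> \<delta> \<iota> ^ Suc k \<le> \<delta> \<iota>"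
  using \<delta>(1,2)[of \<iota> x] by (simp add: mult_left_le power_le_one)

text \<open>These are the two equations left by the means in \<open>corrugate\<close>: the entry
  \<open>ii\<close> of what is produced should be \<open>h\<close>, the entry \<open>ij\<close>
  should vanish. The terms with derivatives of \<open>a\<close>, and the \<open>\<Psi>\<close> they
  force, are smaller than \<open>h\<close> by \<open>\<delta>\<close>. Starting from sqrt h, each
  round corrects first \<open>a\<close>, then \<open>\<Psi>\<close>, gains one power of
  \<open>\<delta>\<close> and spends two derivatives; hence the order
  \<open>m + 2 * Suc k\<close>.\<close>

lemma amplitude:
  assumes "\<forall>\<iota> x. (\<iota>, x) \<in> D \<longrightarrow> 0 < p \<iota>" and c: "c > 0"
    and "\<forall>\<iota> x. (\<iota>, x) \<in> D \<longrightarrow> c * (p \<iota>)\<^sup>2 \<le> h \<iota> x"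
  shows "SC D slow (m + 2 * Suc k) (\<lambda>\<iota>. (p \<iota>)\<^sup>2) h \<Longrightarrow> m + 2 * Suc k \<le> M \<Longrightarrow>
    \<exists>a \<Psi>. SC D slow (Suc (Suc m)) (\<lambda>\<iota>. p \<iota> * \<delta> \<iota>) (\<lambda>\<iota> x. a \<iota> x - sqrt (h \<iota> x)) \<and>
     (\<forall>q. SC D slow (Suc m) (\<lambda>\<iota>. (p \<iota>)\<^sup>2 * \<delta> \<iota>) (\<Psi> q)) \<and>
     (\<forall>q r. SC D slow m (\<lambda>\<iota>. (p \<iota>)\<^sup>2 * \<delta> \<iota>) (pd r (\<Psi> q))) \<and>
     BO D1 (\<lambda>\<iota>. (p \<iota>)\<^sup>2 * \<epsilon> \<iota>) (\<lambda>\<iota> x. (im \<iota>)\<^sup>2 * (pd i a \<iota> x * pd j a \<iota> x) + (pd i (\<Psi> j) \<iota> x + pd j (\<Psi> i) \<iota> x) / 2) \<and>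
     SC D slow m (\<lambda>\<iota>. (p \<iota>)\<^sup>2 * \<delta> \<iota> ^ Suc k) (\<lambda>\<iota> x. (a \<iota> x)\<^sup>2 + (im \<iota>)\<^sup>2 * (pd i a \<iota> x)\<^sup>2 + pd i (\<Psi> i) \<iota> x - h \<iota> x)"
proof (induction k arbitrary: m)
  note p = assms(1)[rule_format] and hp = assms(3)[rule_format]
  have sn: "\<And>k \<iota> x. (\<iota>, x) \<in> D \<Longrightarrow> 0 \<le> slow k \<iota>" by (rule slow_nonneg)
  have im2: "im \<iota> * (im \<iota> * (u * slow q \<iota> * (v * slow q' \<iota>))) = u * v * (\<rho> \<iota>)\<^sup>2" if "(\<iota>, x) \<in> D" for \<iota> x u v q q'
  proof -
    have "im \<iota> * (im \<iota> * (u * slow q \<iota> * (v * slow q' \<iota>))) = (im \<iota> * \<mu> \<iota>) * (im \<iota> * \<mu> \<iota>) * (u * v * (\<rho> \<iota>)\<^sup>2)"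
      by (simp add: slow_def power2_eq_square algebra_simps)
    then show ?thesis by (simp add: im_\<mu>[OF that])
  qed
  have quad: "SC D slow n (\<lambda>\<iota>. P \<iota> * Q \<iota> * (\<rho> \<iota>)\<^sup>2) (\<lambda>\<iota> x. im \<iota> * (im \<iota> * (pd q f \<iota> x * pd q' g \<iota> x)))"
    if "SC D slow (Suc n) P f" "SC D slow (Suc n) Q g" for n P Q f g q q'
    by (rule SC_weight[OF SC_im[OF SC_im[OF SC_mult[OF SC_pd[OF that(1)] SC_pd[OF that(2)]]]]]) (rule im2)
  {
    case 0
    let ?s = "\<lambda>\<iota> x. sqrt (h \<iota> x)"
    have s: "SC D slow (Suc (Suc m)) p ?s"
      using SC_sqrt[OF 0(1) c p hp sn] by simp
    have f: "SC D slow (Suc m) (\<lambda>\<iota>. (p \<iota>)\<^sup>2 * (\<rho> \<iota>)\<^sup>2) (\<lambda>\<iota> x. - (im \<iota> * (im \<iota> * (pd i ?s \<iota> x * pd j ?s \<iota> x))))"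
      using SC_minus[OF quad[OF s s, of i j]] by (simp add: power2_eq_square)
    obtain \<Psi> where \<Psi>: "\<And>q. SC D slow (Suc m) (\<lambda>\<iota>. \<theta> \<iota> * ((p \<iota>)\<^sup>2 * (\<rho> \<iota>)\<^sup>2)) (\<Psi> q)"
      "\<And>r q. SC D slow m (\<lambda>\<iota>. \<theta> \<iota> * ((p \<iota>)\<^sup>2 * (\<rho> \<iota>)\<^sup>2)) (pd r (\<Psi> q))"
      "BO D1 (\<lambda>\<iota>. (p \<iota>)\<^sup>2 * (\<rho> \<iota>)\<^sup>2 * \<epsilon> \<iota>) (\<lambda>\<iota> x. - (im \<iota> * (im \<iota> * (pd i ?s \<iota> x * pd j ?s \<iota> x))) - (pd i (\<Psi> j) \<iota> x + pd j (\<Psi> i) \<iota> x) / 2)"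
      using dec[unfolded decomposable_def, rule_format, OF ij _ f] 0(2) by auto
    have w: "\<theta> \<iota> * ((p \<iota>)\<^sup>2 * (\<rho> \<iota>)\<^sup>2) = (p \<iota>)\<^sup>2 * \<delta> \<iota>" for \<iota> by (simp add: \<delta>_def mult_ac)
    note \<Psi>' = \<Psi>(1,2)[unfolded w]
    have "SC D slow (Suc (Suc m)) (\<lambda>\<iota>. p \<iota> * \<delta> \<iota>) (\<lambda>\<iota> x. ?s \<iota> x - ?s \<iota> x)"
      using SC_const[OF odom sn, where c="\<lambda>_. 0" and P="\<lambda>\<iota>. p \<iota> * \<delta> \<iota>" and m="Suc (Suc m)"] p \<delta>(1) by (simp add: less_imp_le)
    moreover have "BO D1 (\<lambda>\<iota>. (p \<iota>)\<^sup>2 * \<epsilon> \<iota>) (\<lambda>\<iota> x. (im \<iota>)\<^sup>2 * (pd i ?s \<iota> x * pd j ?s \<iota> x) + (pd i (\<Psi> j) \<iota> x + pd j (\<Psi> i) \<iota> x) / 2)"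
    proof (rule BO_cong[OF BO_minus[OF BO_mono[OF \<Psi>(3), of 1]]])
      fix \<iota> x assume "(\<iota>, x) \<in> D1"
      then have a: "(\<iota>, x) \<in> D" using D1 by blast
      show "(p \<iota>)\<^sup>2 * (\<rho> \<iota>)\<^sup>2 * \<epsilon> \<iota> \<le> 1 * ((p \<iota>)\<^sup>2 * \<epsilon> \<iota>)"
        using \<epsilon>[OF a] \<rho>[OF a] by (simp add: mult_right_mono mult_left_le power_le_one)
    qed (simp_all add: power2_eq_square)
    moreover have "SC D slow m (\<lambda>\<iota>. (p \<iota>)\<^sup>2 * \<delta> \<iota>) (\<lambda>\<iota> x. (?s \<iota> x)\<^sup>2 + (im \<iota>)\<^sup>2 * (pd i ?s \<iota> x)\<^sup>2 + pd i (\<Psi> i) \<iota> x - h \<iota> x)"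
    proof (rule SC_cong[OF SC_add[OF slow_w[OF SC_SucD[OF quad[OF s s, of i i]]] \<Psi>'(2)[of i i]]])
      fix \<iota> x assume a: "(\<iota>, x) \<in> D"
      show "p \<iota> * p \<iota> * (\<rho> \<iota>)\<^sup>2 \<le> (p \<iota>)\<^sup>2 * \<delta> \<iota>" using \<delta>(3)[OF a] by (simp add: power2_eq_square mult_left_mono)
      have "0 \<le> h \<iota> x" using hp[OF a] c by (smt (verit) mult_nonneg_nonneg zero_le_power2)
      then show "(?s \<iota> x)\<^sup>2 + (im \<iota>)\<^sup>2 * (pd i ?s \<iota> x)\<^sup>2 + pd i (\<Psi> i) \<iota> x - h \<iota> x
        = im \<iota> * (im \<iota> * (pd i ?s \<iota> x * pd i ?s \<iota> x)) + pd i (\<Psi> i) \<iota> x"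
        by (simp add: power2_eq_square)
    qed
    ultimately show ?case using \<Psi>' by (intro exI[of _ ?s] exI[of _ \<Psi>]) simp
  next
    case (Suc k)
    let ?s = "\<lambda>\<iota> x. sqrt (h \<iota> x)"
    let ?b = "\<lambda>\<iota> x. 1 / sqrt (h \<iota> x)"
    have le: "Suc (Suc m) + 2 * Suc k = m + 2 * Suc (Suc k)" by simp
    obtain a \<Psi> where
      IH: "SC D slow (Suc (Suc (Suc (Suc m)))) (\<lambda>\<iota>. p \<iota> * \<delta> \<iota>) (\<lambda>\<iota> x. a \<iota> x - ?s \<iota> x)"
       "\<And>q. SC D slow (Suc (Suc (Suc m))) (\<lambda>\<iota>. (p \<iota>)\<^sup>2 * \<delta> \<iota>) (\<Psi> q)"
       "\<And>q r. SC D slow (Suc (Suc m)) (\<lambda>\<iota>. (p \<iota>)\<^sup>2 * \<delta> \<iota>) (pd r (\<Psi> q))"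
       "BO D1 (\<lambda>\<iota>. (p \<iota>)\<^sup>2 * \<epsilon> \<iota>) (\<lambda>\<iota> x. (im \<iota>)\<^sup>2 * (pd i a \<iota> x * pd j a \<iota> x) + (pd i (\<Psi> j) \<iota> x + pd j (\<Psi> i) \<iota> x) / 2)"
       "SC D slow (Suc (Suc m)) (\<lambda>\<iota>. (p \<iota>)\<^sup>2 * \<delta> \<iota> ^ Suc k) (\<lambda>\<iota> x. (a \<iota> x)\<^sup>2 + (im \<iota>)\<^sup>2 * (pd i a \<iota> x)\<^sup>2 + pd i (\<Psi> i) \<iota> x - h \<iota> x)"
      using Suc.IH[of "Suc (Suc m)"] Suc.prems unfolding le by blast
    define e where "e = (\<lambda>\<iota> x. (a \<iota> x)\<^sup>2 + (im \<iota>)\<^sup>2 * (pd i a \<iota> x)\<^sup>2 + pd i (\<Psi> i) \<iota> x - h \<iota> x)"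
    have e: "SC D slow (Suc (Suc m)) (\<lambda>\<iota>. (p \<iota>)\<^sup>2 * \<delta> \<iota> ^ Suc k) e" unfolding e_def by (rule IH(5))
    have h2: "SC D slow (Suc (Suc m)) (\<lambda>\<iota>. (p \<iota>)\<^sup>2) h" by (rule SC_order[OF Suc.prems(1)]) simp
    note s = SC_sqrt[OF h2 c p hp sn] and b = SC_inverse_sqrt[OF h2 c p hp sn]
    have as: "SC D slow (Suc (Suc m)) (\<lambda>\<iota>. p \<iota> * \<delta> \<iota>) (\<lambda>\<iota> x. a \<iota> x - ?s \<iota> x)"
      by (rule SC_order[OF IH(1)]) simp
    have a: "SC D slow (Suc (Suc m)) p a"
    proof (rule SC_cong[OF SC_add[OF s slow_w[OF as]]])
      show "p \<iota> * \<delta> \<iota> \<le> p \<iota>" if "(\<iota>, x) \<in> D" for \<iota> x using p[OF that] \<delta>[OF that] by (simp add: mult_left_le)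
    qed (assumption | linarith)+
    \<comment> \<open>The correction linearises a^2 at sqrt h instead of at \<open>a\<close>. The
      mismatch, \<open>e\<close> times (a - sqrt h) / sqrt h, is smaller by one more power of
      \<open>\<delta>\<close>, and the denominator stays the same in all rounds.\<close>
    define \<eta> where "\<eta> = (\<lambda>\<iota> x. (-1/2) * (e \<iota> x * ?b \<iota> x))"
    have \<eta>: "SC D slow (Suc (Suc m)) (\<lambda>\<iota>. p \<iota> * \<delta> \<iota> ^ Suc k) \<eta>"
      unfolding \<eta>_def by (intro SC_scale sn SC_weight[OF SC_mult[OF e b]]) (use p in \<open>auto simp: power2_eq_square\<close>)
    have d: "a \<iota> differentiable (at x)" "\<eta> \<iota> differentiable (at x)" if "(\<iota>, x) \<in> D" for \<iota> x
      using SC_diff[OF a that] SC_diff[OF \<eta> that] by auto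
    have \<delta>k: "p \<iota> * \<delta> \<iota> ^ Suc k \<le> p \<iota> * \<delta> \<iota>" "p \<iota> * \<delta> \<iota> ^ Suc k \<le> p \<iota>" if "(\<iota>, x) \<in> D" for \<iota> x
    proof -
      show "p \<iota> * \<delta> \<iota> ^ Suc k \<le> p \<iota> * \<delta> \<iota>"
        by (rule mult_left_mono[OF power_\<delta>_le[OF that] less_imp_le[OF p[OF that]]])
      then show "p \<iota> * \<delta> \<iota> ^ Suc k \<le> p \<iota>"
        using mult_left_le[OF \<delta>(2)[OF that] less_imp_le[OF p[OF that]]] by linarith
    qed
    have \<eta>p: "SC D slow (Suc (Suc m)) p \<eta>" by (rule slow_w[OF \<eta>], rule \<delta>k(2))
    have \<eta>\<delta>: "SC D slow (Suc (Suc m)) (\<lambda>\<iota>. p \<iota> * \<delta> \<iota>) \<eta>" by (rule slow_w[OF \<eta>], rule \<delta>k(1))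
    let ?W = "\<lambda>\<iota>. (p \<iota>)\<^sup>2 * (\<rho> \<iota>)\<^sup>2 * \<delta> \<iota> ^ Suc k"
    have q1: "SC D slow (Suc m) ?W (\<lambda>\<iota> x. im \<iota> * (im \<iota> * (pd q a \<iota> x * pd r \<eta> \<iota> x)))" for q r
      by (rule SC_weight[OF quad[OF a \<eta>]]) (simp add: power2_eq_square mult_ac)
    have q2: "SC D slow (Suc m) ?W (\<lambda>\<iota> x. im \<iota> * (im \<iota> * (pd q \<eta> \<iota> x * pd r \<eta> \<iota> x)))" for q r
      by (rule SC_weight[OF quad[OF \<eta>p \<eta>]]) (simp add: power2_eq_square mult_ac)
    \<comment> \<open>Minus the change that \<open>\<eta>\<close> causes in the off-diagonal
      quadratic term; solving for it preserves the \<open>ij\<close> equation up to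
      \<open>\<epsilon>\<close> in every round.\<close>
    define f where "f = (\<lambda>\<iota> x. - (im \<iota> * (im \<iota> * (pd i a \<iota> x * pd j \<eta> \<iota> x)) + im \<iota> * (im \<iota> * (pd j a \<iota> x * pd i \<eta> \<iota> x))
       + im \<iota> * (im \<iota> * (pd i \<eta> \<iota> x * pd j \<eta> \<iota> x))))"
    have f: "SC D slow (Suc m) ?W f" unfolding f_def by (intro SC_minus SC_add q1 q2)
    obtain \<Phi> where \<Phi>: "\<And>q. SC D slow (Suc m) (\<lambda>\<iota>. \<theta> \<iota> * ?W \<iota>) (\<Phi> q)"
      "\<And>r q. SC D slow m (\<lambda>\<iota>. \<theta> \<iota> * ?W \<iota>) (pd r (\<Phi> q))"
      "BO D1 (\<lambda>\<iota>. ?W \<iota> * \<epsilon> \<iota>) (\<lambda>\<iota> x. f \<iota> x - (pd i (\<Phi> j) \<iota> x + pd j (\<Phi> i) \<iota> x) / 2)"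
      using dec[unfolded decomposable_def, rule_format, OF ij _ f] Suc.prems(2) by auto
    have w: "\<theta> \<iota> * ?W \<iota> = (p \<iota>)\<^sup>2 * \<delta> \<iota> ^ Suc (Suc k)" for \<iota> by (simp add: \<delta>_def mult_ac)
    note \<Phi>' = \<Phi>(1,2)[unfolded w]
    have wle: "(p \<iota>)\<^sup>2 * \<delta> \<iota> ^ Suc (Suc k) \<le> (p \<iota>)\<^sup>2 * \<delta> \<iota>" if "(\<iota>, x) \<in> D" for \<iota> x
      by (rule mult_left_mono[OF power_\<delta>_le[OF that]]) simp
    have Wle: "?W \<iota> \<le> (p \<iota>)\<^sup>2 * \<delta> \<iota> ^ Suc (Suc k)" if "(\<iota>, x) \<in> D" for \<iota> x
    proof -
      have "(\<rho> \<iota>)\<^sup>2 * \<delta> \<iota> ^ Suc k \<le> \<delta> \<iota> * \<delta> \<iota> ^ Suc k"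
        by (rule mult_right_mono[OF \<delta>(3)[OF that]]) (use \<delta>(1)[OF that] in simp)
      then show ?thesis using mult_left_mono[of _ _ "(p \<iota>)\<^sup>2"] by (simp add: mult.assoc)
    qed
    have \<Phi>w: "SC D slow (Suc m) (\<lambda>\<iota>. (p \<iota>)\<^sup>2 * \<delta> \<iota>) (\<Phi> q)" "SC D slow m (\<lambda>\<iota>. (p \<iota>)\<^sup>2 * \<delta> \<iota>) (pd r (\<Phi> q))" for q r
      by (rule slow_w[OF \<Phi>'(1)], rule wle, assumption) (rule slow_w[OF \<Phi>'(2)], rule wle)
    define a' where "a' = (\<lambda>\<iota> x. a \<iota> x + \<eta> \<iota> x)"
    define \<Psi>' where "\<Psi>' = (\<lambda>q \<iota> x. \<Psi> q \<iota> x + \<Phi> q \<iota> x)"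
    have pa: "pd q a' \<iota> x = pd q a \<iota> x + pd q \<eta> \<iota> x" if "(\<iota>, x) \<in> D" for q \<iota> x
      unfolding a'_def by (rule pd_add[where f=a and g=\<eta>, OF d[OF that]])
    have p\<Psi>: "pd r (\<Psi>' q) \<iota> x = pd r (\<Psi> q) \<iota> x + pd r (\<Phi> q) \<iota> x" if "(\<iota>, x) \<in> D" for q r \<iota> x
      unfolding \<Psi>'_def by (rule pd_add[where f="\<Psi> q" and g="\<Phi> q", OF SC_diff[OF IH(2) that] SC_diff[OF \<Phi>(1) that]])
    have 1: "SC D slow (Suc (Suc m)) (\<lambda>\<iota>. p \<iota> * \<delta> \<iota>) (\<lambda>\<iota> x. a' \<iota> x - ?s \<iota> x)"
      by (rule SC_cong[OF SC_add[OF as \<eta>\<delta>]]) (auto simp: a'_def)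
    have 2: "SC D slow (Suc m) (\<lambda>\<iota>. (p \<iota>)\<^sup>2 * \<delta> \<iota>) (\<Psi>' q)" for q
      unfolding \<Psi>'_def by (intro SC_add SC_order[OF IH(2)] \<Phi>w(1)) simp
    have 3: "SC D slow m (\<lambda>\<iota>. (p \<iota>)\<^sup>2 * \<delta> \<iota>) (pd r (\<Psi>' q))" for q r
      by (rule SC_cong[OF SC_add[OF SC_order[OF IH(3)] \<Phi>w(2)] p\<Psi>]) simp
    have 4: "BO D1 (\<lambda>\<iota>. (p \<iota>)\<^sup>2 * \<epsilon> \<iota>) (\<lambda>\<iota> x. (im \<iota>)\<^sup>2 * (pd i a' \<iota> x * pd j a' \<iota> x) + (pd i (\<Psi>' j) \<iota> x + pd j (\<Psi>' i) \<iota> x) / 2)"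
    proof (rule BO_cong[OF BO_diff[OF IH(4) BO_mono[OF \<Phi>(3), of 1]]])
      fix \<iota> x assume D1a: "(\<iota>, x) \<in> D1"
      then have D: "(\<iota>, x) \<in> D" using D1 by blast
      have "?W \<iota> \<le> (p \<iota>)\<^sup>2" 
        using order_trans[OF Wle[OF D] wle[OF D]] mult_left_le[OF \<delta>(2)[OF D], of "(p \<iota>)\<^sup>2"] by simp
      then show "?W \<iota> * \<epsilon> \<iota> \<le> 1 * ((p \<iota>)\<^sup>2 * \<epsilon> \<iota>)" using mult_right_mono[OF _ \<epsilon>[OF D]] by simp
      show "(im \<iota>)\<^sup>2 * (pd i a' \<iota> x * pd j a' \<iota> x) + (pd i (\<Psi>' j) \<iota> x + pd j (\<Psi>' i) \<iota> x) / 2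
        = (im \<iota>)\<^sup>2 * (pd i a \<iota> x * pd j a \<iota> x) + (pd i (\<Psi> j) \<iota> x + pd j (\<Psi> i) \<iota> x) / 2
          - (f \<iota> x - (pd i (\<Phi> j) \<iota> x + pd j (\<Phi> i) \<iota> x) / 2)"
        unfolding pa[OF D] p\<Psi>[OF D] f_def by (simp add: power2_eq_square algebra_simps add_divide_distrib)
    qed simp
    have 5: "SC D slow m (\<lambda>\<iota>. (p \<iota>)\<^sup>2 * \<delta> \<iota> ^ Suc (Suc k)) (\<lambda>\<iota> x. (a' \<iota> x)\<^sup>2 + (im \<iota>)\<^sup>2 * (pd i a' \<iota> x)\<^sup>2 + pd i (\<Psi>' i) \<iota> x - h \<iota> x)"
    proof -
      let ?V = "\<lambda>\<iota>. (p \<iota>)\<^sup>2 * \<delta> \<iota> ^ Suc (Suc k)"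
      have x1: "SC D slow m ?V (\<lambda>\<iota> x. - (e \<iota> x * ((a \<iota> x - ?s \<iota> x) * ?b \<iota> x)))"
        by (rule SC_minus[OF SC_weight[OF SC_order[OF SC_mult[OF e SC_mult[OF as b]]]]])
           (use p in \<open>auto simp: power2_eq_square mult_ac\<close>)
      have x2: "SC D slow m ?V (\<lambda>\<iota> x. \<eta> \<iota> x * \<eta> \<iota> x)"
        by (rule SC_weight[OF SC_order[OF SC_mult[OF \<eta> \<eta>\<delta>]]]) (auto simp: power2_eq_square mult_ac)
      have x3: "SC D slow m ?V (\<lambda>\<iota> x. im \<iota> * (im \<iota> * (pd i a \<iota> x * pd i \<eta> \<iota> x)))"
        by (rule slow_w[OF SC_SucD[OF q1[of i i]]], rule Wle)
      have x4: "SC D slow m ?V (\<lambda>\<iota> x. im \<iota> * (im \<iota> * (pd i \<eta> \<iota> x * pd i \<eta> \<iota> x)))"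
        by (rule slow_w[OF SC_SucD[OF q2[of i i]]], rule Wle)
      note x3' = SC_scale[of D slow m ?V _ 2, OF x3 sn]
      have gen: "2 * (A * ((-1/2) * (E * B))) = - (E * ((A - S) * B)) - E * (S * B)" for A E B S :: real
        by (simp add: algebra_simps)
      show ?thesis
      proof (rule SC_cong[OF SC_add[OF SC_add[OF x1 x2] SC_add[OF SC_add[OF x3' x4] \<Phi>'(2)[of i i]]]])
        fix \<iota> x assume D: "(\<iota>, x) \<in> D"
        have hpos: "0 < h \<iota> x" using p[OF D] hp[OF D] c by (smt (verit) mult_pos_pos zero_less_power)
        have sb: "?s \<iota> x * ?b \<iota> x = 1" using hpos by simp
        have "2 * (a \<iota> x * \<eta> \<iota> x) = - (e \<iota> x * ((a \<iota> x - ?s \<iota> x) * ?b \<iota> x)) - e \<iota> x * (?s \<iota> x * ?b \<iota> x)"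
          unfolding \<eta>_def by (rule gen)
        then have ea: "e \<iota> x + 2 * (a \<iota> x * \<eta> \<iota> x) = - (e \<iota> x * ((a \<iota> x - ?s \<iota> x) * ?b \<iota> x))"
          unfolding sb by simp
        have "(a' \<iota> x)\<^sup>2 + (im \<iota>)\<^sup>2 * (pd i a' \<iota> x)\<^sup>2 + pd i (\<Psi>' i) \<iota> x - h \<iota> x
          = (e \<iota> x + 2 * (a \<iota> x * \<eta> \<iota> x)) + \<eta> \<iota> x * \<eta> \<iota> x + (2 * (im \<iota> * (im \<iota> * (pd i a \<iota> x * pd i \<eta> \<iota> x)))
            + im \<iota> * (im \<iota> * (pd i \<eta> \<iota> x * pd i \<eta> \<iota> x)) + pd i (\<Phi> i) \<iota> x)"
          unfolding pa[OF D] p\<Psi>[OF D] unfolding a'_def e_def by (simp add: power2_eq_square algebra_simps)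
        then show "(a' \<iota> x)\<^sup>2 + (im \<iota>)\<^sup>2 * (pd i a' \<iota> x)\<^sup>2 + pd i (\<Psi>' i) \<iota> x - h \<iota> x
          = - (e \<iota> x * ((a \<iota> x - ?s \<iota> x) * ?b \<iota> x)) + \<eta> \<iota> x * \<eta> \<iota> x + (2 * (im \<iota> * (im \<iota> * (pd i a \<iota> x * pd i \<eta> \<iota> x)))
            + im \<iota> * (im \<iota> * (pd i \<eta> \<iota> x * pd i \<eta> \<iota> x)) + pd i (\<Phi> i) \<iota> x)" unfolding ea .
      qed
    qed
    from 1 2 3 4 5 show ?case by blast
  }
qed

end

subsection \<open>One corrugation step\<close>

text \<open>An entry of the defect, for families of scalar components. From here to the end of the
  construction \<open>V\<close> is the first field and \<open>\<omega>\<close> the second one, not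
  the domain.\<close>

definition Df :: "(2 \<Rightarrow> 2 \<Rightarrow> 'i fld) \<Rightarrow> (2 \<Rightarrow> 'i fld) \<Rightarrow> (2 \<Rightarrow> 'i fld) \<Rightarrow> 2 \<Rightarrow> 2 \<Rightarrow> 'i fld" where
  "Df A V \<omega> q r = (\<lambda>\<iota> x. A q r \<iota> x
     - ((1/2) * (\<Sum>c\<in>UNIV. pd q (V c) \<iota> x * pd r (V c) \<iota> x) + (1/2) * (pd q (\<omega> r) \<iota> x + pd r (\<omega> q) \<iota> x)))"

text \<open>The second derivatives of the component \<open>V\<^sub>c\<close> gain a factor \<open>\<rho>\<close> for each derivative in a direction
  other than \<open>c\<close>, as only direction \<open>c\<close> carries its fast oscillation. The entry \<open>ii\<close> of the defect
  is the one to be cancelled next; all other terms have size \<open>\<epsilon>\<close>.\<close>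

definition stage_inv where
  "stage_inv D D1 A V0 \<omega>0 G p0 \<epsilon> \<rho> \<nu> m i p p' V \<omega> \<longleftrightarrow>
     (\<forall>c. \<exists>B. SC D (\<lambda>_. \<nu>) (Suc (Suc m)) B (V c)) \<and>
     (\<forall>c q. SC D (\<lambda>_. \<nu>) (Suc m) G (pd q (V c))) \<and>
     (\<forall>c q r. SC D (\<lambda>_. \<nu>) m (\<lambda>\<iota>. p \<iota> * (\<nu> \<iota> / \<rho> \<iota>) * \<rho> \<iota> ^ (of_bool (q \<noteq> c) + of_bool (r \<noteq> c))) (pd r (pd q (V c)))) \<and>
     (\<forall>c. \<exists>B. SC D (\<lambda>_. \<nu>) (Suc (Suc m)) B (\<omega> c)) \<and>
     (\<forall>c. BO D p0 (\<lambda>\<iota> x. V c \<iota> x - V0 c \<iota> x)) \<and>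
     (\<forall>c q. BO D p0 (\<lambda>\<iota> x. pd q (V c) \<iota> x - pd q (V0 c) \<iota> x)) \<and>
     (\<forall>c. BO D (\<lambda>\<iota>. p0 \<iota> * G \<iota>) (\<lambda>\<iota> x. \<omega> c \<iota> x - \<omega>0 c \<iota> x)) \<and>
     (\<forall>c q. BO D (\<lambda>\<iota>. p0 \<iota> * G \<iota>) (\<lambda>\<iota> x. pd q (\<omega> c) \<iota> x - pd q (\<omega>0 c) \<iota> x)) \<and>
     (\<forall>c q r. BO D (\<lambda>\<iota>. p \<iota> * (\<nu> \<iota> / \<rho> \<iota>) * G \<iota>) (\<lambda>\<iota> x. pd r (pd q (\<omega> c)) \<iota> x - pd r (pd q (\<omega>0 c)) \<iota> x)) \<and>
     (\<exists>h h' c. c > (0::real) \<and> SC D (\<lambda>_. \<nu>) m (\<lambda>\<iota>. (p \<iota>)\<^sup>2) h \<and> (\<forall>\<iota> x. (\<iota>, x) \<in> D \<longrightarrow> c * (p \<iota>)\<^sup>2 \<le> h \<iota> x) \<and>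
        SC D (\<lambda>_. \<nu>) m (\<lambda>\<iota>. (p' \<iota>)\<^sup>2) h' \<and>
        (\<forall>j. j \<noteq> i \<longrightarrow> BO D1 (\<lambda>\<iota>. (p0 \<iota>)\<^sup>2 * \<epsilon> \<iota>) (\<lambda>\<iota> x. Df A V \<omega> i i \<iota> x - h \<iota> x) \<and>
           BO D1 (\<lambda>\<iota>. (p0 \<iota>)\<^sup>2 * \<epsilon> \<iota>) (\<lambda>\<iota> x. Df A V \<omega> j j \<iota> x - h' \<iota> x) \<and>
           BO D1 (\<lambda>\<iota>. (p0 \<iota>)\<^sup>2 * \<epsilon> \<iota>) (Df A V \<omega> i j) \<and> BO D1 (\<lambda>\<iota>. (p0 \<iota>)\<^sup>2 * \<epsilon> \<iota>) (Df A V \<omega> j i)))"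

text \<open>For the fields themselves any finite weight will do: it records regularity, while
  quantitative bounds are kept for derivatives and differences.\<close>

lemma SC_add_ex:
  assumes "\<exists>B. SC D \<nu> m B f" "\<exists>B. SC D \<nu> m B g" "\<And>k \<iota> x. (\<iota>, x) \<in> D \<Longrightarrow> 0 \<le> \<nu> k \<iota>"
  shows "\<exists>B. SC D \<nu> m B (\<lambda>\<iota> x. f \<iota> x + g \<iota> x)"
proof -
  obtain B B' where B: "SC D \<nu> m B f" "SC D \<nu> m B' g" using assms by blast
  have "SC D \<nu> m (\<lambda>\<iota>. B \<iota> + B' \<iota>) f"
    by (rule SC_wmono[OF B(1), of 1]) (use SC_nonneg[OF B(2)] assms(3) in auto)
  moreover have "SC D \<nu> m (\<lambda>\<iota>. B \<iota> + B' \<iota>) g"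
    by (rule SC_wmono[OF B(2), of 1]) (use SC_nonneg[OF B(1)] assms(3) in auto)
  ultimately show ?thesis using SC_add by blast
qed

lemma pd_pd_add:
  assumes "SC D \<nu> (Suc (Suc m)) P f" "SC D \<nu>' (Suc (Suc m')) P' g" "(\<iota>, x) \<in> D"
  shows "pd r (pd q (\<lambda>\<iota> x. f \<iota> x + g \<iota> x)) \<iota> x = pd r (pd q f) \<iota> x + pd r (pd q g) \<iota> x"
proof -
  have d: "pd q f \<iota> differentiable (at x)" "pd q g \<iota> differentiable (at x)"
    using SC_diff[OF SC_pd[OF assms(1)] assms(3)] SC_diff[OF SC_pd[OF assms(2)] assms(3)] by auto
  have "pd r (pd q (\<lambda>\<iota> x. f \<iota> x + g \<iota> x)) \<iota> x = pd r (\<lambda>\<iota> x. pd q f \<iota> x + pd q g \<iota> x) \<iota> x"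
  proof (rule pd_cong(2)[OF SC_odom[OF assms(1)] assms(3)])
    show "pd q f \<iota> x + pd q g \<iota> x = pd q (\<lambda>\<iota> x. f \<iota> x + g \<iota> x) \<iota> x" if "(\<iota>, x) \<in> D" for x
      by (rule pd_add[where f=f and g=g, symmetric]) (rule SC_diff[OF assms(1) that], rule SC_diff[OF assms(2) that])
    show "(\<lambda>x. pd q f \<iota> x + pd q g \<iota> x) differentiable (at x)" using d by simp
  qed
  then show ?thesis using pd_add[where f="pd q f" and g="pd q g", OF d] by simp
qed

text \<open>Linear fields supply the constant shifts of diagonal entries. The summand 1 in the
  weight covers their derivative, which is 1 however small \<open>R\<close> may be.\<close>

lemma SC_coord:
  assumes "odom D" "\<And>k \<iota> x. (\<iota>, x) \<in> D \<Longrightarrow> 1 \<le> \<nu> k \<iota>" "\<And>\<iota> x. (\<iota>, x) \<in> D \<Longrightarrow> \<bar>x $ j\<bar> \<le> R"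
  shows "SC D \<nu> m (\<lambda>_. R + 1) (\<lambda>\<iota> x. x $ j)"
proof -
  have B: "BO D (\<lambda>_. R + 1) (\<lambda>\<iota> x. x $ j)" by (rule BO_fun) (use assms(3) in fastforce)
  have "SC D \<nu> (Suc m) (\<lambda>_. R + 1) (\<lambda>\<iota> x. x $ j)"
  proof (rule SC_SucI[OF assms(1) B])
    show "((\<lambda>x. x $ j) has_derivative (\<lambda>h. \<Sum>k\<in>UNIV. h $ k * (if k = j then 1 else 0))) (at x)" for x :: "real^2"
      by (auto intro!: derivative_eq_intros simp: if_distrib cong: if_cong)
    show "SC D \<nu> m (\<lambda>\<iota>. (R + 1) * \<nu> k \<iota>) (\<lambda>\<iota> x. if k = j then 1 else 0)" for k
    proof (rule SC_const[OF assms(1)])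
      fix \<iota> x q assume a: "(\<iota>, x) \<in> D"
      show "0 \<le> \<nu> q \<iota>" using assms(2)[OF a, of q] by linarith
      have "1 * 1 \<le> (R + 1) * \<nu> k \<iota>"
        by (rule mult_mono) (use assms(2)[OF a, of k] assms(3)[OF a] in auto)
      then show "\<bar>if k = j then 1 else 0\<bar> \<le> (R + 1) * \<nu> k \<iota>" by auto
    qed
  qed
  then show ?thesis by (rule SC_SucD)
qed

lemma pd_coord: "pd r (\<lambda>\<iota> x. \<kappa> \<iota> * x $ j) \<iota> x = (if r = j then \<kappa> \<iota> else 0)"
  using pd_eqI[where f="\<lambda>\<iota> x. \<kappa> \<iota> * x $ j" and k=r, OF has_derivative_mult_right[OF has_derivative_vec_nth]]
  by (simp add: axis_def)

context stage
begin

lemma slow_iso: "SC D slow m P f \<Longrightarrow> SC D (\<lambda>_. \<mu>) m P f"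
  by (rule mix_iso[OF slow_mix])

lemma iso_w: "SC D (\<lambda>_. \<mu>) m P f \<Longrightarrow> (\<And>\<iota> x. (\<iota>, x) \<in> D \<Longrightarrow> P \<iota> \<le> Q \<iota>) \<Longrightarrow> SC D (\<lambda>_. \<mu>) m Q f"
  by (rule SC_wmono[where c=1]) (auto simp: less_imp_le[OF \<mu>])

text \<open>The ripple goes into \<open>V i\<close> and cancels the entry \<open>ii\<close>; up to
  \<open>\<epsilon>\<close> the off-diagonal entries stay 0, and \<open>jj\<close> changes by terms
  of size p'^2. So \<open>jj\<close> is the entry to cancel next and the two directions exchange
  their roles. The weight \<open>p''\<close> is free because the cancelled entry will be represented
  by 0.\<close>

lemma stage_step:
  assumes inv: "stage_inv D D1 A V0 \<omega>0 G p0 \<epsilon> \<rho> (\<lambda>\<iota>. \<rho> \<iota> * \<mu> \<iota>) (m + (r + 2 * k + 3)) i p p' V \<omega>"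
    and M: "m + (r + 2 * k + 3) \<le> M"
    and \<rho>pos: "\<And>\<iota> x. (\<iota>, x) \<in> D \<Longrightarrow> 0 < \<rho> \<iota>" and \<mu>1: "\<And>\<iota> x. (\<iota>, x) \<in> D \<Longrightarrow> 1 \<le> \<mu> \<iota>"
    and p: "\<And>\<iota> x. (\<iota>, x) \<in> D \<Longrightarrow> 0 < p \<iota>" "\<And>\<iota> x. (\<iota>, x) \<in> D \<Longrightarrow> p \<iota> \<le> p0 \<iota>"
       "\<And>\<iota> x. (\<iota>, x) \<in> D \<Longrightarrow> p0 \<iota> \<le> G \<iota>"
    and p': "\<And>\<iota> x. (\<iota>, x) \<in> D \<Longrightarrow> 0 < p' \<iota>" "\<And>\<iota> x. (\<iota>, x) \<in> D \<Longrightarrow> p' \<iota> \<le> p \<iota>"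
       "\<And>\<iota> x. (\<iota>, x) \<in> D \<Longrightarrow> (p \<iota>)\<^sup>2 * \<delta> \<iota> \<le> (p' \<iota>)\<^sup>2"
    and tiny: "\<And>\<iota> x. (\<iota>, x) \<in> D \<Longrightarrow> \<rho> \<iota> ^ r \<le> \<epsilon> \<iota>" "\<And>\<iota> x. (\<iota>, x) \<in> D \<Longrightarrow> \<delta> \<iota> ^ Suc k \<le> \<epsilon> \<iota>"
    and R: "\<And>\<iota> x k. (\<iota>, x) \<in> D \<Longrightarrow> \<bar>x $ k\<bar> \<le> R"
  shows "\<exists>V' \<omega>'. stage_inv D D1 A V0 \<omega>0 G p0 \<epsilon> \<rho> \<mu> m j p' p'' V' \<omega>'"
proof -
  let ?L = "r + 2 * k + 3"
  have sl: "(\<lambda>_. \<lambda>\<iota>. \<rho> \<iota> * \<mu> \<iota>) = slow" by (simp add: slow_def)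
  have nd: "\<rho> \<iota> * \<mu> \<iota> / \<rho> \<iota> = \<mu> \<iota>" if "(\<iota>, x) \<in> D" for \<iota> x using \<rho>pos[OF that] by simp
  note inv' = inv[unfolded stage_inv_def sl]
  have V1: "\<exists>B. SC D slow (Suc (Suc (m + ?L))) B (V c)" and V2: "SC D slow (Suc (m + ?L)) G (pd q (V c))"
    and \<omega>1: "\<exists>B. SC D slow (Suc (Suc (m + ?L))) B (\<omega> c)"
    and bV: "BO D p0 (\<lambda>\<iota> x. V c \<iota> x - V0 c \<iota> x)" "BO D p0 (\<lambda>\<iota> x. pd q (V c) \<iota> x - pd q (V0 c) \<iota> x)"
    and b\<omega>: "BO D (\<lambda>\<iota>. p0 \<iota> * G \<iota>) (\<lambda>\<iota> x. \<omega> c \<iota> x - \<omega>0 c \<iota> x)"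
      "BO D (\<lambda>\<iota>. p0 \<iota> * G \<iota>) (\<lambda>\<iota> x. pd q (\<omega> c) \<iota> x - pd q (\<omega>0 c) \<iota> x)" for c q
    using inv' by blast+
  have V3: "SC D slow (m + ?L) (\<lambda>\<iota>. p \<iota> * \<mu> \<iota> * \<rho> \<iota> ^ (of_bool (q \<noteq> c) + of_bool (q' \<noteq> c))) (pd q' (pd q (V c)))" for c q q'
  proof -
    have "SC D slow (m + ?L) (\<lambda>\<iota>. p \<iota> * (\<rho> \<iota> * \<mu> \<iota> / \<rho> \<iota>) * \<rho> \<iota> ^ (of_bool (q \<noteq> c) + of_bool (q' \<noteq> c))) (pd q' (pd q (V c)))"
      using inv' by blast
    then show ?thesis by (rule SC_weight) (simp add: nd)
  qed
  have b\<omega>3: "BO D (\<lambda>\<iota>. p \<iota> * \<mu> \<iota> * G \<iota>) (\<lambda>\<iota> x. pd q' (pd q (\<omega> c)) \<iota> x - pd q' (pd q (\<omega>0 c)) \<iota> x)" for c q q'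
  proof -
    have "BO D (\<lambda>\<iota>. p \<iota> * (\<rho> \<iota> * \<mu> \<iota> / \<rho> \<iota>) * G \<iota>) (\<lambda>\<iota> x. pd q' (pd q (\<omega> c)) \<iota> x - pd q' (pd q (\<omega>0 c)) \<iota> x)"
      using inv' by blast
    then show ?thesis by (rule BO_mono[where c=1]) (simp_all add: nd)
  qed
  note i10 = inv'[THEN conjunct2, THEN conjunct2, THEN conjunct2, THEN conjunct2, THEN conjunct2, THEN conjunct2,
      THEN conjunct2, THEN conjunct2, THEN conjunct2]
  obtain h h' c where c: "c > 0" and h: "SC D slow (m + ?L) (\<lambda>\<iota>. (p \<iota>)\<^sup>2) h"
    and hc: "\<forall>\<iota> x. (\<iota>, x) \<in> D \<longrightarrow> c * (p \<iota>)\<^sup>2 \<le> h \<iota> x" and h': "SC D slow (m + ?L) (\<lambda>\<iota>. (p' \<iota>)\<^sup>2) h'"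
    and Dold: "BO D1 (\<lambda>\<iota>. (p0 \<iota>)\<^sup>2 * \<epsilon> \<iota>) (\<lambda>\<iota> x. Df A V \<omega> i i \<iota> x - h \<iota> x)"
       "BO D1 (\<lambda>\<iota>. (p0 \<iota>)\<^sup>2 * \<epsilon> \<iota>) (\<lambda>\<iota> x. Df A V \<omega> j j \<iota> x - h' \<iota> x)"
       "BO D1 (\<lambda>\<iota>. (p0 \<iota>)\<^sup>2 * \<epsilon> \<iota>) (Df A V \<omega> i j)" "BO D1 (\<lambda>\<iota>. (p0 \<iota>)\<^sup>2 * \<epsilon> \<iota>) (Df A V \<omega> j i)"
    using i10 ij[symmetric] by blast
  have sn: "\<And>k \<iota> x. (\<iota>, x) \<in> D \<Longrightarrow> 0 \<le> slow k \<iota>" by (rule slow_nonneg)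
  have \<mu>n: "\<And>k \<iota> x. (\<iota>, x) \<in> D \<Longrightarrow> 0 \<le> (\<lambda>_. \<mu>) (k::2) \<iota>" using \<mu> by (simp add: less_imp_le)
  \<comment> \<open>Order budget of one step: \<open>2 * Suc k\<close> for the amplitude iteration,
    \<open>r\<close> for the integrations by parts, and one more.\<close>
  have mL: "(m + r + 1) + 2 * Suc k = m + ?L" by simp
  have po: "\<forall>\<iota> x. (\<iota>, x) \<in> D \<longrightarrow> 0 < p \<iota>" using p(1) by blast
  obtain a \<Psi> where a1: "SC D slow (Suc (Suc (m + r + 1))) (\<lambda>\<iota>. p \<iota> * \<delta> \<iota>) (\<lambda>\<iota> x. a \<iota> x - sqrt (h \<iota> x))"
    and \<Psi>: "\<And>q. SC D slow (Suc (m + r + 1)) (\<lambda>\<iota>. (p \<iota>)\<^sup>2 * \<delta> \<iota>) (\<Psi> q)"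
      "\<And>q q'. SC D slow (m + r + 1) (\<lambda>\<iota>. (p \<iota>)\<^sup>2 * \<delta> \<iota>) (pd q' (\<Psi> q))"
    and eij: "BO D1 (\<lambda>\<iota>. (p \<iota>)\<^sup>2 * \<epsilon> \<iota>) (\<lambda>\<iota> x. (im \<iota>)\<^sup>2 * (pd i a \<iota> x * pd j a \<iota> x) + (pd i (\<Psi> j) \<iota> x + pd j (\<Psi> i) \<iota> x) / 2)"
    and eii: "SC D slow (m + r + 1) (\<lambda>\<iota>. (p \<iota>)\<^sup>2 * \<delta> \<iota> ^ Suc k) (\<lambda>\<iota> x. (a \<iota> x)\<^sup>2 + (im \<iota>)\<^sup>2 * (pd i a \<iota> x)\<^sup>2 + pd i (\<Psi> i) \<iota> x - h \<iota> x)"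
    using amplitude[OF po c hc, where m="m + r + 1" and k=k] h M unfolding mL by auto
  have s: "SC D slow (Suc (Suc (m + r + 1))) p (\<lambda>\<iota> x. sqrt (h \<iota> x))"
    by (rule SC_sqrt[OF SC_order[OF h] c p(1) hc[rule_format] sn]) simp
  have a1': "SC D slow (Suc (Suc (m + r + 1))) p (\<lambda>\<iota> x. a \<iota> x - sqrt (h \<iota> x))"
  proof (rule slow_w[OF a1])
    fix \<iota> x assume "(\<iota>, x) \<in> D"
    then show "p \<iota> * \<delta> \<iota> \<le> p \<iota>" using mult_left_le[OF \<delta>(2) less_imp_le[OF p(1)]] by blast
  qed
  have a: "SC D slow (Suc (Suc (Suc m) + r)) p a"
    using SC_cong[OF SC_add[OF s a1'], where g=a] by (simp add: add.commute add.left_commute)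
  have Bo: "SC D slow (Suc (Suc m) + r) P f" if "SC D slow (m + ?L) P f" for P f by (rule SC_order[OF that]) simp
  have Bii: "SC D slow (Suc (Suc m) + r) (\<lambda>\<iota>. p \<iota> * \<mu> \<iota>) (pd i (pd i (V i)))"
    using Bo[OF V3[where q=i and q'=i and c=i]] by simp
  have Bij: "SC D slow (Suc (Suc m) + r) (\<lambda>\<iota>. p \<iota> * \<mu> \<iota> * \<rho> \<iota>) (\<lambda>\<iota> x. pd i (pd j (V i)) \<iota> x + pd j (pd i (V i)) \<iota> x)"
    by (intro SC_add) (use Bo[OF V3[where q=i and q'=j and c=i]] Bo[OF V3[where q=j and q'=i and c=i]] ij in simp_all)
  have Bjj: "SC D slow (Suc (Suc m) + r) (\<lambda>\<iota>. p \<iota> * \<mu> \<iota> * (\<rho> \<iota>)\<^sup>2) (pd j (pd j (V i)))"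
    using Bo[OF V3[where q=j and q'=j and c=i]] ij by (simp add: power2_eq_square)
  define T where "T = ripple a"
  obtain U where U: "\<And>q. SC D mix (Suc (Suc m)) (\<lambda>\<iota>. im \<iota> * (p \<iota>)\<^sup>2) (U q)"
    and E1: "BO D (\<lambda>\<iota>. (p \<iota>)\<^sup>2 * \<rho> \<iota> ^ r) (\<lambda>\<iota> x. (1/2) * (pd i T \<iota> x)\<^sup>2 - T \<iota> x * pd i (pd i (V i)) \<iota> x + pd i (U i) \<iota> x
       - ((a \<iota> x)\<^sup>2 + (im \<iota>)\<^sup>2 * (pd i a \<iota> x)\<^sup>2))"
    and E2: "BO D (\<lambda>\<iota>. (p \<iota>)\<^sup>2 * \<rho> \<iota> ^ r) (\<lambda>\<iota> x. pd i T \<iota> x * pd j T \<iota> x - T \<iota> x * (pd i (pd j (V i)) \<iota> x + pd j (pd i (V i)) \<iota> x)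
       + pd i (U j) \<iota> x + pd j (U i) \<iota> x - 2 * (im \<iota>)\<^sup>2 * (pd i a \<iota> x * pd j a \<iota> x))"
    and F0: "SC D (\<lambda>_. \<mu>) (Suc m) (\<lambda>\<iota>. (p \<iota>)\<^sup>2 * (\<rho> \<iota>)\<^sup>2)
      (\<lambda>\<iota> x. (1/2) * (pd j T \<iota> x)\<^sup>2 - T \<iota> x * pd j (pd j (V i)) \<iota> x + pd j (U j) \<iota> x)"
    using corrugate[OF a Bii Bij Bjj] unfolding T_def by blast
  \<comment> \<open>What the step leaves in \<open>jj\<close>: the corrugation remainder of size p^2
    \<rho>^2 and the contribution of \<open>\<Psi>\<close> of size p^2 \<delta>, both at most
    p'^2.\<close>
  define F where "F = (\<lambda>\<iota> x. ((1/2) * (pd j T \<iota> x)\<^sup>2 - T \<iota> x * pd j (pd j (V i)) \<iota> x + pd j (U j) \<iota> x) + pd j (\<Psi> j) \<iota> x)"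
  have p'2: "(p \<iota>)\<^sup>2 * (\<rho> \<iota>)\<^sup>2 \<le> (p' \<iota>)\<^sup>2" if "(\<iota>, x) \<in> D" for \<iota> x
    using p'(3)[OF that] mult_left_mono[OF \<delta>(3)[OF that], of "(p \<iota>)\<^sup>2"] by simp
  have F: "SC D (\<lambda>_. \<mu>) m (\<lambda>\<iota>. (p' \<iota>)\<^sup>2) F"
    unfolding F_def
  proof (rule SC_add)
    show "SC D (\<lambda>_. \<mu>) m (\<lambda>\<iota>. (p' \<iota>)\<^sup>2) (\<lambda>\<iota> x. (1/2) * (pd j T \<iota> x)\<^sup>2 - T \<iota> x * pd j (pd j (V i)) \<iota> x + pd j (U j) \<iota> x)"
      by (rule iso_w[OF SC_SucD[OF F0]], rule p'2)
    have "SC D slow m (\<lambda>\<iota>. (p' \<iota>)\<^sup>2) (pd j (\<Psi> j))"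
      by (rule slow_w[OF SC_order[OF \<Psi>(2)]], simp, rule p'(3))
    then show "SC D (\<lambda>_. \<mu>) m (\<lambda>\<iota>. (p' \<iota>)\<^sup>2) (pd j (\<Psi> j))" by (rule slow_iso)
  qed
  have hF: "SC D (\<lambda>_. \<mu>) m (\<lambda>\<iota>. (p' \<iota>)\<^sup>2) (\<lambda>\<iota> x. h' \<iota> x - F \<iota> x)"
    by (rule SC_sub[OF slow_iso[OF SC_order[OF h']] F]) simp
  obtain C where C: "C > 0" "\<And>\<iota> x. (\<iota>, x) \<in> D \<Longrightarrow> \<bar>h' \<iota> x - F \<iota> x\<bar> \<le> C * (p' \<iota>)\<^sup>2"
    using BO_E[OF SC_BO[OF hF]] by blast
  \<comment> \<open>The shift exceeds the bound for \<open>h' - F\<close> by p'^2, which restores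
    the lower bound that the next entry must have. It acts on \<open>jj\<close> only;
    \<open>ii\<close> has just been cancelled.\<close>
  define \<kappa> where "\<kappa> = (\<lambda>q \<iota>. if q = j then (C + 1) * (p' \<iota>)\<^sup>2 else 0)"
  define X where "X = (\<lambda>q \<iota> (x :: real^2). - (\<kappa> q \<iota> * x $ j))"
  \<comment> \<open>The term with \<open>T\<close> times the gradient of \<open>V i\<close> converts
    the mixed terms of the quadratic part into \<open>T\<close> times second derivatives, the form
    expected by \<open>corrugate\<close>.\<close>
  define W where "W = (\<lambda>q \<iota> x. (U q \<iota> x - T \<iota> x * pd q (V i) \<iota> x) + \<Psi> q \<iota> x + X q \<iota> x)"
  define V' where "V' = (\<lambda>c \<iota> x. if c = i then V i \<iota> x + T \<iota> x else V c \<iota> x)"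
  define \<omega>' where "\<omega>' = (\<lambda>q \<iota> x. \<omega> q \<iota> x + W q \<iota> x)"
  have V'i: "V' i = (\<lambda>\<iota> x. V i \<iota> x + T \<iota> x)" by (simp add: V'_def)
  have V'n: "V' c = V c" if "c \<noteq> i" for c using that by (simp add: V'_def)
  have sT: "SC D mix (Suc (Suc m)) (\<lambda>\<iota>. im \<iota> * p \<iota>) T"
    unfolding T_def by (rule SC_order[OF SC_ripple[OF a]]) simp
  have Td: "T \<iota> differentiable (at x)" "pd q T \<iota> differentiable (at x)" if "(\<iota>, x) \<in> D" for \<iota> x q
    using SC_diff[OF sT that] SC_diff[OF SC_pd[OF sT] that] by auto
  have Vd: "V c \<iota> differentiable (at x)" "pd q (V c) \<iota> differentiable (at x)" if "(\<iota>, x) \<in> D" for \<iota> x q c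
    using V1 SC_diff[OF _ that] SC_diff[OF V2 that] by blast+
  have im1: "im \<iota> \<le> 1" "0 \<le> im \<iota>" if "(\<iota>, x) \<in> D" for \<iota> x using \<mu>1[OF that] by (auto simp: im_def divide_le_eq)
  have imm: "im \<iota> * z * \<mu> \<iota> = z" if "(\<iota>, x) \<in> D" for \<iota> x z
  proof -
    have "im \<iota> * z * \<mu> \<iota> = (im \<iota> * \<mu> \<iota>) * z" by simp
    then show ?thesis by (simp add: im_\<mu>[OF that])
  qed
  have G: "0 < G \<iota>" "p \<iota> \<le> G \<iota>" "0 < p0 \<iota>" if "(\<iota>, x) \<in> D" for \<iota> x
    using p(1)[OF that] p(2)[OF that] p(3)[OF that] by linarith+
  have pG: "p \<iota> * G \<iota> \<le> p0 \<iota> * G \<iota>" "(p \<iota>)\<^sup>2 \<le> p0 \<iota> * G \<iota>" "(p' \<iota>)\<^sup>2 \<le> p0 \<iota> * G \<iota>" "(p \<iota>)\<^sup>2 \<le> p \<iota> * G \<iota>" if "(\<iota>, x) \<in> D" for \<iota> x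
  proof -
    note g = G[OF that] p(1)[OF that] p(2)[OF that] p'(1)[OF that] p'(2)[OF that]
    show "p \<iota> * G \<iota> \<le> p0 \<iota> * G \<iota>" using g by (simp add: mult_right_mono)
    moreover show "(p \<iota>)\<^sup>2 \<le> p \<iota> * G \<iota>" using g by (simp add: power2_eq_square mult_left_mono)
    ultimately show 1: "(p \<iota>)\<^sup>2 \<le> p0 \<iota> * G \<iota>" by linarith
    have "(p' \<iota>)\<^sup>2 \<le> (p \<iota>)\<^sup>2" using g by (simp add: power_mono)
    with 1 show "(p' \<iota>)\<^sup>2 \<le> p0 \<iota> * G \<iota>" by linarith
  qed
  have UT: "SC D (\<lambda>_. \<mu>) (Suc (Suc m)) (\<lambda>\<iota>. im \<iota> * (p \<iota> * G \<iota>)) (\<lambda>\<iota> x. U q \<iota> x - T \<iota> x * pd q (V i) \<iota> x)" for q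
  proof (rule SC_sub)
    show "SC D (\<lambda>_. \<mu>) (Suc (Suc m)) (\<lambda>\<iota>. im \<iota> * (p \<iota> * G \<iota>)) (U q)"
      by (rule iso_w[OF mix_iso[OF U]]) (auto intro!: mult_left_mono pG im1)
    have "SC D (\<lambda>_. \<mu>) (Suc (Suc m)) G (pd q (V i))"
      by (rule slow_iso[OF SC_order[OF V2]]) simp
    then show "SC D (\<lambda>_. \<mu>) (Suc (Suc m)) (\<lambda>\<iota>. im \<iota> * (p \<iota> * G \<iota>)) (\<lambda>\<iota> x. T \<iota> x * pd q (V i) \<iota> x)"
      by (rule SC_weight[OF SC_mult[OF mix_iso[OF sT]]]) simp
  qed
  have s\<Psi>: "SC D (\<lambda>_. \<mu>) (Suc (Suc m)) (\<lambda>\<iota>. (p \<iota>)\<^sup>2 * \<delta> \<iota>) (\<Psi> q)" for q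
    by (rule slow_iso[OF SC_order[OF \<Psi>(1)]]) simp
  have sX: "SC D (\<lambda>_. \<mu>) n (\<lambda>\<iota>. \<bar>\<kappa> q \<iota>\<bar> * (R + 1)) (X q)" for q n
    unfolding X_def by (intro SC_minus SC_cmult SC_coord[OF odom]) (use \<mu>1 R in auto)
  have sUP: "\<exists>B. SC D (\<lambda>_. \<mu>) (Suc (Suc m)) B (\<lambda>\<iota> x. (U q \<iota> x - T \<iota> x * pd q (V i) \<iota> x) + \<Psi> q \<iota> x)" for q
    using SC_add_ex[of D "\<lambda>_. \<mu>" "Suc (Suc m)"] UT s\<Psi> \<mu>n by blast
  have sW: "\<exists>B. SC D (\<lambda>_. \<mu>) (Suc (Suc m)) B (W q)" for q
    unfolding W_def by (rule SC_add_ex[OF sUP], rule exI, rule sX) (use \<mu>n in auto)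
  have s\<omega>: "\<exists>B. SC D (\<lambda>_. \<mu>) (Suc (Suc m)) B (\<omega> q)" for q
    using \<omega>1[of q] slow_iso[OF SC_order, of "Suc (Suc (m + ?L))" _ "\<omega> q" "Suc (Suc m)"] by auto
  have s\<omega>': "\<exists>B. SC D (\<lambda>_. \<mu>) (Suc (Suc m)) B (\<omega>' q)" for q
    unfolding \<omega>'_def by (rule SC_add_ex[OF s\<omega> sW]) (use \<mu>n in auto)
  \<comment> \<open>The weights contain \<open>G\<close> because \<open>W\<close> includes
    \<open>T\<close> times the gradient of \<open>V i\<close>, which is bounded but not
    small.\<close>
  have W2: "BO D (\<lambda>\<iota>. p0 \<iota> * G \<iota>) (W q)" "BO D (\<lambda>\<iota>. p0 \<iota> * G \<iota>) (pd s (W q))"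
      "BO D (\<lambda>\<iota>. p \<iota> * \<mu> \<iota> * G \<iota>) (pd t (pd s (W q)))" 
    and pW: "\<And>\<iota> x. (\<iota>, x) \<in> D \<Longrightarrow> pd s (W q) \<iota> x = (pd s (U q) \<iota> x - (T \<iota> x * pd s (pd q (V i)) \<iota> x + pd s T \<iota> x * pd q (V i) \<iota> x))
        + pd s (\<Psi> q) \<iota> x - (if s = j then \<kappa> q \<iota> else 0)" for q s t
  proof -
    let ?Z = "\<lambda>\<iota> x. U q \<iota> x - T \<iota> x * pd q (V i) \<iota> x"
    have X: "pd s (X q) \<iota> x = - (if s = j then \<kappa> q \<iota> else 0)" for \<iota> x s
      using pd_coord[of s "\<lambda>\<iota>. - \<kappa> q \<iota>" j \<iota> x] by (simp add: X_def)
    have Xf: "pd s (X q) = (\<lambda>\<iota> x. - (if s = j then \<kappa> q \<iota> else 0))" for s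
      by (intro ext) (rule X)
    obtain BU where BU: "SC D (\<lambda>_. \<mu>) (Suc (Suc m)) BU (\<lambda>\<iota> x. ?Z \<iota> x + \<Psi> q \<iota> x)" using sUP by blast
    have w1: "pd s (W q) \<iota> x = pd s ?Z \<iota> x + pd s (\<Psi> q) \<iota> x + pd s (X q) \<iota> x" if a: "(\<iota>, x) \<in> D" for \<iota> x s
    proof -
      have "pd s (W q) \<iota> x = pd s (\<lambda>\<iota> x. ?Z \<iota> x + \<Psi> q \<iota> x) \<iota> x + pd s (X q) \<iota> x"
        unfolding W_def by (rule pd_add[where f="\<lambda>\<iota> x. ?Z \<iota> x + \<Psi> q \<iota> x" and g="X q", OF SC_diff[OF BU a] SC_diff[OF sX a]])
      also have "pd s (\<lambda>\<iota> x. ?Z \<iota> x + \<Psi> q \<iota> x) \<iota> x = pd s ?Z \<iota> x + pd s (\<Psi> q) \<iota> x"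
        by (rule pd_add[where f="?Z" and g="\<Psi> q", OF SC_diff[OF UT a] SC_diff[OF s\<Psi> a]])
      finally show ?thesis .
    qed
    have w2: "pd t (pd s (W q)) \<iota> x = pd t (pd s ?Z) \<iota> x + pd t (pd s (\<Psi> q)) \<iota> x" if a: "(\<iota>, x) \<in> D" for \<iota> x s t
    proof -
      have "pd t (pd s (W q)) \<iota> x = pd t (pd s (\<lambda>\<iota> x. ?Z \<iota> x + \<Psi> q \<iota> x)) \<iota> x + pd t (pd s (X q)) \<iota> x"
        unfolding W_def by (rule pd_pd_add[OF BU sX a])
      also have "pd t (pd s (\<lambda>\<iota> x. ?Z \<iota> x + \<Psi> q \<iota> x)) \<iota> x = pd t (pd s ?Z) \<iota> x + pd t (pd s (\<Psi> q)) \<iota> x"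
        by (rule pd_pd_add[OF UT s\<Psi> a])
      finally show ?thesis unfolding Xf by simp
    qed
    have \<delta>p: "(p \<iota>)\<^sup>2 * \<delta> \<iota> \<le> (p \<iota>)\<^sup>2" if "(\<iota>, x) \<in> D" for \<iota> x by (rule mult_left_le[OF \<delta>(2)[OF that]]) simp
    have \<kappa>le: "\<bar>\<kappa> q \<iota>\<bar> \<le> (C + 1) * (p0 \<iota> * G \<iota>)" if "(\<iota>, x) \<in> D" for \<iota> x
    proof -
      have "(C + 1) * (p' \<iota>)\<^sup>2 \<le> (C + 1) * (p0 \<iota> * G \<iota>)" by (rule mult_left_mono[OF pG(3)[OF that]]) (use C in simp)
      moreover have "0 \<le> (C + 1) * (p' \<iota>)\<^sup>2" using C by simp
      ultimately show ?thesis unfolding \<kappa>_def by simp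
    qed
    have R0: "0 \<le> R" if "(\<iota>, x) \<in> D" for \<iota> x using R[OF that, of 1] by linarith
    have bX: "BO D (\<lambda>\<iota>. p0 \<iota> * G \<iota>) (X q)"
    proof (rule BO_mono[OF SC_BO[OF sX[where n=0]], of "(C + 1) * (\<bar>R\<bar> + 1)"])
      fix \<iota> x assume a: "(\<iota>, x) \<in> D"
      have "\<bar>\<kappa> q \<iota>\<bar> * (R + 1) \<le> ((C + 1) * (p0 \<iota> * G \<iota>)) * (\<bar>R\<bar> + 1)"
        by (rule mult_mono[OF \<kappa>le[OF a]]) (use R0[OF a] C G[OF a] in auto)
      then show "\<bar>\<kappa> q \<iota>\<bar> * (R + 1) \<le> (C + 1) * (\<bar>R\<bar> + 1) * (p0 \<iota> * G \<iota>)" by (simp add: mult_ac)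
    qed (use C in simp)
    have bX1: "BO D (\<lambda>\<iota>. p0 \<iota> * G \<iota>) (pd s (X q))" for s
    proof (rule BO_I[of "C + 1"])
      fix \<iota> x assume a: "(\<iota>, x) \<in> D"
      show "\<bar>pd s (X q) \<iota> x\<bar> \<le> (C + 1) * (p0 \<iota> * G \<iota>)"
        unfolding X using \<kappa>le[OF a] C G[OF a] by auto
    qed (use C in simp)
    have bZ: "BO D (\<lambda>\<iota>. p0 \<iota> * G \<iota>) ?Z"
    proof (rule BO_mono[OF SC_BO[OF UT], of 1])
      fix \<iota> x assume a: "(\<iota>, x) \<in> D"
      have "im \<iota> * (p \<iota> * G \<iota>) \<le> 1 * (p \<iota> * G \<iota>)"
        by (rule mult_right_mono) (use im1[OF a] p(1)[OF a] G[OF a] in auto)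
      then show "im \<iota> * (p \<iota> * G \<iota>) \<le> 1 * (p0 \<iota> * G \<iota>)" using pG(1)[OF a] by simp
    qed simp
    have bZ1: "BO D (\<lambda>\<iota>. p0 \<iota> * G \<iota>) (pd s ?Z)" for s
      by (rule BO_mono[OF SC_BO[OF SC_pd[OF UT]], of 1]) (auto simp: imm pG)
    have bZ2: "BO D (\<lambda>\<iota>. p \<iota> * \<mu> \<iota> * G \<iota>) (pd t (pd s ?Z))" for s t
    proof (rule BO_mono[OF SC_BO[OF SC_pd[OF SC_pd[OF UT]]], of 1])
      fix \<iota> x assume a: "(\<iota>, x) \<in> D"
      show "im \<iota> * (p \<iota> * G \<iota>) * \<mu> \<iota> * \<mu> \<iota> \<le> 1 * (p \<iota> * \<mu> \<iota> * G \<iota>)"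
        unfolding imm[OF a] by (simp add: mult_ac)
    qed simp
    have b\<Psi>: "BO D (\<lambda>\<iota>. p0 \<iota> * G \<iota>) (\<Psi> q)" "BO D (\<lambda>\<iota>. p0 \<iota> * G \<iota>) (pd s (\<Psi> q))" for s
      using order_trans[OF \<delta>p pG(2)]
      by (auto intro!: BO_mono[OF SC_BO[OF \<Psi>(1)], of 1] BO_mono[OF SC_BO[OF \<Psi>(2)], of 1])
    have b\<Psi>2: "BO D (\<lambda>\<iota>. p \<iota> * \<mu> \<iota> * G \<iota>) (pd t (pd s (\<Psi> q)))" for s t
    proof (rule BO_mono[where c=1])
      show "BO D (\<lambda>\<iota>. (p \<iota>)\<^sup>2 * \<delta> \<iota> * slow t \<iota>) (pd t (pd s (\<Psi> q)))"
        using SC_BO[OF SC_pd[of D slow "m + r" _ "pd s (\<Psi> q)" t]] \<Psi>(2)[of s q] by simp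
      fix \<iota> x assume a: "(\<iota>, x) \<in> D"
      have "(p \<iota>)\<^sup>2 * \<delta> \<iota> * slow t \<iota> \<le> (p \<iota> * G \<iota>) * \<mu> \<iota>"
        by (rule mult_mono) (use order_trans[OF \<delta>p[OF a] pG(4)[OF a]] \<rho>\<mu>_le[OF a] sn[OF a] p(1)[OF a] G[OF a] in \<open>auto simp: slow_def\<close>)
      then show "(p \<iota>)\<^sup>2 * \<delta> \<iota> * slow t \<iota> \<le> 1 * (p \<iota> * \<mu> \<iota> * G \<iota>)" by (simp add: mult_ac)
    qed simp
    show "BO D (\<lambda>\<iota>. p0 \<iota> * G \<iota>) (W q)" unfolding W_def by (intro BO_add bZ b\<Psi> bX)
    show "BO D (\<lambda>\<iota>. p0 \<iota> * G \<iota>) (pd s (W q))" for s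
      by (rule BO_cong[OF BO_add[OF BO_add[OF bZ1 b\<Psi>(2)] bX1] w1])
    show "BO D (\<lambda>\<iota>. p \<iota> * \<mu> \<iota> * G \<iota>) (pd t (pd s (W q)))" for s t
      by (rule BO_cong[OF BO_add[OF bZ2 b\<Psi>2] w2])
    show "pd s (W q) \<iota> x = (pd s (U q) \<iota> x - (T \<iota> x * pd s (pd q (V i)) \<iota> x + pd s T \<iota> x * pd q (V i) \<iota> x))
        + pd s (\<Psi> q) \<iota> x - (if s = j then \<kappa> q \<iota> else 0)" if a: "(\<iota>, x) \<in> D" for \<iota> x
      unfolding w1[OF a] X using SC_diff[OF U a] Td[OF a] Vd[OF a] by (simp add: pds difs)
  qed
  have pV'i: "pd q (V' i) \<iota> x = pd q (V i) \<iota> x + pd q T \<iota> x" if "(\<iota>, x) \<in> D" for \<iota> x q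
    unfolding V'i by (rule pd_add[where f="V i" and g=T, OF Vd(1)[OF that] Td(1)[OF that]])
  \<comment> \<open>This makes second derivatives of size p \<mu> admissible for the next step,
    whose bound is p' \<mu> / \<rho>.\<close>
  have pp: "p \<iota> * \<rho> \<iota> \<le> p' \<iota>" if "(\<iota>, x) \<in> D" for \<iota> x
    using p'2[OF that] p'(1)[OF that] power2_le_imp_le[of "p \<iota> * \<rho> \<iota>" "p' \<iota>"] by (simp add: power_mult_distrib)
  have pp\<mu>: "p \<iota> * \<mu> \<iota> \<le> p' \<iota> * (\<mu> \<iota> / \<rho> \<iota>)" if "(\<iota>, x) \<in> D" for \<iota> x
    using mult_right_mono[OF pp[OF that], of "\<mu> \<iota>"] \<mu>[OF that] \<rho>pos[OF that] by (simp add: field_simps)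
  have sT1: "SC D (\<lambda>_. \<mu>) (Suc m) p (pd q T)" for q
  proof (rule iso_w[OF mix_iso[OF SC_pd[OF sT]]])
    fix \<iota> x assume a: "(\<iota>, x) \<in> D"
    have "im \<iota> * p \<iota> * mix q \<iota> \<le> im \<iota> * p \<iota> * \<mu> \<iota>"
      by (rule mult_left_mono) (use \<rho>\<mu>_le[OF a] im1[OF a] p(1)[OF a] in \<open>auto simp: mix_def\<close>)
    then show "im \<iota> * p \<iota> * mix q \<iota> \<le> p \<iota>" by (simp add: imm[OF a])
  qed
  have sT2: "SC D (\<lambda>_. \<mu>) m (\<lambda>\<iota>. p' \<iota> * (\<mu> \<iota> / \<rho> \<iota>) * \<rho> \<iota> ^ (of_bool (q \<noteq> i) + of_bool (s \<noteq> i))) (pd s (pd q T))" for q s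
  proof (rule iso_w[OF mix_iso[OF SC_pd[OF SC_pd[OF sT]]]])
    fix \<iota> x assume a: "(\<iota>, x) \<in> D"
    have mx: "mix q \<iota> = \<mu> \<iota> * \<rho> \<iota> ^ of_bool (q \<noteq> i)" for q by (simp add: mix_def mult.commute)
    have "im \<iota> * p \<iota> * mix q \<iota> * mix s \<iota> = (im \<iota> * p \<iota> * \<mu> \<iota>) * \<mu> \<iota> * \<rho> \<iota> ^ (of_bool (q \<noteq> i) + of_bool (s \<noteq> i))"
      unfolding mx power_add by (simp only: mult_ac)
    also have "\<dots> = p \<iota> * \<mu> \<iota> * \<rho> \<iota> ^ (of_bool (q \<noteq> i) + of_bool (s \<noteq> i))" unfolding imm[OF a] ..
    also have "\<dots> \<le> p' \<iota> * (\<mu> \<iota> / \<rho> \<iota>) * \<rho> \<iota> ^ (of_bool (q \<noteq> i) + of_bool (s \<noteq> i))"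
      by (rule mult_right_mono[OF pp\<mu>[OF a]]) (use \<rho>(1)[OF a] in simp)
    finally show "im \<iota> * p \<iota> * mix q \<iota> * mix s \<iota> \<le> p' \<iota> * (\<mu> \<iota> / \<rho> \<iota>) * \<rho> \<iota> ^ (of_bool (q \<noteq> i) + of_bool (s \<noteq> i))" .
  qed
  have V3': "SC D (\<lambda>_. \<mu>) m (\<lambda>\<iota>. p' \<iota> * (\<mu> \<iota> / \<rho> \<iota>) * \<rho> \<iota> ^ (of_bool (q \<noteq> c) + of_bool (s \<noteq> c))) (pd s (pd q (V c)))" for q s c
  proof (rule iso_w[OF slow_iso[OF SC_order[OF V3]]])
    fix \<iota> x assume a: "(\<iota>, x) \<in> D"
    show "p \<iota> * \<mu> \<iota> * \<rho> \<iota> ^ (of_bool (q \<noteq> c) + of_bool (s \<noteq> c)) \<le> p' \<iota> * (\<mu> \<iota> / \<rho> \<iota>) * \<rho> \<iota> ^ (of_bool (q \<noteq> c) + of_bool (s \<noteq> c))"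
      by (rule mult_right_mono[OF pp\<mu>[OF a]]) (use \<rho>(1)[OF a] in simp)
  qed simp
  have I1: "\<exists>B. SC D (\<lambda>_. \<mu>) (Suc (Suc m)) B (V' c)" for c
  proof -
    have v: "\<exists>B. SC D (\<lambda>_. \<mu>) (Suc (Suc m)) B (V c)" for c
      using V1[of c] slow_iso[OF SC_order, of "Suc (Suc (m + ?L))" _ "V c" "Suc (Suc m)"] by auto
    show ?thesis
    proof (cases "c = i")
      case True
      show ?thesis unfolding True V'i by (rule SC_add_ex[OF v]) (use mix_iso[OF sT] \<mu>n in auto)
    qed (simp add: V'n v)
  qed
  have I2: "SC D (\<lambda>_. \<mu>) (Suc m) G (pd q (V' c))" for c q
  proof -
    have v: "SC D (\<lambda>_. \<mu>) (Suc m) G (pd q (V c))" for c by (rule slow_iso[OF SC_order[OF V2]]) simp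
    show ?thesis
    proof (cases "c = i")
      case True
      have "SC D (\<lambda>_. \<mu>) (Suc m) G (pd q T)" by (rule iso_w[OF sT1]) (rule G(2))
      from SC_cong[OF SC_add[OF v[of i] this] pV'i] show ?thesis unfolding True .
    qed (simp add: V'n v)
  qed
  have I3: "SC D (\<lambda>_. \<mu>) m (\<lambda>\<iota>. p' \<iota> * (\<mu> \<iota> / \<rho> \<iota>) * \<rho> \<iota> ^ (of_bool (q \<noteq> c) + of_bool (s \<noteq> c))) (pd s (pd q (V' c)))" for q s c
  proof (cases "c = i")
    case True
    obtain B where B: "SC D slow (Suc (Suc (m + ?L))) B (V i)" using V1 by blast
    show ?thesis unfolding True
    proof (rule SC_cong[OF SC_add[OF V3' sT2]])
      show "pd s (pd q (V' i)) \<iota> x = pd s (pd q (V i)) \<iota> x + pd s (pd q T) \<iota> x" if "(\<iota>, x) \<in> D" for \<iota> x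
        unfolding V'i by (rule pd_pd_add[OF B sT that])
    qed
  next
    case False
    show ?thesis unfolding V'n[OF False] by (rule V3')
  qed
  have I5: "BO D p0 (\<lambda>\<iota> x. V' c \<iota> x - V0 c \<iota> x)" "BO D p0 (\<lambda>\<iota> x. pd q (V' c) \<iota> x - pd q (V0 c) \<iota> x)" for c q
  proof -
    have t0: "BO D p0 T"
    proof (rule BO_mono[OF SC_BO[OF sT], of 1])
      fix \<iota> x assume a: "(\<iota>, x) \<in> D"
      show "im \<iota> * p \<iota> \<le> 1 * p0 \<iota>"
        using mult_right_mono[OF im1(1)[OF a] less_imp_le[OF p(1)[OF a]]] p(2)[OF a] by simp
    qed simp
    have t1: "BO D p0 (pd q T)" by (rule BO_mono[OF SC_BO[OF sT1], of 1]) (use p(2) in auto)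
    show "BO D p0 (\<lambda>\<iota> x. V' c \<iota> x - V0 c \<iota> x)"
      by (cases "c = i", rule BO_cong[OF BO_add[OF bV(1) t0]]) (auto simp: V'_def bV)
    show "BO D p0 (\<lambda>\<iota> x. pd q (V' c) \<iota> x - pd q (V0 c) \<iota> x)"
    proof (cases "c = i")
      case True
      show ?thesis unfolding True
        by (rule BO_cong[OF BO_add[OF bV(2)[of q i] t1]]) (simp add: pV'i)
    qed (simp add: V'n bV)
  qed
  have p\<omega>': "pd q (\<omega>' c) \<iota> x = pd q (\<omega> c) \<iota> x + pd q (W c) \<iota> x" if a: "(\<iota>, x) \<in> D" for \<iota> x q c
  proof -
    obtain B B' where "SC D (\<lambda>_. \<mu>) (Suc (Suc m)) B (\<omega> c)" "SC D (\<lambda>_. \<mu>) (Suc (Suc m)) B' (W c)" using s\<omega> sW by blast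
    from SC_diff[OF this(1) a] SC_diff[OF this(2) a] show ?thesis
      unfolding \<omega>'_def by (rule pd_add[where f="\<omega> c" and g="W c"])
  qed
  have pp\<omega>': "pd t (pd q (\<omega>' c)) \<iota> x = pd t (pd q (\<omega> c)) \<iota> x + pd t (pd q (W c)) \<iota> x" if a: "(\<iota>, x) \<in> D" for \<iota> x q c t
  proof -
    obtain B B' where "SC D (\<lambda>_. \<mu>) (Suc (Suc m)) B (\<omega> c)" "SC D (\<lambda>_. \<mu>) (Suc (Suc m)) B' (W c)" using s\<omega> sW by blast
    from pd_pd_add[OF this a] show ?thesis unfolding \<omega>'_def .
  qed
  have I7: "BO D (\<lambda>\<iota>. p0 \<iota> * G \<iota>) (\<lambda>\<iota> x. \<omega>' c \<iota> x - \<omega>0 c \<iota> x)"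
     "BO D (\<lambda>\<iota>. p0 \<iota> * G \<iota>) (\<lambda>\<iota> x. pd q (\<omega>' c) \<iota> x - pd q (\<omega>0 c) \<iota> x)"
     "BO D (\<lambda>\<iota>. p' \<iota> * (\<mu> \<iota> / \<rho> \<iota>) * G \<iota>) (\<lambda>\<iota> x. pd t (pd q (\<omega>' c)) \<iota> x - pd t (pd q (\<omega>0 c)) \<iota> x)" for c q t
  proof -
    show "BO D (\<lambda>\<iota>. p0 \<iota> * G \<iota>) (\<lambda>\<iota> x. \<omega>' c \<iota> x - \<omega>0 c \<iota> x)"
      by (rule BO_cong[OF BO_add[OF b\<omega>(1)[where c=c] W2(1)[where q=c]]]) (simp add: \<omega>'_def)
    show "BO D (\<lambda>\<iota>. p0 \<iota> * G \<iota>) (\<lambda>\<iota> x. pd q (\<omega>' c) \<iota> x - pd q (\<omega>0 c) \<iota> x)"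
      by (rule BO_cong[OF BO_add[OF b\<omega>(2)[where c=c and q=q] W2(2)[where q=c and s=q]]]) (simp add: p\<omega>')
    have "BO D (\<lambda>\<iota>. p \<iota> * \<mu> \<iota> * G \<iota>) (\<lambda>\<iota> x. pd t (pd q (\<omega>' c)) \<iota> x - pd t (pd q (\<omega>0 c)) \<iota> x)"
      by (rule BO_cong[OF BO_add[OF b\<omega>3[where c=c and q=q and q'=t] W2(3)[where q=c and s=q and t=t]]]) (simp add: pp\<omega>')
    then show "BO D (\<lambda>\<iota>. p' \<iota> * (\<mu> \<iota> / \<rho> \<iota>) * G \<iota>) (\<lambda>\<iota> x. pd t (pd q (\<omega>' c)) \<iota> x - pd t (pd q (\<omega>0 c)) \<iota> x)"
    proof (rule BO_mono[where c=1])
      fix \<iota> x assume a: "(\<iota>, x) \<in> D"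
      show "p \<iota> * \<mu> \<iota> * G \<iota> \<le> 1 * (p' \<iota> * (\<mu> \<iota> / \<rho> \<iota>) * G \<iota>)"
        using mult_right_mono[OF pp\<mu>[OF a] less_imp_le[OF G(1)[OF a]]] by simp
    qed simp
  qed
  have sum2: "(\<Sum>c\<in>UNIV. f c) = f i + f j" for f :: "2 \<Rightarrow> real"
  proof -
    have u: "(UNIV :: 2 set) = {i, j}" using UNIV_2_pair[OF ij] by blast
    show ?thesis unfolding u using ij by (subst sum.insert) auto
  qed
  have Df': "Df A V' \<omega>' q s \<iota> x = Df A V \<omega> q s \<iota> x
      - ((1/2) * (pd q T \<iota> x * pd s T \<iota> x) - (1/2) * (T \<iota> x * (pd q (pd s (V i)) \<iota> x + pd s (pd q (V i)) \<iota> x))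
        + (1/2) * (pd q (U s) \<iota> x + pd s (U q) \<iota> x) + (1/2) * (pd q (\<Psi> s) \<iota> x + pd s (\<Psi> q) \<iota> x)
        - (1/2) * ((if q = j then \<kappa> s \<iota> else 0) + (if s = j then \<kappa> q \<iota> else 0)))"
    if a: "(\<iota>, x) \<in> D" for \<iota> x q s
    unfolding Df_def sum2 p\<omega>'[OF a] pW[OF a] pV'i[OF a] V'n[OF ij[symmetric]]
    by (simp add: algebra_simps add_divide_distrib diff_divide_distrib)
  have tw: "BO D1 (\<lambda>\<iota>. (p0 \<iota>)\<^sup>2 * \<epsilon> \<iota>) f" if "BO D1 (\<lambda>\<iota>. (p \<iota>)\<^sup>2 * z \<iota>) f" "\<forall>\<iota> x. (\<iota>, x) \<in> D \<longrightarrow> z \<iota> \<le> \<epsilon> \<iota>" for f z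
  proof (rule BO_mono[OF that(1), of 1])
    fix \<iota> x assume "(\<iota>, x) \<in> D1"
    then have a: "(\<iota>, x) \<in> D" using D1 by blast
    have "(p \<iota>)\<^sup>2 * z \<iota> \<le> (p \<iota>)\<^sup>2 * \<epsilon> \<iota>" by (rule mult_left_mono[OF that(2)[rule_format, OF a] zero_le_power2])
    also have "\<dots> \<le> (p0 \<iota>)\<^sup>2 * \<epsilon> \<iota>"
      by (rule mult_right_mono[OF _ \<epsilon>[OF a]]) (use p(1)[OF a] p(2)[OF a] in \<open>simp add: power_mono\<close>)
    finally show "(p \<iota>)\<^sup>2 * z \<iota> \<le> 1 * ((p0 \<iota>)\<^sup>2 * \<epsilon> \<iota>)" by simp
  qed simp
  have t\<rho>: "\<forall>\<iota> x. (\<iota>, x) \<in> D \<longrightarrow> \<rho> \<iota> ^ r \<le> \<epsilon> \<iota>" and t\<delta>: "\<forall>\<iota> x. (\<iota>, x) \<in> D \<longrightarrow> \<delta> \<iota> ^ Suc k \<le> \<epsilon> \<iota>"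
    and t\<epsilon>: "\<forall>\<iota> x. (\<iota>, x) \<in> D \<longrightarrow> \<epsilon> \<iota> \<le> \<epsilon> \<iota>" using tiny by blast+
  note e1 = tw[OF BO_subset[OF E1 D1] t\<rho>] and e2 = tw[OF BO_subset[OF E2 D1] t\<rho>]
    and e3 = tw[OF eij t\<epsilon>] and e4 = tw[OF BO_subset[OF SC_BO[OF eii] D1] t\<delta>]
  have \<kappa>i: "\<kappa> i = (\<lambda>_. 0)" using ij by (simp add: \<kappa>_def)
  have Jii: "BO D1 (\<lambda>\<iota>. (p0 \<iota>)\<^sup>2 * \<epsilon> \<iota>) (\<lambda>\<iota> x. Df A V' \<omega>' i i \<iota> x - 0)"
  proof (rule BO_cong[OF BO_diff[OF Dold(1) BO_add[OF e1 e4]]])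
    fix \<iota> x assume "(\<iota>, x) \<in> D1"
    then have a: "(\<iota>, x) \<in> D" using D1 by blast
    show "Df A V' \<omega>' i i \<iota> x - 0 = Df A V \<omega> i i \<iota> x - h \<iota> x
      - ((1/2) * (pd i T \<iota> x)\<^sup>2 - T \<iota> x * pd i (pd i (V i)) \<iota> x + pd i (U i) \<iota> x - ((a \<iota> x)\<^sup>2 + (im \<iota>)\<^sup>2 * (pd i a \<iota> x)\<^sup>2)
        + ((a \<iota> x)\<^sup>2 + (im \<iota>)\<^sup>2 * (pd i a \<iota> x)\<^sup>2 + pd i (\<Psi> i) \<iota> x - h \<iota> x))"
      unfolding Df'[OF a] using ij by (simp add: power2_eq_square algebra_simps)
  qed
  have Jij: "BO D1 (\<lambda>\<iota>. (p0 \<iota>)\<^sup>2 * \<epsilon> \<iota>) (Df A V' \<omega>' i j)"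
  proof (rule BO_cong[OF BO_diff[OF Dold(3) BO_add[OF BO_scale[OF e2, of "1/2"] e3]]])
    fix \<iota> x assume "(\<iota>, x) \<in> D1"
    then have a: "(\<iota>, x) \<in> D" using D1 by blast
    show "Df A V' \<omega>' i j \<iota> x = Df A V \<omega> i j \<iota> x
      - (1/2 * (pd i T \<iota> x * pd j T \<iota> x - T \<iota> x * (pd i (pd j (V i)) \<iota> x + pd j (pd i (V i)) \<iota> x)
         + pd i (U j) \<iota> x + pd j (U i) \<iota> x - 2 * (im \<iota>)\<^sup>2 * (pd i a \<iota> x * pd j a \<iota> x))
       + ((im \<iota>)\<^sup>2 * (pd i a \<iota> x * pd j a \<iota> x) + (pd i (\<Psi> j) \<iota> x + pd j (\<Psi> i) \<iota> x) / 2))"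
      unfolding Df'[OF a] \<kappa>i using ij by (simp add: algebra_simps add_divide_distrib)
  qed
  have Jji: "BO D1 (\<lambda>\<iota>. (p0 \<iota>)\<^sup>2 * \<epsilon> \<iota>) (Df A V' \<omega>' j i)"
  proof (rule BO_cong[OF BO_diff[OF Dold(4) BO_add[OF BO_scale[OF e2, of "1/2"] e3]]])
    fix \<iota> x assume "(\<iota>, x) \<in> D1"
    then have a: "(\<iota>, x) \<in> D" using D1 by blast
    show "Df A V' \<omega>' j i \<iota> x = Df A V \<omega> j i \<iota> x
      - (1/2 * (pd i T \<iota> x * pd j T \<iota> x - T \<iota> x * (pd i (pd j (V i)) \<iota> x + pd j (pd i (V i)) \<iota> x)
         + pd i (U j) \<iota> x + pd j (U i) \<iota> x - 2 * (im \<iota>)\<^sup>2 * (pd i a \<iota> x * pd j a \<iota> x))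
       + ((im \<iota>)\<^sup>2 * (pd i a \<iota> x * pd j a \<iota> x) + (pd i (\<Psi> j) \<iota> x + pd j (\<Psi> i) \<iota> x) / 2))"
      unfolding Df'[OF a] \<kappa>i using ij by (simp add: algebra_simps add_divide_distrib)
  qed
  define hn where "hn = (\<lambda>\<iota> x. (h' \<iota> x - F \<iota> x) + \<kappa> j \<iota>)"
  have Jjj: "BO D1 (\<lambda>\<iota>. (p0 \<iota>)\<^sup>2 * \<epsilon> \<iota>) (\<lambda>\<iota> x. Df A V' \<omega>' j j \<iota> x - hn \<iota> x)"
  proof (rule BO_cong[OF Dold(2)])
    fix \<iota> x assume "(\<iota>, x) \<in> D1"
    then have a: "(\<iota>, x) \<in> D" using D1 by blast
    show "Df A V' \<omega>' j j \<iota> x - hn \<iota> x = Df A V \<omega> j j \<iota> x - h' \<iota> x"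
      unfolding Df'[OF a] hn_def F_def by (simp add: power2_eq_square algebra_simps)
  qed
  have shn: "SC D (\<lambda>_. \<mu>) m (\<lambda>\<iota>. (p' \<iota>)\<^sup>2) hn"
    unfolding hn_def
  proof (rule SC_add[OF hF])
    have "SC D (\<lambda>_. \<mu>) m (\<lambda>\<iota>. (C + 1) * (p' \<iota>)\<^sup>2) (\<lambda>\<iota> x. \<kappa> j \<iota>)"
      by (rule SC_const[OF odom]) (use \<mu>n C in \<open>auto simp: \<kappa>_def\<close>)
    then show "SC D (\<lambda>_. \<mu>) m (\<lambda>\<iota>. (p' \<iota>)\<^sup>2) (\<lambda>\<iota> x. \<kappa> j \<iota>)"
      by (rule SC_wmono[where c="C + 1"]) (use \<mu>n C in auto)
  qed
  have hnl: "1 * (p' \<iota>)\<^sup>2 \<le> hn \<iota> x" if "(\<iota>, x) \<in> D" for \<iota> x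
    using C(2)[OF that] unfolding hn_def \<kappa>_def by (simp add: algebra_simps abs_le_iff)
  \<comment> \<open>The entry \<open>ii\<close> is of size \<open>\<epsilon>\<close> now, so the
    function 0 represents it and every weight is allowed.\<close>
  have z: "SC D (\<lambda>_. \<mu>) m (\<lambda>\<iota>. (p'' \<iota>)\<^sup>2) (\<lambda>\<iota> x. 0)"
    by (rule SC_const[OF odom, where c="\<lambda>_. 0"]) (use \<mu>n in auto)
  have Jall: "\<forall>j'. j' \<noteq> j \<longrightarrow> BO D1 (\<lambda>\<iota>. (p0 \<iota>)\<^sup>2 * \<epsilon> \<iota>) (\<lambda>\<iota> x. Df A V' \<omega>' j j \<iota> x - hn \<iota> x) \<and>
           BO D1 (\<lambda>\<iota>. (p0 \<iota>)\<^sup>2 * \<epsilon> \<iota>) (\<lambda>\<iota> x. Df A V' \<omega>' j' j' \<iota> x - 0) \<and>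
           BO D1 (\<lambda>\<iota>. (p0 \<iota>)\<^sup>2 * \<epsilon> \<iota>) (Df A V' \<omega>' j j') \<and> BO D1 (\<lambda>\<iota>. (p0 \<iota>)\<^sup>2 * \<epsilon> \<iota>) (Df A V' \<omega>' j' j)"
  proof (intro allI impI)
    fix j' assume "j' \<noteq> j"
    then have "j' = i" using UNIV_2_pair[OF ij, of j'] by blast
    then show "BO D1 (\<lambda>\<iota>. (p0 \<iota>)\<^sup>2 * \<epsilon> \<iota>) (\<lambda>\<iota> x. Df A V' \<omega>' j j \<iota> x - hn \<iota> x) \<and>
           BO D1 (\<lambda>\<iota>. (p0 \<iota>)\<^sup>2 * \<epsilon> \<iota>) (\<lambda>\<iota> x. Df A V' \<omega>' j' j' \<iota> x - 0) \<and>
           BO D1 (\<lambda>\<iota>. (p0 \<iota>)\<^sup>2 * \<epsilon> \<iota>) (Df A V' \<omega>' j j') \<and> BO D1 (\<lambda>\<iota>. (p0 \<iota>)\<^sup>2 * \<epsilon> \<iota>) (Df A V' \<omega>' j' j)"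
      using Jjj Jii Jij Jji by blast
  qed
  have "\<exists>h h' c. c > (0::real) \<and> SC D (\<lambda>_. \<mu>) m (\<lambda>\<iota>. (p' \<iota>)\<^sup>2) h \<and> (\<forall>\<iota> x. (\<iota>, x) \<in> D \<longrightarrow> c * (p' \<iota>)\<^sup>2 \<le> h \<iota> x) \<and>
        SC D (\<lambda>_. \<mu>) m (\<lambda>\<iota>. (p'' \<iota>)\<^sup>2) h' \<and>
        (\<forall>j'. j' \<noteq> j \<longrightarrow> BO D1 (\<lambda>\<iota>. (p0 \<iota>)\<^sup>2 * \<epsilon> \<iota>) (\<lambda>\<iota> x. Df A V' \<omega>' j j \<iota> x - h \<iota> x) \<and>
           BO D1 (\<lambda>\<iota>. (p0 \<iota>)\<^sup>2 * \<epsilon> \<iota>) (\<lambda>\<iota> x. Df A V' \<omega>' j' j' \<iota> x - h' \<iota> x) \<and>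
           BO D1 (\<lambda>\<iota>. (p0 \<iota>)\<^sup>2 * \<epsilon> \<iota>) (Df A V' \<omega>' j j') \<and> BO D1 (\<lambda>\<iota>. (p0 \<iota>)\<^sup>2 * \<epsilon> \<iota>) (Df A V' \<omega>' j' j))"
    by (rule exI[of _ hn], rule exI[of _ "\<lambda>_ _. 0"], rule exI[of _ 1]) (use shn hnl z Jall in simp)
  then have "stage_inv D D1 A V0 \<omega>0 G p0 \<epsilon> \<rho> \<mu> m j p' p'' V' \<omega>'"
    unfolding stage_inv_def by (intro conjI allI I1 I2 I3 s\<omega>' I5 I7) 
  then show ?thesis by blast
qed

end

subsection \<open>Iterating the step\<close>

text \<open>The truncated \<open>n - 1\<close> matters: both diagonal entries start at size p^2, so
  the first corrugation merely brings the second entry to the front and the gain begins with the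
  second corrugation. Thereafter each step multiplies the amplitude by
  \<open>\<rho> * \<tau>\<close> and the frequency by 1 / \<rho>, hence their product by
  \<open>\<tau>\<close>.\<close>

lemma stage_iterate:
  fixes D D1 :: "('i \<times> (real^2)) set" and \<nu>0 p \<rho> \<tau> \<epsilon> :: "'i \<Rightarrow> real"
  defines "pp \<equiv> \<lambda>n \<iota>. p \<iota> * (\<rho> \<iota> * \<tau> \<iota>) ^ (n - 1)" and "\<nu> \<equiv> \<lambda>n \<iota>. \<nu>0 \<iota> / \<rho> \<iota> ^ n"
  assumes D: "odom D" "D1 \<subseteq> D"
    and r\<rho>: "\<And>\<iota>. 0 < \<rho> \<iota>" "\<And>\<iota> x. (\<iota>, x) \<in> D \<Longrightarrow> \<rho> \<iota> \<le> 1"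
    and t\<tau>: "\<And>\<iota> x. (\<iota>, x) \<in> D \<Longrightarrow> 1 \<le> \<tau> \<iota>" "\<And>\<iota> x. (\<iota>, x) \<in> D \<Longrightarrow> \<rho> \<iota> * \<tau> \<iota> \<le> 1"
    and \<nu>0: "\<And>\<iota> x. (\<iota>, x) \<in> D \<Longrightarrow> 1 \<le> \<nu>0 \<iota>"
    and p: "\<And>\<iota> x. (\<iota>, x) \<in> D \<Longrightarrow> 0 < p \<iota>" "\<And>\<iota> x. (\<iota>, x) \<in> D \<Longrightarrow> p \<iota> \<le> G \<iota>"
    and e\<epsilon>: "\<And>\<iota> x. (\<iota>, x) \<in> D \<Longrightarrow> \<rho> \<iota> ^ r \<le> \<epsilon> \<iota>" "\<And>\<iota> x. (\<iota>, x) \<in> D \<Longrightarrow> ((\<rho> \<iota>)\<^sup>2 * (\<tau> \<iota>)\<^sup>2) ^ Suc k \<le> \<epsilon> \<iota>"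
    and R: "\<And>\<iota> x k. (\<iota>, x) \<in> D \<Longrightarrow> \<bar>x $ k\<bar> \<le> R"
    and M: "m + J * (r + 2 * k + 3) \<le> M"
    and dec: "\<And>n. n < J \<Longrightarrow> decomposable D D1 (\<lambda>\<iota>. (\<tau> \<iota>)\<^sup>2) \<epsilon> M (\<lambda>_. \<nu> n)"
    and start: "stage_inv D D1 A V0 \<omega>0 G p \<epsilon> \<rho> \<nu>0 (m + J * (r + 2 * k + 3)) i p p V \<omega>"
  shows "\<exists>i V \<omega>. stage_inv D D1 A V0 \<omega>0 G p \<epsilon> \<rho> (\<nu> J) m i (pp J) (pp (Suc J)) V \<omega>"
proof -
  let ?L = "r + 2 * k + 3"
  have pp0: "pp 0 = p" "pp (Suc 0) = p" and \<nu>00: "\<nu> 0 = \<nu>0" by (simp_all add: pp_def \<nu>_def)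
  have "n \<le> J \<Longrightarrow> \<exists>i V \<omega>. stage_inv D D1 A V0 \<omega>0 G p \<epsilon> \<rho> (\<nu> n) (m + (J - n) * ?L) i (pp n) (pp (Suc n)) V \<omega>" for n
  proof (induction n)
    case 0
    then show ?case using start unfolding pp0 \<nu>00 by auto
  next
    case (Suc n)
    obtain i V \<omega> where IH: "stage_inv D D1 A V0 \<omega>0 G p \<epsilon> \<rho> (\<nu> n) (m + (J - n) * ?L) i (pp n) (pp (Suc n)) V \<omega>"
      using Suc by auto
    obtain j :: 2 where ij: "i \<noteq> j" by (cases "i = 0") (use that[of 0] that[of 1] in auto)
    have \<rho>\<nu>: "(\<lambda>\<iota>. \<rho> \<iota> * \<nu> (Suc n) \<iota>) = \<nu> n"
      using r\<rho>(1) by (intro ext) (simp add: \<nu>_def less_imp_neq[symmetric])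
    have \<nu>1: "1 \<le> \<nu> n \<iota>" if "(\<iota>, x) \<in> D" for n \<iota> x
    proof -
      have "\<rho> \<iota> ^ n \<le> \<nu>0 \<iota>" using power_le_one[of "\<rho> \<iota>" n] r\<rho>(1)[of \<iota>] r\<rho>(2)[OF that] \<nu>0[OF that] by linarith
      then show ?thesis using r\<rho>(1)[of \<iota>] by (simp add: \<nu>_def)
    qed
    have \<rho>\<tau>: "0 \<le> \<rho> \<iota> * \<tau> \<iota>" "(\<rho> \<iota>)\<^sup>2 * (\<tau> \<iota>)\<^sup>2 \<le> 1" if "(\<iota>, x) \<in> D" for \<iota> x
    proof -
      show 0: "0 \<le> \<rho> \<iota> * \<tau> \<iota>" using r\<rho>(1)[of \<iota>] t\<tau>(1)[OF that] by simp
      show "(\<rho> \<iota>)\<^sup>2 * (\<tau> \<iota>)\<^sup>2 \<le> 1"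
        using power_le_one[OF 0 t\<tau>(2)[OF that], of 2] by (simp add: power_mult_distrib)
    qed
    have \<epsilon>0: "0 \<le> \<epsilon> \<iota>" if "(\<iota>, x) \<in> D" for \<iota> x
      using e\<epsilon>(1)[OF that] zero_le_power[of "\<rho> \<iota>" r] r\<rho>(1)[of \<iota>] by linarith
    interpret corrugation D "\<nu> (Suc n)" \<rho> i j
      using D ij r\<rho> \<nu>1[of _ _ "Suc n"] by unfold_locales (auto intro: less_imp_le less_le_trans[OF zero_less_one])
    interpret stage D "\<nu> (Suc n)" \<rho> i j D1 "\<lambda>\<iota>. (\<tau> \<iota>)\<^sup>2" \<epsilon> M
    proof unfold_locales
      show "1 \<le> (\<tau> \<iota>)\<^sup>2" if "(\<iota>, x) \<in> D" for \<iota> x using t\<tau>(1)[OF that] by simp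
      show "decomposable D D1 (\<lambda>\<iota>. (\<tau> \<iota>)\<^sup>2) \<epsilon> M slow"
        unfolding slow_def \<rho>\<nu> using dec[of n] Suc(2) by simp
    qed (use D \<rho>\<tau> \<epsilon>0 in auto)
    have pos: "0 < \<rho> \<iota> * \<tau> \<iota>" if "(\<iota>, x) \<in> D" for \<iota> x using r\<rho>(1)[of \<iota>] t\<tau>(1)[OF that] by simp
    have JL: "m + (J - n) * ?L = (m + (J - Suc n) * ?L) + ?L"
      using Suc(2) by (metis Suc_diff_Suc Suc_le_lessD add.assoc add.commute mult_Suc)
    have le1: "pp n \<iota> \<le> p \<iota>" "0 < pp n \<iota>" if a: "(\<iota>, x) \<in> D" for n \<iota> x
      unfolding pp_def using p(1)[OF a] pos[OF a] t\<tau>(2)[OF a] by (auto intro!: mult_left_le power_le_one)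
    have "\<exists>V' \<omega>'. stage_inv D D1 A V0 \<omega>0 G p \<epsilon> \<rho> (\<nu> (Suc n)) (m + (J - Suc n) * ?L) j (pp (Suc n)) (pp (Suc (Suc n))) V' \<omega>'"
    proof (rule stage_step)
      show "stage_inv D D1 A V0 \<omega>0 G p \<epsilon> \<rho> (\<lambda>\<iota>. \<rho> \<iota> * \<nu> (Suc n) \<iota>) (m + (J - Suc n) * ?L + ?L) i (pp n) (pp (Suc n)) V \<omega>"
        using IH unfolding \<rho>\<nu> JL .
      have "(J - n) * ?L \<le> J * ?L" by (rule mult_right_mono) auto
      then show "m + (J - Suc n) * ?L + ?L \<le> M" using M JL by linarith
      fix \<iota> x assume a: "(\<iota>, x) \<in> D"
      show "0 < \<rho> \<iota>" "1 \<le> \<nu> (Suc n) \<iota>" "0 < pp n \<iota>" "pp n \<iota> \<le> p \<iota>" "p \<iota> \<le> G \<iota>" "0 < pp (Suc n) \<iota>"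
        using r\<rho>(1) \<nu>1[OF a] le1[OF a] p(2)[OF a] by auto
      have "(\<rho> \<iota> * \<tau> \<iota>) ^ n \<le> (\<rho> \<iota> * \<tau> \<iota>) ^ (n - 1)"
        by (rule power_decreasing) (use t\<tau>(2)[OF a] \<rho>\<tau>[OF a] in auto)
      then show "pp (Suc n) \<iota> \<le> pp n \<iota>" unfolding pp_def using p(1)[OF a] by simp
      \<comment> \<open>At the first step both weights are \<open>p\<close> and
        \<open>\<delta>\<close> being at most 1 suffices; afterwards this is an equality, as
        \<open>\<delta>\<close> is (\<rho> \<tau>)^2.\<close>
      show "(pp n \<iota>)\<^sup>2 * \<delta> \<iota> \<le> (pp (Suc n) \<iota>)\<^sup>2"
      proof (cases n)
        case 0
        then show ?thesis using \<rho>\<tau>(2)[OF a] by (simp add: pp_def \<delta>_def mult_left_le)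
      next
        case (Suc n')
        then show ?thesis by (simp add: pp_def \<delta>_def power_mult_distrib mult_ac)
      qed
      show "\<rho> \<iota> ^ r \<le> \<epsilon> \<iota>" "\<delta> \<iota> ^ Suc k \<le> \<epsilon> \<iota>" using e\<epsilon>[OF a] by (simp_all add: \<delta>_def)
      show "\<bar>x $ k\<bar> \<le> R" for k by (rule R[OF a])
    qed
    then show ?case by blast
  qed
  from this[of J] show ?thesis by simp
qed

text \<open>When the centre of a small ball belongs to the index, uniformity in the index is
  uniformity in the centre. For a field that does not depend on the centre, the estimate can then be
  read off at the centre itself.\<close>

lemma SC_pointwise:
  assumes "odom D" "\<And>\<iota> x. (\<iota>, x) \<in> D \<Longrightarrow> 0 < (t \<iota> :: real)"
  shows "SC {((\<iota>, x0), x). (\<iota>, x0) \<in> D \<and> x \<in> ball x0 (t \<iota>)} (\<lambda>k. \<nu> k \<circ> fst) m (P \<circ> fst) (\<lambda>k. f (fst k)) \<Longrightarrow> SC D \<nu> m P f"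
proof (induction m arbitrary: P f)
  let ?D = "{((\<iota>, x0), x). (\<iota>, x0) \<in> D \<and> x \<in> ball x0 (t \<iota>)}"
  have B: "BO D P f" if "BO ?D (P \<circ> fst) (\<lambda>k. f (fst k))" for P and f :: "'a fld"
    using that assms(2) unfolding BO_def by fastforce
  {
    case 0
    have "isCont (f \<iota>) x" if "(\<iota>, x) \<in> D" for \<iota> x
      using SC_isCont[OF 0, of "(\<iota>, x)" x] that assms(2)[OF that] by simp
    then show ?case using B[OF SC_BO[OF 0]] assms(1) by (simp add: SC.simps)
  next
    case (Suc m)
    show ?case
    proof (rule SC_SucI_pd[OF assms(1) B[OF SC_BO[OF Suc(2)]]])
      show "f \<iota> differentiable (at x)" if "(\<iota>, x) \<in> D" for \<iota> x
        using SC_diff[OF Suc(2), of "(\<iota>, x)" x] that assms(2)[OF that] by simp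
      show "SC D \<nu> m (\<lambda>\<iota>. P \<iota> * \<nu> k \<iota>) (pd k f)" for k
      proof (rule Suc.IH)
        have "pd k (\<lambda>k. f (fst k)) = (\<lambda>\<kappa> :: 'a \<times> (real^2). pd k f (fst \<kappa>))" by (simp add: pd_def)
        then show "SC ?D (\<lambda>k. \<nu> k \<circ> fst) m ((\<lambda>\<iota>. P \<iota> * \<nu> k \<iota>) \<circ> fst) (\<lambda>\<kappa>. pd k f (fst \<kappa>))"
          using SC_pd[OF Suc(2), of k] by (simp add: comp_def)
      qed
    qed
  }
qed

text \<open>The commutator does not change when constants are subtracted from \<open>f\<close> and \<open>g\<close>. Taking
  their values at the centre of a small ball, uniformly in that centre, yields the quadratic gain.\<close>

lemma SC_commutator:
  fixes f g :: "'i fld"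
  assumes "odom D" and t: "\<And>\<iota> x. (\<iota>, x) \<in> D \<Longrightarrow> 0 < t \<iota>"
    and c: "\<And>\<iota> x. (\<iota>, x) \<in> D \<Longrightarrow> continuous_on UNIV (f \<iota>)" "\<And>\<iota> x. (\<iota>, x) \<in> D \<Longrightarrow> continuous_on UNIV (g \<iota>)"
    and f: "\<And>\<iota> x y. (\<iota>, x) \<in> D \<Longrightarrow> dist x y \<le> (4 * real m + 1) * t \<iota> \<Longrightarrow> \<bar>f \<iota> y - f \<iota> x\<bar> \<le> P \<iota>"
    and g: "\<And>\<iota> x y. (\<iota>, x) \<in> D \<Longrightarrow> dist x y \<le> (4 * real m + 1) * t \<iota> \<Longrightarrow> \<bar>g \<iota> y - g \<iota> x\<bar> \<le> P \<iota>"
  shows "SC D (\<lambda>_ \<iota>. 1 / t \<iota>) m (\<lambda>\<iota>. (P \<iota>)\<^sup>2)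
    (\<lambda>\<iota> x. moll m (t \<iota>) (\<lambda>y. f \<iota> y * g \<iota> y) x - moll m (t \<iota>) (f \<iota>) x * moll m (t \<iota>) (g \<iota>) x)"
proof -
  let ?E = "{((\<iota>, x0), x). (\<iota>, x0) \<in> D \<and> x \<in> ball x0 (t \<iota>)}"
  let ?f = "\<lambda>(\<iota>, x0) y. f \<iota> y - f \<iota> x0" let ?g = "\<lambda>(\<iota>, x0) y. g \<iota> y - g \<iota> x0"
  have E: "odom ?E"
  proof -
    have "open {x. (\<iota>, x0) \<in> D \<and> x \<in> ball x0 (t \<iota>)}" for \<iota> x0
      by (cases "(\<iota>, x0) \<in> D") (simp_all del: mem_ball)
    then show ?thesis by (auto simp: odom_def)
  qed
  \<comment> \<open>The margin in the hypotheses is the reach \<open>4 * m * t\<close> of the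
    mollification plus the radius \<open>t\<close> of the ball.\<close>
  have near: "dist x0 y \<le> (4 * real m + 1) * t \<iota>" if "((\<iota>, x0), x) \<in> ?E" "dist x y \<le> 4 * real m * t \<iota>" for \<iota> x0 x y
    using that dist_triangle[of x0 y x] by (auto simp: algebra_simps)
  have P0: "0 \<le> P \<iota>" if "(\<iota>, x0) \<in> D" for \<iota> x0 using f[OF that, of x0] t[OF that] by simp
  have S1: "SC ?E (\<lambda>_ k. 1 / (t \<circ> fst) k) m (P \<circ> fst) (\<lambda>k. moll m ((t \<circ> fst) k) (?f k))"
  proof (rule SC_moll[OF E])
    fix k :: "'i \<times> (real^2)" and x assume a: "(k, x) \<in> ?E"
    obtain \<iota> x0 where k: "k = (\<iota>, x0)" by (cases k)
    have D: "(\<iota>, x0) \<in> D" using a k by simp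
    show "0 < (t \<circ> fst) k" using t[OF D] k by simp
    show "continuous_on UNIV (?f k)" unfolding k prod.case by (intro continuous_on_diff c(1)[OF D] continuous_on_const)
    fix y assume "dist x y \<le> 4 * real m * (t \<circ> fst) k"
    then show "\<bar>?f k y\<bar> \<le> (P \<circ> fst) k" unfolding k using f[OF D near[of \<iota> x0 x y]] a k by simp
  qed
  have S2: "SC ?E (\<lambda>_ k. 1 / (t \<circ> fst) k) m (P \<circ> fst) (\<lambda>k. moll m ((t \<circ> fst) k) (?g k))"
  proof (rule SC_moll[OF E])
    fix k :: "'i \<times> (real^2)" and x assume a: "(k, x) \<in> ?E"
    obtain \<iota> x0 where k: "k = (\<iota>, x0)" by (cases k)
    have D: "(\<iota>, x0) \<in> D" using a k by simp
    show "0 < (t \<circ> fst) k" using t[OF D] k by simp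
    show "continuous_on UNIV (?g k)" unfolding k prod.case by (intro continuous_on_diff c(2)[OF D] continuous_on_const)
    fix y assume "dist x y \<le> 4 * real m * (t \<circ> fst) k"
    then show "\<bar>?g k y\<bar> \<le> (P \<circ> fst) k" unfolding k using g[OF D near[of \<iota> x0 x y]] a k by simp
  qed
  have S3: "SC ?E (\<lambda>_ k. 1 / (t \<circ> fst) k) m (\<lambda>k. (P \<circ> fst) k * (P \<circ> fst) k) (\<lambda>k. moll m ((t \<circ> fst) k) (\<lambda>y. ?f k y * ?g k y))"
  proof (rule SC_moll[OF E])
    fix k :: "'i \<times> (real^2)" and x assume a: "(k, x) \<in> ?E"
    obtain \<iota> x0 where k: "k = (\<iota>, x0)" by (cases k)
    have D: "(\<iota>, x0) \<in> D" using a k by simp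
    show "0 < (t \<circ> fst) k" using t[OF D] k by simp
    show "continuous_on UNIV (\<lambda>y. ?f k y * ?g k y)" unfolding k using c[OF D] by (auto intro!: continuous_intros)
    fix y assume "dist x y \<le> 4 * real m * (t \<circ> fst) k"
    then have n: "dist x0 y \<le> (4 * real m + 1) * t \<iota>" using near a k by simp
    have "\<bar>f \<iota> y - f \<iota> x0\<bar> * \<bar>g \<iota> y - g \<iota> x0\<bar> \<le> P \<iota> * P \<iota>"
      by (rule mult_mono[OF f[OF D n] g[OF D n] P0[OF D]]) simp
    then show "\<bar>?f k y * ?g k y\<bar> \<le> (P \<circ> fst) k * (P \<circ> fst) k" unfolding k by (simp add: abs_mult)
  qed
  have "SC ?E (\<lambda>_ k. 1 / (t \<circ> fst) k) m (\<lambda>k. (P \<circ> fst) k * (P \<circ> fst) k)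
     (\<lambda>k x. moll m ((t \<circ> fst) k) (\<lambda>y. ?f k y * ?g k y) x - moll m ((t \<circ> fst) k) (?f k) x * moll m ((t \<circ> fst) k) (?g k) x)"
    by (rule SC_sub[OF S3 SC_mult[OF S1 S2]])
  then have "SC ?E (\<lambda>_ k. 1 / (t \<circ> fst) k) m (\<lambda>k. (P \<circ> fst) k * (P \<circ> fst) k)
     (\<lambda>k x. moll m (t (fst k)) (\<lambda>y. f (fst k) y * g (fst k) y) x - moll m (t (fst k)) (f (fst k)) x * moll m (t (fst k)) (g (fst k)) x)"
  proof (rule SC_cong)
    fix k :: "'i \<times> (real^2)" and x assume a: "(k, x) \<in> ?E"
    obtain \<iota> x0 where k: "k = (\<iota>, x0)" by (cases k)
    have D: "(\<iota>, x0) \<in> D" using a k by simp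
    note cf = c(1)[OF D] and cg = c(2)[OF D]
    define A B where "A = f \<iota> x0" and "B = g \<iota> x0"
    have cst: "moll m s (\<lambda>_. z) = (\<lambda>_. z)" for z s using moll_affine[of m s z 0] by simp
    have e1: "moll m (t \<iota>) (\<lambda>y. f \<iota> y - A) = (\<lambda>y. moll m (t \<iota>) (f \<iota>) y - A)"
      using moll_diff[OF cf continuous_on_const, of m "t \<iota>" A] by (simp add: cst)
    have e2: "moll m (t \<iota>) (\<lambda>y. g \<iota> y - B) = (\<lambda>y. moll m (t \<iota>) (g \<iota>) y - B)"
      using moll_diff[OF cg continuous_on_const, of m "t \<iota>" B] by (simp add: cst)
    have "(\<lambda>y. (f \<iota> y - A) * (g \<iota> y - B)) = (\<lambda>y. (f \<iota> y * g \<iota> y - B * f \<iota> y) - (A * g \<iota> y - A * B))"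
      by (simp add: fun_eq_iff algebra_simps)
    then have e3: "moll m (t \<iota>) (\<lambda>y. (f \<iota> y - A) * (g \<iota> y - B)) = (\<lambda>y. (moll m (t \<iota>) (\<lambda>y. f \<iota> y * g \<iota> y) y
        - B * moll m (t \<iota>) (f \<iota>) y) - (A * moll m (t \<iota>) (g \<iota>) y - A * B))"
      using cf cg by (simp add: moll_diff moll_cmult cst continuous_on_mult continuous_on_diff)
    show "moll m (t (fst k)) (\<lambda>y. f (fst k) y * g (fst k) y) x - moll m (t (fst k)) (f (fst k)) x * moll m (t (fst k)) (g (fst k)) x
      = moll m ((t \<circ> fst) k) (\<lambda>y. ?f k y * ?g k y) x - moll m ((t \<circ> fst) k) (?f k) x * moll m ((t \<circ> fst) k) (?g k) x"
      unfolding k comp_def fst_conv prod.case A_def[symmetric] B_def[symmetric] e1 e2 e3 by (simp add: algebra_simps)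
  qed
  then show ?thesis
    by (intro SC_pointwise[OF assms(1) t]) (simp_all add: comp_def power2_eq_square)
qed

subsection \<open>Mollified data\<close>

lemma C1_lipschitz:
  assumes "C1 f d" "\<And>z k. dist x z \<le> r \<Longrightarrow> \<bar>d k z\<bar> \<le> B" "dist x y \<le> r"
  shows "\<bar>f y - f x\<bar> \<le> 2 * B * dist x y"
proof -
  have r: "0 \<le> r" using assms(3) zero_le_dist[of x y] by linarith
  have "norm (f y - f x) \<le> 2 * B * norm (y - x)"
  proof (rule differentiable_bound[of "cball x r"])
    fix z assume z: "z \<in> cball x r"
    show "(f has_derivative (\<lambda>h. \<Sum>k\<in>UNIV. h $ k * d k z)) (at z within cball x r)"
      by (rule has_derivative_at_withinI) (use assms(1) in \<open>simp add: C1_def\<close>)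
    have B: "\<bar>d k z\<bar> \<le> B" for k using assms(2) z by simp
    have "0 \<le> B" using B[of 1] by linarith
    show "onorm (\<lambda>h. \<Sum>k\<in>UNIV. h $ k * d k z) \<le> 2 * B"
    proof (rule onorm_le)
      fix h :: "real^2"
      have "\<bar>h $ k * d k z\<bar> \<le> norm h * B" for k
        unfolding abs_mult by (rule mult_mono[OF component_le_norm_cart B]) auto
      from this[of 1] this[of 2]
      have "\<bar>h $ 1 * d 1 z + h $ 2 * d 2 z\<bar> \<le> 2 * (norm h * B)" by linarith
      then show "norm (\<Sum>k\<in>UNIV. h $ k * d k z) \<le> 2 * B * norm h" by (simp add: sum_2 mult_ac)
    qed
  next
    show "convex (cball x r)" by (rule convex_cball)
    show "x \<in> cball x r" "y \<in> cball x r" using r assms(3) by simp_all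
  qed
  then show ?thesis by (simp add: dist_norm norm_minus_commute)
qed

text \<open>\<open>\<zeta>\<close> stands for the distance to the domain; all that counts is that it
  is 1-Lipschitz, nonpositive somewhere, and that its sublevel set at 1 is bounded. The fields are
  regular on the whole plane, but bounds are assumed only where \<zeta> is at most
  \<open>2 * l\<close>. \<open>N\<close> is the number of derivatives that the whole construction
  spends.\<close>

locale data =
  fixes I :: "'i set" and \<zeta> :: "real^2 \<Rightarrow> real" and R :: real and l g Mb d :: "'i \<Rightarrow> real" and N :: nat
    and fv fw :: "2 \<Rightarrow> 'i fld" and fA :: "2 \<Rightarrow> 2 \<Rightarrow> 'i fld"
  assumes \<zeta>: "\<And>x y. \<zeta> y \<le> \<zeta> x + dist x y" "\<exists>x. \<zeta> x \<le> 0"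
    and R: "0 < R" "\<And>x k. \<zeta> x \<le> 1 \<Longrightarrow> \<bar>x $ k\<bar> \<le> R"
    and l: "\<And>\<iota>. \<iota> \<in> I \<Longrightarrow> 0 < l \<iota>" "\<And>\<iota>. \<iota> \<in> I \<Longrightarrow> l \<iota> \<le> 1 / 2"
    and N: "1 \<le> N"
    and fv: "\<And>\<iota> c. \<iota> \<in> I \<Longrightarrow> C1 (fv c \<iota>) (\<lambda>q. pd q (fv c) \<iota>)"
       "\<And>\<iota> c q. \<iota> \<in> I \<Longrightarrow> C1 (pd q (fv c) \<iota>) (\<lambda>r. pd r (pd q (fv c)) \<iota>)"
    and fw: "\<And>\<iota> c. \<iota> \<in> I \<Longrightarrow> C1 (fw c \<iota>) (\<lambda>q. pd q (fw c) \<iota>)"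
       "\<And>\<iota> c q. \<iota> \<in> I \<Longrightarrow> C1 (pd q (fw c) \<iota>) (\<lambda>r. pd r (pd q (fw c)) \<iota>)"
    and fA: "\<And>\<iota> q r. \<iota> \<in> I \<Longrightarrow> continuous_on UNIV (fA q r \<iota>)"
    and Mb: "\<And>\<iota>. \<iota> \<in> I \<Longrightarrow> 0 < Mb \<iota>"
    and bv: "\<And>\<iota> c y. \<iota> \<in> I \<Longrightarrow> \<zeta> y \<le> 2 * l \<iota> \<Longrightarrow> \<bar>fv c \<iota> y\<bar> \<le> Mb \<iota>"
       "\<And>\<iota> c y q. \<iota> \<in> I \<Longrightarrow> \<zeta> y \<le> 2 * l \<iota> \<Longrightarrow> \<bar>pd q (fv c) \<iota> y\<bar> \<le> Mb \<iota>"
       "\<And>\<iota> c y q. \<iota> \<in> I \<Longrightarrow> \<zeta> y \<le> 2 * l \<iota> \<Longrightarrow> \<bar>pd q (fv c) \<iota> y\<bar> \<le> g \<iota>"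
       "\<And>\<iota> c y q r. \<iota> \<in> I \<Longrightarrow> \<zeta> y \<le> 2 * l \<iota> \<Longrightarrow> \<bar>pd r (pd q (fv c)) \<iota> y\<bar> \<le> Mb \<iota>"
    and bw: "\<And>\<iota> c y. \<iota> \<in> I \<Longrightarrow> \<zeta> y \<le> 2 * l \<iota> \<Longrightarrow> \<bar>fw c \<iota> y\<bar> \<le> Mb \<iota>"
       "\<And>\<iota> c y q. \<iota> \<in> I \<Longrightarrow> \<zeta> y \<le> 2 * l \<iota> \<Longrightarrow> \<bar>pd q (fw c) \<iota> y\<bar> \<le> Mb \<iota>"
       "\<And>\<iota> c y q r. \<iota> \<in> I \<Longrightarrow> \<zeta> y \<le> 2 * l \<iota> \<Longrightarrow> \<bar>pd r (pd q (fw c)) \<iota> y\<bar> \<le> Mb \<iota>"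
    and bD: "\<And>\<iota> y q r. \<iota> \<in> I \<Longrightarrow> \<zeta> y \<le> 2 * l \<iota> \<Longrightarrow> \<bar>Df fA fv fw q r \<iota> y\<bar> \<le> d \<iota>"
    and sA: "\<And>\<iota> y q r. \<iota> \<in> I \<Longrightarrow> \<zeta> y \<le> 2 * l \<iota> \<Longrightarrow> fA q r \<iota> y = fA r q \<iota> y"
begin

text \<open>\<open>N\<close> rounds of averaging reach \<open>4 * N * t\<close>, which is l / 16
  with this choice.\<close>

definition t :: "'i \<Rightarrow> real" where "t \<iota> = l \<iota> / (64 * real N)"
text \<open>An open set strictly between the region of the conclusion, \<open>D1\<close>, and that
  of the hypotheses. The outer gap is used up by mollification, the inner one by the
  cut-off.\<close>

definition D where "D = {(\<iota>, x). \<iota> \<in> I \<and> \<zeta> x < 3 / 2 * l \<iota>}"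
definition D1 where "D1 = {(\<iota>, x). \<iota> \<in> I \<and> \<zeta> x \<le> l \<iota>}"
definition mo :: "'i fld \<Rightarrow> 'i fld" where "mo f = (\<lambda>\<iota>. moll N (t \<iota>) (f \<iota>))"

lemma DI: "(\<iota>, x) \<in> D \<Longrightarrow> \<iota> \<in> I" by (simp add: D_def)
lemma D1_D: "D1 \<subseteq> D"
proof
  fix z assume "z \<in> D1"
  then obtain \<iota> x where z: "z = (\<iota>, x)" "\<iota> \<in> I" "\<zeta> x \<le> l \<iota>" by (auto simp: D1_def)
  then have "\<zeta> x < 3 / 2 * l \<iota>" using l(1)[of \<iota>] by linarith
  then show "z \<in> D" using z by (simp add: D_def)
qed

lemma t_pos: "\<iota> \<in> I \<Longrightarrow> 0 < t \<iota>" using l(1) N by (simp add: t_def)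

lemma t_le: "\<iota> \<in> I \<Longrightarrow> (4 * real N + 1) * t \<iota> \<le> 5 / 64 * l \<iota>" "\<iota> \<in> I \<Longrightarrow> 4 * real N * t \<iota> = l \<iota> / 16"
proof -
  assume i: "\<iota> \<in> I"
  have "(4 * real N + 1) * t \<iota> \<le> (5 * real N) * t \<iota>"
    by (rule mult_right_mono) (use N t_pos[OF i] in auto)
  then show "(4 * real N + 1) * t \<iota> \<le> 5 / 64 * l \<iota>" using N by (simp add: t_def)
  show "4 * real N * t \<iota> = l \<iota> / 16" using N by (simp add: t_def)
qed

lemma \<zeta>_cont: "continuous_on UNIV \<zeta>"
  unfolding continuous_on_iff
proof (intro ballI allI impI)
  fix x :: "real^2" and e :: real assume e: "0 < e"
  have "dist (\<zeta> x') (\<zeta> x) \<le> dist x' x" for x'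
    using \<zeta>(1)[of x' x] \<zeta>(1)[of x x'] dist_commute[of x x'] unfolding dist_real_def by linarith
  then show "\<exists>d>0. \<forall>x'\<in>UNIV. dist x' x < d \<longrightarrow> dist (\<zeta> x') (\<zeta> x) < e"
    using e le_less_trans by blast
qed

lemma odom_D: "odom D"
proof -
  have "open {x. \<zeta> x < 3 / 2 * l \<iota>}" for \<iota>
    by (rule open_Collect_less[OF \<zeta>_cont continuous_on_const])
  then have "open {x. (\<iota>, x) \<in> D}" for \<iota> unfolding D_def by (cases "\<iota> \<in> I") simp_all
  then show ?thesis by (simp add: odom_def)
qed

lemma near: "(\<iota>, x) \<in> D \<Longrightarrow> dist x y \<le> 5 / 64 * l \<iota> \<Longrightarrow> \<zeta> y \<le> 2 * l \<iota>"
  using \<zeta>(1)[of y x] l(1)[of \<iota>] by (simp add: D_def)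

lemma near': "(\<iota>, x) \<in> D \<Longrightarrow> dist x y \<le> 4 * real N * t \<iota> \<Longrightarrow> \<zeta> y \<le> 2 * l \<iota>"
  using near[of \<iota> x y] t_le(2)[OF DI] l(1)[OF DI, of \<iota> x] by simp

lemma t_l: "SC D (\<lambda>_ \<iota>. 1 / t \<iota>) m P f \<Longrightarrow> SC D (\<lambda>_ \<iota>. 1 / l \<iota>) m P f"
proof (rule SC_mono[where c=1 and c'="64 * real N"])
  fix \<iota> x assume "(\<iota>, x) \<in> D"
  then show "0 \<le> 1 / t \<iota> \<and> 1 / t \<iota> \<le> 64 * real N * (1 / l \<iota>)"
    using l(1)[OF DI, of \<iota> x] by (simp add: t_def)
qed (use N in auto)

lemma SC_mo:
  assumes "\<And>\<iota>. \<iota> \<in> I \<Longrightarrow> continuous_on UNIV (f \<iota>)" "\<And>\<iota> y. \<iota> \<in> I \<Longrightarrow> \<zeta> y \<le> 2 * l \<iota> \<Longrightarrow> \<bar>f \<iota> y\<bar> \<le> P \<iota>"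
  shows "SC D (\<lambda>_ \<iota>. 1 / l \<iota>) N P (mo f)"
  unfolding mo_def
  by (intro t_l SC_moll odom_D) (use assms t_pos near' DI in auto)

lemma fv_cont: "\<iota> \<in> I \<Longrightarrow> continuous_on UNIV (fv c \<iota>)" "\<iota> \<in> I \<Longrightarrow> continuous_on UNIV (pd q (fv c) \<iota>)"
    "\<iota> \<in> I \<Longrightarrow> continuous_on UNIV (pd r (pd q (fv c)) \<iota>)"
  by (erule C1_continuous[OF fv(1)], erule C1_continuous[OF fv(2)], erule fv(2)[unfolded C1_def, THEN conjunct2, rule_format])

lemma fw_cont: "\<iota> \<in> I \<Longrightarrow> continuous_on UNIV (fw c \<iota>)" "\<iota> \<in> I \<Longrightarrow> continuous_on UNIV (pd q (fw c) \<iota>)"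
    "\<iota> \<in> I \<Longrightarrow> continuous_on UNIV (pd r (pd q (fw c)) \<iota>)"
  by (erule C1_continuous[OF fw(1)], erule C1_continuous[OF fw(2)], erule fw(2)[unfolded C1_def, THEN conjunct2, rule_format])

lemma pd_mo: "\<iota> \<in> I \<Longrightarrow> C1 (f \<iota>) (\<lambda>q. pd q f \<iota>) \<Longrightarrow> pd q (mo f) \<iota> x = mo (pd q f) \<iota> x"
  unfolding mo_def by (rule C1_pd[where f="\<lambda>\<iota>. moll N (t \<iota>) (f \<iota>)" and d="\<lambda>q. moll N (t \<iota>) (pd q f \<iota>)"]) (rule moll_C1)

lemma pd_mo_v: "\<iota> \<in> I \<Longrightarrow> pd q (mo (fv c)) \<iota> = mo (pd q (fv c)) \<iota>" "\<iota> \<in> I \<Longrightarrow> pd q (mo (fw c)) \<iota> = mo (pd q (fw c)) \<iota>"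
proof -
  show "pd q (mo (fv c)) \<iota> = mo (pd q (fv c)) \<iota>" if i: "\<iota> \<in> I"
    by (rule ext) (rule pd_mo[where f="fv c", OF i fv(1)[OF i]])
  show "pd q (mo (fw c)) \<iota> = mo (pd q (fw c)) \<iota>" if i: "\<iota> \<in> I"
    by (rule ext) (rule pd_mo[where f="fw c", OF i fw(1)[OF i]])
qed

lemma pd_cong_fun: "f \<iota> = f' \<iota> \<Longrightarrow> pd q f \<iota> = pd q f' \<iota>"
  by (simp add: pd_def)

lemma SC_V0:
  "SC D (\<lambda>_ \<iota>. 1 / l \<iota>) N Mb (mo (fv c))" "SC D (\<lambda>_ \<iota>. 1 / l \<iota>) N g (pd q (mo (fv c)))"
  "SC D (\<lambda>_ \<iota>. 1 / l \<iota>) N Mb (pd r (pd q (mo (fv c))))"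
  "SC D (\<lambda>_ \<iota>. 1 / l \<iota>) N Mb (mo (fw c))" "SC D (\<lambda>_ \<iota>. 1 / l \<iota>) N Mb (pd r (pd q (mo (fw c))))"
proof -
  show "SC D (\<lambda>_ \<iota>. 1 / l \<iota>) N Mb (mo (fv c))" by (rule SC_mo) (use fv_cont bv in auto)
  show "SC D (\<lambda>_ \<iota>. 1 / l \<iota>) N Mb (mo (fw c))" by (rule SC_mo) (use fw_cont bw in auto)
  have "SC D (\<lambda>_ \<iota>. 1 / l \<iota>) N g (mo (pd q (fv c)))" by (rule SC_mo) (use fv_cont bv in auto)
  then show "SC D (\<lambda>_ \<iota>. 1 / l \<iota>) N g (pd q (mo (fv c)))"
    by (rule SC_cong) (simp add: pd_mo_v(1) DI)
  have "SC D (\<lambda>_ \<iota>. 1 / l \<iota>) N Mb (mo (pd r (pd q (fv c))))" by (rule SC_mo) (use fv_cont bv in auto)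
  then show "SC D (\<lambda>_ \<iota>. 1 / l \<iota>) N Mb (pd r (pd q (mo (fv c))))"
  proof (rule SC_cong)
    fix \<iota> x assume a: "(\<iota>, x) \<in> D"
    show "pd r (pd q (mo (fv c))) \<iota> x = mo (pd r (pd q (fv c))) \<iota> x"
      unfolding pd_cong_fun[where f="pd q (mo (fv c))" and f'="mo (pd q (fv c))", OF pd_mo_v(1)[OF DI[OF a]]]
      by (rule pd_mo[where f="pd q (fv c)", OF DI[OF a] fv(2)[OF DI[OF a]]])
  qed
  have "SC D (\<lambda>_ \<iota>. 1 / l \<iota>) N Mb (mo (pd r (pd q (fw c))))" by (rule SC_mo) (use fw_cont bw in auto)
  then show "SC D (\<lambda>_ \<iota>. 1 / l \<iota>) N Mb (pd r (pd q (mo (fw c))))"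
  proof (rule SC_cong)
    fix \<iota> x assume a: "(\<iota>, x) \<in> D"
    show "pd r (pd q (mo (fw c))) \<iota> x = mo (pd r (pd q (fw c))) \<iota> x"
      unfolding pd_cong_fun[where f="pd q (mo (fw c))" and f'="mo (pd q (fw c))", OF pd_mo_v(2)[OF DI[OF a]]]
      by (rule pd_mo[where f="pd q (fw c)", OF DI[OF a] fw(2)[OF DI[OF a]]])
  qed
qed

lemma osc_small:
  assumes "\<iota> \<in> I" "C1 f e" "\<And>y k. \<zeta> y \<le> 2 * l \<iota> \<Longrightarrow> \<bar>e k y\<bar> \<le> Mb \<iota>" "(\<iota>, x) \<in> D" "dist x y \<le> 5 / 64 * l \<iota>"
  shows "\<bar>f y - f x\<bar> \<le> l \<iota> * Mb \<iota>"
proof -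
  have "\<bar>f y - f x\<bar> \<le> 2 * Mb \<iota> * dist x y"
    by (rule C1_lipschitz[OF assms(2) _ assms(5)]) (use assms(3) near[OF assms(4)] in auto)
  also have "\<dots> \<le> 2 * Mb \<iota> * (5 / 64 * l \<iota>)"
    by (rule mult_left_mono[OF assms(5)]) (use Mb[OF assms(1)] in simp)
  also have "\<dots> \<le> l \<iota> * Mb \<iota>" using Mb[OF assms(1)] l(1)[OF assms(1)] by (simp add: field_simps)
  finally show ?thesis .
qed

lemma mo_close:
  assumes "\<And>\<iota>. \<iota> \<in> I \<Longrightarrow> C1 (f \<iota>) (e \<iota>)" "\<And>\<iota> y k. \<iota> \<in> I \<Longrightarrow> \<zeta> y \<le> 2 * l \<iota> \<Longrightarrow> \<bar>e \<iota> k y\<bar> \<le> Mb \<iota>"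
  shows "BO D (\<lambda>\<iota>. l \<iota> * Mb \<iota>) (\<lambda>\<iota> x. mo f \<iota> x - f \<iota> x)"
proof (rule BO_fun)
  fix \<iota> x assume a: "(\<iota>, x) \<in> D"
  note i = DI[OF a]
  have "\<bar>moll N (t \<iota>) (f \<iota>) x - (f \<iota> x + 0 \<bullet> x)\<bar> \<le> l \<iota> * Mb \<iota>"
  proof (rule moll_near_affine[OF C1_continuous[OF assms(1)[OF i]]])
    fix y assume "dist x y \<le> 4 * real N * t \<iota>"
    then have "dist x y \<le> 5 / 64 * l \<iota>" using t_le(2)[OF i] l(1)[OF i] by simp
    then show "\<bar>f \<iota> y - (f \<iota> x + 0 \<bullet> y)\<bar> \<le> l \<iota> * Mb \<iota>"
      using osc_small[OF i assms(1)[OF i] assms(2)[OF i] a] by simp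
  qed (use t_pos[OF i] in simp)
  then show "\<bar>mo f \<iota> x - f \<iota> x\<bar> \<le> l \<iota> * Mb \<iota>" by (simp add: mo_def)
qed

lemma V0_close:
  "BO D (\<lambda>\<iota>. l \<iota> * Mb \<iota>) (\<lambda>\<iota> x. mo (fv c) \<iota> x - fv c \<iota> x)"
  "BO D (\<lambda>\<iota>. l \<iota> * Mb \<iota>) (\<lambda>\<iota> x. pd q (mo (fv c)) \<iota> x - pd q (fv c) \<iota> x)"
  "BO D (\<lambda>\<iota>. l \<iota> * Mb \<iota>) (\<lambda>\<iota> x. mo (fw c) \<iota> x - fw c \<iota> x)"
  "BO D (\<lambda>\<iota>. l \<iota> * Mb \<iota>) (\<lambda>\<iota> x. pd q (mo (fw c)) \<iota> x - pd q (fw c) \<iota> x)"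
proof -
  show "BO D (\<lambda>\<iota>. l \<iota> * Mb \<iota>) (\<lambda>\<iota> x. mo (fv c) \<iota> x - fv c \<iota> x)" by (rule mo_close[OF fv(1) bv(2)])
  show "BO D (\<lambda>\<iota>. l \<iota> * Mb \<iota>) (\<lambda>\<iota> x. mo (fw c) \<iota> x - fw c \<iota> x)" by (rule mo_close[OF fw(1) bw(2)])
  show "BO D (\<lambda>\<iota>. l \<iota> * Mb \<iota>) (\<lambda>\<iota> x. pd q (mo (fv c)) \<iota> x - pd q (fv c) \<iota> x)"
    by (rule BO_cong[OF mo_close[OF fv(2)[where q=q and c=c] bv(4)[where q=q and c=c]]]) (simp_all add: pd_mo_v(1) DI)
  show "BO D (\<lambda>\<iota>. l \<iota> * Mb \<iota>) (\<lambda>\<iota> x. pd q (mo (fw c)) \<iota> x - pd q (fw c) \<iota> x)"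
    by (rule BO_cong[OF mo_close[OF fw(2)[where q=q and c=c] bw(3)[where q=q and c=c]]]) (simp_all add: pd_mo_v(2) DI)
qed

definition D0 :: "2 \<Rightarrow> 2 \<Rightarrow> 'i fld" where
  "D0 = Df (\<lambda>q r. mo (fA q r)) (\<lambda>c. mo (fv c)) (\<lambda>c. mo (fw c))"

text \<open>Mollification commutes with every part of the defect except the products of gradients.
  The commutator is quadratic in the oscillation of the gradient over the mollification scale, which
  is at most l M; this is the origin of (l M)^2.\<close>

lemma SC_D0: "SC D (\<lambda>_ \<iota>. 1 / l \<iota>) N (\<lambda>\<iota>. d \<iota> + (l \<iota> * Mb \<iota>)\<^sup>2) (D0 q r)"
proof -
  let ?P = "\<lambda>\<iota>. d \<iota> + (l \<iota> * Mb \<iota>)\<^sup>2"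
  let ?com = "\<lambda>c \<iota> x. moll N (t \<iota>) (\<lambda>y. pd q (fv c) \<iota> y * pd r (fv c) \<iota> y) x - moll N (t \<iota>) (pd q (fv c) \<iota>) x * moll N (t \<iota>) (pd r (fv c) \<iota>) x"
  have \<nu>: "0 \<le> 1 / l \<iota>" if "(\<iota>, x) \<in> D" for \<iota> x using l(1)[OF DI[OF that]] by simp
  have d0: "0 \<le> d \<iota>" if "(\<iota>, x) \<in> D" for \<iota> x
    using bD[OF DI[OF that] near[OF that, of x], of q r] l(1)[OF DI[OF that]] by simp
  have com: "SC D (\<lambda>_ \<iota>. 1 / l \<iota>) N ?P (?com c)" for c
  proof (rule SC_wmono[OF t_l[OF SC_commutator[OF odom_D, where P="\<lambda>\<iota>. l \<iota> * Mb \<iota>"]], where c=1])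
    fix \<iota> x y assume a: "(\<iota>, x) \<in> D" and xy: "dist x y \<le> (4 * real N + 1) * t \<iota>"
    have n: "dist x y \<le> 5 / 64 * l \<iota>" using xy t_le(1)[OF DI[OF a]] by linarith
    show "\<bar>pd q (fv c) \<iota> y - pd q (fv c) \<iota> x\<bar> \<le> l \<iota> * Mb \<iota>" "\<bar>pd r (fv c) \<iota> y - pd r (fv c) \<iota> x\<bar> \<le> l \<iota> * Mb \<iota>"
      by (rule osc_small[OF DI[OF a] fv(2)[OF DI[OF a]] bv(4)[OF DI[OF a]] a n], assumption)+
  qed (use t_pos fv_cont DI d0 \<nu> in auto)
  have cD: "continuous_on UNIV (Df fA fv fw q r \<iota>)" if "\<iota> \<in> I" for \<iota>
    unfolding Df_def by (intro continuous_intros fA fv_cont fw_cont that)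
  have mD: "SC D (\<lambda>_ \<iota>. 1 / l \<iota>) N ?P (mo (Df fA fv fw q r))"
    by (rule SC_wmono[OF SC_mo[OF cD bD], where c=1]) (use \<nu> in auto)
  have "SC D (\<lambda>_ \<iota>. 1 / l \<iota>) N ?P (\<lambda>\<iota> x. mo (Df fA fv fw q r) \<iota> x + (1/2) * (?com 1 \<iota> x + ?com 2 \<iota> x))"
    by (intro SC_add mD SC_scale com) (use \<nu> in auto)
  then show ?thesis
  proof (rule SC_cong)
    fix \<iota> x assume a: "(\<iota>, x) \<in> D"
    note i = DI[OF a]
    have e1: "Df fA fv fw q r \<iota> = (\<lambda>x. fA q r \<iota> x
     - ((1/2) * (pd q (fv 1) \<iota> x * pd r (fv 1) \<iota> x + pd q (fv 2) \<iota> x * pd r (fv 2) \<iota> x) + (1/2) * (pd q (fw r) \<iota> x + pd r (fw q) \<iota> x)))"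
      by (simp add: Df_def sum_2)
    have gen: "moll N s (\<lambda>x. a x - (k * (b x + b' x) + k * (e x + e' x)))
        = (\<lambda>x. moll N s a x - (k * (moll N s b x + moll N s b' x) + k * (moll N s e x + moll N s e' x)))"
      if "continuous_on UNIV a" "continuous_on UNIV b" "continuous_on UNIV b'" "continuous_on UNIV e" "continuous_on UNIV e'"
      for s k a b b' e e'
      using that by (simp add: moll_diff moll_add moll_cmult continuous_on_add continuous_on_mult)
    have e2: "mo (Df fA fv fw q r) \<iota> x = moll N (t \<iota>) (fA q r \<iota>) x - ((1/2) * (moll N (t \<iota>) (\<lambda>x. pd q (fv 1) \<iota> x * pd r (fv 1) \<iota> x) x
        + moll N (t \<iota>) (\<lambda>x. pd q (fv 2) \<iota> x * pd r (fv 2) \<iota> x) x) + (1/2) * (moll N (t \<iota>) (pd q (fw r) \<iota>) x + moll N (t \<iota>) (pd r (fw q) \<iota>) x))"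
      unfolding mo_def e1
      by (subst gen) (intro continuous_on_mult fA[OF i] fv_cont(2)[OF i] fw_cont(2)[OF i] refl)+
    show "D0 q r \<iota> x = mo (Df fA fv fw q r) \<iota> x + (1/2) * (?com 1 \<iota> x + ?com 2 \<iota> x)"
      unfolding e2 unfolding D0_def Df_def sum_2 pd_mo_v[OF i] unfolding mo_def by (simp add: algebra_simps)
  qed
qed

lemma D0_sym: assumes "(\<iota>, x) \<in> D" shows "D0 q r \<iota> x = D0 r q \<iota> x"
proof -
  note i = DI[OF assms]
  have "moll N (t \<iota>) (fA q r \<iota>) x = moll N (t \<iota>) (fA r q \<iota>) x"
  proof -
    have "\<bar>moll N (t \<iota>) (\<lambda>y. fA q r \<iota> y - fA r q \<iota> y) x\<bar> \<le> 0"
    proof (rule moll_bound[where x=x and r=0])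
      show "continuous_on UNIV (\<lambda>y. fA q r \<iota> y - fA r q \<iota> y)" by (intro continuous_on_diff fA i)
      show "0 \<le> t \<iota>" using t_pos[OF i] by simp
      fix y assume "dist x y \<le> 0 + 4 * real N * t \<iota>"
      then have "\<zeta> y \<le> 2 * l \<iota>" by (intro near'[OF assms]) simp
      then show "\<bar>fA q r \<iota> y - fA r q \<iota> y\<bar> \<le> 0" using sA[OF i, of y q r] by simp
    qed simp
    then show ?thesis using moll_diff[OF fA[OF i, of q r] fA[OF i, of r q], of N "t \<iota>"] by simp
  qed
  then show ?thesis by (simp add: D0_def Df_def mo_def algebra_simps)
qed

text \<open>The profile is 1 for \<zeta> up to 9/8 l and 0 from 5/4 l on. Mollification moves these
  thresholds by l / 16, so the transition takes place between 17/16 l and 4/3 l, inside the gap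
  between \<open>D1\<close> and the complement of \<open>D\<close>.\<close>

definition cut :: "'i fld" where "cut = mo (\<lambda>\<iota> x. max 0 (min 1 (10 - 8 * \<zeta> x / l \<iota>)))"

lemma cut_bounds: assumes "\<iota> \<in> I"
  shows "\<zeta> x \<le> 17 / 16 * l \<iota> \<Longrightarrow> cut \<iota> x = 1" and "4 / 3 * l \<iota> < \<zeta> x \<Longrightarrow> cut \<iota> x = 0"
proof -
  let ?f = "\<lambda>x. max 0 (min 1 (10 - 8 * \<zeta> x / l \<iota>))"
  have c: "continuous_on UNIV ?f"
    using l(1)[OF assms] by (intro continuous_intros \<zeta>_cont) simp
  have lp: "0 < l \<iota>" by (rule l(1)[OF assms])
  have tt: "dist x y \<le> l \<iota> / 16" if "dist x y \<le> 0 + 4 * real N * t \<iota>" for y using that t_le(2)[OF assms] by simp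
  show "cut \<iota> x = 1" if x: "\<zeta> x \<le> 17 / 16 * l \<iota>"
  proof -
    have "\<bar>moll N (t \<iota>) ?f x - (1 + 0 \<bullet> x)\<bar> \<le> 0"
    proof (rule moll_near_affine[OF c])
      fix y assume "dist x y \<le> 4 * real N * t \<iota>"
      then have "\<zeta> y \<le> 9 / 8 * l \<iota>" using tt[of y] \<zeta>(1)[of y x] x by simp
      then have "8 * \<zeta> y / l \<iota> \<le> 9" using lp by (simp add: field_simps)
      then show "\<bar>?f y - (1 + 0 \<bullet> y)\<bar> \<le> 0" by simp
    qed (use t_pos[OF assms] in simp)
    then show ?thesis by (simp add: cut_def mo_def)
  qed
  show "cut \<iota> x = 0" if x: "4 / 3 * l \<iota> < \<zeta> x"
  proof -
    have "\<bar>moll N (t \<iota>) ?f x - (0 + 0 \<bullet> x)\<bar> \<le> 0"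
    proof (rule moll_near_affine[OF c])
      fix y assume "dist x y \<le> 4 * real N * t \<iota>"
      then have "5 / 4 * l \<iota> \<le> \<zeta> y" using tt[of y] \<zeta>(1)[of x y] x lp by (simp add: dist_commute)
      then have "10 \<le> 8 * \<zeta> y / l \<iota>" using lp by (simp add: field_simps)
      then show "\<bar>?f y - (0 + 0 \<bullet> y)\<bar> \<le> 0" by simp
    qed (use t_pos[OF assms] in simp)
    then show ?thesis by (simp add: cut_def mo_def)
  qed
qed

lemma SC_cut: "SC (I \<times> UNIV) (\<lambda>_ \<iota>. 1 / l \<iota>) N (\<lambda>_. 1) cut"
proof (rule SC_mono[where c=1 and c'="64 * real N"])
  show "SC (I \<times> UNIV) (\<lambda>_ \<iota>. 1 / t \<iota>) N (\<lambda>_. 1) cut"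
    unfolding cut_def mo_def
  proof (rule SC_moll[OF odom_UNIV])
    fix \<iota> and x :: "real^2" assume "(\<iota>, x) \<in> I \<times> UNIV"
    then have i: "\<iota> \<in> I" by simp
    show "0 < t \<iota>" by (rule t_pos[OF i])
    show "continuous_on UNIV (\<lambda>x. max 0 (min 1 (10 - 8 * \<zeta> x / l \<iota>)))"
      using l(1)[OF i] by (intro continuous_intros \<zeta>_cont) simp
  qed simp
  fix \<iota> and x :: "real^2" assume "(\<iota>, x) \<in> I \<times> UNIV"
  then show "0 \<le> 1 / t \<iota> \<and> 1 / t \<iota> \<le> 64 * real N * (1 / l \<iota>)"
    using l(1)[of \<iota>] by (simp add: t_def)
qed (use N in auto)

text \<open>\<open>divergence_decomposition\<close> wants a compactly supported field on the plane.
  Multiplying by \<open>cut\<close> provides one and leaves the equation intact on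
  \<open>D1\<close>, where \<open>cut\<close> is 1; this is why \<open>decomposable\<close> demands
  the equation on the smaller set only. The loss is the number of scales, so \<open>\<theta>\<close>
  has to dominate \<open>2 * n\<close>.\<close>

lemma decomposable_D:
  fixes \<theta> \<epsilon> \<nu> :: "'i \<Rightarrow> real" and n :: "'i \<Rightarrow> nat"
  assumes n: "Cn > 0" "\<And>\<iota>. \<iota> \<in> I \<Longrightarrow> real (2 * n \<iota>) \<le> Cn * \<theta> \<iota>"
    and \<epsilon>: "\<And>\<iota>. \<iota> \<in> I \<Longrightarrow> (1 + \<nu> \<iota>) / 2 ^ n \<iota> \<le> \<epsilon> \<iota>"
    and \<nu>: "\<And>\<iota>. \<iota> \<in> I \<Longrightarrow> 1 / l \<iota> \<le> \<nu> \<iota>"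
  shows "decomposable D D1 \<theta> \<epsilon> N (\<lambda>_. \<nu>)"
  unfolding decomposable_def
proof (intro allI impI)
  fix m P f i j assume ij: "(i::2) \<noteq> j" and mN: "Suc m \<le> N" and f: "SC D (\<lambda>_. \<nu>) (Suc m) P f"
  obtain x0 where x0: "\<zeta> x0 \<le> 0" using \<zeta>(2) by blast
  have x0D: "(\<iota>, x0) \<in> D" if "\<iota> \<in> I" for \<iota> using x0 l(1)[OF that] that by (simp add: D_def)
  have P: "0 \<le> P \<iota>" if "\<iota> \<in> I" for \<iota> by (rule SC_nonneg[OF f x0D[OF that]])
  have \<nu>1: "1 \<le> \<nu> \<iota>" if "\<iota> \<in> I" for \<iota>
  proof -
    have "1 \<le> 1 / l \<iota>" using l[OF that] by (simp add: field_simps)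
    then show ?thesis using \<nu>[OF that] by linarith
  qed
  define F where "F = (\<lambda>\<iota> x. cut \<iota> x * f \<iota> x)"
  have "SC (I \<times> UNIV) (\<lambda>_. \<nu>) (Suc m) (\<lambda>_. 1) cut"
    by (rule SC_mono[OF SC_order[OF SC_cut mN], where c=1 and c'=1]) (use \<nu> l in \<open>auto simp: less_imp_le\<close>)
  then have "SC D (\<lambda>_. \<nu>) (Suc m) (\<lambda>_. 1) cut"
    by (rule SC_sub_dom[OF _ odom_D]) (auto simp: DI)
  from SC_mult[OF this f] have FD: "SC D (\<lambda>_. \<nu>) (Suc m) P F" unfolding F_def by simp
  define Z where "Z = {(\<iota>, x). \<iota> \<in> I \<and> 4 / 3 * l \<iota> < \<zeta> x}"
  have oZ: "odom Z"
  proof -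
    have "open {x. 4 / 3 * l \<iota> < \<zeta> x}" for \<iota> by (rule open_Collect_less[OF continuous_on_const \<zeta>_cont])
    then have "open {x. (\<iota>, x) \<in> Z}" for \<iota> unfolding Z_def by (cases "\<iota> \<in> I") simp_all
    then show ?thesis by (simp add: odom_def)
  qed
  have F: "SC (I \<times> UNIV) (\<lambda>_. \<nu>) (Suc m) P F"
  proof (rule SC_extend[OF FD odom_UNIV oZ])
    show "I \<times> UNIV \<subseteq> D \<union> Z" using l(1) by (force simp: D_def Z_def)
    show "F \<iota> x = 0" if "(\<iota>, x) \<in> Z" for \<iota> x using that cut_bounds(2) by (auto simp: F_def Z_def)
  qed (use P \<nu>1 in \<open>auto intro: order_trans[OF zero_le_one]\<close>)
  have supp: "F \<iota> y = 0" if "\<iota> \<in> I" "R < \<bar>y $ k\<bar>" for \<iota> y k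
  proof -
    \<comment> \<open>As l is at most 1/2, the cut-off vanishes where \<zeta> exceeds 1, hence
      outside the box of size \<open>R\<close>.\<close>
    have "1 < \<zeta> y" using R(2)[of y k] that(2) by linarith
    then have "4 / 3 * l \<iota> < \<zeta> y" using l(2)[OF that(1)] by simp
    then show ?thesis using cut_bounds(2)[OF that(1)] by (simp add: F_def)
  qed
  obtain \<Psi> where \<Psi>: "\<And>q. BO (I \<times> UNIV) (\<lambda>\<iota>. real (2 * n \<iota>) * P \<iota>) (\<Psi> q)"
    "\<And>q p. SC (I \<times> UNIV) (\<lambda>_. \<nu>) m (\<lambda>\<iota>. real (2 * n \<iota>) * P \<iota>) (pd p (\<Psi> q))"
    "\<And>q \<iota> x. \<iota> \<in> I \<Longrightarrow> \<Psi> q \<iota> differentiable (at x)"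
    "BO (I \<times> UNIV) (\<lambda>\<iota>. P \<iota> * (1 + \<nu> \<iota>) / 2 ^ n \<iota>) (\<lambda>\<iota> x. F \<iota> x - (pd i (\<Psi> j) \<iota> x + pd j (\<Psi> i) \<iota> x) / 2)"
    by (rule divergence_decomposition[OF F ij supp R(1), where n=n]) (use \<nu>1 in \<open>auto intro: order_trans[OF zero_le_one]\<close>)
  have w: "real (2 * n \<iota>) * P \<iota> \<le> Cn * (\<theta> \<iota> * P \<iota>)" if "\<iota> \<in> I" for \<iota>
    using mult_right_mono[OF n(2)[OF that] P[OF that]] by (simp add: mult.assoc)
  have sub: "D \<subseteq> I \<times> UNIV" by (auto simp: D_def)
  have \<Psi>D: "SC D (\<lambda>_. \<nu>) m (\<lambda>\<iota>. \<theta> \<iota> * P \<iota>) (pd p (\<Psi> q))" for p q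
    by (rule SC_wmono[OF SC_sub_dom[OF \<Psi>(2) odom_D sub] n(1)]) (use w \<nu>1 DI in \<open>auto intro: order_trans[OF zero_le_one]\<close>)
  have \<theta>P: "0 \<le> \<theta> \<iota> * P \<iota>" if "(\<iota>, x) \<in> D" for \<iota> x using SC_nonneg[OF \<Psi>D that] .
  have "SC D (\<lambda>_. \<nu>) (Suc m) (\<lambda>\<iota>. \<theta> \<iota> * P \<iota>) (\<Psi> q)" for q
  proof (rule SC_SucI_pd[OF odom_D])
    show "BO D (\<lambda>\<iota>. \<theta> \<iota> * P \<iota>) (\<Psi> q)"
      by (rule BO_mono[OF BO_subset[OF \<Psi>(1) sub] n(1)]) (use w DI in auto)
    show "SC D (\<lambda>_. \<nu>) m (\<lambda>\<iota>. \<theta> \<iota> * P \<iota> * \<nu> \<iota>) (pd k (\<Psi> q))" for k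
    proof (rule SC_wmono[OF \<Psi>D, where c=1])
      fix \<iota> x assume a: "(\<iota>, x) \<in> D"
      show "\<theta> \<iota> * P \<iota> \<le> 1 * (\<theta> \<iota> * P \<iota> * \<nu> \<iota>)"
        using mult_left_mono[OF \<nu>1[OF DI[OF a]] \<theta>P[OF a]] by simp
    qed (use \<nu>1 DI in \<open>auto intro: order_trans[OF zero_le_one]\<close>)
  qed (use \<Psi>(3) DI in auto)
  moreover have "BO D1 (\<lambda>\<iota>. P \<iota> * \<epsilon> \<iota>) (\<lambda>\<iota> x. f \<iota> x - (pd i (\<Psi> j) \<iota> x + pd j (\<Psi> i) \<iota> x) / 2)"
  proof (rule BO_cong[OF BO_mono[OF BO_subset[OF \<Psi>(4), of D1], where c=1]])
    fix \<iota> x assume a: "(\<iota>, x) \<in> D1"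
    then have i: "\<iota> \<in> I" by (simp add: D1_def)
    show "P \<iota> * (1 + \<nu> \<iota>) / 2 ^ n \<iota> \<le> 1 * (P \<iota> * \<epsilon> \<iota>)"
      using mult_left_mono[OF \<epsilon>[OF i] P[OF i]] by simp
    show "f \<iota> x - (pd i (\<Psi> j) \<iota> x + pd j (\<Psi> i) \<iota> x) / 2 = F \<iota> x - (pd i (\<Psi> j) \<iota> x + pd j (\<Psi> i) \<iota> x) / 2"
      using cut_bounds(1)[OF i, of x] l(1)[OF i] a by (simp add: F_def D1_def)
  qed (auto simp: D1_def)
  ultimately show "\<exists>\<Psi>. (\<forall>q. SC D (\<lambda>_. \<nu>) (Suc m) (\<lambda>\<iota>. \<theta> \<iota> * P \<iota>) (\<Psi> q)) \<and>
          (\<forall>p q. SC D (\<lambda>_. \<nu>) m (\<lambda>\<iota>. \<theta> \<iota> * P \<iota>) (pd p (\<Psi> q))) \<and>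
          BO D1 (\<lambda>\<iota>. P \<iota> * \<epsilon> \<iota>) (\<lambda>\<iota> x. f \<iota> x - (pd i (\<Psi> j) \<iota> x + pd j (\<Psi> i) \<iota> x) / 2)"
    using \<Psi>D by blast
qed

end

context data
begin

text \<open>\<open>p\<close> contains the factor \<open>\<tau>\<close> because solving the
  off-diagonal equation for the mollified defect enlarges its diagonal entries by \<tau>^2.
  \<open>G\<close> bounds the gradient of the first field throughout, and \<open>Z\<close> is the
  bound for second derivatives after the last step.\<close>

lemma core:
  fixes \<rho> \<tau> \<epsilon> :: "'i \<Rightarrow> real" and n :: "'i \<Rightarrow> nat" and Cn :: real and J r k :: nat
  defines "p \<equiv> \<lambda>\<iota>. \<tau> \<iota> * sqrt (d \<iota> + (l \<iota> * Mb \<iota>)\<^sup>2)"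
  defines "G \<equiv> \<lambda>\<iota>. g \<iota> + p \<iota>"
  defines "Z \<equiv> \<lambda>\<iota>. p \<iota> * \<tau> \<iota> ^ (J - 1) / (l \<iota> * \<rho> \<iota> ^ 3)"
  assumes h\<rho>: "\<And>\<iota>. 0 < \<rho> \<iota>" "\<And>\<iota>. \<iota> \<in> I \<Longrightarrow> \<rho> \<iota> \<le> 1"
    and h\<tau>: "\<And>\<iota>. \<iota> \<in> I \<Longrightarrow> 1 \<le> \<tau> \<iota>" "\<And>\<iota>. \<iota> \<in> I \<Longrightarrow> \<rho> \<iota> * \<tau> \<iota> \<le> 1"
    and h\<epsilon>: "\<And>\<iota>. \<iota> \<in> I \<Longrightarrow> \<rho> \<iota> ^ r \<le> \<epsilon> \<iota>" "\<And>\<iota>. \<iota> \<in> I \<Longrightarrow> ((\<rho> \<iota>)\<^sup>2 * (\<tau> \<iota>)\<^sup>2) ^ Suc k \<le> \<epsilon> \<iota>"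
    and hn: "0 < Cn" "\<And>\<iota>. \<iota> \<in> I \<Longrightarrow> real (2 * n \<iota>) \<le> Cn * (\<tau> \<iota>)\<^sup>2"
      "\<And>\<iota>. \<iota> \<in> I \<Longrightarrow> (1 + 1 / (l \<iota> * \<rho> \<iota> ^ (J + 1))) / 2 ^ n \<iota> \<le> \<epsilon> \<iota>"
    and J: "1 \<le> J" and hN: "4 + J * (r + 2 * k + 3) \<le> N"
  obtains V \<omega> \<nu> where "\<And>\<iota>. \<iota> \<in> I \<Longrightarrow> 1 / l \<iota> \<le> \<nu> \<iota>" "\<And>c. \<exists>B. SC D (\<lambda>_. \<nu>) 4 B (V c)" "\<And>c. \<exists>B. SC D (\<lambda>_. \<nu>) 4 B (\<omega> c)"
    "\<And>c. BO D p (\<lambda>\<iota> x. V c \<iota> x - fv c \<iota> x)" "\<And>c q. BO D p (\<lambda>\<iota> x. pd q (V c) \<iota> x - pd q (fv c) \<iota> x)"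
    "\<And>c q s. BO D Z (pd s (pd q (V c)))"
    "\<And>c. BO D (\<lambda>\<iota>. p \<iota> * (1 + G \<iota>)) (\<lambda>\<iota> x. \<omega> c \<iota> x - fw c \<iota> x)"
    "\<And>c q. BO D (\<lambda>\<iota>. p \<iota> * (1 + G \<iota>)) (\<lambda>\<iota> x. pd q (\<omega> c) \<iota> x - pd q (fw c) \<iota> x)"
    "\<And>c q s. BO D (\<lambda>\<iota>. Z \<iota> * (1 + G \<iota>)) (pd s (pd q (\<omega> c)))"
    "\<And>q s. BO D1 (\<lambda>\<iota>. (p \<iota>)\<^sup>2 * ((\<rho> \<iota> * \<tau> \<iota>) ^ (2 * (J - 1)) + \<epsilon> \<iota>)) (Df (\<lambda>q r. mo (fA q r)) V \<omega> q s)"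
proof -
  let ?L = "r + 2 * k + 3"
  \<comment> \<open>Order 2 is left after \<open>J\<close> steps; this gives the final fields
    themselves order 4.\<close>
  let ?m = "2 + J * ?L"
  define P0 where "P0 = (\<lambda>\<iota>. d \<iota> + (l \<iota> * Mb \<iota>)\<^sup>2)"
  \<comment> \<open>One factor 1 / \<rho> above the mollification frequency. The mollified second
    derivatives are isotropic, of size M, at most p / l; the most demanding case of the invariant,
    two transversal derivatives, allows p \<nu>0 / \<rho> times \<rho>^2, and that is p / l.\<close>
  define \<nu>0 where "\<nu>0 = (\<lambda>\<iota>. 1 / (l \<iota> * \<rho> \<iota>))"
  obtain x0 where x0: "\<zeta> x0 \<le> 0" using \<zeta>(2) by blast
  have x0D: "(\<iota>, x0) \<in> D" if "\<iota> \<in> I" for \<iota> using x0 l(1)[OF that] that by (simp add: D_def)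
  have d0: "0 \<le> d \<iota>" and g0: "0 \<le> g \<iota>" if "\<iota> \<in> I" for \<iota>
  proof -
    have "\<zeta> x0 \<le> 2 * l \<iota>" using x0 l(1)[OF that] by simp
    from bD[OF that this, of 1 1] bv(3)[OF that this, of 1 1] show "0 \<le> d \<iota>" "0 \<le> g \<iota>" by linarith+
  qed
  have lM: "0 < l \<iota> * Mb \<iota>" if "\<iota> \<in> I" for \<iota> using l(1)[OF that] Mb[OF that] by simp
  have P0: "0 < P0 \<iota>" if "\<iota> \<in> I" for \<iota>
    unfolding P0_def using d0[OF that] zero_less_power[OF lM[OF that], of 2] by linarith
  have p2: "(p \<iota>)\<^sup>2 = (\<tau> \<iota>)\<^sup>2 * P0 \<iota>" if "\<iota> \<in> I" for \<iota>
    using P0[OF that] unfolding p_def P0_def[symmetric] by (simp add: power_mult_distrib P0_def)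
  \<comment> \<open>Mollification changes the fields by l M, so these changes are covered by the
    weight \<open>p\<close>.\<close>
  have plM: "l \<iota> * Mb \<iota> \<le> p \<iota>" if "\<iota> \<in> I" for \<iota>
  proof -
    have "l \<iota> * Mb \<iota> \<le> sqrt (d \<iota> + (l \<iota> * Mb \<iota>)\<^sup>2)"
      by (rule real_le_rsqrt) (use d0[OF that] in simp)
    also have "\<dots> \<le> \<tau> \<iota> * sqrt (d \<iota> + (l \<iota> * Mb \<iota>)\<^sup>2)"
      using mult_right_mono[OF h\<tau>(1)[OF that], of "sqrt (d \<iota> + (l \<iota> * Mb \<iota>)\<^sup>2)"] d0[OF that] by simp
    finally show ?thesis by (simp add: p_def)
  qed
  have pp: "0 < p \<iota>" if "\<iota> \<in> I" for \<iota> using plM[OF that] lM[OF that] by linarith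
  have G: "p \<iota> \<le> G \<iota>" "g \<iota> \<le> G \<iota>" "0 < G \<iota>" if "\<iota> \<in> I" for \<iota>
    using g0[OF that] pp[OF that] by (simp_all add: G_def)
  have l1: "1 \<le> 1 / l \<iota>" if "\<iota> \<in> I" for \<iota> using l[OF that] by (simp add: field_simps)
  have \<rho>n: "\<rho> \<iota> ^ n' \<le> 1" "0 < \<rho> \<iota> ^ n'" if "\<iota> \<in> I" for \<iota> n'
    using h\<rho>(1)[of \<iota>] h\<rho>(2)[OF that] by (simp_all add: power_le_one)
  have l\<nu>: "1 / l \<iota> \<le> \<nu>0 \<iota> / \<rho> \<iota> ^ n'" "\<nu>0 \<iota> / \<rho> \<iota> ^ n' = 1 / (l \<iota> * \<rho> \<iota> ^ (n' + 1))" if "\<iota> \<in> I" for \<iota> n'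
  proof -
    show e: "\<nu>0 \<iota> / \<rho> \<iota> ^ n' = 1 / (l \<iota> * \<rho> \<iota> ^ (n' + 1))" by (simp add: \<nu>0_def mult_ac)
    have "l \<iota> * \<rho> \<iota> ^ (n' + 1) \<le> l \<iota>" using \<rho>n(1)[OF that, of "n' + 1"] l(1)[OF that] by (intro mult_left_le) auto
    then show "1 / l \<iota> \<le> \<nu>0 \<iota> / \<rho> \<iota> ^ n'"
      unfolding e using \<rho>n(2)[OF that, of "n' + 1"] l(1)[OF that] by (intro divide_left_mono) auto
  qed
  have l\<nu>0: "1 / l \<iota> \<le> \<nu>0 \<iota>" if "\<iota> \<in> I" for \<iota> using l\<nu>(1)[OF that, of 0] by simp
  have dec: "decomposable D D1 (\<lambda>\<iota>. (\<tau> \<iota>)\<^sup>2) \<epsilon> N (\<lambda>_. \<nu>)" 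
    if \<nu>: "\<And>\<iota>. \<iota> \<in> I \<Longrightarrow> 1 / l \<iota> \<le> \<nu> \<iota>" "\<And>\<iota>. \<iota> \<in> I \<Longrightarrow> \<nu> \<iota> \<le> 1 / (l \<iota> * \<rho> \<iota> ^ (J + 1))" for \<nu>
  proof (rule decomposable_D[OF hn(1)])
    fix \<iota> assume i: "\<iota> \<in> I"
    show "real (2 * n \<iota>) \<le> Cn * (\<tau> \<iota>)\<^sup>2" by (rule hn(2)[OF i])
    have "(1 + \<nu> \<iota>) / 2 ^ n \<iota> \<le> (1 + 1 / (l \<iota> * \<rho> \<iota> ^ (J + 1))) / 2 ^ n \<iota>"
      by (rule divide_right_mono) (use \<nu>(2)[OF i] in auto)
    then show "(1 + \<nu> \<iota>) / 2 ^ n \<iota> \<le> \<epsilon> \<iota>" using hn(3)[OF i] by linarith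
    show "1 / l \<iota> \<le> \<nu> \<iota>" by (rule \<nu>(1)[OF i])
  qed
  have mono\<nu>: "1 / (l \<iota> * \<rho> \<iota> ^ (n' + 1)) \<le> 1 / (l \<iota> * \<rho> \<iota> ^ (J + 1))" if "\<iota> \<in> I" "n' \<le> J" for \<iota> n'
  proof -
    have "\<rho> \<iota> ^ (J + 1) \<le> \<rho> \<iota> ^ (n' + 1)"
      by (rule power_decreasing) (use that h\<rho>(1)[of \<iota>] h\<rho>(2) in auto)
    then show ?thesis
      using l(1)[OF that(1)] h\<rho>(1)[of \<iota>] by (intro divide_left_mono mult_left_mono mult_pos_pos) auto
  qed
  have dec0: "decomposable D D1 (\<lambda>\<iota>. (\<tau> \<iota>)\<^sup>2) \<epsilon> N (\<lambda>_ \<iota>. 1 / l \<iota>)"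
    by (rule dec) (use l\<nu>(1)[of _ J] l\<nu>(2)[of _ J] in auto)
  have decn: "decomposable D D1 (\<lambda>\<iota>. (\<tau> \<iota>)\<^sup>2) \<epsilon> N (\<lambda>_ \<iota>. \<nu>0 \<iota> / \<rho> \<iota> ^ n')" if "n' < J" for n'
  proof (rule dec)
    fix \<iota> assume i: "\<iota> \<in> I"
    show "1 / l \<iota> \<le> \<nu>0 \<iota> / \<rho> \<iota> ^ n'" by (rule l\<nu>(1)[OF i])
    show "\<nu>0 \<iota> / \<rho> \<iota> ^ n' \<le> 1 / (l \<iota> * \<rho> \<iota> ^ (J + 1))"
      unfolding l\<nu>(2)[OF i] by (rule mono\<nu>[OF i]) (use that in simp)
  qed
  have ij: "(1::2) \<noteq> 2" by simp
  have SD0: "SC D (\<lambda>_ \<iota>. 1 / l \<iota>) (Suc (Suc ?m)) P0 (D0 q s)" for q s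
    unfolding P0_def by (rule SC_order[OF SC_D0]) (use hN in simp)
  obtain \<Psi> :: "2 \<Rightarrow> 'i fld" where \<Psi>: "\<And>q. SC D (\<lambda>_ \<iota>. 1 / l \<iota>) (Suc (Suc ?m)) (\<lambda>\<iota>. (\<tau> \<iota>)\<^sup>2 * P0 \<iota>) (\<Psi> q)"
    "\<And>s q. SC D (\<lambda>_ \<iota>. 1 / l \<iota>) (Suc ?m) (\<lambda>\<iota>. (\<tau> \<iota>)\<^sup>2 * P0 \<iota>) (pd s (\<Psi> q))"
    "BO D1 (\<lambda>\<iota>. P0 \<iota> * \<epsilon> \<iota>) (\<lambda>\<iota> x. D0 1 2 \<iota> x - (pd 1 (\<Psi> 2) \<iota> x + pd 2 (\<Psi> 1) \<iota> x) / 2)"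
  proof -
    have "Suc (Suc ?m) \<le> N" using hN by simp
    from dec0[unfolded decomposable_def, rule_format, OF ij this SD0[of 1 2]] that show thesis by blast
  qed
  have lp: "\<And>k \<iota> x. (\<iota>, x) \<in> D \<Longrightarrow> 0 \<le> (\<lambda>_ \<iota>. 1 / l \<iota>) (k::2) \<iota>" using l(1) DI by (simp add: less_imp_le)
  have \<nu>p: "\<And>k \<iota> x. (\<iota>, x) \<in> D \<Longrightarrow> 0 \<le> (\<lambda>_. \<nu>0) (k::2) \<iota>" using l\<nu>0 l1 DI by (meson order_trans zero_le_one)
  have up: "SC D (\<lambda>_. \<nu>0) m' P f" if "SC D (\<lambda>_ \<iota>. 1 / l \<iota>) m' P f" for m' P f
    by (rule SC_mono[OF that, where c=1 and c'=1]) (use lp l\<nu>0 DI in auto)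
  have \<Psi>1: "SC D (\<lambda>_ \<iota>. 1 / l \<iota>) (Suc (Suc ?m)) (\<lambda>\<iota>. (p \<iota>)\<^sup>2) (\<Psi> q)" for q
    by (rule SC_weight[OF \<Psi>(1)]) (simp add: p2 DI)
  have \<Psi>2: "SC D (\<lambda>_ \<iota>. 1 / l \<iota>) (Suc ?m) (\<lambda>\<iota>. (p \<iota>)\<^sup>2) (pd s (\<Psi> q))" for q s
    by (rule SC_weight[OF \<Psi>(2)]) (simp add: p2 DI)
  have P0p: "P0 \<iota> \<le> (p \<iota>)\<^sup>2" if "\<iota> \<in> I" for \<iota>
    using mult_right_mono[OF one_le_power[OF h\<tau>(1)[OF that], of 2] less_imp_le[OF P0[OF that]]] by (simp add: p2[OF that])
  define h0 where "h0 = (\<lambda>q \<iota> x. D0 q q \<iota> x - pd q (\<Psi> q) \<iota> x)"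
  have h0: "SC D (\<lambda>_. \<nu>0) ?m (\<lambda>\<iota>. (p \<iota>)\<^sup>2) (h0 q)" for q
    unfolding h0_def
    by (intro up SC_sub SC_wmono[OF SC_order[OF SD0], where c=1] SC_order[OF \<Psi>2]) (use P0p DI lp in auto)
  obtain C1 where C1: "C1 > 0" "\<And>\<iota> x. (\<iota>, x) \<in> D \<Longrightarrow> \<bar>h0 1 \<iota> x\<bar> \<le> C1 * (p \<iota>)\<^sup>2"
    using BO_E[OF SC_BO[OF h0]] by blast
  obtain C2 where C2: "C2 > 0" "\<And>\<iota> x. (\<iota>, x) \<in> D \<Longrightarrow> \<bar>h0 2 \<iota> x\<bar> \<le> C2 * (p \<iota>)\<^sup>2"
    using BO_E[OF SC_BO[OF h0]] by blast
  \<comment> \<open>One constant shifts both diagonal entries; the summand 1 leaves a lower bound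
    p^2.\<close>
  define C where "C = C1 + C2 + 1"
  define \<kappa> where "\<kappa> = (\<lambda>\<iota>. C * (p \<iota>)\<^sup>2)"
  define X where "X = (\<lambda>q \<iota> (x :: real^2). - \<kappa> \<iota> * x $ q)"
  define W where "W = (\<lambda>q \<iota> x. \<Psi> q \<iota> x + X q \<iota> x)"
  define \<omega> where "\<omega> = (\<lambda>q \<iota> x. mo (fw q) \<iota> x + W q \<iota> x)"
  have C0: "0 < C" using C1 C2 by (simp add: C_def)
  have RD: "\<bar>x $ k\<bar> \<le> R" if "(\<iota>, x) \<in> D" for \<iota> x k
    by (rule R(2)) (use that l[OF DI[OF that]] in \<open>auto simp: D_def\<close>)
  have sX: "SC D (\<lambda>_ \<iota>. 1 / l \<iota>) n' (\<lambda>\<iota>. \<bar>- \<kappa> \<iota>\<bar> * (R + 1)) (X q)" for q n'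
    unfolding X_def by (rule SC_cmult[OF SC_coord[OF odom_D]]) (use l1 DI RD in auto)
  have pX: "pd s (X q) = (\<lambda>\<iota> x. if s = q then - \<kappa> \<iota> else 0)" for s q
    unfolding X_def by (intro ext) (rule pd_coord)
  have ex: "\<exists>B. SC E \<mu> m' B f" if "SC E \<mu> m' B f" for E \<mu> m' B and f :: "'i fld" using that by blast
  have sW: "\<exists>B. SC D (\<lambda>_ \<iota>. 1 / l \<iota>) (Suc (Suc ?m)) B (W q)" for q
    unfolding W_def by (rule SC_add_ex[OF ex[OF \<Psi>1] ex[OF sX] lp])
  have sw: "SC D (\<lambda>_ \<iota>. 1 / l \<iota>) (Suc (Suc ?m)) Mb (mo (fw q))" for q
    by (rule SC_order[OF SC_V0(4)]) (use hN in simp)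
  have s\<omega>: "\<exists>B. SC D (\<lambda>_. \<nu>0) (Suc (Suc ?m)) B (\<omega> q)" for q
  proof -
    have "\<exists>B. SC D (\<lambda>_ \<iota>. 1 / l \<iota>) (Suc (Suc ?m)) B (\<omega> q)"
      unfolding \<omega>_def by (rule SC_add_ex[OF ex[OF sw] sW lp])
    then show ?thesis using up by blast
  qed
  have p\<omega>: "pd s (\<omega> q) \<iota> x = pd s (mo (fw q)) \<iota> x + (pd s (\<Psi> q) \<iota> x + (if s = q then - \<kappa> \<iota> else 0))"
    "pd t (pd s (\<omega> q)) \<iota> x = pd t (pd s (mo (fw q))) \<iota> x + pd t (pd s (\<Psi> q)) \<iota> x"
    if a: "(\<iota>, x) \<in> D" for \<iota> x q s t
  proof -
    obtain B where B: "SC D (\<lambda>_ \<iota>. 1 / l \<iota>) (Suc (Suc ?m)) B (W q)" using sW by blast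
    have "pd s (\<omega> q) \<iota> x = pd s (mo (fw q)) \<iota> x + pd s (W q) \<iota> x"
      unfolding \<omega>_def by (rule pd_add[where f="mo (fw q)" and g="W q", OF SC_diff[OF sw a] SC_diff[OF B a]])
    also have "pd s (W q) \<iota> x = pd s (\<Psi> q) \<iota> x + pd s (X q) \<iota> x"
      unfolding W_def by (rule pd_add[where f="\<Psi> q" and g="X q", OF SC_diff[OF \<Psi>1 a] SC_diff[OF sX a]])
    finally show "pd s (\<omega> q) \<iota> x = pd s (mo (fw q)) \<iota> x + (pd s (\<Psi> q) \<iota> x + (if s = q then - \<kappa> \<iota> else 0))"
      unfolding pX .
    have "pd t (pd s (\<omega> q)) \<iota> x = pd t (pd s (mo (fw q))) \<iota> x + pd t (pd s (W q)) \<iota> x"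
      unfolding \<omega>_def by (rule pd_pd_add[OF sw B a])
    also have "pd t (pd s (W q)) \<iota> x = pd t (pd s (\<Psi> q)) \<iota> x + pd t (pd s (X q)) \<iota> x"
      unfolding W_def by (rule pd_pd_add[OF \<Psi>1 sX a])
    also have "pd t (pd s (X q)) \<iota> x = 0" unfolding pX by simp
    finally show "pd t (pd s (\<omega> q)) \<iota> x = pd t (pd s (mo (fw q))) \<iota> x + pd t (pd s (\<Psi> q)) \<iota> x" by simp
  qed
  have p2G: "(p \<iota>)\<^sup>2 \<le> p \<iota> * G \<iota>" if "\<iota> \<in> I" for \<iota>
    unfolding power2_eq_square by (rule mult_left_mono) (use G[OF that] pp[OF that] in auto)
  have b\<kappa>: "BO D (\<lambda>\<iota>. p \<iota> * G \<iota>) (\<lambda>\<iota> x. if s = q then - \<kappa> \<iota> else 0)" for s q :: 2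
    by (rule BO_I[OF C0]) (use C0 p2G DI pp G in \<open>auto simp: \<kappa>_def less_imp_le intro!: mult_left_mono\<close>)
  have bX: "BO D (\<lambda>\<iota>. p \<iota> * G \<iota>) (X q)" for q
  proof (rule BO_mono[OF SC_BO[OF sX], of "C * (R + 1)"])
    fix \<iota> x assume "(\<iota>, x) \<in> D"
    then have i: "\<iota> \<in> I" by (rule DI)
    have "C * (R + 1) * (p \<iota>)\<^sup>2 \<le> C * (R + 1) * (p \<iota> * G \<iota>)"
      by (rule mult_left_mono[OF p2G[OF i]]) (use C0 R in simp)
    then show "\<bar>- \<kappa> \<iota>\<bar> * (R + 1) \<le> C * (R + 1) * (p \<iota> * G \<iota>)"
      using C0 by (simp add: \<kappa>_def abs_mult mult_ac)
  qed (use C0 R in simp)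
  have I\<omega>: "BO D (\<lambda>\<iota>. p \<iota> * G \<iota>) (\<lambda>\<iota> x. \<omega> c \<iota> x - mo (fw c) \<iota> x)"
      "BO D (\<lambda>\<iota>. p \<iota> * G \<iota>) (\<lambda>\<iota> x. pd q (\<omega> c) \<iota> x - pd q (mo (fw c)) \<iota> x)"
      "BO D (\<lambda>\<iota>. p \<iota> * (\<nu>0 \<iota> / \<rho> \<iota>) * G \<iota>) (\<lambda>\<iota> x. pd s (pd q (\<omega> c)) \<iota> x - pd s (pd q (mo (fw c))) \<iota> x)" for c q s
  proof -
    have b1: "BO D (\<lambda>\<iota>. p \<iota> * G \<iota>) (\<Psi> c)" by (rule BO_mono[OF SC_BO[OF \<Psi>1], of 1]) (use p2G DI in auto)
    have b2: "BO D (\<lambda>\<iota>. p \<iota> * G \<iota>) (pd q (\<Psi> c))" by (rule BO_mono[OF SC_BO[OF \<Psi>2], of 1]) (use p2G DI in auto)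
    show "BO D (\<lambda>\<iota>. p \<iota> * G \<iota>) (\<lambda>\<iota> x. \<omega> c \<iota> x - mo (fw c) \<iota> x)"
      by (rule BO_cong[OF BO_add[OF b1 bX[of c]]]) (simp add: \<omega>_def W_def)
    show "BO D (\<lambda>\<iota>. p \<iota> * G \<iota>) (\<lambda>\<iota> x. pd q (\<omega> c) \<iota> x - pd q (mo (fw c)) \<iota> x)"
      by (rule BO_cong[OF BO_add[OF b2 b\<kappa>[of q c]]]) (simp add: p\<omega>(1))
    have "BO D (\<lambda>\<iota>. p \<iota> * (\<nu>0 \<iota> / \<rho> \<iota>) * G \<iota>) (pd s (pd q (\<Psi> c)))"
    proof (rule BO_mono[OF SC_BO[OF SC_pd[OF \<Psi>2]], of 1])
      fix \<iota> x assume "(\<iota>, x) \<in> D"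
      then have i: "\<iota> \<in> I" by (rule DI)
      have "(p \<iota>)\<^sup>2 * (1 / l \<iota>) \<le> (p \<iota> * G \<iota>) * (\<nu>0 \<iota> / \<rho> \<iota> ^ 1)"
        by (rule mult_mono[OF p2G[OF i] l\<nu>(1)[OF i]]) (use pp[OF i] G[OF i] l(1)[OF i] in auto)
      then show "(p \<iota>)\<^sup>2 * (1 / l \<iota>) \<le> 1 * (p \<iota> * (\<nu>0 \<iota> / \<rho> \<iota>) * G \<iota>)" by (simp add: mult_ac)
    qed simp
    then show "BO D (\<lambda>\<iota>. p \<iota> * (\<nu>0 \<iota> / \<rho> \<iota>) * G \<iota>) (\<lambda>\<iota> x. pd s (pd q (\<omega> c)) \<iota> x - pd s (pd q (mo (fw c))) \<iota> x)"
      by (rule BO_cong) (simp add: p\<omega>(2))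
  qed
  have zero: "BO E Q (\<lambda>\<iota> x. f \<iota> x - f \<iota> x)" if "\<And>\<iota> x. (\<iota>, x) \<in> E \<Longrightarrow> 0 \<le> Q \<iota>" for E Q and f :: "'i fld"
    by (rule BO_fun) (use that in simp)
  have Dfe: "Df (\<lambda>q r. mo (fA q r)) (\<lambda>c. mo (fv c)) \<omega> q s \<iota> x = D0 q s \<iota> x - (pd q (\<Psi> s) \<iota> x + pd s (\<Psi> q) \<iota> x) / 2
      + (if q = s then \<kappa> \<iota> else 0)" if a: "(\<iota>, x) \<in> D" for q s \<iota> x
    unfolding D0_def Df_def p\<omega>[OF a] by (simp add: algebra_simps add_divide_distrib)
  define h where "h = (\<lambda>q \<iota> x. h0 q \<iota> x + \<kappa> \<iota>)"
  have h: "SC D (\<lambda>_. \<nu>0) ?m (\<lambda>\<iota>. (p \<iota>)\<^sup>2) (h q)" for q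
    unfolding h_def
  proof (rule SC_add[OF h0])
    have "SC D (\<lambda>_. \<nu>0) ?m (\<lambda>\<iota>. C * (p \<iota>)\<^sup>2) (\<lambda>\<iota> x. \<kappa> \<iota>)"
      by (rule SC_const[OF odom_D \<nu>p]) (use C0 in \<open>auto simp: \<kappa>_def\<close>)
    then show "SC D (\<lambda>_. \<nu>0) ?m (\<lambda>\<iota>. (p \<iota>)\<^sup>2) (\<lambda>\<iota> x. \<kappa> \<iota>)"
      by (rule SC_wmono[OF _ C0]) (use \<nu>p in auto)
  qed
  have hlow: "1 * (p \<iota>)\<^sup>2 \<le> h 1 \<iota> x" if "(\<iota>, x) \<in> D" for \<iota> x
  proof -
    have "0 \<le> C2 * (p \<iota>)\<^sup>2" using C2 by simp
    then show ?thesis using C1(2)[OF that] unfolding h_def \<kappa>_def C_def by (simp add: algebra_simps abs_le_iff)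
  qed
  have \<epsilon>0: "0 \<le> \<epsilon> \<iota>" if "\<iota> \<in> I" for \<iota> using h\<epsilon>(1)[OF that] \<rho>n(2)[OF that, of r] by linarith
  have D1I: "(\<iota>, x) \<in> D1 \<Longrightarrow> \<iota> \<in> I" for \<iota> x by (simp add: D1_def)
  have w\<epsilon>: "BO D1 (\<lambda>\<iota>. (p \<iota>)\<^sup>2 * \<epsilon> \<iota>) f" if "BO D1 (\<lambda>\<iota>. P0 \<iota> * \<epsilon> \<iota>) f" for f
    by (rule BO_mono[OF that, of 1]) (use P0p \<epsilon>0 D1I in \<open>auto intro!: mult_right_mono\<close>)
  have start: "stage_inv D D1 (\<lambda>q r. mo (fA q r)) (\<lambda>c. mo (fv c)) (\<lambda>c. mo (fw c)) G p \<epsilon> \<rho> \<nu>0 ?m 1 p p (\<lambda>c. mo (fv c)) \<omega>"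
  proof -
    have 1: "\<exists>B. SC D (\<lambda>_. \<nu>0) (Suc (Suc ?m)) B (mo (fv c))" for c
      by (rule exI, rule up, rule SC_order[OF SC_V0(1)]) (use hN in simp)
    have 2: "SC D (\<lambda>_. \<nu>0) (Suc ?m) G (pd q (mo (fv c)))" for c q
    proof (rule SC_wmono[OF up[OF SC_order[OF SC_V0(2)]], where c=1])
      show "Suc ?m \<le> N" using hN by simp
    qed (use G DI \<nu>p in auto)
    have 3: "SC D (\<lambda>_. \<nu>0) ?m (\<lambda>\<iota>. p \<iota> * (\<nu>0 \<iota> / \<rho> \<iota>) * \<rho> \<iota> ^ (of_bool (q \<noteq> c) + of_bool (s \<noteq> c))) (pd s (pd q (mo (fv c))))" for c q s
    proof (rule SC_wmono[OF up[OF SC_order[OF SC_V0(3)]], where c=1])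
      show "?m \<le> N" using hN by simp
      fix \<iota> x assume "(\<iota>, x) \<in> D"
      then have i: "\<iota> \<in> I" by (rule DI)
      let ?e = "of_bool (q \<noteq> c) + of_bool (s \<noteq> c) :: nat"
      have "\<rho> \<iota> ^ 2 \<le> \<rho> \<iota> ^ ?e" by (rule power_decreasing) (use h\<rho>(1)[of \<iota>] h\<rho>(2)[OF i] in auto)
      then have "p \<iota> * (\<nu>0 \<iota> / \<rho> \<iota>) * \<rho> \<iota> ^ 2 \<le> p \<iota> * (\<nu>0 \<iota> / \<rho> \<iota>) * \<rho> \<iota> ^ ?e"
        by (rule mult_left_mono) (use pp[OF i] l(1)[OF i] h\<rho>(1)[of \<iota>] in \<open>auto simp: \<nu>0_def\<close>)
      moreover have "p \<iota> * (\<nu>0 \<iota> / \<rho> \<iota>) * \<rho> \<iota> ^ 2 = p \<iota> / l \<iota>"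
        using h\<rho>(1)[of \<iota>] by (simp add: \<nu>0_def power2_eq_square)
      moreover have "Mb \<iota> \<le> p \<iota> / l \<iota>" using plM[OF i] l(1)[OF i] by (simp add: pos_le_divide_eq mult.commute)
      ultimately show "Mb \<iota> \<le> 1 * (p \<iota> * (\<nu>0 \<iota> / \<rho> \<iota>) * \<rho> \<iota> ^ ?e)" by linarith
    qed (use \<nu>p in auto)
    have 5: "BO D p (\<lambda>\<iota> x. mo (fv c) \<iota> x - mo (fv c) \<iota> x)" "BO D p (\<lambda>\<iota> x. pd q (mo (fv c)) \<iota> x - pd q (mo (fv c)) \<iota> x)" for c q
      by (rule zero, rule less_imp_le, rule pp, erule DI)+
    have pe: "0 \<le> (p \<iota>)\<^sup>2 * \<epsilon> \<iota>" if "(\<iota>, x) \<in> D1" for \<iota> x using \<epsilon>0[OF D1I[OF that]] by simp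
    have z: "BO D1 (\<lambda>\<iota>. (p \<iota>)\<^sup>2 * \<epsilon> \<iota>) (\<lambda>\<iota> x. Df (\<lambda>q r. mo (fA q r)) (\<lambda>c. mo (fv c)) \<omega> q q \<iota> x - h q \<iota> x)" for q
      by (rule BO_cong[OF zero[where f="\<lambda>_ _. 0"]]) (use pe D1_D in \<open>auto simp: Dfe h_def h0_def\<close>)
    have y: "BO D1 (\<lambda>\<iota>. (p \<iota>)\<^sup>2 * \<epsilon> \<iota>) (Df (\<lambda>q r. mo (fA q r)) (\<lambda>c. mo (fv c)) \<omega> 1 2)"
      "BO D1 (\<lambda>\<iota>. (p \<iota>)\<^sup>2 * \<epsilon> \<iota>) (Df (\<lambda>q r. mo (fA q r)) (\<lambda>c. mo (fv c)) \<omega> 2 1)"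
      by (rule BO_cong[OF w\<epsilon>[OF \<Psi>(3)]], use D1_D D0_sym[of _ _ 2 1] in \<open>auto simp: Dfe add.commute\<close>)+
    have "\<exists>h h' c. c > (0::real) \<and> SC D (\<lambda>_. \<nu>0) ?m (\<lambda>\<iota>. (p \<iota>)\<^sup>2) h \<and> (\<forall>\<iota> x. (\<iota>, x) \<in> D \<longrightarrow> c * (p \<iota>)\<^sup>2 \<le> h \<iota> x) \<and>
        SC D (\<lambda>_. \<nu>0) ?m (\<lambda>\<iota>. (p \<iota>)\<^sup>2) h' \<and>
        (\<forall>j. j \<noteq> 1 \<longrightarrow> BO D1 (\<lambda>\<iota>. (p \<iota>)\<^sup>2 * \<epsilon> \<iota>) (\<lambda>\<iota> x. Df (\<lambda>q r. mo (fA q r)) (\<lambda>c. mo (fv c)) \<omega> 1 1 \<iota> x - h \<iota> x) \<and>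
           BO D1 (\<lambda>\<iota>. (p \<iota>)\<^sup>2 * \<epsilon> \<iota>) (\<lambda>\<iota> x. Df (\<lambda>q r. mo (fA q r)) (\<lambda>c. mo (fv c)) \<omega> j j \<iota> x - h' \<iota> x) \<and>
           BO D1 (\<lambda>\<iota>. (p \<iota>)\<^sup>2 * \<epsilon> \<iota>) (Df (\<lambda>q r. mo (fA q r)) (\<lambda>c. mo (fv c)) \<omega> 1 j) \<and>
           BO D1 (\<lambda>\<iota>. (p \<iota>)\<^sup>2 * \<epsilon> \<iota>) (Df (\<lambda>q r. mo (fA q r)) (\<lambda>c. mo (fv c)) \<omega> j 1))"
    proof (rule exI[of _ "h 1"], rule exI[of _ "h 2"], rule exI[of _ 1], intro conjI allI impI)
      fix j :: 2 assume "j \<noteq> 1"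
      then have "j = 2" using exhaust_2[of j] by blast
      then show "BO D1 (\<lambda>\<iota>. (p \<iota>)\<^sup>2 * \<epsilon> \<iota>) (\<lambda>\<iota> x. Df (\<lambda>q r. mo (fA q r)) (\<lambda>c. mo (fv c)) \<omega> j j \<iota> x - h 2 \<iota> x)"
        "BO D1 (\<lambda>\<iota>. (p \<iota>)\<^sup>2 * \<epsilon> \<iota>) (Df (\<lambda>q r. mo (fA q r)) (\<lambda>c. mo (fv c)) \<omega> 1 j)"
        "BO D1 (\<lambda>\<iota>. (p \<iota>)\<^sup>2 * \<epsilon> \<iota>) (Df (\<lambda>q r. mo (fA q r)) (\<lambda>c. mo (fv c)) \<omega> j 1)" using z y by simp_all
    qed (use h hlow z in auto)
    then show ?thesis
      unfolding stage_inv_def by (intro conjI allI 1 2 3 s\<omega> 5 I\<omega>)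
  qed
  have \<nu>01: "1 \<le> \<nu>0 \<iota>" if "\<iota> \<in> I" for \<iota> using l\<nu>0[OF that] l1[OF that] by linarith
  have "\<exists>i V \<omega>. stage_inv D D1 (\<lambda>q r. mo (fA q r)) (\<lambda>c. mo (fv c)) (\<lambda>c. mo (fw c)) G p \<epsilon> \<rho> (\<lambda>\<iota>. \<nu>0 \<iota> / \<rho> \<iota> ^ J) 2 i
      (\<lambda>\<iota>. p \<iota> * (\<rho> \<iota> * \<tau> \<iota>) ^ (J - 1)) (\<lambda>\<iota>. p \<iota> * (\<rho> \<iota> * \<tau> \<iota>) ^ (Suc J - 1)) V \<omega>"
    by (rule stage_iterate[OF odom_D D1_D h\<rho>(1) _ _ _ _ _ _ _ _ _ _ decn start])
       (use h\<rho> h\<tau> h\<epsilon> \<nu>01 pp G RD hN DI in auto)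
  then obtain i V' \<omega>' where S: "stage_inv D D1 (\<lambda>q r. mo (fA q r)) (\<lambda>c. mo (fv c)) (\<lambda>c. mo (fw c)) G p \<epsilon> \<rho> (\<lambda>\<iota>. \<nu>0 \<iota> / \<rho> \<iota> ^ J) 2 i
      (\<lambda>\<iota>. p \<iota> * (\<rho> \<iota> * \<tau> \<iota>) ^ (J - 1)) (\<lambda>\<iota>. p \<iota> * (\<rho> \<iota> * \<tau> \<iota>) ^ (Suc J - 1)) V' \<omega>'" by blast
  let ?\<nu> = "\<lambda>\<iota>. \<nu>0 \<iota> / \<rho> \<iota> ^ J" and ?p = "\<lambda>\<iota>. p \<iota> * (\<rho> \<iota> * \<tau> \<iota>) ^ (J - 1)" and ?p' = "\<lambda>\<iota>. p \<iota> * (\<rho> \<iota> * \<tau> \<iota>) ^ (Suc J - 1)"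
  let ?Df = "Df (\<lambda>q r. mo (fA q r)) V' \<omega>'"
  note S' = S[unfolded stage_inv_def]
  have S1: "\<exists>B. SC D (\<lambda>_. ?\<nu>) (Suc (Suc 2)) B (V' c)" and S3: "SC D (\<lambda>_. ?\<nu>) 2 (\<lambda>\<iota>. ?p \<iota> * (?\<nu> \<iota> / \<rho> \<iota>) * \<rho> \<iota> ^ (of_bool (q \<noteq> c) + of_bool (s \<noteq> c))) (pd s (pd q (V' c)))"
    and S4: "\<exists>B. SC D (\<lambda>_. ?\<nu>) (Suc (Suc 2)) B (\<omega>' c)"
    and S5: "BO D p (\<lambda>\<iota> x. V' c \<iota> x - mo (fv c) \<iota> x)" and S6: "BO D p (\<lambda>\<iota> x. pd q (V' c) \<iota> x - pd q (mo (fv c)) \<iota> x)"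
    and S7: "BO D (\<lambda>\<iota>. p \<iota> * G \<iota>) (\<lambda>\<iota> x. \<omega>' c \<iota> x - mo (fw c) \<iota> x)"
    and S8: "BO D (\<lambda>\<iota>. p \<iota> * G \<iota>) (\<lambda>\<iota> x. pd q (\<omega>' c) \<iota> x - pd q (mo (fw c)) \<iota> x)"
    and S9: "BO D (\<lambda>\<iota>. ?p \<iota> * (?\<nu> \<iota> / \<rho> \<iota>) * G \<iota>) (\<lambda>\<iota> x. pd s (pd q (\<omega>' c)) \<iota> x - pd s (pd q (mo (fw c))) \<iota> x)" for c q s
    using S' by blast+
  obtain H H' where T: "SC D (\<lambda>_. ?\<nu>) 2 (\<lambda>\<iota>. (?p \<iota>)\<^sup>2) H" "SC D (\<lambda>_. ?\<nu>) 2 (\<lambda>\<iota>. (?p' \<iota>)\<^sup>2) H'"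
    "\<forall>j. j \<noteq> i \<longrightarrow> BO D1 (\<lambda>\<iota>. (p \<iota>)\<^sup>2 * \<epsilon> \<iota>) (\<lambda>\<iota> x. ?Df i i \<iota> x - H \<iota> x) \<and>
       BO D1 (\<lambda>\<iota>. (p \<iota>)\<^sup>2 * \<epsilon> \<iota>) (\<lambda>\<iota> x. ?Df j j \<iota> x - H' \<iota> x) \<and>
       BO D1 (\<lambda>\<iota>. (p \<iota>)\<^sup>2 * \<epsilon> \<iota>) (?Df i j) \<and> BO D1 (\<lambda>\<iota>. (p \<iota>)\<^sup>2 * \<epsilon> \<iota>) (?Df j i)"
    using S' by (elim conjE exE) (rule that, assumption+)
  note S10 = T(1,2) T(3)[rule_format, THEN conjunct1] T(3)[rule_format, THEN conjunct2, THEN conjunct1]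
    T(3)[rule_format, THEN conjunct2, THEN conjunct2, THEN conjunct1]
    T(3)[rule_format, THEN conjunct2, THEN conjunct2, THEN conjunct2]
  have \<tau>n: "1 \<le> \<tau> \<iota> ^ n'" if "\<iota> \<in> I" for \<iota> n' by (rule one_le_power[OF h\<tau>(1)[OF that]])
  \<comment> \<open>Three powers of 1 / \<rho> survive: one from \<open>\<nu>0\<close>, one from the
    form of the invariant, and one because \<open>J\<close> frequency steps face only
    \<open>J - 1\<close> amplitude gains.\<close>
  have pZ: "?p \<iota> * (?\<nu> \<iota> / \<rho> \<iota>) = Z \<iota>" if "\<iota> \<in> I" for \<iota>
  proof -
    have e: "\<rho> \<iota> ^ J = \<rho> \<iota> ^ (J - 1) * \<rho> \<iota>" using J power_minus_mult[of J "\<rho> \<iota>"] by simp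
    show ?thesis using h\<rho>(1)[of \<iota>] l(1)[OF that]
      unfolding Z_def \<nu>0_def e power_mult_distrib by (simp add: field_simps power3_eq_cube)
  qed
  have Zp: "p \<iota> / l \<iota> \<le> Z \<iota>" if "\<iota> \<in> I" for \<iota>
  proof -
    have "p \<iota> / l \<iota> \<le> (p \<iota> * \<tau> \<iota> ^ (J - 1)) / (l \<iota> * \<rho> \<iota> ^ 3)"
    proof (rule frac_le)
      show "p \<iota> \<le> p \<iota> * \<tau> \<iota> ^ (J - 1)" using mult_left_mono[OF \<tau>n[OF that, of "J - 1"], of "p \<iota>"] pp[OF that] by simp
      then show "0 \<le> p \<iota> * \<tau> \<iota> ^ (J - 1)" using pp[OF that] by linarith
      show "0 < l \<iota> * \<rho> \<iota> ^ 3" "l \<iota> * \<rho> \<iota> ^ 3 \<le> l \<iota>" using l(1)[OF that] \<rho>n[OF that, of 3] by (simp_all add: mult_left_le)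
    qed
    then show ?thesis by (simp add: Z_def)
  qed
  have Z0: "0 < Z \<iota>" if "\<iota> \<in> I" for \<iota>
    by (rule less_le_trans[OF _ Zp[OF that]]) (use pp[OF that] l(1)[OF that] in simp)
  have MZ: "Mb \<iota> \<le> Z \<iota>" if "\<iota> \<in> I" for \<iota>
    by (rule order_trans[OF _ Zp[OF that]]) (use plM[OF that] l(1)[OF that] in \<open>simp add: pos_le_divide_eq mult.commute\<close>)
  have G1: "a * G \<iota> \<le> 1 * (a * (1 + G \<iota>))" "a \<le> 1 * (a * (1 + G \<iota>))" if "\<iota> \<in> I" "0 \<le> a" for \<iota> a
    using that(2) G(3)[OF that(1)] by (simp_all add: algebra_simps)
  have lMp: "BO D p f" if "BO D (\<lambda>\<iota>. l \<iota> * Mb \<iota>) f" for f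
    by (rule BO_mono[OF that, of 1]) (use plM DI in auto)
  have pG: "BO D (\<lambda>\<iota>. p \<iota> * (1 + G \<iota>)) f" if "BO D p f" for f
    by (rule BO_mono[OF that zero_less_one], rule G1(2)) (use pp DI in \<open>auto simp: less_imp_le\<close>)
  have pG': "BO D (\<lambda>\<iota>. p \<iota> * (1 + G \<iota>)) f" if "BO D (\<lambda>\<iota>. p \<iota> * G \<iota>) f" for f
    by (rule BO_mono[OF that zero_less_one], rule G1(1)) (use pp DI in \<open>auto simp: less_imp_le\<close>)
  let ?P = "\<lambda>\<iota>. (p \<iota>)\<^sup>2 * ((\<rho> \<iota> * \<tau> \<iota>) ^ (2 * (J - 1)) + \<epsilon> \<iota>)"
  \<comment> \<open>All that is left of the defect: the last two diagonal entries and the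
    accumulated errors of size p^2 \<epsilon>.\<close>
  have p2J: "(?p \<iota>)\<^sup>2 \<le> ?P \<iota>" "(?p' \<iota>)\<^sup>2 \<le> ?P \<iota>" "(p \<iota>)\<^sup>2 * \<epsilon> \<iota> \<le> ?P \<iota>" if "\<iota> \<in> I" for \<iota>
  proof -
    have \<rho>\<tau>: "0 \<le> \<rho> \<iota> * \<tau> \<iota>" using h\<rho>(1)[of \<iota>] h\<tau>(1)[OF that] by simp
    have e: "(?p \<iota>)\<^sup>2 = (p \<iota>)\<^sup>2 * (\<rho> \<iota> * \<tau> \<iota>) ^ (2 * (J - 1))"
      unfolding power_mult_distrib[of "p \<iota>"] power_mult[symmetric] by (simp only: mult.commute)
    show "(?p \<iota>)\<^sup>2 \<le> ?P \<iota>" unfolding e using \<epsilon>0[OF that] by (intro mult_left_mono) auto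
    moreover have "?p' \<iota> \<le> ?p \<iota>"
      using pp[OF that] power_decreasing[OF _ \<rho>\<tau> h\<tau>(2)[OF that], of "J - 1" "Suc J - 1"] by (intro mult_left_mono) auto
    then have "(?p' \<iota>)\<^sup>2 \<le> (?p \<iota>)\<^sup>2" using pp[OF that] \<rho>\<tau> by (intro power_mono) auto
    ultimately show "(?p' \<iota>)\<^sup>2 \<le> ?P \<iota>" by linarith
    show "(p \<iota>)\<^sup>2 * \<epsilon> \<iota> \<le> ?P \<iota>" using \<rho>\<tau> by (intro mult_left_mono) auto
  qed
  have toP: "BO D1 ?P f" if "BO D1 Q f" "\<And>\<iota>. \<iota> \<in> I \<Longrightarrow> Q \<iota> \<le> ?P \<iota>" for Q f
    by (rule BO_mono[OF that(1) zero_less_one]) (use that(2) D1I in auto)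
  have sub: "BO D1 Q f" if "BO D Q f" for Q f using that D1_D unfolding BO_def by blast
  have bDf: "BO D1 ?P (?Df q s)" for q s
  proof -
    have H: "BO D1 ?P H" "BO D1 ?P H'"
      using toP[OF sub[OF SC_BO[OF S10(1)]] p2J(1)] toP[OF sub[OF SC_BO[OF S10(2)]] p2J(2)] by simp_all
    have d: "BO D1 ?P (?Df i i)" "BO D1 ?P (?Df j j)" "BO D1 ?P (?Df i j)" "BO D1 ?P (?Df j i)" if ji: "j \<noteq> i" for j
    proof -
      show "BO D1 ?P (?Df i i)" by (rule BO_cong[OF BO_add[OF H(1) toP[OF S10(3)[OF ji] p2J(3)]]]) simp_all
      show "BO D1 ?P (?Df j j)" by (rule BO_cong[OF BO_add[OF H(2) toP[OF S10(4)[OF ji] p2J(3)]]]) simp_all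
      show "BO D1 ?P (?Df i j)" "BO D1 ?P (?Df j i)" using toP[OF S10(5)[OF ji] p2J(3)] toP[OF S10(6)[OF ji] p2J(3)] by simp_all
    qed
    obtain j :: 2 where ji: "j \<noteq> i" by (cases "i = 0") (use that[of 0] that[of 1] in auto)
    have two: "k = i \<or> k = j" for k using ji exhaust_2[of i] exhaust_2[of j] exhaust_2[of k] by auto
    show ?thesis using two[of q] two[of s] d[OF ji] by auto
  qed
  show thesis
  proof (rule that[of ?\<nu> V' \<omega>'])
    show "1 / l \<iota> \<le> ?\<nu> \<iota>" if "\<iota> \<in> I" for \<iota> by (rule l\<nu>(1)[OF that])
    show "\<exists>B. SC D (\<lambda>_. ?\<nu>) 4 B (V' c)" "\<exists>B. SC D (\<lambda>_. ?\<nu>) 4 B (\<omega>' c)" for c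
      using S1[of c] S4[of c] by (simp_all add: eval_nat_numeral)
    show "BO D p (\<lambda>\<iota> x. V' c \<iota> x - fv c \<iota> x)" for c
      by (rule BO_cong[OF BO_add[OF S5[of c] lMp[OF V0_close(1)[of c]]]]) simp
    show "BO D p (\<lambda>\<iota> x. pd q (V' c) \<iota> x - pd q (fv c) \<iota> x)" for c q
      by (rule BO_cong[OF BO_add[OF S6[of q c] lMp[OF V0_close(2)[where q=q and c=c]]]]) simp
    show "BO D Z (pd s (pd q (V' c)))" for c q s
    proof (rule BO_mono[OF SC_BO[OF S3] zero_less_one])
      fix \<iota> x assume "(\<iota>, x) \<in> D"
      then have i: "\<iota> \<in> I" by (rule DI)
      have "Z \<iota> * \<rho> \<iota> ^ (of_bool (q \<noteq> c) + of_bool (s \<noteq> c)) \<le> Z \<iota>"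
        by (rule mult_left_le[OF \<rho>n(1)[OF i]]) (use Z0[OF i] in simp)
      then show "?p \<iota> * (?\<nu> \<iota> / \<rho> \<iota>) * \<rho> \<iota> ^ (of_bool (q \<noteq> c) + of_bool (s \<noteq> c)) \<le> 1 * Z \<iota>"
        unfolding pZ[OF i] by simp
    qed
    show "BO D (\<lambda>\<iota>. p \<iota> * (1 + G \<iota>)) (\<lambda>\<iota> x. \<omega>' c \<iota> x - fw c \<iota> x)" for c
      by (rule BO_cong[OF BO_add[OF pG'[OF S7[of c]] pG[OF lMp[OF V0_close(3)[of c]]]]]) simp
    show "BO D (\<lambda>\<iota>. p \<iota> * (1 + G \<iota>)) (\<lambda>\<iota> x. pd q (\<omega>' c) \<iota> x - pd q (fw c) \<iota> x)" for c q
      by (rule BO_cong[OF BO_add[OF pG'[OF S8[of q c]] pG[OF lMp[OF V0_close(4)[where q=q and c=c]]]]]) simp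
    show "BO D (\<lambda>\<iota>. Z \<iota> * (1 + G \<iota>)) (pd s (pd q (\<omega>' c)))" for c q s
    proof (rule BO_cong[OF BO_add[OF BO_mono[OF S9[of s q c] zero_less_one] BO_mono[OF SC_BO[OF SC_V0(5)[where r=s and q=q and c=c]] zero_less_one]]])
      fix \<iota> x assume "(\<iota>, x) \<in> D"
      then have i: "\<iota> \<in> I" by (rule DI)
      show "?p \<iota> * (?\<nu> \<iota> / \<rho> \<iota>) * G \<iota> \<le> 1 * (Z \<iota> * (1 + G \<iota>))"
        unfolding pZ[OF i] by (rule G1(1)[OF i]) (use Z0[OF i] in simp)
      show "Mb \<iota> \<le> 1 * (Z \<iota> * (1 + G \<iota>))"
        by (rule order_trans[OF MZ[OF i] G1(2)[OF i]]) (use Z0[OF i] in simp)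
    qed simp
    show "BO D1 ?P (?Df q s)" for q s by (rule bDf)
  qed
qed

end

subsection \<open>The parameters\<close>

text \<open>The parameters of the iteration: with \<open>\<sigma> = \<lambda>l\<close>, the frequency ratio is \<open>1 / \<rho> = sqrt \<sigma>\<close>, and
  \<open>\<tau>\<close> is a power of \<open>\<lambda>\<close> so small that all losses of factors \<open>\<tau>\<close> are controlled by \<open>\<lambda>\<close> to the
  power \<open>\<gamma> / 2\<close>.\<close>

lemma parameters_exist:
  fixes \<gamma> :: real and N K :: nat
  assumes NK: "1 \<le> N" "1 \<le> K" and \<gamma>: "0 < \<gamma>" "\<gamma> < 1"
  defines "J \<equiv> K * N + 2" and "r \<equiv> 2 * (K * N) + 2" and "k \<equiv> K * N + 1"
  obtains Cn where "0 < Cn" "\<And>l lam. 0 < l \<Longrightarrow> l \<le> 1 / 2 \<Longrightarrow> 0 < lam \<Longrightarrow> 1 \<le> lam powr (1 - \<gamma>) * l \<Longrightarrow>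
    \<exists>\<rho> \<tau> \<epsilon> n. 0 < \<rho> \<and> \<rho> \<le> 1 \<and> 1 \<le> \<tau> \<and> \<rho> * \<tau> \<le> 1 \<and> \<rho> ^ r \<le> \<epsilon> \<and> ((\<rho>)\<^sup>2 * \<tau>\<^sup>2) ^ Suc k \<le> \<epsilon> \<and>
      real (2 * n) \<le> Cn * \<tau>\<^sup>2 \<and> (1 + 1 / (l * \<rho> ^ (J + 1))) / 2 ^ n \<le> \<epsilon> \<and>
      \<tau> \<le> lam powr (\<gamma> / 2) \<and> \<tau> ^ J / (l * \<rho> ^ 3) \<le> (lam * l) ^ (K + N) * lam powr (\<gamma> / 2) / l \<and>
      \<tau> ^ (J + 1) / (l * \<rho> ^ 3) \<le> (lam * l) ^ (K + N) * lam powr \<gamma> / l \<and> \<tau>\<^sup>2 \<le> lam powr \<gamma> \<and>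
      \<tau>\<^sup>2 * ((\<rho> * \<tau>) ^ (2 * (J - 1)) + \<epsilon>) \<le> 2 / (lam * l) ^ (K * N)"
proof -
  \<comment> \<open>Large enough that every power of \<tau> occurring below has exponent at most
    \<open>2 * Q\<close>, and \<tau>^(2 Q) is \<open>lam\<close> to the power \<gamma>.\<close>
  define Q where "Q = 4 * J"
  \<comment> \<open>Counts the powers of \<open>lam\<close> that 2^n has to beat:
    \<open>J + 2\<close> from the highest frequency, \<open>K * N\<close> from the wanted gain and
    one for \<tau>^2.\<close>
  define B where "B = J + K * N + 3"
  define Cn where "Cn = 4 + 2 * real B * real Q / (\<gamma> * ln 2)"
  have Q: "0 < Q" by (simp add: Q_def J_def)
  have Cn: "0 < Cn" unfolding Cn_def using \<gamma> by (intro add_pos_nonneg divide_nonneg_nonneg mult_nonneg_nonneg) auto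
  show thesis
  proof (rule that[OF Cn])
    fix l lam :: real assume l: "0 < l" "l \<le> 1 / 2" and lam: "0 < lam" "1 \<le> lam powr (1 - \<gamma>) * l"
    define \<sigma> where "\<sigma> = lam * l"
    define \<tau> where "\<tau> = lam powr (\<gamma> / (2 * real Q))"
    define \<rho> where "\<rho> = 1 / sqrt \<sigma>"
    \<comment> \<open>Chosen so that \<tau>^2 \<epsilon> is exactly the gain \<sigma>^(- K N) wanted
      for the defect.\<close>
    define \<epsilon> where "\<epsilon> = 1 / (\<sigma> ^ (K * N) * \<tau>\<^sup>2)"
    have lam1: "1 \<le> lam"
    proof (rule ccontr)
      assume "\<not> 1 \<le> lam"
      then have "lam powr (1 - \<gamma>) \<le> 1" using lam(1) \<gamma> by (intro powr_le1) auto
      then have "lam powr (1 - \<gamma>) * l \<le> 1 * l" using l by (intro mult_right_mono) auto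
      then show False using lam l by linarith
    qed
    \<comment> \<open>By hypothesis the second factor is at least 1, so \<sigma> dominates
      \<open>lam\<close> to the power \<gamma> and with it all losses in \<tau>.\<close>
    have s1: "\<sigma> = lam powr \<gamma> * (lam powr (1 - \<gamma>) * l)"
      using lam(1) by (simp add: \<sigma>_def mult.assoc[symmetric] powr_add[symmetric])
    have g1: "1 \<le> lam powr \<gamma>" using lam1 \<gamma> by (intro ge_one_powr_ge_zero) auto
    have gs: "lam powr \<gamma> \<le> \<sigma>" unfolding s1 using mult_left_mono[OF lam(2), of "lam powr \<gamma>"] g1 by simp
    have \<sigma>1: "1 \<le> \<sigma>" using g1 gs by linarith
    have \<tau>1: "1 \<le> \<tau>" unfolding \<tau>_def using lam1 \<gamma> by (intro ge_one_powr_ge_zero) auto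
    have \<tau>n: "\<tau> ^ m = lam powr (real m * (\<gamma> / (2 * real Q)))" for m
      unfolding \<tau>_def using lam(1) by (simp add: powr_realpow[symmetric] powr_powr mult.commute)
    have \<tau>Q: "\<tau> ^ Q = lam powr (\<gamma> / 2)" "\<tau> ^ (2 * Q) = lam powr \<gamma>" using Q by (simp_all add: \<tau>n)
    have \<tau>le: "\<tau> ^ m \<le> \<tau> ^ n" if "m \<le> n" for m n by (rule power_increasing[OF that \<tau>1])
    have \<tau>\<sigma>: "\<tau> ^ m \<le> \<sigma>" if "m \<le> 2 * Q" for m using \<tau>le[OF that] \<tau>Q gs by simp
    have \<rho>: "0 < \<rho>" "\<rho> \<le> 1" "\<rho>\<^sup>2 = 1 / \<sigma>" using \<sigma>1 by (simp_all add: \<rho>_def power_divide)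
    have \<rho>e: "\<rho> ^ (2 * m) = 1 / \<sigma> ^ m" for m unfolding power_mult \<rho>(3) by (simp add: power_one_over)
    have \<rho>l: "1 / \<rho> ^ m \<le> \<sigma> ^ m" for m
    proof -
      have "sqrt \<sigma> \<le> \<sigma>" using \<sigma>1 by (intro real_le_lsqrt) (auto simp: power2_eq_square)
      then have "sqrt \<sigma> ^ m \<le> \<sigma> ^ m" using \<sigma>1 by (intro power_mono) auto
      then show ?thesis by (simp add: \<rho>_def power_one_over)
    qed
    \<comment> \<open>The exact value is \<sigma>^(3/2); it is rounded up to \<sigma>^2, and K + N
      is at least 2.\<close>
    have \<rho>3: "1 / \<rho> ^ 3 \<le> \<sigma> ^ (K + N)"
    proof -
      have "1 / \<rho> ^ 3 \<le> 1 / \<rho> ^ (2 * 2)"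
        by (rule divide_left_mono[OF power_decreasing]) (use \<rho> in auto)
      also have "\<dots> = \<sigma> ^ 2" unfolding \<rho>e by simp
      also have "\<dots> \<le> \<sigma> ^ (K + N)" by (rule power_increasing) (use NK \<sigma>1 in auto)
      finally show ?thesis .
    qed
    have Zle: "\<tau> ^ m / (l * \<rho> ^ 3) \<le> \<sigma> ^ (K + N) * c / l" if "\<tau> ^ m \<le> c" for m c
    proof -
      have "\<tau> ^ m / (l * \<rho> ^ 3) = (\<tau> ^ m * (1 / \<rho> ^ 3)) / l" by simp
      also have "\<dots> \<le> (c * \<sigma> ^ (K + N)) / l"
        by (intro divide_right_mono mult_mono that \<rho>3 order_trans[OF _ that]) (use \<tau>1 l \<rho> in auto)
      finally show ?thesis by (simp add: mult.commute)
    qed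
    have pos: "0 < \<sigma> ^ m" "0 < \<tau> ^ m" for m using \<sigma>1 \<tau>1 by auto
    \<comment> \<open>The choice of \<open>r\<close> leaves one spare factor 1 / \<sigma>, which
      beats \<tau>^2.\<close>
    have e1: "\<rho> ^ r \<le> \<epsilon>"
    proof -
      have "\<rho> ^ r = 1 / (\<sigma> ^ (K * N) * \<sigma>)" using \<rho>e[of "K * N + 1"] by (simp add: r_def mult.commute)
      also have "\<dots> \<le> \<epsilon>" unfolding \<epsilon>_def
        using \<tau>\<sigma>[of 2] pos(1)[of "K * N"] pos(2)[of 2] \<sigma>1 Q by (intro divide_left_mono mult_left_mono mult_pos_pos) auto
      finally show ?thesis .
    qed
    have e2: "(\<rho>\<^sup>2 * \<tau>\<^sup>2) ^ Suc k \<le> \<epsilon>"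
    proof -
      have "(\<rho>\<^sup>2 * \<tau>\<^sup>2) ^ Suc k = \<tau> ^ (2 * Suc k) / (\<sigma> ^ (K * N) * \<sigma>\<^sup>2)"
        unfolding power_mult_distrib power_mult[symmetric] \<rho>e by (simp add: k_def power2_eq_square mult_ac)
      also have "\<dots> \<le> \<epsilon>"
      proof -
        have "\<tau> ^ (2 * Suc k) * \<tau>\<^sup>2 = \<tau> ^ (2 * Suc k + 2)" by (simp only: power_add)
        also have "\<dots> \<le> \<sigma>" by (rule \<tau>\<sigma>) (simp add: k_def Q_def J_def)
        also have "\<sigma> \<le> \<sigma>\<^sup>2" using \<sigma>1 by (simp add: power2_eq_square)
        finally have "\<tau> ^ (2 * Suc k) * \<tau>\<^sup>2 * \<sigma> ^ (K * N) \<le> \<sigma>\<^sup>2 * \<sigma> ^ (K * N)" by (rule mult_right_mono) (use \<sigma>1 in simp)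
        then show ?thesis unfolding \<epsilon>_def using pos \<sigma>1 \<tau>1
          by (subst frac_le_eq) (auto simp: divide_le_0_iff mult_ac)
      qed
      finally show ?thesis .
    qed
    have e3: "\<tau>\<^sup>2 * ((\<rho> * \<tau>) ^ (2 * (J - 1)) + \<epsilon>) \<le> 2 / \<sigma> ^ (K * N)"
    proof -
      have a: "2 * (J - 1) = 2 * (K * N + 1)" by (simp add: J_def)
      have "\<tau>\<^sup>2 * (\<rho> * \<tau>) ^ (2 * (J - 1)) = \<tau> ^ (2 * (K * N + 1) + 2) / (\<sigma> ^ (K * N) * \<sigma>)"
        unfolding power_mult_distrib a \<rho>e power_add by simp
      also have "\<dots> \<le> \<sigma> / (\<sigma> ^ (K * N) * \<sigma>)"
        by (rule divide_right_mono[OF \<tau>\<sigma>]) (use pos \<sigma>1 in \<open>auto simp: Q_def J_def\<close>)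
      also have "\<dots> = 1 / \<sigma> ^ (K * N)" using \<sigma>1 by simp
      finally have "\<tau>\<^sup>2 * (\<rho> * \<tau>) ^ (2 * (J - 1)) \<le> 1 / \<sigma> ^ (K * N)" .
      moreover have "\<tau>\<^sup>2 * \<epsilon> = 1 / \<sigma> ^ (K * N)" using \<tau>1 by (simp add: \<epsilon>_def)
      ultimately show ?thesis by (simp add: distrib_left)
    qed
    define n where "n = nat \<lceil>1 + real B * (ln lam / ln 2)\<rceil>"
    have L0: "0 \<le> real B * (ln lam / ln 2)" using lam1 by simp
    have n1: "1 + real B * (ln lam / ln 2) \<le> real n" "real n \<le> 2 + real B * (ln lam / ln 2)"
      using L0 unfolding n_def by linarith+
    \<comment> \<open>The inequality ln x \<le> x - 1 at x = \<tau>^2 trades the logarithm, that is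
      the number of scales, for \<tau>^2. It produces the factor \<open>real Q\<close> / \<gamma> in
      \<open>Cn\<close>.\<close>
    have lnlam: "ln lam \<le> real Q / \<gamma> * \<tau>\<^sup>2"
    proof -
      have "ln (\<tau>\<^sup>2) = \<gamma> / real Q * ln lam" using lam(1) Q unfolding \<tau>n by (simp add: ln_powr)
      then have "\<gamma> / real Q * ln lam \<le> \<tau>\<^sup>2" using ln_le_minus_one[of "\<tau>\<^sup>2"] \<tau>1 by simp
      then show ?thesis using \<gamma> Q by (simp add: field_simps)
    qed
    have n2: "real (2 * n) \<le> Cn * \<tau>\<^sup>2"
    proof -
      have "real (2 * n) \<le> 4 + 2 * (real B * (ln lam / ln 2))" using n1(2) by simp
      also have "\<dots> \<le> 4 * \<tau>\<^sup>2 + 2 * (real B * ((real Q / \<gamma> * \<tau>\<^sup>2) / ln 2))"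
        using \<tau>1 lnlam by (intro add_mono mult_left_mono divide_right_mono) auto
      also have "\<dots> = Cn * \<tau>\<^sup>2" by (simp add: Cn_def distrib_right)
      finally show ?thesis .
    qed
    have n3: "(1 + 1 / (l * \<rho> ^ (J + 1))) / 2 ^ n \<le> \<epsilon>"
    proof -
      have "2 * lam ^ B = 2 powr (1 + real B * (ln lam / ln 2))"
      proof -
        have "lam ^ B = exp (ln 2 * (real B * (ln lam / ln 2)))"
          using lam(1) by (simp add: exp_of_nat_mult)
        then show ?thesis by (simp add: powr_def exp_add distrib_right distrib_left mult.commute)
      qed
      also have "\<dots> \<le> 2 powr real n" by (rule powr_mono[OF n1(1)]) simp
      also have "\<dots> = 2 ^ n" by (simp add: powr_realpow)
      finally have 2: "2 * lam ^ B \<le> 2 ^ n" .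
      have sl: "\<sigma> \<le> lam" unfolding \<sigma>_def using l lam1 by (intro mult_left_le) auto
      have 1: "1 / l \<le> lam" using \<sigma>1 l unfolding \<sigma>_def by (simp add: divide_le_eq)
      have "1 / (l * \<rho> ^ (J + 1)) = (1 / l) * (1 / \<rho> ^ (J + 1))" by simp
      also have "\<dots> \<le> lam * \<sigma> ^ (J + 1)" by (rule mult_mono[OF 1 \<rho>l]) (use lam \<rho> in auto)
      also have "\<dots> \<le> lam * lam ^ (J + 1)" by (intro mult_left_mono power_mono sl) (use lam \<sigma>1 in auto)
      also have "\<dots> = lam ^ (J + 2)" by simp
      finally have a: "1 + 1 / (l * \<rho> ^ (J + 1)) \<le> 2 * lam ^ (J + 2)" using one_le_power[OF lam1, of "J + 2"] by linarith
      have "\<sigma> ^ (K * N) * \<tau>\<^sup>2 \<le> lam ^ (K * N) * lam"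
        by (intro mult_mono power_mono sl order_trans[OF \<tau>\<sigma>]) (use \<sigma>1 lam Q in auto)
      then have "(1 + 1 / (l * \<rho> ^ (J + 1))) * (\<sigma> ^ (K * N) * \<tau>\<^sup>2) \<le> (2 * lam ^ (J + 2)) * (lam ^ (K * N) * lam)"
        by (rule mult_mono[OF a]) (use lam \<sigma>1 in auto)
      also have "\<dots> = 2 * lam ^ B" by (simp add: B_def power_add power3_eq_cube power2_eq_square mult_ac)
      also note 2
      finally show ?thesis unfolding \<epsilon>_def using pos \<sigma>1 \<tau>1 by (simp add: field_simps)
    qed
    have \<rho>\<tau>: "\<rho> * \<tau> \<le> 1"
    proof -
      have "(\<rho> * \<tau>)\<^sup>2 \<le> 1" using \<tau>\<sigma>[of 2] \<sigma>1 Q by (simp add: power_mult_distrib \<rho>(3))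
      then show ?thesis using power2_le_imp_le[of "\<rho> * \<tau>" 1] by simp
    qed
    have t1: "\<tau> \<le> lam powr (\<gamma> / 2)" using \<tau>le[of 1 Q] Q \<tau>Q by simp
    have t2: "\<tau>\<^sup>2 \<le> lam powr \<gamma>" using \<tau>le[of 2 "2 * Q"] Q unfolding \<tau>Q by simp
    have t3: "\<tau> ^ J \<le> lam powr (\<gamma> / 2)" using \<tau>le[of J Q] \<tau>Q by (simp add: Q_def)
    have t4: "\<tau> ^ (J + 1) \<le> lam powr \<gamma>" using \<tau>le[of "J + 1" "2 * Q"] unfolding \<tau>Q by (simp add: Q_def J_def)
    show "\<exists>\<rho> \<tau> \<epsilon> n. 0 < \<rho> \<and> \<rho> \<le> 1 \<and> 1 \<le> \<tau> \<and> \<rho> * \<tau> \<le> 1 \<and> \<rho> ^ r \<le> \<epsilon> \<and> ((\<rho>)\<^sup>2 * \<tau>\<^sup>2) ^ Suc k \<le> \<epsilon> \<and>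
      real (2 * n) \<le> Cn * \<tau>\<^sup>2 \<and> (1 + 1 / (l * \<rho> ^ (J + 1))) / 2 ^ n \<le> \<epsilon> \<and>
      \<tau> \<le> lam powr (\<gamma> / 2) \<and> \<tau> ^ J / (l * \<rho> ^ 3) \<le> (lam * l) ^ (K + N) * lam powr (\<gamma> / 2) / l \<and>
      \<tau> ^ (J + 1) / (l * \<rho> ^ 3) \<le> (lam * l) ^ (K + N) * lam powr \<gamma> / l \<and> \<tau>\<^sup>2 \<le> lam powr \<gamma> \<and>
      \<tau>\<^sup>2 * ((\<rho> * \<tau>) ^ (2 * (J - 1)) + \<epsilon>) \<le> 2 / (lam * l) ^ (K * N)"
      unfolding \<sigma>_def[symmetric]
      by (intro exI[of _ \<rho>] exI[of _ \<tau>] exI[of _ \<epsilon>] exI[of _ n] conjI \<rho> \<tau>1 \<rho>\<tau> e1 e2 e3 n2 n3 t1 t2 Zle t3 t4)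
  qed
qed

subsection \<open>The stage for the components of the fields\<close>

lemma pd_partial: "pd k f \<iota> = partial UNIV k (f \<iota>)"
  by (simp add: pd_def partial_def fun_eq_iff)

lemma C_class_continuous: "C_class m f \<Longrightarrow> continuous_on UNIV f"
  by (cases m) (auto intro: differentiable_imp_continuous_on)

lemma C_class_C1:
  assumes "C_class (Suc m) f"
  shows "C1 f (\<lambda>k. partial UNIV k f)"
  unfolding C1_def
proof (intro conjI allI)
  show "(f has_derivative (\<lambda>h. \<Sum>k\<in>UNIV. h $ k * partial UNIV k f x)) (at x)" for x
    using has_derivative_pd[of "\<lambda>_. f" _ x] assms by (simp add: pd_partial differentiable_on_def)
  show "continuous_on UNIV (partial UNIV k f)" for k
    using assms C_class_continuous[of m "partial UNIV k f"] by simp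
qed

lemma SC_C_class: "SC (I \<times> UNIV) \<nu> m P f \<Longrightarrow> \<iota> \<in> I \<Longrightarrow> C_class m (f \<iota>)"
proof (induction m arbitrary: P f)
  case 0
  then show ?case by (simp add: SC_continuous)
next
  case (Suc m)
  have "f \<iota> differentiable_on UNIV"
    using SC_diff[OF Suc(2)] Suc(3) by (simp add: differentiable_on_def)
  moreover have "C_class m (partial UNIV k (f \<iota>))" for k
    using Suc(1)[OF SC_pd[OF Suc(2)] Suc(3)] unfolding pd_partial .
  ultimately show ?case by simp
qed

text \<open>Each component comes with its own existential constant; there are finitely many
  components, so the sum of the constants serves them all.\<close>

lemma BO_finite:
  fixes f :: "'a::finite \<Rightarrow> 'i fld"
  assumes "\<And>a. BO D P (f a)"
  obtains C where "C > 0" "\<And>a \<iota> x. (\<iota>, x) \<in> D \<Longrightarrow> \<bar>f a \<iota> x\<bar> \<le> C * P \<iota>"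
proof -
  have "\<exists>c. \<forall>a. 0 < c a \<and> (\<forall>\<iota> x. (\<iota>, x) \<in> D \<longrightarrow> \<bar>f a \<iota> x\<bar> \<le> c a * P \<iota>)"
    by (rule choice) (use assms in \<open>auto simp: BO_def\<close>)
  then obtain c where c: "\<And>a. 0 < c a" "\<And>a \<iota> x. (\<iota>, x) \<in> D \<Longrightarrow> \<bar>f a \<iota> x\<bar> \<le> c a * P \<iota>" by blast
  show thesis
  proof
    show "0 < sum c UNIV" by (rule sum_pos) (use c in auto)
    fix a \<iota> x assume a: "(\<iota>, x) \<in> D"
    have "c a \<le> sum c UNIV" by (rule member_le_sum) (use c in \<open>auto intro: less_imp_le\<close>)
    then have "c a * P \<iota> \<le> sum c UNIV * P \<iota>" by (rule mult_right_mono[OF _ BO_nonneg[OF assms a]])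
    then show "\<bar>f a \<iota> x\<bar> \<le> sum c UNIV * P \<iota>" using c(2)[OF a, of a] by linarith
  qed
qed

lemma BO_finite2:
  fixes f :: "'a::finite \<Rightarrow> 'b::finite \<Rightarrow> 'i fld"
  assumes "\<And>a b. BO D P (f a b)"
  obtains C where "C > 0" "\<And>a b \<iota> x. (\<iota>, x) \<in> D \<Longrightarrow> \<bar>f a b \<iota> x\<bar> \<le> C * P \<iota>"
proof -
  have "BO D P ((\<lambda>(a, b). f a b) z)" for z using assms by (cases z) simp
  from BO_finite[of D P "\<lambda>(a, b). f a b", OF this] obtain C where
    C: "C > 0" "\<And>z \<iota> x. (\<iota>, x) \<in> D \<Longrightarrow> \<bar>(\<lambda>(a, b). f a b) z \<iota> x\<bar> \<le> C * P \<iota>" by blast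
  show thesis by (rule that[OF C(1)]) (use C(2)[of _ _ "(_, _)"] in simp)
qed

lemma BO_finite3:
  fixes f :: "'a::finite \<Rightarrow> 'b::finite \<Rightarrow> 'c::finite \<Rightarrow> 'i fld"
  assumes "\<And>a b c. BO D P (f a b c)"
  obtains C where "C > 0" "\<And>a b c \<iota> x. (\<iota>, x) \<in> D \<Longrightarrow> \<bar>f a b c \<iota> x\<bar> \<le> C * P \<iota>"
proof -
  have "BO D P ((\<lambda>(a, b). f a b) z c)" for z c using assms by (cases z) simp
  from BO_finite2[of D P "\<lambda>(a, b). f a b", OF this] obtain C where
    C: "C > 0" "\<And>z c \<iota> x. (\<iota>, x) \<in> D \<Longrightarrow> \<bar>(\<lambda>(a, b). f a b) z c \<iota> x\<bar> \<le> C * P \<iota>" by blast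
  show thesis by (rule that[OF C(1)]) (use C(2)[of _ _ "(_, _)"] in simp)
qed

lemma abs_le_scale:
  fixes P Q :: real
  assumes "\<bar>y\<bar> \<le> c * P" "0 < c" "c \<le> C" "P \<le> Q"
  shows "\<bar>y\<bar> \<le> C * Q"
proof -
  have "0 \<le> c * P" using assms(1) abs_ge_zero[of y] by linarith
  then have "0 \<le> P" using assms(2) by (simp add: zero_le_mult_iff)
  then have "c * P \<le> C * Q" using assms by (intro mult_mono) auto
  then show ?thesis using assms(1) by linarith
qed

definition mat_defect :: "(2 \<Rightarrow> 2 \<Rightarrow> real^2 \<Rightarrow> real) \<Rightarrow> (2 \<Rightarrow> real^2 \<Rightarrow> real) \<Rightarrow> (2 \<Rightarrow> real^2 \<Rightarrow> real) \<Rightarrow> 2 \<Rightarrow> 2 \<Rightarrow> real^2 \<Rightarrow> real" where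
  "mat_defect A V W q r x = A q r x
     - ((1/2) * (\<Sum>c\<in>UNIV. partial UNIV q (V c) x * partial UNIV r (V c) x)
        + (1/2) * (partial UNIV q (W r) x + partial UNIV r (W q) x))"

lemma Df_mat_defect: "Df A V W q r \<iota> = mat_defect (\<lambda>q r. A q r \<iota>) (\<lambda>c. V c \<iota>) (\<lambda>c. W c \<iota>) q r"
  by (simp add: Df_def mat_defect_def pd_partial fun_eq_iff)

text \<open>The hypotheses on a single datum, by components and without norms: \<open>d\<close> and
  \<open>g\<close> are arbitrary upper bounds. Regularity is asked on the plane, bounds only where
  \<zeta> is at most \<open>2 * l\<close>.\<close>

definition admissible :: "(real^2 \<Rightarrow> real) \<Rightarrow> real \<Rightarrow> real \<Rightarrow> real \<Rightarrow> real \<Rightarrow> real \<Rightarrow> real \<Rightarrow>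
    (2 \<Rightarrow> real^2 \<Rightarrow> real) \<Rightarrow> (2 \<Rightarrow> real^2 \<Rightarrow> real) \<Rightarrow> (2 \<Rightarrow> 2 \<Rightarrow> real^2 \<Rightarrow> real) \<Rightarrow> bool" where
  "admissible \<zeta> \<gamma> l lam M d g fv fw fA \<longleftrightarrow>
     0 < l \<and> l \<le> 1 / 2 \<and> 0 < lam \<and> 1 \<le> lam powr (1 - \<gamma>) * l \<and> 0 < M \<and>
     (\<forall>c. C_class 2 (fv c)) \<and> (\<forall>c. C_class 2 (fw c)) \<and> (\<forall>q r. continuous_on UNIV (fA q r)) \<and>
     (\<forall>y c q r. \<zeta> y \<le> 2 * l \<longrightarrow> \<bar>fv c y\<bar> \<le> M \<and> \<bar>partial UNIV q (fv c) y\<bar> \<le> M \<and> \<bar>partial UNIV q (fv c) y\<bar> \<le> g \<and>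
        \<bar>partial UNIV r (partial UNIV q (fv c)) y\<bar> \<le> M \<and> \<bar>fw c y\<bar> \<le> M \<and> \<bar>partial UNIV q (fw c) y\<bar> \<le> M \<and>
        \<bar>partial UNIV r (partial UNIV q (fw c)) y\<bar> \<le> M \<and> \<bar>mat_defect fA fv fw q r y\<bar> \<le> d \<and> fA q r y = fA r q y)"

text \<open>The finer regularity of \<open>A\<close> enters through the last clause alone: at each
  point its mollification error is measured against any affine function that agrees with
  \<open>A\<close> there. This keeps the distinction between s = 0 and s = 1 out of the
  construction.\<close>

definition improves :: "(real^2 \<Rightarrow> real) \<Rightarrow> real \<Rightarrow> nat \<Rightarrow> nat \<Rightarrow> real \<Rightarrow> real \<Rightarrow> real \<Rightarrow> real \<Rightarrow> real \<Rightarrow> real \<Rightarrow>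
    (2 \<Rightarrow> real^2 \<Rightarrow> real) \<Rightarrow> (2 \<Rightarrow> real^2 \<Rightarrow> real) \<Rightarrow> (2 \<Rightarrow> 2 \<Rightarrow> real^2 \<Rightarrow> real) \<Rightarrow>
    (2 \<Rightarrow> real^2 \<Rightarrow> real) \<Rightarrow> (2 \<Rightarrow> real^2 \<Rightarrow> real) \<Rightarrow> bool" where
  "improves \<zeta> \<gamma> N K C l lam M d g fv fw fA V W \<longleftrightarrow>
    (\<forall>c. C_class 2 (V c)) \<and> (\<forall>c. C_class 2 (W c)) \<and> (\<forall>x c q s. \<zeta> x \<le> l \<longrightarrow>
      \<bar>V c x - fv c x\<bar> \<le> C * (lam powr (\<gamma> / 2) * (sqrt d + l * M)) \<and>
      \<bar>partial UNIV q (V c) x - partial UNIV q (fv c) x\<bar> \<le> C * (lam powr (\<gamma> / 2) * (sqrt d + l * M)) \<and>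
      \<bar>partial UNIV s (partial UNIV q (V c)) x\<bar> \<le> C * ((lam * l) ^ (K + N) * lam powr (\<gamma> / 2) / l * (sqrt d + l * M)) \<and>
      \<bar>W c x - fw c x\<bar> \<le> C * (lam powr \<gamma> * (sqrt d + l * M) * (1 + sqrt d + l * M + g)) \<and>
      \<bar>partial UNIV q (W c) x - partial UNIV q (fw c) x\<bar> \<le> C * (lam powr \<gamma> * (sqrt d + l * M) * (1 + sqrt d + l * M + g)) \<and>
      \<bar>partial UNIV s (partial UNIV q (W c)) x\<bar>
        \<le> C * ((lam * l) ^ (K + N) * lam powr \<gamma> / l * (sqrt d + l * M) * (1 + sqrt d + l * M + g)) \<and>
      (\<forall>a c0 b. fA q s x = c0 + b \<bullet> x \<longrightarrow> (\<forall>y. dist x y \<le> l / 16 \<longrightarrow> \<bar>fA q s y - (c0 + b \<bullet> y)\<bar> \<le> a) \<longrightarrow>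
        \<bar>mat_defect fA V W q s x\<bar> \<le> a + C * ((d + (l * M)\<^sup>2) / (lam * l) ^ (K * N))))"

context data
begin

text \<open>The constructed fields are controlled on \<open>D\<close> only. Multiplication by
  \<open>cut\<close> extends them to the plane, as membership in the function spaces requires, and
  alters nothing near the region where \<zeta> is at most l.\<close>

lemma extend_cut:
  assumes V: "SC D (\<lambda>_. \<nu>) m B V" and \<nu>: "\<And>\<iota>. \<iota> \<in> I \<Longrightarrow> 1 / l \<iota> \<le> \<nu> \<iota>" and m: "2 \<le> m" "m \<le> N" and i: "\<iota> \<in> I"
  shows "C_class 2 (\<lambda>x. cut \<iota> x * V \<iota> x)"
    and "\<zeta> x \<le> l \<iota> \<Longrightarrow> cut \<iota> x * V \<iota> x = V \<iota> x"
    and "\<zeta> x \<le> l \<iota> \<Longrightarrow> partial UNIV q (\<lambda>x. cut \<iota> x * V \<iota> x) x = pd q V \<iota> x"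
    and "\<zeta> x \<le> l \<iota> \<Longrightarrow> partial UNIV s (partial UNIV q (\<lambda>x. cut \<iota> x * V \<iota> x)) x = pd s (pd q V) \<iota> x"
proof -
  let ?V = "\<lambda>\<iota> x. cut \<iota> x * V \<iota> x"
  have \<nu>0: "0 \<le> 1 / l \<iota>" "0 \<le> \<nu> \<iota>" if "\<iota> \<in> I" for \<iota>
  proof -
    show "0 \<le> 1 / l \<iota>" using l(1)[OF that] by simp
    then show "0 \<le> \<nu> \<iota>" using \<nu>[OF that] by linarith
  qed
  have oZ: "odom {(\<iota>, x). \<iota> \<in> I \<and> 4 / 3 * l \<iota> < \<zeta> x}"
  proof -
    have "open {x. 4 / 3 * l \<iota> < \<zeta> x}" for \<iota> by (rule open_Collect_less[OF continuous_on_const \<zeta>_cont])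
    then have "open {x. \<iota> \<in> I \<and> 4 / 3 * l \<iota> < \<zeta> x}" for \<iota> by (cases "\<iota> \<in> I") simp_all
    then show ?thesis by (simp add: odom_def)
  qed
  have "SC D (\<lambda>_. \<nu>) m (\<lambda>_. 1) cut"
  proof (rule SC_mono[OF SC_sub_dom[OF SC_order[OF SC_cut m(2)] odom_D], where c=1 and c'=1])
    show "D \<subseteq> I \<times> UNIV" by (auto simp: D_def)
    show "0 \<le> 1 / l \<iota> \<and> 1 / l \<iota> \<le> 1 * \<nu> \<iota>" if "(\<iota>, x) \<in> D" for \<iota> x
      using \<nu>[OF DI[OF that]] \<nu>0[OF DI[OF that]] by simp
  qed simp_all
  from SC_mult[OF this V] have "SC D (\<lambda>_. \<nu>) m B ?V" by simp
  then have "SC D (\<lambda>_. \<nu>) m (\<lambda>\<iota>. \<bar>B \<iota>\<bar>) ?V"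
  proof (rule SC_wmono[OF _ zero_less_one])
    show "0 \<le> \<nu> \<iota>" if "(\<iota>, x) \<in> D" for \<iota> x by (rule \<nu>0(2)[OF DI[OF that]])
  qed simp
  then have S: "SC (I \<times> UNIV) (\<lambda>_. \<nu>) m (\<lambda>\<iota>. \<bar>B \<iota>\<bar>) ?V"
  proof (rule SC_extend[OF _ odom_UNIV oZ])
    show "I \<times> UNIV \<subseteq> D \<union> {(\<iota>, x). \<iota> \<in> I \<and> 4 / 3 * l \<iota> < \<zeta> x}"
    proof
      fix z :: "'i \<times> (real^2)" assume "z \<in> I \<times> UNIV"
      then obtain \<iota> x where z: "z = (\<iota>, x)" "\<iota> \<in> I" by auto
      have "\<zeta> x < 3 / 2 * l \<iota> \<or> 4 / 3 * l \<iota> < \<zeta> x" using l(1)[OF z(2)] by linarith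
      then show "z \<in> D \<union> {(\<iota>, x). \<iota> \<in> I \<and> 4 / 3 * l \<iota> < \<zeta> x}" using z by (auto simp: D_def)
    qed
    show "cut \<iota> x * V \<iota> x = 0" if "(\<iota>, x) \<in> {(\<iota>, x). \<iota> \<in> I \<and> 4 / 3 * l \<iota> < \<zeta> x}" for \<iota> x
      using cut_bounds(2)[of \<iota> x] that by simp
    show "0 \<le> \<nu> \<iota>" if "(\<iota>, x) \<in> I \<times> UNIV" for \<iota> and x :: "real^2" using \<nu>0(2)[of \<iota>] that by simp
  qed simp
  show "C_class 2 (\<lambda>x. cut \<iota> x * V \<iota> x)"
    by (rule SC_C_class[OF SC_order[OF S m(1)] i])
  \<comment> \<open>On this slightly larger open set \<open>cut\<close> is 1, so derivatives agree
    also at points with \<zeta> equal to l.\<close>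
  define E :: "('i \<times> (real^2)) set" where "E = {(\<iota>, x). \<iota> \<in> I \<and> \<zeta> x < 17 / 16 * l \<iota>}"
  have oE: "odom E"
  proof -
    have "open {x. \<zeta> x < 17 / 16 * l \<iota>}" for \<iota> by (rule open_Collect_less[OF \<zeta>_cont continuous_on_const])
    then have "open {x. (\<iota>, x) \<in> E}" for \<iota> unfolding E_def by (cases "\<iota> \<in> I") simp_all
    then show ?thesis by (simp add: odom_def)
  qed
  have ED: "E \<subseteq> D"
  proof
    fix z assume "z \<in> E"
    then obtain \<iota> x where z: "z = (\<iota>, x)" "\<iota> \<in> I" "\<zeta> x < 17 / 16 * l \<iota>" by (auto simp: E_def)
    then have "\<zeta> x < 3 / 2 * l \<iota>" using l(1)[of \<iota>] by linarith
    then show "z \<in> D" using z by (simp add: D_def)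
  qed
  from le_Suc_ex[OF m(1)] obtain m' where "m = 2 + m'" by blast
  then have m': "m = Suc (Suc m')" by simp
  note V' = V[unfolded m']
  have e0: "?V \<iota> x = V \<iota> x" if "(\<iota>, x) \<in> E" for \<iota> x using cut_bounds(1)[of \<iota> x] that by (simp add: E_def)
  have e1: "pd q ?V \<iota> x = pd q V \<iota> x" if a: "(\<iota>, x) \<in> E" for \<iota> x q
    by (rule pd_cong(2)[where f=V and g="?V", OF oE a]) (rule e0[symmetric], assumption, rule SC_diff[OF V' subsetD[OF ED a]])
  have e2: "pd s (pd q ?V) \<iota> x = pd s (pd q V) \<iota> x" if a: "(\<iota>, x) \<in> E" for \<iota> x
    by (rule pd_cong(2)[where f="pd q V" and g="pd q ?V", OF oE a]) (rule e1[symmetric], assumption, rule SC_diff[OF SC_pd[OF V'] subsetD[OF ED a]])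
  assume "\<zeta> x \<le> l \<iota>"
  then have "\<zeta> x < 17 / 16 * l \<iota>" using l(1)[OF i] by linarith
  then have a: "(\<iota>, x) \<in> E" using i by (simp add: E_def)
  have p: "partial UNIV k (\<lambda>x. cut \<iota> x * V \<iota> x) = pd k ?V \<iota>" for k by (simp add: pd_partial)
  show "cut \<iota> x * V \<iota> x = V \<iota> x" using e0[OF a] .
  show "partial UNIV q (\<lambda>x. cut \<iota> x * V \<iota> x) x = pd q V \<iota> x" unfolding p by (rule e1[OF a])
  show "partial UNIV s (partial UNIV q (\<lambda>x. cut \<iota> x * V \<iota> x)) x = pd s (pd q V) \<iota> x"
    unfolding p by (simp only: pd_partial[symmetric]) (rule e2[OF a])
qed

end

text \<open>Applies \<open>core\<close> with parameters chosen separately for each index and turns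
  the losses in \<tau> and \<rho> into powers of \<open>lam\<close> and
  \<open>lam * l\<close>.\<close>

lemma family_stage:
  fixes I :: "'i set" and \<zeta> :: "real^2 \<Rightarrow> real" and R \<gamma> :: real and N K :: nat and l lam M d g :: "'i \<Rightarrow> real"
    and fv fw :: "2 \<Rightarrow> 'i fld" and fA :: "2 \<Rightarrow> 2 \<Rightarrow> 'i fld"
  assumes \<zeta>: "\<And>x y. \<zeta> y \<le> \<zeta> x + dist x y" "\<exists>x. \<zeta> x \<le> 0"
    and R: "0 < R" "\<And>x k. \<zeta> x \<le> 1 \<Longrightarrow> \<bar>x $ k\<bar> \<le> R"
    and NK: "1 \<le> N" "1 \<le> K" and \<gamma>: "0 < \<gamma>" "\<gamma> < 1"
    and adm: "\<And>\<iota>. \<iota> \<in> I \<Longrightarrow> admissible \<zeta> \<gamma> (l \<iota>) (lam \<iota>) (M \<iota>) (d \<iota>) (g \<iota>) (\<lambda>c. fv c \<iota>) (\<lambda>c. fw c \<iota>) (\<lambda>q r. fA q r \<iota>)"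
  obtains C where "0 < C" "\<And>\<iota>. \<iota> \<in> I \<Longrightarrow> \<exists>V W. improves \<zeta> \<gamma> N K C (l \<iota>) (lam \<iota>) (M \<iota>) (d \<iota>) (g \<iota>) (\<lambda>c. fv c \<iota>) (\<lambda>c. fw c \<iota>) (\<lambda>q r. fA q r \<iota>) V W"
proof -
  define J r k where "J = K * N + 2" and "r = 2 * (K * N) + 2" and "k = K * N + 1"
  \<comment> \<open>Four derivatives for the final fields plus the cost of \<open>J\<close> steps.
    The number of mollification rounds has to be the same.\<close>
  define Nm where "Nm = 4 + J * (r + 2 * k + 3)"
  note A = adm[unfolded admissible_def]
  have A1: "0 < l \<iota>" "l \<iota> \<le> 1 / 2" "0 < lam \<iota>" "1 \<le> lam \<iota> powr (1 - \<gamma>) * l \<iota>" "0 < M \<iota>"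
    "C_class 2 (fv c \<iota>)" "C_class 2 (fw c \<iota>)" "continuous_on UNIV (fA q s \<iota>)" if "\<iota> \<in> I" for \<iota> c q s
    using A[OF that] by blast+
  have A2: "\<bar>fv c \<iota> y\<bar> \<le> M \<iota>" "\<bar>pd q (fv c) \<iota> y\<bar> \<le> M \<iota>" "\<bar>pd q (fv c) \<iota> y\<bar> \<le> g \<iota>"
    "\<bar>pd s (pd q (fv c)) \<iota> y\<bar> \<le> M \<iota>" "\<bar>fw c \<iota> y\<bar> \<le> M \<iota>" "\<bar>pd q (fw c) \<iota> y\<bar> \<le> M \<iota>"
    "\<bar>pd s (pd q (fw c)) \<iota> y\<bar> \<le> M \<iota>" "\<bar>Df fA fv fw q s \<iota> y\<bar> \<le> d \<iota>" "fA q s \<iota> y = fA s q \<iota> y"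
    if "\<iota> \<in> I" "\<zeta> y \<le> 2 * l \<iota>" for \<iota> y c q s
    unfolding pd_partial Df_mat_defect using A[OF that(1)] that(2) by blast+
  have C1: "C1 (fv c \<iota>) (\<lambda>q. pd q (fv c) \<iota>)" "C1 (pd q (fv c) \<iota>) (\<lambda>r. pd r (pd q (fv c)) \<iota>)"
    "C1 (fw c \<iota>) (\<lambda>q. pd q (fw c) \<iota>)" "C1 (pd q (fw c) \<iota>) (\<lambda>r. pd r (pd q (fw c)) \<iota>)" if "\<iota> \<in> I" for \<iota> c q
  proof -
    have v: "C_class (Suc (Suc 0)) (fv c \<iota>)" "C_class (Suc (Suc 0)) (fw c \<iota>)"
      using A1(6,7)[OF that, of c] by (simp_all only: numeral_2_eq_2)
    then have v': "C_class (Suc 0) (partial UNIV q (fv c \<iota>))" "C_class (Suc 0) (partial UNIV q (fw c \<iota>))"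
      unfolding C_class.simps(2)[of "Suc 0"] by blast+
    show "C1 (fv c \<iota>) (\<lambda>q. pd q (fv c) \<iota>)" "C1 (pd q (fv c) \<iota>) (\<lambda>r. pd r (pd q (fv c)) \<iota>)"
      "C1 (fw c \<iota>) (\<lambda>q. pd q (fw c) \<iota>)" "C1 (pd q (fw c) \<iota>) (\<lambda>r. pd r (pd q (fw c)) \<iota>)"
      unfolding pd_partial using C_class_C1[OF v(1)] C_class_C1[OF v(2)] C_class_C1[OF v'(1)] C_class_C1[OF v'(2)] by simp_all
  qed
  interpret data I \<zeta> R l g M d Nm fv fw fA
    by unfold_locales (fact \<zeta> R A1 A2 C1 | simp add: Nm_def)+
  let ?J = "K * N + 2" and ?r = "2 * (K * N) + 2" and ?k = "K * N + 1"
  obtain Cn where Cn: "0 < Cn" and P: "\<And>l lam. 0 < l \<Longrightarrow> l \<le> 1 / 2 \<Longrightarrow> 0 < lam \<Longrightarrow> 1 \<le> lam powr (1 - \<gamma>) * l \<Longrightarrow>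
    \<exists>\<rho> \<tau> \<epsilon> n. 0 < \<rho> \<and> \<rho> \<le> 1 \<and> 1 \<le> \<tau> \<and> \<rho> * \<tau> \<le> 1 \<and> \<rho> ^ ?r \<le> \<epsilon> \<and> ((\<rho>)\<^sup>2 * \<tau>\<^sup>2) ^ Suc ?k \<le> \<epsilon> \<and>
      real (2 * n) \<le> Cn * \<tau>\<^sup>2 \<and> (1 + 1 / (l * \<rho> ^ (?J + 1))) / 2 ^ n \<le> \<epsilon> \<and>
      \<tau> \<le> lam powr (\<gamma> / 2) \<and> \<tau> ^ ?J / (l * \<rho> ^ 3) \<le> (lam * l) ^ (K + N) * lam powr (\<gamma> / 2) / l \<and>
      \<tau> ^ (?J + 1) / (l * \<rho> ^ 3) \<le> (lam * l) ^ (K + N) * lam powr \<gamma> / l \<and> \<tau>\<^sup>2 \<le> lam powr \<gamma> \<and>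
      \<tau>\<^sup>2 * ((\<rho> * \<tau>) ^ (2 * (?J - 1)) + \<epsilon>) \<le> 2 / (lam * l) ^ (K * N)"
    by (rule parameters_exist[OF NK \<gamma>]) (rule that; assumption)
  define Q where "Q = (\<lambda>\<iota> \<rho> \<tau> \<epsilon> n. \<rho> \<le> 1 \<and> 1 \<le> \<tau> \<and> \<rho> * \<tau> \<le> 1 \<and> \<rho> ^ ?r \<le> \<epsilon> \<and> ((\<rho>)\<^sup>2 * \<tau>\<^sup>2) ^ Suc ?k \<le> \<epsilon> \<and>
      real (2 * n) \<le> Cn * \<tau>\<^sup>2 \<and> (1 + 1 / (l \<iota> * \<rho> ^ (?J + 1))) / 2 ^ n \<le> \<epsilon> \<and>
      \<tau> \<le> lam \<iota> powr (\<gamma> / 2) \<and> \<tau> ^ ?J / (l \<iota> * \<rho> ^ 3) \<le> (lam \<iota> * l \<iota>) ^ (K + N) * lam \<iota> powr (\<gamma> / 2) / l \<iota> \<and>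
      \<tau> ^ (?J + 1) / (l \<iota> * \<rho> ^ 3) \<le> (lam \<iota> * l \<iota>) ^ (K + N) * lam \<iota> powr \<gamma> / l \<iota> \<and> \<tau>\<^sup>2 \<le> lam \<iota> powr \<gamma> \<and>
      \<tau>\<^sup>2 * ((\<rho> * \<tau>) ^ (2 * (?J - 1)) + \<epsilon>) \<le> 2 / (lam \<iota> * l \<iota>) ^ (K * N))"
  \<comment> \<open>Positivity of \<rho> stands outside the implication since \<open>core\<close>
    requires it for every index, also for those outside \<open>I\<close>.\<close>
  have "\<exists>\<rho> \<tau> \<epsilon> n. 0 < \<rho> \<and> (\<iota> \<in> I \<longrightarrow> Q \<iota> \<rho> \<tau> \<epsilon> n)" for \<iota>
  proof (cases "\<iota> \<in> I")
    case True
    from P[OF A1(1-4)[OF True]] show ?thesis unfolding Q_def by (elim exE) (intro exI conjI impI, auto)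
  qed (auto intro!: exI[of _ 1])
  then obtain \<rho> \<tau> \<epsilon> n where q: "\<And>\<iota>. 0 < \<rho> \<iota> \<and> (\<iota> \<in> I \<longrightarrow> Q \<iota> (\<rho> \<iota>) (\<tau> \<iota>) (\<epsilon> \<iota>) (n \<iota>))" by metis
  have \<rho>0: "0 < \<rho> \<iota>" for \<iota> using q by blast
  have Q: "\<rho> \<iota> \<le> 1" "1 \<le> \<tau> \<iota>" "\<rho> \<iota> * \<tau> \<iota> \<le> 1" "\<rho> \<iota> ^ ?r \<le> \<epsilon> \<iota>" "((\<rho> \<iota>)\<^sup>2 * (\<tau> \<iota>)\<^sup>2) ^ Suc ?k \<le> \<epsilon> \<iota>"
      "real (2 * n \<iota>) \<le> Cn * (\<tau> \<iota>)\<^sup>2" "(1 + 1 / (l \<iota> * \<rho> \<iota> ^ (?J + 1))) / 2 ^ n \<iota> \<le> \<epsilon> \<iota>"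
      "\<tau> \<iota> \<le> lam \<iota> powr (\<gamma> / 2)" "\<tau> \<iota> ^ ?J / (l \<iota> * \<rho> \<iota> ^ 3) \<le> (lam \<iota> * l \<iota>) ^ (K + N) * lam \<iota> powr (\<gamma> / 2) / l \<iota>"
      "\<tau> \<iota> ^ (?J + 1) / (l \<iota> * \<rho> \<iota> ^ 3) \<le> (lam \<iota> * l \<iota>) ^ (K + N) * lam \<iota> powr \<gamma> / l \<iota>" "(\<tau> \<iota>)\<^sup>2 \<le> lam \<iota> powr \<gamma>"
      "(\<tau> \<iota>)\<^sup>2 * ((\<rho> \<iota> * \<tau> \<iota>) ^ (2 * (?J - 1)) + \<epsilon> \<iota>) \<le> 2 / (lam \<iota> * l \<iota>) ^ (K * N)" if "\<iota> \<in> I" for \<iota>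
    using q[of \<iota>] that unfolding Q_def by blast+
  let ?S = "\<lambda>\<iota>. sqrt (d \<iota> + (l \<iota> * M \<iota>)\<^sup>2)"
  let ?p = "\<lambda>\<iota>. \<tau> \<iota> * ?S \<iota>"
  let ?G = "\<lambda>\<iota>. g \<iota> + ?p \<iota>"
  let ?Z = "\<lambda>\<iota>. ?p \<iota> * \<tau> \<iota> ^ (?J - 1) / (l \<iota> * \<rho> \<iota> ^ 3)"
  let ?\<delta> = "\<lambda>\<iota>. sqrt (d \<iota>) + l \<iota> * M \<iota>"
  let ?\<Delta> = "\<lambda>\<iota>. 1 + sqrt (d \<iota>) + l \<iota> * M \<iota> + g \<iota>"
  have w: "?p \<iota> \<le> lam \<iota> powr (\<gamma> / 2) * ?\<delta> \<iota>" "?p \<iota> * (1 + ?G \<iota>) \<le> lam \<iota> powr \<gamma> * ?\<delta> \<iota> * ?\<Delta> \<iota>"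
      "?Z \<iota> \<le> (lam \<iota> * l \<iota>) ^ (K + N) * lam \<iota> powr (\<gamma> / 2) / l \<iota> * ?\<delta> \<iota>"
      "?Z \<iota> * (1 + ?G \<iota>) \<le> (lam \<iota> * l \<iota>) ^ (K + N) * lam \<iota> powr \<gamma> / l \<iota> * ?\<delta> \<iota> * ?\<Delta> \<iota>"
      "(?p \<iota>)\<^sup>2 * ((\<rho> \<iota> * \<tau> \<iota>) ^ (2 * (?J - 1)) + \<epsilon> \<iota>) \<le> 2 * ((d \<iota> + (l \<iota> * M \<iota>)\<^sup>2) / (lam \<iota> * l \<iota>) ^ (K * N))"
    if i: "\<iota> \<in> I" for \<iota>
  proof -
    obtain x0 where "\<zeta> x0 \<le> 0" using \<zeta>(2) by blast
    then have x0: "\<zeta> x0 \<le> 2 * l \<iota>" using A1(1)[OF i] by simp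
    have d0: "0 \<le> d \<iota>" using A2(8)[OF i x0, of 1 1] abs_ge_zero by (rule order_trans[rotated])
    have g0: "0 \<le> g \<iota>" using A2(3)[OF i x0, of 1 1] abs_ge_zero by (rule order_trans[rotated])
    have lM: "0 < l \<iota> * M \<iota>" using A1(1,5)[OF i] by simp
    have S: "0 \<le> ?S \<iota>" "?S \<iota> \<le> ?\<delta> \<iota>"
      using sqrt_add_le_add_sqrt[of "d \<iota>" "(l \<iota> * M \<iota>)\<^sup>2"] d0 lM by auto
    have \<delta>: "0 \<le> ?\<delta> \<iota>" using S by linarith
    note \<tau> = Q(2)[OF i]
    show 1: "?p \<iota> \<le> lam \<iota> powr (\<gamma> / 2) * ?\<delta> \<iota>"
      by (rule mult_mono[OF Q(8)[OF i] S(2)]) (use S in auto)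
    \<comment> \<open>The gradient bound contains \<open>p\<close> and with it another factor
      \<tau>. Bounds for the second field are products of two such quantities; hence the power
      \<gamma> there and \<gamma> / 2 for the first field.\<close>
    have G: "1 + ?G \<iota> \<le> \<tau> \<iota> * ?\<Delta> \<iota>"
    proof -
      have "1 * (1 + g \<iota>) \<le> \<tau> \<iota> * (1 + g \<iota>)" by (rule mult_right_mono[OF \<tau>]) (use g0 in simp)
      moreover have "?p \<iota> \<le> \<tau> \<iota> * ?\<delta> \<iota>" by (rule mult_left_mono[OF S(2)]) (use \<tau> in simp)
      ultimately show ?thesis by (simp add: algebra_simps)
    qed
    have G0: "0 \<le> 1 + ?G \<iota>" using g0 S \<tau> by (intro add_nonneg_nonneg mult_nonneg_nonneg) auto
    have \<Delta>: "0 \<le> ?\<Delta> \<iota>" using \<delta> g0 by linarith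
    have "?p \<iota> * (1 + ?G \<iota>) \<le> (\<tau> \<iota> * ?\<delta> \<iota>) * (\<tau> \<iota> * ?\<Delta> \<iota>)"
      by (rule mult_mono[OF _ G]) (use S \<tau> G0 \<delta> in \<open>auto intro: mult_left_mono\<close>)
    also have "\<dots> = (\<tau> \<iota>)\<^sup>2 * (?\<delta> \<iota> * ?\<Delta> \<iota>)" by (simp only: power2_eq_square mult_ac)
    also have "\<dots> \<le> lam \<iota> powr \<gamma> * (?\<delta> \<iota> * ?\<Delta> \<iota>)"
      by (rule mult_right_mono[OF Q(11)[OF i]]) (use \<delta> \<Delta> in simp)
    finally show "?p \<iota> * (1 + ?G \<iota>) \<le> lam \<iota> powr \<gamma> * ?\<delta> \<iota> * ?\<Delta> \<iota>" by (simp only: mult.assoc)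
    have Z: "?Z \<iota> = \<tau> \<iota> ^ ?J / (l \<iota> * \<rho> \<iota> ^ 3) * ?S \<iota>" by simp
    have lr: "0 < l \<iota> * \<rho> \<iota> ^ 3" using A1(1)[OF i] \<rho>0 by simp
    have \<tau>n: "0 \<le> \<tau> \<iota> ^ m / (l \<iota> * \<rho> \<iota> ^ 3)" for m using \<tau> lr by simp
    show "?Z \<iota> \<le> (lam \<iota> * l \<iota>) ^ (K + N) * lam \<iota> powr (\<gamma> / 2) / l \<iota> * ?\<delta> \<iota>"
      unfolding Z by (rule mult_mono[OF Q(9)[OF i] S(2)]) (use S order_trans[OF \<tau>n Q(9)[OF i]] in auto)
    have "?Z \<iota> * (1 + ?G \<iota>) \<le> (\<tau> \<iota> ^ ?J / (l \<iota> * \<rho> \<iota> ^ 3) * ?\<delta> \<iota>) * (\<tau> \<iota> * ?\<Delta> \<iota>)"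
      unfolding Z by (rule mult_mono[OF mult_left_mono[OF S(2) \<tau>n] G]) (use mult_nonneg_nonneg[OF \<tau>n[of ?J] \<delta>] G0 in auto)
    also have "\<dots> = \<tau> \<iota> ^ (?J + 1) / (l \<iota> * \<rho> \<iota> ^ 3) * (?\<delta> \<iota> * ?\<Delta> \<iota>)" by simp
    also have "\<dots> \<le> (lam \<iota> * l \<iota>) ^ (K + N) * lam \<iota> powr \<gamma> / l \<iota> * (?\<delta> \<iota> * ?\<Delta> \<iota>)"
      by (rule mult_right_mono[OF Q(10)[OF i]]) (use \<delta> \<Delta> in simp)
    finally show "?Z \<iota> * (1 + ?G \<iota>) \<le> (lam \<iota> * l \<iota>) ^ (K + N) * lam \<iota> powr \<gamma> / l \<iota> * ?\<delta> \<iota> * ?\<Delta> \<iota>"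
      by (simp only: mult.assoc)
    have S2: "(?S \<iota>)\<^sup>2 = d \<iota> + (l \<iota> * M \<iota>)\<^sup>2" using d0 by simp
    have "(?p \<iota>)\<^sup>2 * ((\<rho> \<iota> * \<tau> \<iota>) ^ (2 * (?J - 1)) + \<epsilon> \<iota>)
        = ((\<tau> \<iota>)\<^sup>2 * ((\<rho> \<iota> * \<tau> \<iota>) ^ (2 * (?J - 1)) + \<epsilon> \<iota>)) * (d \<iota> + (l \<iota> * M \<iota>)\<^sup>2)"
      unfolding power_mult_distrib[of "\<tau> \<iota>" "?S \<iota>"] S2 by (simp only: mult_ac)
    also have "\<dots> \<le> (2 / (lam \<iota> * l \<iota>) ^ (K * N)) * (d \<iota> + (l \<iota> * M \<iota>)\<^sup>2)"
      by (rule mult_right_mono[OF Q(12)[OF i]]) (use d0 in simp)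
    finally show "(?p \<iota>)\<^sup>2 * ((\<rho> \<iota> * \<tau> \<iota>) ^ (2 * (?J - 1)) + \<epsilon> \<iota>) \<le> 2 * ((d \<iota> + (l \<iota> * M \<iota>)\<^sup>2) / (lam \<iota> * l \<iota>) ^ (K * N))"
      by simp
  qed
  show thesis
  proof (rule core[where \<rho>=\<rho> and \<tau>=\<tau> and \<epsilon>=\<epsilon> and n=n and Cn=Cn and J="?J" and r="?r" and k="?k"])
    show "0 < \<rho> \<iota>" for \<iota> by (rule \<rho>0)
    show "4 + ?J * (?r + 2 * ?k + 3) \<le> Nm" by (simp add: Nm_def J_def r_def k_def)
    fix V W \<nu>
    assume F: "\<And>\<iota>. \<iota> \<in> I \<Longrightarrow> 1 / l \<iota> \<le> \<nu> \<iota>" "\<And>c. \<exists>B. SC D (\<lambda>_. \<nu>) 4 B (V c)" "\<And>c. \<exists>B. SC D (\<lambda>_. \<nu>) 4 B (W c)"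
      "\<And>c. BO D ?p (\<lambda>\<iota> x. V c \<iota> x - fv c \<iota> x)" "\<And>c q. BO D ?p (\<lambda>\<iota> x. pd q (V c) \<iota> x - pd q (fv c) \<iota> x)"
      "\<And>c q s. BO D ?Z (pd s (pd q (V c)))"
      "\<And>c. BO D (\<lambda>\<iota>. ?p \<iota> * (1 + ?G \<iota>)) (\<lambda>\<iota> x. W c \<iota> x - fw c \<iota> x)"
      "\<And>c q. BO D (\<lambda>\<iota>. ?p \<iota> * (1 + ?G \<iota>)) (\<lambda>\<iota> x. pd q (W c) \<iota> x - pd q (fw c) \<iota> x)"
      "\<And>c q s. BO D (\<lambda>\<iota>. ?Z \<iota> * (1 + ?G \<iota>)) (pd s (pd q (W c)))"
      "\<And>q s. BO D1 (\<lambda>\<iota>. (?p \<iota>)\<^sup>2 * ((\<rho> \<iota> * \<tau> \<iota>) ^ (2 * (?J - 1)) + \<epsilon> \<iota>)) (Df (\<lambda>q r. mo (fA q r)) V W q s)"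
    obtain c1 where c1: "c1 > 0" "\<And>c \<iota> x. (\<iota>, x) \<in> D \<Longrightarrow> \<bar>V c \<iota> x - fv c \<iota> x\<bar> \<le> c1 * ?p \<iota>"
      by (rule BO_finite[where f="\<lambda>c \<iota> x. V c \<iota> x - fv c \<iota> x", OF F(4)]) (rule that; assumption)
    obtain c2 where c2: "c2 > 0" "\<And>c q \<iota> x. (\<iota>, x) \<in> D \<Longrightarrow> \<bar>pd q (V c) \<iota> x - pd q (fv c) \<iota> x\<bar> \<le> c2 * ?p \<iota>"
      by (rule BO_finite2[where f="\<lambda>c q \<iota> x. pd q (V c) \<iota> x - pd q (fv c) \<iota> x", OF F(5)]) (rule that; assumption)
    obtain c3 where c3: "c3 > 0" "\<And>c q s \<iota> x. (\<iota>, x) \<in> D \<Longrightarrow> \<bar>pd s (pd q (V c)) \<iota> x\<bar> \<le> c3 * ?Z \<iota>"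
      by (rule BO_finite3[where f="\<lambda>c q s. pd s (pd q (V c))", OF F(6)]) (rule that; assumption)
    obtain c4 where c4: "c4 > 0" "\<And>c \<iota> x. (\<iota>, x) \<in> D \<Longrightarrow> \<bar>W c \<iota> x - fw c \<iota> x\<bar> \<le> c4 * (?p \<iota> * (1 + ?G \<iota>))"
      by (rule BO_finite[where f="\<lambda>c \<iota> x. W c \<iota> x - fw c \<iota> x", OF F(7)]) (rule that; assumption)
    obtain c5 where c5: "c5 > 0" "\<And>c q \<iota> x. (\<iota>, x) \<in> D \<Longrightarrow> \<bar>pd q (W c) \<iota> x - pd q (fw c) \<iota> x\<bar> \<le> c5 * (?p \<iota> * (1 + ?G \<iota>))"
      by (rule BO_finite2[where f="\<lambda>c q \<iota> x. pd q (W c) \<iota> x - pd q (fw c) \<iota> x", OF F(8)]) (rule that; assumption)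
    obtain c6 where c6: "c6 > 0" "\<And>c q s \<iota> x. (\<iota>, x) \<in> D \<Longrightarrow> \<bar>pd s (pd q (W c)) \<iota> x\<bar> \<le> c6 * (?Z \<iota> * (1 + ?G \<iota>))"
      by (rule BO_finite3[where f="\<lambda>c q s. pd s (pd q (W c))", OF F(9)]) (rule that; assumption)
    obtain c7 where c7: "c7 > 0" "\<And>q s \<iota> x. (\<iota>, x) \<in> D1 \<Longrightarrow> \<bar>Df (\<lambda>q r. mo (fA q r)) V W q s \<iota> x\<bar>
        \<le> c7 * ((?p \<iota>)\<^sup>2 * ((\<rho> \<iota> * \<tau> \<iota>) ^ (2 * (?J - 1)) + \<epsilon> \<iota>))"
      by (rule BO_finite2[where f="\<lambda>q s. Df (\<lambda>q r. mo (fA q r)) V W q s", OF F(10)]) (rule that; assumption)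
    define C where "C = c1 + c2 + c3 + c4 + c5 + c6 + 2 * c7"
    have C: "0 < C" "c1 \<le> C" "c2 \<le> C" "c3 \<le> C" "c4 \<le> C" "c5 \<le> C" "c6 \<le> C" "2 * c7 \<le> C"
      using c1(1) c2(1) c3(1) c4(1) c5(1) c6(1) c7(1) by (simp_all add: C_def)
    show thesis
    proof (rule that[OF C(1)])
      fix \<iota> assume i: "\<iota> \<in> I"
      let ?V = "\<lambda>c x. cut \<iota> x * V c \<iota> x" and ?W = "\<lambda>c x. cut \<iota> x * W c \<iota> x"
      have N4: "(2::nat) \<le> 4" "4 \<le> Nm" by (simp_all add: Nm_def)
      have V: "C_class 2 (?V c)" "\<zeta> x \<le> l \<iota> \<Longrightarrow> ?V c x = V c \<iota> x" "\<zeta> x \<le> l \<iota> \<Longrightarrow> partial UNIV q (?V c) x = pd q (V c) \<iota> x"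
        "\<zeta> x \<le> l \<iota> \<Longrightarrow> partial UNIV s (partial UNIV q (?V c)) x = pd s (pd q (V c)) \<iota> x" for c x q s
      proof -
        obtain B where B: "SC D (\<lambda>_. \<nu>) 4 B (V c)" using F(2) by blast
        show "C_class 2 (?V c)" "\<zeta> x \<le> l \<iota> \<Longrightarrow> ?V c x = V c \<iota> x" "\<zeta> x \<le> l \<iota> \<Longrightarrow> partial UNIV q (?V c) x = pd q (V c) \<iota> x"
          "\<zeta> x \<le> l \<iota> \<Longrightarrow> partial UNIV s (partial UNIV q (?V c)) x = pd s (pd q (V c)) \<iota> x"
          using extend_cut[OF B F(1) N4 i] by blast+
      qed
      have W: "C_class 2 (?W c)" "\<zeta> x \<le> l \<iota> \<Longrightarrow> ?W c x = W c \<iota> x" "\<zeta> x \<le> l \<iota> \<Longrightarrow> partial UNIV q (?W c) x = pd q (W c) \<iota> x"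
        "\<zeta> x \<le> l \<iota> \<Longrightarrow> partial UNIV s (partial UNIV q (?W c)) x = pd s (pd q (W c)) \<iota> x" for c x q s
      proof -
        obtain B where B: "SC D (\<lambda>_. \<nu>) 4 B (W c)" using F(3) by blast
        show "C_class 2 (?W c)" "\<zeta> x \<le> l \<iota> \<Longrightarrow> ?W c x = W c \<iota> x" "\<zeta> x \<le> l \<iota> \<Longrightarrow> partial UNIV q (?W c) x = pd q (W c) \<iota> x"
          "\<zeta> x \<le> l \<iota> \<Longrightarrow> partial UNIV s (partial UNIV q (?W c)) x = pd s (pd q (W c)) \<iota> x"
          using extend_cut[OF B F(1) N4 i] by blast+
      qed
      show "\<exists>V W. improves \<zeta> \<gamma> N K C (l \<iota>) (lam \<iota>) (M \<iota>) (d \<iota>) (g \<iota>) (\<lambda>c. fv c \<iota>) (\<lambda>c. fw c \<iota>) (\<lambda>q r. fA q r \<iota>) V W"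
        unfolding improves_def
      proof (rule exI[of _ ?V], rule exI[of _ ?W], intro conjI allI impI)
        show "C_class 2 (?V c)" "C_class 2 (?W c)" for c by (rule V, rule W)
        fix x c q s assume x: "\<zeta> x \<le> l \<iota>"
        then have x1: "(\<iota>, x) \<in> D1" using i by (simp add: D1_def)
        then have xD: "(\<iota>, x) \<in> D" using D1_D by blast
        show "\<bar>?V c x - fv c \<iota> x\<bar> \<le> C * (lam \<iota> powr (\<gamma> / 2) * ?\<delta> \<iota>)"
          unfolding V(2)[OF x] by (rule abs_le_scale[OF c1(2)[OF xD] c1(1) C(2) w(1)[OF i]])
        show "\<bar>partial UNIV q (?V c) x - partial UNIV q (fv c \<iota>) x\<bar> \<le> C * (lam \<iota> powr (\<gamma> / 2) * ?\<delta> \<iota>)"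
          unfolding V(3)[OF x] pd_partial[symmetric] by (rule abs_le_scale[OF c2(2)[OF xD] c2(1) C(3) w(1)[OF i]])
        show "\<bar>partial UNIV s (partial UNIV q (?V c)) x\<bar> \<le> C * ((lam \<iota> * l \<iota>) ^ (K + N) * lam \<iota> powr (\<gamma> / 2) / l \<iota> * ?\<delta> \<iota>)"
          unfolding V(4)[OF x] by (rule abs_le_scale[OF c3(2)[OF xD] c3(1) C(4) w(3)[OF i]])
        show "\<bar>?W c x - fw c \<iota> x\<bar> \<le> C * (lam \<iota> powr \<gamma> * ?\<delta> \<iota> * ?\<Delta> \<iota>)"
          unfolding W(2)[OF x] by (rule abs_le_scale[OF c4(2)[OF xD] c4(1) C(5) w(2)[OF i]])
        show "\<bar>partial UNIV q (?W c) x - partial UNIV q (fw c \<iota>) x\<bar> \<le> C * (lam \<iota> powr \<gamma> * ?\<delta> \<iota> * ?\<Delta> \<iota>)"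
          unfolding W(3)[OF x] pd_partial[symmetric] by (rule abs_le_scale[OF c5(2)[OF xD] c5(1) C(6) w(2)[OF i]])
        show "\<bar>partial UNIV s (partial UNIV q (?W c)) x\<bar> \<le> C * ((lam \<iota> * l \<iota>) ^ (K + N) * lam \<iota> powr \<gamma> / l \<iota> * ?\<delta> \<iota> * ?\<Delta> \<iota>)"
          unfolding W(4)[OF x] by (rule abs_le_scale[OF c6(2)[OF xD] c6(1) C(7) w(4)[OF i]])
        fix a c0 b assume a: "fA q s \<iota> x = c0 + b \<bullet> x" "\<forall>y. dist x y \<le> l \<iota> / 16 \<longrightarrow> \<bar>fA q s \<iota> y - (c0 + b \<bullet> y)\<bar> \<le> a"
        have 1: "\<bar>mo (fA q s) \<iota> x - fA q s \<iota> x\<bar> \<le> a"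
          unfolding a(1) mo_def
          by (rule moll_near_affine[OF A1(8)[OF i]]) (use a(2) t_pos[OF i] t_le(2)[OF i] in auto)
        have 2: "\<bar>Df (\<lambda>q r. mo (fA q r)) V W q s \<iota> x\<bar> \<le> C * ((d \<iota> + (l \<iota> * M \<iota>)\<^sup>2) / (lam \<iota> * l \<iota>) ^ (K * N))"
        proof (rule abs_le_scale[OF _ _ C(8)])
          show "\<bar>Df (\<lambda>q r. mo (fA q r)) V W q s \<iota> x\<bar>
              \<le> 2 * c7 * ((?p \<iota>)\<^sup>2 * ((\<rho> \<iota> * \<tau> \<iota>) ^ (2 * (?J - 1)) + \<epsilon> \<iota>) / 2)"
            using c7(2)[OF x1] by simp
          show "(?p \<iota>)\<^sup>2 * ((\<rho> \<iota> * \<tau> \<iota>) ^ (2 * (?J - 1)) + \<epsilon> \<iota>) / 2 \<le> (d \<iota> + (l \<iota> * M \<iota>)\<^sup>2) / (lam \<iota> * l \<iota>) ^ (K * N)"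
            using w(5)[OF i] by linarith
        qed (use c7 in simp)
        have "mat_defect (\<lambda>q r. fA q r \<iota>) ?V ?W q s x = Df (\<lambda>q r. mo (fA q r)) V W q s \<iota> x - (mo (fA q s) \<iota> x - fA q s \<iota> x)"
          unfolding mat_defect_def Df_def V(3)[OF x] W(3)[OF x] by simp
        then show "\<bar>mat_defect (\<lambda>q r. fA q r \<iota>) ?V ?W q s x\<bar> \<le> a + C * ((d \<iota> + (l \<iota> * M \<iota>)\<^sup>2) / (lam \<iota> * l \<iota>) ^ (K * N))"
          using 1 2 by linarith
      qed
    qed
  qed (use Q Cn in auto)
qed

text \<open>Uniformity comes from taking the set of all admissible data as index set, each datum
  being its own index: a single application to this family yields one constant for all data.\<close>

lemma scalar_stage:
  fixes \<zeta> :: "real^2 \<Rightarrow> real" and R \<gamma> :: real and N K :: nat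
  assumes \<zeta>: "\<And>x y. \<zeta> y \<le> \<zeta> x + dist x y" "\<exists>x. \<zeta> x \<le> 0"
    and R: "0 < R" "\<And>x k. \<zeta> x \<le> 1 \<Longrightarrow> \<bar>x $ k\<bar> \<le> R"
    and NK: "1 \<le> N" "1 \<le> K" and \<gamma>: "0 < \<gamma>" "\<gamma> < 1"
  obtains C where "0 < C" "\<And>l lam M d g fv fw fA. admissible \<zeta> \<gamma> l lam M d g fv fw fA \<Longrightarrow>
    \<exists>V W. improves \<zeta> \<gamma> N K C l lam M d g fv fw fA V W"
proof -
  let ?I = "{\<iota>. admissible \<zeta> \<gamma> (fst \<iota>) (fst (snd \<iota>)) (fst (snd (snd \<iota>))) (fst (snd (snd (snd \<iota>)))) (fst (snd (snd (snd (snd \<iota>))))) (fst (snd (snd (snd (snd (snd \<iota>)))))) (fst (snd (snd (snd (snd (snd (snd \<iota>))))))) (snd (snd (snd (snd (snd (snd (snd \<iota>)))))))}"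
  show thesis
  proof (rule family_stage[where I="?I" and l="\<lambda>\<iota>. fst \<iota>" and lam="\<lambda>\<iota>. fst (snd \<iota>)" and M="\<lambda>\<iota>. fst (snd (snd \<iota>))" and d="\<lambda>\<iota>. fst (snd (snd (snd \<iota>)))" and g="\<lambda>\<iota>. fst (snd (snd (snd (snd \<iota>))))"
        and fv="\<lambda>c \<iota>. (fst (snd (snd (snd (snd (snd \<iota>)))))) c" and fw="\<lambda>c \<iota>. (fst (snd (snd (snd (snd (snd (snd \<iota>))))))) c" and fA="\<lambda>q r \<iota>. (snd (snd (snd (snd (snd (snd (snd \<iota>))))))) q r" and \<zeta>=\<zeta> and R=R and N=N and K=K and \<gamma>=\<gamma>])
    fix C assume C: "0 < C" "\<And>\<iota>. \<iota> \<in> ?I \<Longrightarrow> \<exists>V W. improves \<zeta> \<gamma> N K C (fst \<iota>) (fst (snd \<iota>)) (fst (snd (snd \<iota>))) (fst (snd (snd (snd \<iota>)))) (fst (snd (snd (snd (snd \<iota>))))) (fst (snd (snd (snd (snd (snd \<iota>)))))) (fst (snd (snd (snd (snd (snd (snd \<iota>))))))) (snd (snd (snd (snd (snd (snd (snd \<iota>))))))) V W"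
    show thesis
    proof (rule that[OF C(1)])
      fix l lam M d g fv fw fA assume "admissible \<zeta> \<gamma> l lam M d g fv fw fA"
      then show "\<exists>V W. improves \<zeta> \<gamma> N K C l lam M d g fv fw fA V W"
        using C(2)[of "(l, lam, M, d, g, fv, fw, fA)"] by simp
    qed
  qed (fact assms | simp)+
qed

subsection \<open>Norms on closed neighbourhoods\<close>

lemma closed_nbhd_infdist:
  assumes "\<omega> \<noteq> {}" "0 \<le> r"
  shows "x \<in> closed_nbhd \<omega> r \<longleftrightarrow> infdist x \<omega> \<le> r"
proof
  assume "x \<in> closed_nbhd \<omega> r"
  then obtain c y where c: "c \<in> closure \<omega>" "y \<in> cball 0 r" "x = c + y"
    by (auto simp: closed_nbhd_def elim!: set_plus_elim)
  have "infdist x \<omega> \<le> infdist c \<omega> + dist x c" by (rule infdist_triangle)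
  also have "infdist c \<omega> = 0" using c(1) in_closure_iff_infdist_zero[OF assms(1)] by blast
  finally show "infdist x \<omega> \<le> r" using c by (simp add: dist_norm)
next
  assume r: "infdist x \<omega> \<le> r"
  obtain c where c: "c \<in> closure \<omega>" "infdist x (closure \<omega>) = dist x c"
    using infdist_attains_inf[of "closure \<omega>" x] assms(1) by auto
  have "infdist x (closure \<omega>) \<le> infdist x \<omega>" by (rule infdist_mono[OF closure_subset assms(1)])
  then have "x - c \<in> cball 0 r" using r c(2) by (simp add: dist_norm norm_minus_commute)
  then have "c + (x - c) \<in> closed_nbhd \<omega> r" unfolding closed_nbhd_def by (rule set_plus_intro[OF c(1)])
  then show "x \<in> closed_nbhd \<omega> r" by simp
qed

lemma compact_closed_nbhd:
  assumes "bounded \<omega>"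
  shows "compact (closed_nbhd \<omega> r)"
proof -
  have "compact {x + y | x y. x \<in> closure \<omega> \<and> y \<in> cball 0 r}"
    by (rule compact_sums) (use assms in \<open>auto simp: compact_closure\<close>)
  also have "{x + y | x y. x \<in> closure \<omega> \<and> y \<in> cball 0 r} = closed_nbhd \<omega> r"
    unfolding closed_nbhd_def set_plus_def by blast
  finally show ?thesis .
qed

lemma partials_closed_nbhd:
  assumes "0 < r"
  shows "C_class m F \<Longrightarrow> (\<And>y. y \<in> closed_nbhd \<omega> r \<Longrightarrow> f y = F y) \<Longrightarrow> length is \<le> m \<Longrightarrow> x \<in> closed_nbhd \<omega> r \<Longrightarrow>
    partials (closed_nbhd \<omega> r) is f x = partials UNIV is F x"
proof (induction "is" arbitrary: f F m)
  case (Cons i "is")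
  obtain m' where m: "m = Suc m'" using Cons(4) by (cases m) auto
  have "partials (closed_nbhd \<omega> r) is (partial (closed_nbhd \<omega> r) i f) x = partials UNIV is (partial UNIV i F) x"
  proof (rule Cons.IH[of m'])
    show "C_class m' (partial UNIV i F)" using Cons(2) m by simp
    show "partial (closed_nbhd \<omega> r) i f y = partial UNIV i F y" if "y \<in> closed_nbhd \<omega> r" for y
      by (rule partial_closed_nbhd[OF assms that]) (use Cons(2,3) m in \<open>auto simp: differentiable_on_def\<close>)
  qed (use Cons m in auto)
  then show ?case by simp
qed simp

lemma C_class_partials: "C_class m F \<Longrightarrow> length is \<le> m \<Longrightarrow> continuous_on UNIV (partials UNIV is F)"
proof (induction "is" arbitrary: F m)
  case Nil
  then show ?case by (simp add: C_class_continuous)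
next
  case (Cons i "is")
  then obtain m' where "m = Suc m'" by (cases m) auto
  then have "C_class m' (partial UNIV i F)" "length is \<le> m'" using Cons(2,3) by simp_all
  then show ?case using Cons.IH by simp
qed

lemma finite_multi_indices: "finite {is :: 2 list. length is = j}"
  using finite_lists_length_eq[of "UNIV :: 2 set" j] by simp

text \<open>A real supremum bounds its members only over a bounded set; compactness of the
  neighbourhood and continuity of the derivatives of \<open>F\<close> provide this.\<close>

lemma partials_le_grad_norm:
  assumes \<omega>: "bounded \<omega>" and r: "0 < r" and F: "C_class m F" "\<And>y. y \<in> closed_nbhd \<omega> r \<Longrightarrow> f y = F y"
    and "length is \<le> m" and x: "x \<in> closed_nbhd \<omega> r"
  shows "norm (partials (closed_nbhd \<omega> r) is f x) \<le> grad_norm (length is) (closed_nbhd \<omega> r) f"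
proof -
  let ?S = "closed_nbhd \<omega> r" and ?I = "{js :: 2 list. length js = length is}"
  let ?g = "\<lambda>x. \<Sum>js\<in>?I. norm (partials UNIV js F x)"
  have "continuous_on ?S ?g"
  proof (intro continuous_on_sum continuous_on_norm)
    fix js assume "js \<in> ?I"
    then have "length js \<le> m" using assms(5) by simp
    then show "continuous_on ?S (partials UNIV js F)"
      using C_class_partials[OF F(1)] continuous_on_subset by blast
  qed
  then have "compact (?g ` ?S)" by (rule compact_continuous_image[OF _ compact_closed_nbhd[OF \<omega>]])
  then have "bdd_above (?g ` ?S)" by (intro bounded_imp_bdd_above compact_imp_bounded)
  then obtain B where B: "\<And>x. x \<in> ?S \<Longrightarrow> ?g x \<le> B" by (auto simp: bdd_above_def)
  have "L2_set (\<lambda>js. norm (partials ?S js f x)) ?I \<le> B" if x: "x \<in> ?S" for x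
  proof -
    have "L2_set (\<lambda>js. norm (partials ?S js f x)) ?I \<le> (\<Sum>js\<in>?I. norm (partials ?S js f x))"
      by (rule L2_set_le_sum) simp
    also have "\<dots> = ?g x"
      by (rule sum.cong[OF refl]) (use partials_closed_nbhd[OF r F _ x] assms(5) in auto)
    also have "\<dots> \<le> B" by (rule B[OF x])
    finally show ?thesis .
  qed
  then have b: "bdd_above ((\<lambda>x. L2_set (\<lambda>js. norm (partials ?S js f x)) ?I) ` ?S)"
    by (intro bdd_aboveI2)
  have "norm (partials ?S is f x) \<le> L2_set (\<lambda>js. norm (partials ?S js f x)) ?I"
    by (rule member_le_L2_set[OF finite_multi_indices, of "is" _ "\<lambda>js. norm (partials ?S js f x)"]) simp
  also have "\<dots> \<le> grad_norm (length is) ?S f"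
    unfolding grad_norm_def by (rule cSUP_upper[OF x b])
  finally show ?thesis .
qed

lemma grad_norm_le_C_norm:
  assumes \<omega>: "bounded \<omega>" "\<omega> \<noteq> {}" and r: "0 < r" and F: "C_class m F" "\<And>y. y \<in> closed_nbhd \<omega> r \<Longrightarrow> f y = F y" and "j \<le> m"
  shows "grad_norm j (closed_nbhd \<omega> r) f \<le> C_norm m (closed_nbhd \<omega> r) f"
    and "0 \<le> grad_norm j (closed_nbhd \<omega> r) f"
proof -
  obtain x where "x \<in> \<omega>" using \<omega>(2) by blast
  then have x: "x \<in> closed_nbhd \<omega> r" using closed_nbhd_infdist[OF \<omega>(2), of r x] r by simp
  have n: "0 \<le> grad_norm i (closed_nbhd \<omega> r) f" if "i \<le> m" for i
  proof -
    have "norm (partials (closed_nbhd \<omega> r) (replicate i 1) f x) \<le> grad_norm i (closed_nbhd \<omega> r) f"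
      using partials_le_grad_norm[OF \<omega>(1) r F(1), of f "replicate i 1"] F(2) x that by simp
    then show ?thesis by (rule order_trans[OF norm_ge_zero])
  qed
  show "0 \<le> grad_norm j (closed_nbhd \<omega> r) f" by (rule n[OF assms(6)])
  show "grad_norm j (closed_nbhd \<omega> r) f \<le> C_norm m (closed_nbhd \<omega> r) f"
    unfolding C_norm_def by (rule member_le_sum) (use n assms(6) in auto)
qed

text \<open>There are 2^j lists of directions of length \<open>j\<close>, mixed derivatives being
  counted with their order.\<close>

lemma grad_norm_le:
  assumes "S \<noteq> {}" "\<And>is x. length is = j \<Longrightarrow> x \<in> S \<Longrightarrow> norm (partials S is f x) \<le> c"
  shows "grad_norm j S f \<le> 2 ^ j * c"
  unfolding grad_norm_def
proof (rule cSUP_least[OF assms(1)])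
  fix x assume x: "x \<in> S"
  let ?I = "{is :: 2 list. length is = j}"
  have "L2_set (\<lambda>is. norm (partials S is f x)) ?I \<le> (\<Sum>is\<in>?I. norm (partials S is f x))"
    by (rule L2_set_le_sum) simp
  also have "\<dots> \<le> (\<Sum>is\<in>?I. c)" by (rule sum_mono) (use assms(2) x in simp)
  also have "\<dots> = 2 ^ j * c" using card_lists_length_eq[of "UNIV :: 2 set" j] by simp
  finally show "L2_set (\<lambda>is. norm (partials S is f x)) ?I \<le> 2 ^ j * c" .
qed

section \<open>Linear images, sums and components of differentiable functions\<close>

lemma partial_bounded_linear:
  assumes "bounded_linear T" "F differentiable (at x)"
  shows "partial UNIV i (\<lambda>x. T (F x)) x = T (partial UNIV i F x)"
proof -
  have "(F has_derivative frechet_derivative F (at x)) (at x)" using assms(2) frechet_derivative_works by blast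
  from bounded_linear.has_derivative[OF assms(1) this]
  have "((\<lambda>x. T (F x)) has_derivative (\<lambda>h. T (frechet_derivative F (at x) h))) (at x)" .
  from frechet_derivative_at[OF this, symmetric] show ?thesis by (simp add: partial_def)
qed

lemma C_class_bounded_linear:
  assumes T: "bounded_linear T"
  shows "C_class m F \<Longrightarrow> C_class m (\<lambda>x. T (F x))"
proof (induction m arbitrary: F)
  case 0
  then show ?case by (simp add: bounded_linear.continuous_on[OF T])
next
  case (Suc m)
  have d: "F differentiable (at x)" for x using Suc(2) by (simp add: differentiable_on_def)
  have "partial UNIV i (\<lambda>x. T (F x)) = (\<lambda>x. T (partial UNIV i F x))" for i
    by (rule ext) (rule partial_bounded_linear[OF T d])
  moreover have "(\<lambda>x. T (F x)) differentiable (at x)" for x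
    using d[of x] bounded_linear.has_derivative[OF T] unfolding differentiable_def by blast
  ultimately show ?case using Suc by (simp add: differentiable_on_def)
qed

lemma partials_bounded_linear:
  assumes T: "bounded_linear T"
  shows "C_class m F \<Longrightarrow> length is \<le> m \<Longrightarrow> partials UNIV is (\<lambda>x. T (F x)) x = T (partials UNIV is F x)"
proof (induction "is" arbitrary: F m)
  case (Cons i "is")
  obtain m' where m: "m = Suc m'" using Cons(3) by (cases m) auto
  have "F differentiable (at x)" for x using Cons(2) m by (simp add: differentiable_on_def)
  then have "partial UNIV i (\<lambda>x. T (F x)) = (\<lambda>x. T (partial UNIV i F x))"
    by (intro ext partial_bounded_linear[OF T])
  then show ?case using Cons.IH[of m' "partial UNIV i F"] Cons(2,3) m by simp
qed simp

lemma partial_add: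
  assumes "f differentiable (at x)" "g differentiable (at x)"
  shows "partial UNIV i (\<lambda>x. f x + g x) x = partial UNIV i f x + partial UNIV i g x"
  using frechet_derivative_at[OF has_derivative_add[OF assms[unfolded frechet_derivative_works]], symmetric]
  by (simp add: partial_def)

lemma C_class_add: "C_class m f \<Longrightarrow> C_class m g \<Longrightarrow> C_class m (\<lambda>x. f x + g x)"
proof (induction m arbitrary: f g)
  case 0
  then show ?case by (simp add: continuous_on_add)
next
  case (Suc m)
  have "partial UNIV i (\<lambda>x. f x + g x) = (\<lambda>x. partial UNIV i f x + partial UNIV i g x)" for i
    by (rule ext, rule partial_add) (use Suc in \<open>simp_all add: differentiable_on_def\<close>)
  then show ?case using Suc by (simp add: differentiable_on_add)
qed

lemma C_class_diff: "C_class m f \<Longrightarrow> C_class m g \<Longrightarrow> C_class m (\<lambda>x. f x - g x)"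
  using C_class_add[of m f "\<lambda>x. - g x"] C_class_bounded_linear[OF bounded_linear_minus[OF bounded_linear_ident], of m g] by simp

lemma C_class_vector:
  fixes f :: "2 \<Rightarrow> real^2 \<Rightarrow> real"
  assumes "\<And>c. C_class m (f c)"
  shows "C_class m (\<lambda>x. (vec_lambda (\<lambda>c. f c x) :: real^2))"
proof -
  have "(\<lambda>x. (vec_lambda (\<lambda>c. f c x) :: real^2)) = (\<lambda>x. f 1 x *\<^sub>R axis 1 1 + f 2 x *\<^sub>R axis 2 1)"
    by (auto simp: vec_eq_iff forall_2 axis_def fun_eq_iff)
  moreover have "C_class m (\<lambda>x. f 1 x *\<^sub>R axis 1 1 + f 2 x *\<^sub>R (axis 2 1 :: real^2))"
    by (intro C_class_add C_class_bounded_linear[OF bounded_linear_scaleR_left] assms)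
  ultimately show ?thesis by simp
qed

lemma norm_vec2_le:
  fixes z :: "'b::real_normed_vector^2"
  assumes "\<And>c. norm (z $ c) \<le> B"
  shows "norm z \<le> 2 * B"
proof -
  have "norm z \<le> (\<Sum>c\<in>UNIV. norm (z $ c))" unfolding norm_vec_def by (rule L2_set_le_sum) simp
  also have "\<dots> \<le> 2 * B" using assms[of 1] assms[of 2] by (simp add: sum_2)
  finally show ?thesis .
qed

text \<open>Passes from derivatives within the neighbourhood to those of global extensions, for
  which the scalar construction is made.\<close>

lemma defect_nth:
  fixes Fv Fw :: "real^2 \<Rightarrow> real^2"
  assumes r: "0 < r" and x: "x \<in> closed_nbhd \<omega> r" and v: "C_class (Suc m) Fv" "\<And>y. y \<in> closed_nbhd \<omega> r \<Longrightarrow> v y = Fv y"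
    and w: "C_class (Suc m) Fw" "\<And>y. y \<in> closed_nbhd \<omega> r \<Longrightarrow> w y = Fw y" and A: "A x = FA x"
  shows "defect (closed_nbhd \<omega> r) A v w x $ q $ s
    = mat_defect (\<lambda>q s y. FA y $ q $ s) (\<lambda>c y. Fv y $ c) (\<lambda>c y. Fw y $ c) q s x"
proof -
  let ?S = "closed_nbhd \<omega> r"
  have g: "grad ?S f x $ c $ p = partial UNIV p (\<lambda>y. F y $ c) x"
    if F: "C_class (Suc m) F" "\<And>y. y \<in> ?S \<Longrightarrow> f y = F y" for f F :: "real^2 \<Rightarrow> real^2" and c p
  proof -
    have d: "F differentiable (at x)" using F(1) by (simp add: differentiable_on_def)
    have "grad ?S f x $ c $ p = partial ?S p f x $ c" by (simp add: grad_def jacobian_def matrix_def partial_def)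
    also have "\<dots> = partial UNIV p F x $ c" using partial_closed_nbhd[OF r x d F(2)] by simp
    also have "\<dots> = partial UNIV p (\<lambda>y. F y $ c) x"
      using partial_bounded_linear[OF bounded_linear_vec_nth d] by simp
    finally show ?thesis .
  qed
  show ?thesis
    unfolding defect_def mat_defect_def sym_part_def
    by (simp add: transpose_def matrix_matrix_mult_def g[OF v] g[OF w] A)
qed

text \<open>The difference quotients have to be bounded before their supremum is meaningful; the
  local bound of the extension on a ball containing the compact neighbourhood ensures this.\<close>

lemma Holder_seminorm_upper:
  assumes \<omega>: "bounded \<omega>" and r: "0 < r" and F: "C_class m F" "\<And>y. y \<in> closed_nbhd \<omega> r \<Longrightarrow> f y = F y"
    and H: "\<And>is. length is = m \<Longrightarrow> locally_Holder \<beta> (partials UNIV is F)"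
    and x: "x \<in> closed_nbhd \<omega> r" "y \<in> closed_nbhd \<omega> r" and "is": "length is = m"
  shows "norm (partials UNIV is F x - partials UNIV is F y) \<le> Holder_seminorm m \<beta> (closed_nbhd \<omega> r) f * dist x y powr \<beta>"
proof (cases "x = y")
  case False
  let ?S = "closed_nbhd \<omega> r" and ?I = "{is :: 2 list. length is = m}"
  let ?P = "{(x, y). x \<in> ?S \<and> y \<in> ?S \<and> x \<noteq> y}"
  let ?q = "\<lambda>(x, y). L2_set (\<lambda>is. norm (partials ?S is f x - partials ?S is f y)) ?I / dist x y powr \<beta>"
  have "bounded ?S" by (rule compact_imp_bounded[OF compact_closed_nbhd[OF \<omega>]])
  then obtain R where "\<And>x. x \<in> ?S \<Longrightarrow> norm x \<le> R" unfolding bounded_iff by blast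
  then have R: "?S \<subseteq> cball 0 R" by (intro subsetI) simp
  have "\<forall>is. \<exists>c. length is = m \<longrightarrow> (\<forall>x\<in>cball 0 R. \<forall>y\<in>cball 0 R. norm (partials UNIV is F x - partials UNIV is F y) \<le> c * dist x y powr \<beta>)"
  proof
    show "\<exists>c. length is = m \<longrightarrow> (\<forall>x\<in>cball 0 R. \<forall>y\<in>cball 0 R. norm (partials UNIV is F x - partials UNIV is F y) \<le> c * dist x y powr \<beta>)" for "is"
      using H[of "is", unfolded locally_Holder_def, THEN spec[of _ R]] by (cases "length is = m") auto
  qed
  from choice[OF this] obtain h where h0:
    "\<forall>is. length is = m \<longrightarrow> (\<forall>x\<in>cball 0 R. \<forall>y\<in>cball 0 R. norm (partials UNIV is F x - partials UNIV is F y) \<le> h is * dist x y powr \<beta>)"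
    by (elim exE) (rule that)
  have h: "norm (partials UNIV is F x - partials UNIV is F y) \<le> h is * dist x y powr \<beta>"
    if "length is = m" "x \<in> ?S" "y \<in> ?S" for "is" x y
    by (rule h0[rule_format, OF that(1) subsetD[OF R that(2)] subsetD[OF R that(3)]])
  have e: "partials ?S is f z = partials UNIV is F z" if "length is = m" "z \<in> ?S" for "is" z
    by (rule partials_closed_nbhd[OF r F _ that(2)]) (use that in simp_all)
  have b: "?q z \<le> sum h ?I" if "z \<in> ?P" for z
  proof -
    obtain x y where z: "z = (x, y)" "x \<in> ?S" "y \<in> ?S" "x \<noteq> y" using \<open>z \<in> ?P\<close> by auto
    have "L2_set (\<lambda>is. norm (partials ?S is f x - partials ?S is f y)) ?I
        \<le> (\<Sum>is\<in>?I. norm (partials ?S is f x - partials ?S is f y))" by (rule L2_set_le_sum) simp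
    also have "\<dots> \<le> (\<Sum>is\<in>?I. h is * dist x y powr \<beta>)"
      by (rule sum_mono) (use e h z in simp)
    finally show ?thesis using z by (simp add: sum_distrib_right[symmetric] divide_le_eq)
  qed
  have q: "?q (x, y) \<le> Holder_seminorm m \<beta> ?S f"
    unfolding Holder_seminorm_def
  proof (rule cSUP_upper[where f="?q" and x="(x, y)"])
    show "(x, y) \<in> ?P" using False x by simp
    show "bdd_above (?q ` ?P)" by (rule bdd_aboveI2[OF b])
  qed
  have "norm (partials ?S is f x - partials ?S is f y) \<le> L2_set (\<lambda>is. norm (partials ?S is f x - partials ?S is f y)) ?I"
    by (rule member_le_L2_set[OF finite_multi_indices, of "is" _ "\<lambda>is. norm (partials ?S is f x - partials ?S is f y)"]) (simp add: "is")
  also have "\<dots> \<le> Holder_seminorm m \<beta> ?S f * dist x y powr \<beta>"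
    using q False by (simp add: divide_le_eq)
  finally show ?thesis by (simp only: e[OF "is" x(1)] e[OF "is" x(2)])
qed simp

text \<open>This is \<open>C1_lipschitz\<close> for the difference of \<open>f\<close> and its
  linear part at \<open>x\<close>.\<close>

lemma C1_near_affine:
  assumes f: "C1 f e" and B: "\<And>z k. dist x z \<le> r \<Longrightarrow> \<bar>e k z - e k x\<bar> \<le> B" and y: "dist x y \<le> r"
  shows "\<bar>f y - ((f x - (\<Sum>k\<in>UNIV. e k x * x $ k)) + (vec_lambda (\<lambda>k. e k x)) \<bullet> y)\<bar> \<le> 2 * B * dist x y"
proof -
  let ?h = "\<lambda>y. f y - (\<Sum>k\<in>UNIV. e k x * y $ k)"
  have "C1 ?h (\<lambda>k z. e k z - e k x)"
    unfolding C1_def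
  proof (intro conjI allI)
    show "(?h has_derivative (\<lambda>h. \<Sum>k\<in>UNIV. h $ k * (e k z - e k x))) (at z)" for z
      using f unfolding C1_def
      by (auto intro!: derivative_eq_intros simp: sum_2 algebra_simps)
    show "continuous_on UNIV (\<lambda>z. e k z - e k x)" for k
      using f unfolding C1_def by (intro continuous_on_diff continuous_on_const) blast
  qed
  from C1_lipschitz[OF this B y] show ?thesis by (simp add: inner_vec_def sum_2 algebra_simps)
qed

text \<open>The affine function is the value at \<open>x\<close> if s = 0 and the tangent at
  \<open>x\<close> if s = 1. All points concerned lie within \<open>2 * l\<close> of the domain, and
  the radius l / 16 leaves room to absorb the factor 2 of \<open>C1_near_affine\<close>.\<close>

lemma Holder_near_affine:
  fixes F :: "real^2 \<Rightarrow> real^2^2"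
  assumes \<omega>: "bounded \<omega>" "\<omega> \<noteq> {}" and l: "0 < l" and s: "s \<in> {0, 1}" and \<beta>: "0 < \<beta>"
    and F: "C_class s F" "\<And>y. y \<in> closed_nbhd \<omega> (2 * l) \<Longrightarrow> A y = F y"
    and H: "\<And>is. length is = s \<Longrightarrow> locally_Holder \<beta> (partials UNIV is F)"
    and x: "infdist x \<omega> \<le> l"
  shows "\<exists>c b. F x $ q $ r = c + b \<bullet> x \<and> (\<forall>y. dist x y \<le> l / 16 \<longrightarrow>
    \<bar>F y $ q $ r - (c + b \<bullet> y)\<bar> \<le> l powr (real s + \<beta>) * Holder_norm s \<beta> (closed_nbhd \<omega> (2 * l)) A)"
proof -
  let ?S = "closed_nbhd \<omega> (2 * l)"
  let ?h = "Holder_seminorm s \<beta> ?S A"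
  have l2: "0 < 2 * l" using l by simp
  have S: "y \<in> ?S" if "dist x y \<le> l" for y
  proof -
    have "infdist y \<omega> \<le> infdist x \<omega> + dist y x" by (rule infdist_triangle)
    then have "infdist y \<omega> \<le> 2 * l" using x that by (simp add: dist_commute)
    then show ?thesis using closed_nbhd_infdist[OF \<omega>(2), of "2 * l" y] l by simp
  qed
  have xS: "x \<in> ?S" by (rule S) (use l in simp)
  have U: "norm (partials UNIV is F z - partials UNIV is F y) \<le> ?h * dist z y powr \<beta>"
    if "z \<in> ?S" "y \<in> ?S" "length is = s" for z y "is"
    by (rule Holder_seminorm_upper[OF \<omega>(1) l2]) (fact F H that)+
  \<comment> \<open>The sign of a supremum has to come from one of its members; \<open>x\<close> and
    a point at distance l provide the pair.\<close>
  have h0: "0 \<le> ?h"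
  proof -
    let ?y = "x + l *\<^sub>R axis 1 1"
    have d: "dist x ?y = l" using l by (simp add: dist_norm norm_axis_real)
    have "norm (partials UNIV (replicate s 1) F x - partials UNIV (replicate s 1) F ?y) \<le> ?h * dist x ?y powr \<beta>"
      by (rule U[OF xS S]) (use d in auto)
    then have "0 \<le> ?h * l powr \<beta>" unfolding d by (rule order_trans[OF norm_ge_zero])
    then show ?thesis using l by (simp add: zero_le_mult_iff)
  qed
  have "0 \<le> C_norm s ?S A" unfolding C_norm_def
    by (rule sum_nonneg) (use grad_norm_le_C_norm(2)[OF \<omega> l2 F] in auto)
  then have hn: "?h \<le> Holder_norm s \<beta> ?S A" by (simp add: Holder_norm_def)
  have near: "\<bar>partials UNIV is F y $ q $ r - partials UNIV is F x $ q $ r\<bar> \<le> ?h * l powr \<beta>"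
    if "dist x y \<le> l / 16" "length is = s" for y "is"
  proof -
    have "\<bar>(partials UNIV is F y - partials UNIV is F x) $ q $ r\<bar> \<le> norm (partials UNIV is F y - partials UNIV is F x)"
      using component_le_norm_cart[of "(partials UNIV is F y - partials UNIV is F x) $ q" r]
        Finite_Cartesian_Product.norm_nth_le[of "partials UNIV is F y - partials UNIV is F x" q] by linarith
    also have "\<dots> \<le> ?h * dist y x powr \<beta>"
      by (rule U[OF S xS that(2)]) (use that l in auto)
    also have "\<dots> \<le> ?h * l powr \<beta>"
      by (rule mult_left_mono[OF powr_mono2 h0]) (use that l \<beta> in \<open>auto simp: dist_commute\<close>)
    finally show ?thesis by simp
  qed
  show ?thesis
  proof (cases "s = 0")
    case True
    show ?thesis
    proof (intro exI[of _ "F x $ q $ r"] exI[of _ 0] conjI allI impI)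
      fix y assume y: "dist x y \<le> l / 16"
      have "\<bar>F y $ q $ r - F x $ q $ r\<bar> \<le> ?h * l powr \<beta>" using near[OF y, of "[]"] True by simp
      also have "\<dots> \<le> Holder_norm s \<beta> ?S A * l powr \<beta>" by (rule mult_right_mono[OF hn]) simp
      finally show "\<bar>F y $ q $ r - (F x $ q $ r + 0 \<bullet> y)\<bar> \<le> l powr (real s + \<beta>) * Holder_norm s \<beta> ?S A"
        using True by (simp add: mult.commute)
    qed simp
  next
    case False
    then have s1: "s = Suc 0" using s by simp
    let ?f = "\<lambda>y. F y $ q $ r"
    have T: "bounded_linear (\<lambda>z :: real^2^2. z $ q $ r)"
      using bounded_linear_compose[OF bounded_linear_vec_nth bounded_linear_vec_nth] .
    have f: "C1 ?f (\<lambda>k. partial UNIV k ?f)"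
      by (rule C_class_C1, rule C_class_bounded_linear[OF T], rule F(1)[unfolded s1])
    have p: "partial UNIV k ?f z = partials UNIV [k] F z $ q $ r" for k z
      using partials_bounded_linear[OF T F(1), of "[k]" z] s1 by simp
    show ?thesis
    proof (intro exI conjI allI impI)
      show "?f x = (?f x - (\<Sum>k\<in>UNIV. partial UNIV k ?f x * x $ k)) + vec_lambda (\<lambda>k. partial UNIV k ?f x) \<bullet> x"
        by (simp add: inner_vec_def)
      fix y assume y: "dist x y \<le> l / 16"
      have "\<bar>?f y - ((?f x - (\<Sum>k\<in>UNIV. partial UNIV k ?f x * x $ k)) + vec_lambda (\<lambda>k. partial UNIV k ?f x) \<bullet> y)\<bar>
          \<le> 2 * (?h * l powr \<beta>) * dist x y"
      proof (rule C1_near_affine[OF f _ y])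
        show "\<bar>partial UNIV k ?f z - partial UNIV k ?f x\<bar> \<le> ?h * l powr \<beta>" if "dist x z \<le> l / 16" for z k
          unfolding p by (rule near[OF that]) (simp add: s1)
      qed
      also have "\<dots> \<le> 2 * (?h * l powr \<beta>) * (l / 2)"
        by (rule mult_left_mono) (use y l h0 in auto)
      also have "\<dots> = ?h * (l powr \<beta> * l)" by simp
      also have "\<dots> \<le> Holder_norm s \<beta> ?S A * (l powr \<beta> * l)" by (rule mult_right_mono[OF hn]) (use l in simp)
      also have "l powr \<beta> * l = l powr (real s + \<beta>)" using l s1 by (simp add: powr_add)
      finally show "\<bar>?f y - ((?f x - (\<Sum>k\<in>UNIV. partial UNIV k ?f x * x $ k)) + vec_lambda (\<lambda>k. partial UNIV k ?f x) \<bullet> y)\<bar>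
          \<le> l powr (real s + \<beta>) * Holder_norm s \<beta> ?S A" by (simp add: mult.commute)
    qed
  qed
qed

lemma linear_entry: "bounded_linear (\<lambda>z :: real^2^2. z $ q $ r)"
  using bounded_linear_compose[OF bounded_linear_vec_nth bounded_linear_vec_nth] .

lemma abs_entry_le_norm: "\<bar>(z :: real^2^2) $ q $ r\<bar> \<le> norm z"
  using component_le_norm_cart[of "z $ q" r] Finite_Cartesian_Product.norm_nth_le[of z q] by linarith

lemma component_partials_le_grad_norm:
  fixes F :: "real^2 \<Rightarrow> real^2"
  assumes \<omega>: "bounded \<omega>" and r: "0 < r" and F: "C_class m F" "\<And>y. y \<in> closed_nbhd \<omega> r \<Longrightarrow> f y = F y"
    and "is": "length is \<le> m" and x: "x \<in> closed_nbhd \<omega> r"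
  shows "\<bar>partials UNIV is (\<lambda>y. F y $ c) x\<bar> \<le> grad_norm (length is) (closed_nbhd \<omega> r) f"
proof -
  have "partials UNIV is (\<lambda>y. F y $ c) x = partials (closed_nbhd \<omega> r) is f x $ c"
    using partials_bounded_linear[OF bounded_linear_vec_nth F(1) "is"] partials_closed_nbhd[OF r F "is" x] by simp
  also have "\<bar>\<dots>\<bar> \<le> norm (partials (closed_nbhd \<omega> r) is f x)" by (rule component_le_norm_cart)
  also have "\<dots> \<le> grad_norm (length is) (closed_nbhd \<omega> r) f" by (rule partials_le_grad_norm[OF \<omega> r F "is" x])
  finally show ?thesis .
qed

lemma grad_norm_components_le:
  fixes F :: "real^2 \<Rightarrow> real^2"
  assumes \<omega>: "\<omega> \<noteq> {}" and r: "0 < r" and F: "C_class m F" "\<And>y. y \<in> closed_nbhd \<omega> r \<Longrightarrow> f y = F y" and j: "j \<le> m"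
    and B: "\<And>is x c. length is = j \<Longrightarrow> x \<in> closed_nbhd \<omega> r \<Longrightarrow> \<bar>partials UNIV is (\<lambda>y. F y $ c) x\<bar> \<le> B"
  shows "grad_norm j (closed_nbhd \<omega> r) f \<le> 2 ^ j * (2 * B)"
proof (rule grad_norm_le)
  obtain x where "x \<in> \<omega>" using \<omega> by blast
  then show "closed_nbhd \<omega> r \<noteq> {}" using closed_nbhd_infdist[OF \<omega>, of r x] r by auto
  fix "is" :: "2 list" and x assume i: "length is = j" and x: "x \<in> closed_nbhd \<omega> r"
  then have i': "length is \<le> m" using j by simp
  show "norm (partials (closed_nbhd \<omega> r) is f x) \<le> 2 * B"
  proof (rule norm_vec2_le)
    fix c
    have "partials (closed_nbhd \<omega> r) is f x $ c = partials UNIV is (\<lambda>y. F y $ c) x"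
      using partials_bounded_linear[OF bounded_linear_vec_nth F(1) i'] partials_closed_nbhd[OF r F i' x] by simp
    then show "norm (partials (closed_nbhd \<omega> r) is f x $ c) \<le> B" using B[OF i x] by simp
  qed
qed

lemma C_class_2_partials:
  assumes "C_class 2 f"
  shows "f differentiable (at x)" "partial UNIV q f differentiable (at x)" "continuous_on UNIV (partial UNIV q f)"
  using assms by (auto simp: numeral_2_eq_2 differentiable_on_def intro: differentiable_imp_continuous_on)

lemma continuous_mat_defect:
  assumes "continuous_on UNIV (A q r)" "\<And>c. C_class 2 (V c)" "\<And>c. C_class 2 (W c)"
  shows "continuous_on UNIV (mat_defect A V W q r)"
  unfolding mat_defect_def
  by (intro continuous_intros assms(1) C_class_2_partials(3) assms(2,3))

text \<open>The constant 6 is 2 for order 0, from two components, plus 4 for order 1, from two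
  components and two directions.\<close>

lemma grad_norm_diff_le:
  fixes Fv :: "real^2 \<Rightarrow> real^2" and V :: "2 \<Rightarrow> real^2 \<Rightarrow> real"
  assumes \<omega>: "\<omega> \<noteq> {}" and r: "0 < r" and Fv: "C_class 2 Fv" "\<And>y. y \<in> closed_nbhd \<omega> r \<Longrightarrow> v y = Fv y"
    and V: "\<And>c. C_class 2 (V c)"
    and B0: "\<And>x c. x \<in> closed_nbhd \<omega> r \<Longrightarrow> \<bar>V c x - Fv x $ c\<bar> \<le> B"
    and B1: "\<And>x c q. x \<in> closed_nbhd \<omega> r \<Longrightarrow> \<bar>partial UNIV q (V c) x - partial UNIV q (\<lambda>y. Fv y $ c) x\<bar> \<le> B"
  shows "C_norm 1 (closed_nbhd \<omega> r) (\<lambda>x. vec_lambda (\<lambda>c. V c x) - v x) \<le> 6 * B"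
proof -
  let ?F = "\<lambda>x. vec_lambda (\<lambda>c. V c x) - Fv x"
  let ?f = "\<lambda>x. vec_lambda (\<lambda>c. V c x) - v x"
  have F: "C_class 2 ?F" by (rule C_class_diff[OF C_class_vector[OF V] Fv(1)])
  have eq: "?f y = ?F y" if "y \<in> closed_nbhd \<omega> r" for y using Fv(2)[OF that] by simp
  have v: "C_class 2 (\<lambda>y. Fv y $ c)" for c by (rule C_class_bounded_linear[OF bounded_linear_vec_nth Fv(1)])
  have c: "(\<lambda>y. ?F y $ c) = (\<lambda>y. V c y - Fv y $ c)" for c by simp
  have p: "partial UNIV q (\<lambda>y. V c y - Fv y $ c) x = partial UNIV q (V c) x - partial UNIV q (\<lambda>y. Fv y $ c) x" for q c x
    using partial_add[OF C_class_2_partials(1)[OF V] differentiable_minus[OF C_class_2_partials(1)[OF v]]]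
      partial_bounded_linear[OF bounded_linear_minus[OF bounded_linear_ident] C_class_2_partials(1)[OF v]] by simp
  have "grad_norm 0 (closed_nbhd \<omega> r) ?f \<le> 2 ^ 0 * (2 * B)"
    by (rule grad_norm_components_le[OF \<omega> r F eq]) (use B0 in auto)
  moreover have "grad_norm 1 (closed_nbhd \<omega> r) ?f \<le> 2 ^ 1 * (2 * B)"
  proof (rule grad_norm_components_le[OF \<omega> r F eq])
    fix "is" :: "2 list" and x c assume "length is = 1" and x: "x \<in> closed_nbhd \<omega> r"
    then obtain q where "is = [q]" by (cases "is") auto
    then show "\<bar>partials UNIV is (\<lambda>y. ?F y $ c) x\<bar> \<le> B" unfolding c using B1[OF x] by (simp add: p)
  qed simp_all
  ultimately show ?thesis by (simp add: C_norm_def)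
qed

text \<open>The constant 8 is four lists of directions times two components.\<close>

lemma grad_norm_2_le:
  fixes V :: "2 \<Rightarrow> real^2 \<Rightarrow> real"
  assumes \<omega>: "\<omega> \<noteq> {}" and r: "0 < r" and V: "\<And>c. C_class 2 (V c)"
    and B: "\<And>x c q s. x \<in> closed_nbhd \<omega> r \<Longrightarrow> \<bar>partial UNIV s (partial UNIV q (V c)) x\<bar> \<le> B"
  shows "grad_norm 2 (closed_nbhd \<omega> r) (\<lambda>x. vec_lambda (\<lambda>c. V c x) :: real^2) \<le> 8 * B"
proof -
  have "grad_norm 2 (closed_nbhd \<omega> r) (\<lambda>x. vec_lambda (\<lambda>c. V c x) :: real^2) \<le> 2 ^ 2 * (2 * B)"
  proof (rule grad_norm_components_le[OF \<omega> r C_class_vector[of 2 V, OF V]])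
    fix "is" :: "2 list" and x c assume i: "length is = 2" and x: "x \<in> closed_nbhd \<omega> r"
    obtain q s where "is = [q, s]" using i by (auto simp: length_Suc_conv numeral_2_eq_2)
    then show "\<bar>partials UNIV is (\<lambda>y. (vec_lambda (\<lambda>c. V c y) :: real^2) $ c) x\<bar> \<le> B" using B[OF x] by simp
  qed simp_all
  then show ?thesis by simp
qed

text \<open>Translates the scalar result into norms of vector fields. Global representatives of
  \<open>v\<close>, \<open>w\<close> and \<open>A\<close> feed the construction, while norms and
  defects see them only on the neighbourhoods. The signs of three norms are recorded for the later
  enlargement of constants.\<close>

lemma stage_exists:
  fixes \<omega> :: "(real^2) set" and v w :: "real^2 \<Rightarrow> real^2" and A :: "real^2 \<Rightarrow> real^2^2"
  defines "S1 l \<equiv> closed_nbhd \<omega> l" and "S2 l \<equiv> closed_nbhd \<omega> (2 * l)"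
  assumes \<omega>: "bounded \<omega>" "\<omega> \<noteq> {}"
    and C: "0 < C" "\<And>l lam M d g fv fw fA. admissible (\<lambda>x. infdist x \<omega>) \<gamma> l lam M d g fv fw fA \<Longrightarrow>
      \<exists>V W. improves (\<lambda>x. infdist x \<omega>) \<gamma> N K C l lam M d g fv fw fA V W"
    and s: "s \<in> {0, 1}" and \<beta>: "0 < \<beta>" and l: "0 < l" "l \<le> 1 / 2" and lam: "0 < lam" "1 \<le> lam powr (1 - \<gamma>) * l" and M: "0 < M"
    and vw: "v \<in> C_space 2 (S2 l)" "w \<in> C_space 2 (S2 l)" and A: "A \<in> Holder_space s \<beta> (S2 l)" "\<And>x. x \<in> S2 l \<Longrightarrow> transpose (A x) = A x"
    and MC: "C_norm 2 (S2 l) v \<le> M" "C_norm 2 (S2 l) w \<le> M"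
  shows "0 \<le> C_norm 0 (S2 l) (defect (S2 l) A v w)" "0 \<le> grad_norm 1 (S2 l) v" "0 \<le> Holder_norm s \<beta> (S2 l) A"
    and "\<exists>v' \<in> C_space 2 (S1 l). \<exists>w' \<in> C_space 2 (S1 l).
    C_norm 1 (S1 l) (\<lambda>x. v' x - v x) \<le> 6 * (C * (lam powr (\<gamma> / 2) * (sqrt (C_norm 0 (S2 l) (defect (S2 l) A v w)) + l * M))) \<and>
    C_norm 1 (S1 l) (\<lambda>x. w' x - w x) \<le> 6 * (C * (lam powr \<gamma> * (sqrt (C_norm 0 (S2 l) (defect (S2 l) A v w)) + l * M)
        * (1 + sqrt (C_norm 0 (S2 l) (defect (S2 l) A v w)) + l * M + grad_norm 1 (S2 l) v))) \<and>
    grad_norm 2 (S1 l) v' \<le> 8 * (C * ((lam * l) ^ (K + N) * lam powr (\<gamma> / 2) / l * (sqrt (C_norm 0 (S2 l) (defect (S2 l) A v w)) + l * M))) \<and>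
    grad_norm 2 (S1 l) w' \<le> 8 * (C * ((lam * l) ^ (K + N) * lam powr \<gamma> / l * (sqrt (C_norm 0 (S2 l) (defect (S2 l) A v w)) + l * M)
        * (1 + sqrt (C_norm 0 (S2 l) (defect (S2 l) A v w)) + l * M + grad_norm 1 (S2 l) v))) \<and>
    C_norm 0 (S1 l) (defect (S1 l) A v' w')
      \<le> 4 * (l powr (real s + \<beta>) * Holder_norm s \<beta> (S2 l) A
          + C * ((C_norm 0 (S2 l) (defect (S2 l) A v w) + (l * M)\<^sup>2) / (lam * l) ^ (K * N)))"
proof -
  let ?S1 = "closed_nbhd \<omega> l" and ?S2 = "closed_nbhd \<omega> (2 * l)"
  note SS = S1_def S2_def
  let ?D = "defect ?S2 A v w"
  obtain Fv Fw where Fv: "C_class 2 Fv" "\<And>y. y \<in> ?S2 \<Longrightarrow> v y = Fv y" and Fw: "C_class 2 Fw" "\<And>y. y \<in> ?S2 \<Longrightarrow> w y = Fw y"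
    using vw unfolding C_space_def SS by blast
  obtain F where F: "C_class s F" "\<And>y. y \<in> ?S2 \<Longrightarrow> A y = F y" "\<And>is. length is = s \<Longrightarrow> locally_Holder \<beta> (partials UNIV is F)"
    using A(1) unfolding Holder_space_def SS by blast
  have l2: "0 < 2 * l" using l by simp
  have S2: "y \<in> ?S2 \<longleftrightarrow> infdist y \<omega> \<le> 2 * l" for y using closed_nbhd_infdist[OF \<omega>(2)] l by simp
  have S1: "y \<in> ?S1 \<longleftrightarrow> infdist y \<omega> \<le> l" for y using closed_nbhd_infdist[OF \<omega>(2)] l by simp
  have S12: "y \<in> ?S1 \<Longrightarrow> y \<in> ?S2" for y using S1 S2 l by simp
  define fv where "fv = (\<lambda>c y. Fv y $ c)"
  define fw where "fw = (\<lambda>c y. Fw y $ c)"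
  define fA where "fA = (\<lambda>q r y. F y $ q $ r)"
  have cv: "C_class 2 (fv c)" "C_class 2 (fw c)" for c
    unfolding fv_def fw_def using C_class_bounded_linear[OF bounded_linear_vec_nth] Fv(1) Fw(1) by blast+
  have cA: "continuous_on UNIV (fA q r)" for q r
    unfolding fA_def by (rule C_class_continuous[OF C_class_bounded_linear[OF linear_entry F(1)]])
  have D: "?D x $ q $ r = mat_defect fA fv fw q r x" if "x \<in> ?S2" for x q r
    unfolding fA_def fv_def fw_def
    by (rule defect_nth[OF l2 that, where m=1]) (use Fv Fw F(2)[OF that] in \<open>simp_all add: numeral_2_eq_2\<close>)
  define FD where "FD = (\<lambda>x. vec_lambda (\<lambda>q. vec_lambda (\<lambda>r. mat_defect fA fv fw q r x)) :: real^2^2)"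
  have FD: "C_class 0 FD" "\<And>x. x \<in> ?S2 \<Longrightarrow> ?D x = FD x"
  proof -
    show "C_class 0 FD" unfolding FD_def
      by (simp, intro continuous_on_vec_lambda continuous_mat_defect cA cv)
    show "?D x = FD x" if "x \<in> ?S2" for x by (simp add: vec_eq_iff FD_def D[OF that])
  qed
  have C0: "C_norm 0 S f = grad_norm 0 S f" for S and f :: "real^2 \<Rightarrow> real^2^2" by (simp add: C_norm_def)
  define d where "d = C_norm 0 ?S2 ?D"
  define g where "g = grad_norm 1 ?S2 v"
  have bv: "\<bar>partials UNIV is (fv c) y\<bar> \<le> grad_norm (length is) ?S2 v" "\<bar>partials UNIV is (fv c) y\<bar> \<le> M"
    "\<bar>partials UNIV is (fw c) y\<bar> \<le> M" if "y \<in> ?S2" "length is \<le> 2" for "is" c y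
  proof -
    show 1: "\<bar>partials UNIV is (fv c) y\<bar> \<le> grad_norm (length is) ?S2 v"
      unfolding fv_def by (rule component_partials_le_grad_norm[OF \<omega>(1) l2 Fv that(2,1)])
    show "\<bar>partials UNIV is (fv c) y\<bar> \<le> M"
      using 1 grad_norm_le_C_norm(1)[OF \<omega> l2 Fv that(2)] MC(1) unfolding SS by linarith
    show "\<bar>partials UNIV is (fw c) y\<bar> \<le> M"
      using component_partials_le_grad_norm[OF \<omega>(1) l2 Fw that(2,1), of c] grad_norm_le_C_norm(1)[OF \<omega> l2 Fw that(2)] MC(2)
      unfolding SS fw_def by linarith
  qed
  have bd: "\<bar>mat_defect fA fv fw q r y\<bar> \<le> d" if "y \<in> ?S2" for q r y
  proof -
    have "\<bar>?D y $ q $ r\<bar> \<le> norm (?D y)" by (rule abs_entry_le_norm)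
    also have "\<dots> \<le> d" using partials_le_grad_norm[OF \<omega>(1) l2 FD, of "[]" y] that by (simp add: d_def C0)
    finally show ?thesis by (simp add: D[OF that])
  qed
  have "admissible (\<lambda>x. infdist x \<omega>) \<gamma> l lam M d g fv fw fA"
    unfolding admissible_def
  proof (intro conjI allI impI l lam M cv cA)
    fix y c q r assume "infdist y \<omega> \<le> 2 * l"
    then have y: "y \<in> ?S2" by (simp add: S2)
    show "\<bar>fv c y\<bar> \<le> M" "\<bar>partial UNIV q (fv c) y\<bar> \<le> M" "\<bar>partial UNIV r (partial UNIV q (fv c)) y\<bar> \<le> M"
      "\<bar>fw c y\<bar> \<le> M" "\<bar>partial UNIV q (fw c) y\<bar> \<le> M" "\<bar>partial UNIV r (partial UNIV q (fw c)) y\<bar> \<le> M"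
      using bv(2,3)[OF y, of "[]" c] bv(2,3)[OF y, of "[q]" c] bv(2,3)[OF y, of "[q, r]" c] by simp_all
    show "\<bar>partial UNIV q (fv c) y\<bar> \<le> g" using bv(1)[OF y, of "[q]" c] by (simp add: g_def)
    show "\<bar>mat_defect fA fv fw q r y\<bar> \<le> d" by (rule bd[OF y])
    have "transpose (F y) = F y" using A(2)[of y] y F(2)[OF y] by (simp add: SS)
    then have "transpose (F y) $ q $ r = F y $ q $ r" by simp
    then show "fA q r y = fA r q y" by (simp add: fA_def transpose_def)
  qed
  then obtain V W where "improves (\<lambda>x. infdist x \<omega>) \<gamma> N K C l lam M d g fv fw fA V W" using C(2) by blast
  note imp = this[unfolded improves_def]
  have V: "C_class 2 (V c)" and W: "C_class 2 (W c)" for c using imp by blast+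
  let ?\<delta> = "sqrt d + l * M"
  have I: "\<bar>V c x - fv c x\<bar> \<le> C * (lam powr (\<gamma> / 2) * ?\<delta>)"
      "\<bar>partial UNIV q (V c) x - partial UNIV q (fv c) x\<bar> \<le> C * (lam powr (\<gamma> / 2) * ?\<delta>)"
      "\<bar>partial UNIV r (partial UNIV q (V c)) x\<bar> \<le> C * ((lam * l) ^ (K + N) * lam powr (\<gamma> / 2) / l * ?\<delta>)"
      "\<bar>W c x - fw c x\<bar> \<le> C * (lam powr \<gamma> * ?\<delta> * (1 + sqrt d + l * M + g))"
      "\<bar>partial UNIV q (W c) x - partial UNIV q (fw c) x\<bar> \<le> C * (lam powr \<gamma> * ?\<delta> * (1 + sqrt d + l * M + g))"
      "\<bar>partial UNIV r (partial UNIV q (W c)) x\<bar> \<le> C * ((lam * l) ^ (K + N) * lam powr \<gamma> / l * ?\<delta> * (1 + sqrt d + l * M + g))"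
      "\<And>a c0 b. fA q r x = c0 + b \<bullet> x \<Longrightarrow> \<forall>y. dist x y \<le> l / 16 \<longrightarrow> \<bar>fA q r y - (c0 + b \<bullet> y)\<bar> \<le> a \<Longrightarrow>
        \<bar>mat_defect fA V W q r x\<bar> \<le> a + C * ((d + (l * M)\<^sup>2) / (lam * l) ^ (K * N))"
    if x: "x \<in> ?S1" for x c q r
    using imp[THEN conjunct2, THEN conjunct2, rule_format, OF x[unfolded S1], of c q r] by blast+
  define v' where "v' = (\<lambda>x. vec_lambda (\<lambda>c. V c x) :: real^2)"
  define w' where "w' = (\<lambda>x. vec_lambda (\<lambda>c. W c x) :: real^2)"
  have v': "C_class 2 v'" and w': "C_class 2 w'" unfolding v'_def w'_def by (rule C_class_vector, rule V, rule C_class_vector, rule W)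
  have D': "norm (defect ?S1 A v' w' x) \<le> 4 * (l powr (real s + \<beta>) * Holder_norm s \<beta> ?S2 A + C * ((d + (l * M)\<^sup>2) / (lam * l) ^ (K * N)))" (is "_ \<le> 4 * ?B")
    if x: "x \<in> ?S1" for x
  proof -
    have e: "defect ?S1 A v' w' x $ q $ r = mat_defect fA V W q r x" for q r
    proof -
      have "defect ?S1 A v' w' x $ q $ r = mat_defect (\<lambda>q r y. F y $ q $ r) (\<lambda>c y. v' y $ c) (\<lambda>c y. w' y $ c) q r x"
        by (rule defect_nth[OF l(1) x, where m=1]) (use v' w' F(2)[OF S12[OF x]] in \<open>simp_all add: numeral_2_eq_2\<close>)
      then show ?thesis by (simp add: fA_def v'_def w'_def)
    qed
    have B: "\<bar>mat_defect fA V W q r x\<bar> \<le> ?B" for q r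
    proof -
      have "\<exists>c b. F x $ q $ r = c + b \<bullet> x \<and> (\<forall>y. dist x y \<le> l / 16 \<longrightarrow>
          \<bar>F y $ q $ r - (c + b \<bullet> y)\<bar> \<le> l powr (real s + \<beta>) * Holder_norm s \<beta> ?S2 A)"
        by (rule Holder_near_affine[OF \<omega> l(1) s \<beta>]) (fact F x[unfolded S1])+
      then show ?thesis using I(7)[OF x, of q r] unfolding fA_def by blast
    qed
    have "norm (defect ?S1 A v' w' x) \<le> 2 * (2 * ?B)"
      by (rule norm_vec2_le, rule norm_vec2_le) (simp only: real_norm_def e B)
    then show ?thesis by simp
  qed
  obtain x0 where "x0 \<in> \<omega>" using \<omega>(2) by blast
  then have ne: "?S1 \<noteq> {}" using S1[of x0] l by auto
  have x0: "x0 \<in> ?S1" "x0 \<in> ?S2" "infdist x0 \<omega> \<le> l" using S1[of x0] S2[of x0] l \<open>x0 \<in> \<omega>\<close> by simp_all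
  have "0 \<le> d" using bd[OF x0(2), of 1 1] by linarith
  then show "0 \<le> C_norm 0 (S2 l) (defect (S2 l) A v w)" by (simp add: d_def SS)
  have "0 \<le> g" using bv(1)[OF x0(2), of "[1]" 1] by (simp add: g_def)
  then show "0 \<le> grad_norm 1 (S2 l) v" by (simp add: g_def SS)
  have "\<exists>c b. F x0 $ 1 $ 1 = c + b \<bullet> x0 \<and> (\<forall>y. dist x0 y \<le> l / 16 \<longrightarrow>
      \<bar>F y $ 1 $ 1 - (c + b \<bullet> y)\<bar> \<le> l powr (real s + \<beta>) * Holder_norm s \<beta> ?S2 A)"
    by (rule Holder_near_affine[OF \<omega> l(1) s \<beta>]) (fact F x0(3))+
  then obtain c b where "\<bar>F x0 $ 1 $ 1 - (c + b \<bullet> x0)\<bar> \<le> l powr (real s + \<beta>) * Holder_norm s \<beta> ?S2 A"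
    using l(1) by (metis dist_self divide_nonneg_pos less_imp_le zero_less_numeral)
  then have "0 \<le> l powr (real s + \<beta>) * Holder_norm s \<beta> ?S2 A" by linarith
  then show "0 \<le> Holder_norm s \<beta> (S2 l) A" using l(1) by (simp add: SS zero_le_mult_iff)
  show "\<exists>v' \<in> C_space 2 (S1 l). \<exists>w' \<in> C_space 2 (S1 l).
    C_norm 1 (S1 l) (\<lambda>x. v' x - v x) \<le> 6 * (C * (lam powr (\<gamma> / 2) * (sqrt (C_norm 0 (S2 l) (defect (S2 l) A v w)) + l * M))) \<and>
    C_norm 1 (S1 l) (\<lambda>x. w' x - w x) \<le> 6 * (C * (lam powr \<gamma> * (sqrt (C_norm 0 (S2 l) (defect (S2 l) A v w)) + l * M)
        * (1 + sqrt (C_norm 0 (S2 l) (defect (S2 l) A v w)) + l * M + grad_norm 1 (S2 l) v))) \<and>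
    grad_norm 2 (S1 l) v' \<le> 8 * (C * ((lam * l) ^ (K + N) * lam powr (\<gamma> / 2) / l * (sqrt (C_norm 0 (S2 l) (defect (S2 l) A v w)) + l * M))) \<and>
    grad_norm 2 (S1 l) w' \<le> 8 * (C * ((lam * l) ^ (K + N) * lam powr \<gamma> / l * (sqrt (C_norm 0 (S2 l) (defect (S2 l) A v w)) + l * M)
        * (1 + sqrt (C_norm 0 (S2 l) (defect (S2 l) A v w)) + l * M + grad_norm 1 (S2 l) v))) \<and>
    C_norm 0 (S1 l) (defect (S1 l) A v' w')
      \<le> 4 * (l powr (real s + \<beta>) * Holder_norm s \<beta> (S2 l) A
          + C * ((C_norm 0 (S2 l) (defect (S2 l) A v w) + (l * M)\<^sup>2) / (lam * l) ^ (K * N)))"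
    unfolding SS d_def[symmetric] g_def[symmetric]
  proof (rule bexI[of _ v'], rule bexI[of _ w'], intro conjI)
    show "C_norm 1 ?S1 (\<lambda>x. v' x - v x) \<le> 6 * (C * (lam powr (\<gamma> / 2) * ?\<delta>))"
      unfolding v'_def by (rule grad_norm_diff_le[OF \<omega>(2) l(1) Fv(1) Fv(2)[OF S12] V]) (use I(1,2) in \<open>simp_all add: fv_def\<close>)
    show "C_norm 1 ?S1 (\<lambda>x. w' x - w x) \<le> 6 * (C * (lam powr \<gamma> * ?\<delta> * (1 + sqrt d + l * M + g)))"
      unfolding w'_def by (rule grad_norm_diff_le[OF \<omega>(2) l(1) Fw(1) Fw(2)[OF S12] W]) (use I(4,5) in \<open>simp_all add: fw_def\<close>)
    show "grad_norm 2 ?S1 v' \<le> 8 * (C * ((lam * l) ^ (K + N) * lam powr (\<gamma> / 2) / l * ?\<delta>))"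
      unfolding v'_def by (rule grad_norm_2_le[OF \<omega>(2) l(1) V I(3)])
    show "grad_norm 2 ?S1 w' \<le> 8 * (C * ((lam * l) ^ (K + N) * lam powr \<gamma> / l * ?\<delta> * (1 + sqrt d + l * M + g)))"
      unfolding w'_def by (rule grad_norm_2_le[OF \<omega>(2) l(1) W I(6)])
    have "grad_norm 0 ?S1 (defect ?S1 A v' w') \<le> 2 ^ 0 * (4 * (l powr (real s + \<beta>) * Holder_norm s \<beta> ?S2 A
          + C * ((d + (l * M)\<^sup>2) / (lam * l) ^ (K * N))))"
      by (rule grad_norm_le[OF ne]) (use D' in simp)
    then show "C_norm 0 ?S1 (defect ?S1 A v' w') \<le> 4 * (l powr (real s + \<beta>) * Holder_norm s \<beta> ?S2 A
          + C * ((d + (l * M)\<^sup>2) / (lam * l) ^ (K * N)))" by (simp add: C0)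
    show "v' \<in> C_space 2 ?S1" "w' \<in> C_space 2 ?S1" using v' w' by (auto simp: C_space_def)
  qed
qed

text \<open>The value 1/2 for the bound on l keeps the neighbourhoods inside a fixed bounded set and
  all frequencies at least 1. The value 1 for the threshold is enough because the parameters only
  need \<open>lam * l\<close> to dominate \<open>lam\<close> to the power \<gamma>; every other loss
  goes into the constant.\<close>

theorem theorem1p3:
  fixes \<omega> :: "(real^2) set"
  assumes "smooth_planar_domain \<omega>" and "bounded \<omega>"
  shows "\<exists>l\<^sub>0::real. 0 < l\<^sub>0 \<and> l\<^sub>0 < 1 \<and>
    (\<forall>(N::nat) (K::nat) (\<gamma>::real). N \<ge> 1 \<longrightarrow> K \<ge> 1 \<longrightarrow> 0 < \<gamma> \<longrightarrow> \<gamma> < 1 \<longrightarrow>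
      (\<exists>(\<sigma>\<^sub>0::real) (C::real). \<sigma>\<^sub>0 \<ge> 1 \<and> C > 0 \<and>
        (\<forall>(s::nat) (\<beta>::real) (l::real) (lam::real) (M::real)
            (v :: real^2 \<Rightarrow> real^2) (w :: real^2 \<Rightarrow> real^2) (A :: real^2 \<Rightarrow> real^2^2).
          let S2 = closed_nbhd \<omega> (2 * l); S1 = closed_nbhd \<omega> l; D = defect S2 A v w in
          s \<in> {0, 1} \<longrightarrow> 0 < \<beta> \<longrightarrow> \<beta> \<le> 1 \<longrightarrow> 0 < l \<longrightarrow> 0 < lam \<longrightarrow> 0 < M \<longrightarrow>
          v \<in> C_space 2 S2 \<longrightarrow> w \<in> C_space 2 S2 \<longrightarrow>
          A \<in> Holder_space s \<beta> S2 \<longrightarrow> (\<forall>x\<in>S2. transpose (A x) = A x) \<longrightarrow>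
          l \<le> l\<^sub>0 \<longrightarrow> lam powr (1 - \<gamma>) * l \<ge> \<sigma>\<^sub>0 \<longrightarrow>
          M \<ge> Max {C_norm 2 S2 v, C_norm 2 S2 w, 1} \<longrightarrow>
          (\<exists>v' \<in> C_space 2 S1. \<exists>w' \<in> C_space 2 S1.
            let D' = defect S1 A v' w' in
            C_norm 1 S1 (\<lambda>x. v' x - v x)
              \<le> C * lam powr (\<gamma> / 2) * (sqrt (C_norm 0 S2 D) + l * M) \<and>
            C_norm 1 S1 (\<lambda>x. w' x - w x)
              \<le> C * lam powr \<gamma> * (sqrt (C_norm 0 S2 D) + l * M)
                  * (1 + sqrt (C_norm 0 S2 D) + l * M + grad_norm 1 S2 v) \<and>
            grad_norm 2 S1 v'
              \<le> C * ((lam * l) ^ (K + N) * lam powr (\<gamma> / 2) / l) * (sqrt (C_norm 0 S2 D) + l * M) \<and>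
            grad_norm 2 S1 w'
              \<le> C * ((lam * l) ^ (K + N) * lam powr \<gamma> / l) * (sqrt (C_norm 0 S2 D) + l * M)
                  * (1 + sqrt (C_norm 0 S2 D) + l * M + grad_norm 1 S2 v) \<and>
            C_norm 0 S1 D'
              \<le> C * (l powr (real s + \<beta>) * Holder_norm s \<beta> S2 A
                       + (C_norm 0 S2 D + (l * M)\<^sup>2) / (lam * l) ^ (K * N))))))"
proof -
  have ne: "\<omega> \<noteq> {}" using assms(1) by (simp add: smooth_planar_domain_def)
  let ?\<zeta> = "\<lambda>x. infdist x \<omega>"
  have \<zeta>: "?\<zeta> y \<le> ?\<zeta> x + dist x y" for x y
    using infdist_triangle[of y \<omega> x] by (simp add: dist_commute)
  obtain x0 where "x0 \<in> \<omega>" using ne by blast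
  then have \<zeta>0: "\<exists>x. ?\<zeta> x \<le> 0" by (intro exI[of _ x0]) simp
  have "bounded (closed_nbhd \<omega> 1)" by (rule compact_imp_bounded[OF compact_closed_nbhd[OF assms(2)]])
  then obtain R0 where R0: "\<And>x. x \<in> closed_nbhd \<omega> 1 \<Longrightarrow> norm x \<le> R0" unfolding bounded_iff by blast
  have R: "\<bar>x $ k\<bar> \<le> max R0 1" if "?\<zeta> x \<le> 1" for x k
    using component_le_norm_cart[of x k] R0[of x] closed_nbhd_infdist[OF ne, of 1 x] that by simp
  \<comment> \<open>\<open>8 * C + 4\<close> dominates the constants 6 C and 8 C of the first four
    bounds and both 4 and 4 C of the last one.\<close>
  have scale: "y \<le> (8 * C + 4) * X" if "y \<le> k * (C * X)" "0 \<le> X" "k \<le> 8" "0 < C" for y k C X :: real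
  proof -
    have "k * (C * X) \<le> 8 * (C * X)" using that by (intro mult_right_mono) auto
    then have "y \<le> 8 * (C * X)" using that(1) by linarith
    also have "\<dots> \<le> (8 * C + 4) * X" using that(2) by (simp add: algebra_simps)
    finally show ?thesis .
  qed
  show ?thesis
  proof (rule exI[of _ "1 / 2"], intro conjI allI impI)
    fix N K :: nat and \<gamma> :: real assume NK: "1 \<le> N" "1 \<le> K" and \<gamma>: "0 < \<gamma>" "\<gamma> < 1"
    obtain C where C: "0 < C" "\<And>l lam M d g fv fw fA. admissible ?\<zeta> \<gamma> l lam M d g fv fw fA \<Longrightarrow>
        \<exists>V W. improves ?\<zeta> \<gamma> N K C l lam M d g fv fw fA V W"
    proof (rule scalar_stage[of ?\<zeta> "max R0 1" N K \<gamma>])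
      show "?\<zeta> y \<le> ?\<zeta> x + dist x y" for x y by (rule \<zeta>)
      show "\<bar>x $ k\<bar> \<le> max R0 1" if "?\<zeta> x \<le> 1" for x k by (rule R[OF that])
    qed (use \<zeta>0 NK \<gamma> in auto)
    show "\<exists>(\<sigma>\<^sub>0::real) (C::real). \<sigma>\<^sub>0 \<ge> 1 \<and> C > 0 \<and>
        (\<forall>(s::nat) (\<beta>::real) (l::real) (lam::real) (M::real)
            (v :: real^2 \<Rightarrow> real^2) (w :: real^2 \<Rightarrow> real^2) (A :: real^2 \<Rightarrow> real^2^2).
          let S2 = closed_nbhd \<omega> (2 * l); S1 = closed_nbhd \<omega> l; D = defect S2 A v w in
          s \<in> {0, 1} \<longrightarrow> 0 < \<beta> \<longrightarrow> \<beta> \<le> 1 \<longrightarrow> 0 < l \<longrightarrow> 0 < lam \<longrightarrow> 0 < M \<longrightarrow>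
          v \<in> C_space 2 S2 \<longrightarrow> w \<in> C_space 2 S2 \<longrightarrow>
          A \<in> Holder_space s \<beta> S2 \<longrightarrow> (\<forall>x\<in>S2. transpose (A x) = A x) \<longrightarrow>
          l \<le> 1 / 2 \<longrightarrow> lam powr (1 - \<gamma>) * l \<ge> \<sigma>\<^sub>0 \<longrightarrow>
          M \<ge> Max {C_norm 2 S2 v, C_norm 2 S2 w, 1} \<longrightarrow>
          (\<exists>v' \<in> C_space 2 S1. \<exists>w' \<in> C_space 2 S1.
            let D' = defect S1 A v' w' in
            C_norm 1 S1 (\<lambda>x. v' x - v x)
              \<le> C * lam powr (\<gamma> / 2) * (sqrt (C_norm 0 S2 D) + l * M) \<and>
            C_norm 1 S1 (\<lambda>x. w' x - w x)
              \<le> C * lam powr \<gamma> * (sqrt (C_norm 0 S2 D) + l * M)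
                  * (1 + sqrt (C_norm 0 S2 D) + l * M + grad_norm 1 S2 v) \<and>
            grad_norm 2 S1 v'
              \<le> C * ((lam * l) ^ (K + N) * lam powr (\<gamma> / 2) / l) * (sqrt (C_norm 0 S2 D) + l * M) \<and>
            grad_norm 2 S1 w'
              \<le> C * ((lam * l) ^ (K + N) * lam powr \<gamma> / l) * (sqrt (C_norm 0 S2 D) + l * M)
                  * (1 + sqrt (C_norm 0 S2 D) + l * M + grad_norm 1 S2 v) \<and>
            C_norm 0 S1 D'
              \<le> C * (l powr (real s + \<beta>) * Holder_norm s \<beta> S2 A
                       + (C_norm 0 S2 D + (l * M)\<^sup>2) / (lam * l) ^ (K * N))))"
      unfolding Let_def
    proof (rule exI[of _ 1], rule exI[of _ "8 * C + 4"], intro conjI allI impI)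
      fix s :: nat and \<beta> l lam M :: real and v w :: "real^2 \<Rightarrow> real^2" and A :: "real^2 \<Rightarrow> real^2^2"
      let ?S2 = "closed_nbhd \<omega> (2 * l)" and ?S1 = "closed_nbhd \<omega> l"
      let ?d = "C_norm 0 ?S2 (defect ?S2 A v w)" and ?g = "grad_norm 1 ?S2 v" and ?h = "Holder_norm s \<beta> ?S2 A"
      assume a: "s \<in> {0, 1}" "0 < \<beta>" "0 < l" "0 < lam" "0 < M" "v \<in> C_space 2 ?S2" "w \<in> C_space 2 ?S2"
        "A \<in> Holder_space s \<beta> ?S2" "\<forall>x\<in>?S2. transpose (A x) = A x" "l \<le> 1 / 2" "1 \<le> lam powr (1 - \<gamma>) * l"
        "Max {C_norm 2 ?S2 v, C_norm 2 ?S2 w, 1} \<le> M"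
      have MC: "C_norm 2 ?S2 v \<le> M" "C_norm 2 ?S2 w \<le> M" using a(12) by simp_all
      note st = stage_exists[OF assms(2) ne C a(1-3,10,4,11,5-8) _ MC]
      have p: "0 \<le> ?d" "0 \<le> ?g" "0 \<le> ?h" by (rule st; use a(9) in blast)+
      let ?\<delta> = "sqrt ?d + l * M"
      obtain v' w' where vw: "v' \<in> C_space 2 ?S1" "w' \<in> C_space 2 ?S1"
        "C_norm 1 ?S1 (\<lambda>x. v' x - v x) \<le> 6 * (C * (lam powr (\<gamma> / 2) * ?\<delta>))"
        "C_norm 1 ?S1 (\<lambda>x. w' x - w x) \<le> 6 * (C * (lam powr \<gamma> * ?\<delta> * (1 + sqrt ?d + l * M + ?g)))"
        "grad_norm 2 ?S1 v' \<le> 8 * (C * ((lam * l) ^ (K + N) * lam powr (\<gamma> / 2) / l * ?\<delta>))"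
        "grad_norm 2 ?S1 w' \<le> 8 * (C * ((lam * l) ^ (K + N) * lam powr \<gamma> / l * ?\<delta> * (1 + sqrt ?d + l * M + ?g)))"
        "C_norm 0 ?S1 (defect ?S1 A v' w') \<le> 4 * (l powr (real s + \<beta>) * ?h + C * ((?d + (l * M)\<^sup>2) / (lam * l) ^ (K * N)))"
        using st(4) a(9) by blast
      have \<delta>: "0 \<le> ?\<delta>" "0 \<le> 1 + sqrt ?d + l * M + ?g" using p a(3,5) by simp_all
      show "\<exists>v' \<in> C_space 2 ?S1. \<exists>w' \<in> C_space 2 ?S1.
            C_norm 1 ?S1 (\<lambda>x. v' x - v x) \<le> (8 * C + 4) * lam powr (\<gamma> / 2) * ?\<delta> \<and>
            C_norm 1 ?S1 (\<lambda>x. w' x - w x) \<le> (8 * C + 4) * lam powr \<gamma> * ?\<delta> * (1 + sqrt ?d + l * M + ?g) \<and>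
            grad_norm 2 ?S1 v' \<le> (8 * C + 4) * ((lam * l) ^ (K + N) * lam powr (\<gamma> / 2) / l) * ?\<delta> \<and>
            grad_norm 2 ?S1 w' \<le> (8 * C + 4) * ((lam * l) ^ (K + N) * lam powr \<gamma> / l) * ?\<delta> * (1 + sqrt ?d + l * M + ?g) \<and>
            C_norm 0 ?S1 (defect ?S1 A v' w')
              \<le> (8 * C + 4) * (l powr (real s + \<beta>) * ?h + (?d + (l * M)\<^sup>2) / (lam * l) ^ (K * N))"
        unfolding mult.assoc[of "8 * C + 4"]
      proof (rule bexI[OF _ vw(1)], rule bexI[OF _ vw(2)], intro conjI)
        show "C_norm 1 ?S1 (\<lambda>x. v' x - v x) \<le> (8 * C + 4) * (lam powr (\<gamma> / 2) * ?\<delta>)"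
          by (rule scale[OF vw(3) _ _ C(1)]) (use \<delta> in simp_all)
        show "C_norm 1 ?S1 (\<lambda>x. w' x - w x) \<le> (8 * C + 4) * (lam powr \<gamma> * ?\<delta> * (1 + sqrt ?d + l * M + ?g))"
          by (rule scale[OF vw(4) _ _ C(1)]) (use mult_nonneg_nonneg[OF mult_nonneg_nonneg[OF powr_ge_zero \<delta>(1)] \<delta>(2)] in simp_all)
        have \<sigma>: "0 \<le> (lam * l) ^ (K + N) * lam powr e / l" for e using a(3,4) by simp
        show "grad_norm 2 ?S1 v' \<le> (8 * C + 4) * ((lam * l) ^ (K + N) * lam powr (\<gamma> / 2) / l * ?\<delta>)"
          by (rule scale[OF vw(5) mult_nonneg_nonneg[OF \<sigma> \<delta>(1)] _ C(1)]) simp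
        show "grad_norm 2 ?S1 w' \<le> (8 * C + 4) * ((lam * l) ^ (K + N) * lam powr \<gamma> / l * ?\<delta> * (1 + sqrt ?d + l * M + ?g))"
          by (rule scale[OF vw(6) mult_nonneg_nonneg[OF mult_nonneg_nonneg[OF \<sigma> \<delta>(1)] \<delta>(2)] _ C(1)]) simp
        let ?a = "l powr (real s + \<beta>) * ?h" and ?b = "(?d + (l * M)\<^sup>2) / (lam * l) ^ (K * N)"
        have ab: "0 \<le> ?a" "0 \<le> ?b" using p a(3,4) by simp_all
        have "0 \<le> C * ?a" "0 \<le> C * ?b" by (rule mult_nonneg_nonneg[OF less_imp_le[OF C(1)]], rule ab)+
        then have "4 * (?a + C * ?b) \<le> (8 * C + 4) * (?a + ?b)"
          using ab by (simp only: distrib_left distrib_right mult.assoc)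
        then show "C_norm 0 ?S1 (defect ?S1 A v' w') \<le> (8 * C + 4) * (?a + ?b)" using vw(7) by linarith
      qed
    qed (use C(1) in auto)
  qed simp_all
qed

end
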